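(* Let $\hat\alpha^{MFC}$ be the MFC solution and $\bar x^{MFC}_t=\mathbb E[X^{\hat\alpha^{MFC}}_t]$, $t\in[0,T]$. Let $(\lambda,\mu)$ be a mean field CCE. Then: (i) if $\mathfrak J(\lambda,\mu)\ge\mathfrak J(\hat\alpha^{MFC},\bar x^{MFC})$, then $(\lambda,\mu)=(\hat\alpha^{MFC},\bar x^{MFC})$ (that is, $\lambda=\hat\alpha^{MFC}$ $d\mathbb P\otimes dt$-a.e. and $\mu=\bar x^{MFC}$ $\mathbb P$-a.s.), so $\mathfrak J(\lambda,\mu)=\mathfrak J(\hat\alpha^{MFC},\bar x^{MFC})$; (ii) if the MFC solution (i.e. the pair $(\hat\alpha^{MFC},\bar x^{MFC})$) is not a mean field Nash equilibrium, then $\mathfrak J(\lambda,\mu)<\mathfrak J(\hat\alpha^{MFC},\bar x^{MFC})$; in particular the MFC solution is not a mean field CCE either.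
   Context: Data. Fix $T>0$, $d,k\in\mathbb N$. $\mathcal S^n$ is the set of real symmetric $n\times n$ matrices, ordered by $\ge$ in the positive semidefinite sense; $I_n$ is the identity. Given: $A,\sigma\in L^\infty([0,T];\mathbb R^{d\times d})$, $B\in L^\infty([0,T];\mathbb R^{d\times k})$, $Q,\bar Q,\tilde Q\in L^\infty([0,T];\mathcal S^d)$, $R\in\mathcal C([0,T];\mathcal S^k)$, $H,\bar H,\tilde H\in\mathcal S^d$, $S\in L^\infty([0,T];\mathbb R^{k\times d})$, $L,q\in L^\infty([0,T];\mathbb R^d)$, $r\in L^\infty([0,T];\mathbb R^k)$, with $H,\bar H,\tilde H\ge0$; $Q_t\ge d_1I_d$ and $R_t\ge d_2I_k$ for all $t$, where $d_1\ge0$, $d_2>0$; $\sup_t|S_t|^2<d_1d_2$ if $d_1>0$, and $S\equiv0$ if $d_1=0$. Probability. $(\Omega,\mathcal F,\mathbb F=(\mathcal F_t)_{t\in[0,T]},\mathbb P)$ is a complete filtered probability space satisfying the usual conditions, $W$ a $d$-dimensional $\mathbb F$-Brownian motion, $\xi$ an $\mathbb R^d$-valued $\mathcal F_0$-measurable random variable independent of $W$, with law $\nu$ having finite second moment. $\mathcal F_0$ supports a uniform random variable independent of $(\xi,W)$. $\mathbb F^1$ is the filtration generated by $\xi$ and $W$ (satisfying the usual conditions). For a filtration $\mathbb G$, $\mathbb H^2(\mathbb G)$ is the set of $\mathbb G$-progressively measurable $\mathbb R^k$-valued processes $\alpha$ with $\mathbb E\int_0^T|\alpha_t|^2dt<\infty$.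 "Independent of $\xi$ and $W$" means independent of the pair $(\xi,W)$. State and payoff. For $\lambda\in\mathbb H^2(\mathbb F)$, $X=X^\lambda$ solves $dX_t=(A_tX_t+B_t\lambda_t)dt+\sigma_tdW_t$, $X_0=\xi$, and $$\begin{aligned}\mathfrak J(\lambda,\mu)=\mathbb E\Big[&\int_0^T\big(\langle L_t,\mu_t\rangle-\tfrac12\langle\bar Q_t\mu_t,\mu_t\rangle-\tfrac12\langle Q_tX_t,X_t\rangle-\langle\tilde Q_tX_t,\mu_t\rangle-\langle q_t,X_t\rangle-\tfrac12\langle R_t\lambda_t,\lambda_t\rangle-\langle S_tX_t,\lambda_t\rangle-\langle r_t,\lambda_t\rangle\big)dt\\&-\tfrac12\langle\bar H\mu_T,\mu_T\rangle-\tfrac12\langle HX_T,X_T\rangle-\langle\tilde HX_T,\mu_T\rangle\Big].\end{aligned}$$ Correlated flow: a pair $(\lambda,\mu)$ with $\lambda\in\mathbb H^2(\mathbb F)$ and $\mu$ an $\mathcal F_0$-measurable $\mathcal C([0,T];\mathbb R^d)$-valued random variable independent of $\xi$ and $W$. Mean field coarse correlated equilibrium (CCE): a correlated flow $(\lambda,\mu)$ such that (i) $\mathfrak J(\lambda,\mu)\ge\mathfrak J(\beta,\mu)$ for every $\beta\in\mathbb H^2(\mathbb F^1)$; (ii) (consistency) $\mu_t=\mathbb E[X^\lambda_t\mid\mu]$ $\mathbb P$-a.s. for all $t\in[0,T]$. Mean field Nash equilibrium (NE): a pair $(\hat\alpha,\hat m)\in\mathbb H^2(\mathbb F^1)\times\mathcal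 C([0,T];\mathbb R^d)$ ($\hat m$ deterministic) such that $\mathfrak J(\hat\alpha,\hat m)=\max_{\beta\in\mathbb H^2(\mathbb F^1)}\mathfrak J(\beta,\hat m)$ and $\hat m_t=\mathbb E[X^{\hat\alpha}_t]$ for all $t\in[0,T]$. MFC (mean field control) solution: a strategy $\hat\alpha^{MFC}\in\mathbb H^2(\mathbb F^1)$ with $\mathfrak J(\hat\alpha^{MFC},\mathbb E[X^{\hat\alpha^{MFC}}])=\max_{\beta\in\mathbb H^2(\mathbb F^1)}\mathfrak J(\beta,\mathbb E[X^\beta])$, where $\mathbb E[X^\beta]=(\mathbb E[X^\beta_t])_{t\in[0,T]}$. It is taken as part of the setting that such a maximizer exists and is unique (up to $d\mathbb P\otimes dt$-null sets); it is denoted $\hat\alpha^{MFC}$. *)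

theory Defs
  imports "HOL-Probability.Probability"
begin

section \<open>Coefficients of the linear-quadratic problem\<close>

record ('d::finite, 'k::finite) lq_data =
  lq_T :: real
  lq_A :: "real \<Rightarrow> real ^ 'd ^ 'd"
  lq_B :: "real \<Rightarrow> real ^ 'k ^ 'd"
  lq_sigma :: "real \<Rightarrow> real ^ 'd ^ 'd"
  lq_Q :: "real \<Rightarrow> real ^ 'd ^ 'd"
  lq_Qbar :: "real \<Rightarrow> real ^ 'd ^ 'd"
  lq_Qtilde :: "real \<Rightarrow> real ^ 'd ^ 'd"
  lq_R :: "real \<Rightarrow> real ^ 'k ^ 'k"
  lq_S :: "real \<Rightarrow> real ^ 'd ^ 'k"
  lq_L :: "real \<Rightarrow> real ^ 'd"
  lq_q :: "real \<Rightarrow> real ^ 'd"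
  lq_r :: "real \<Rightarrow> real ^ 'k"
  lq_H :: "real ^ 'd ^ 'd"
  lq_Hbar :: "real ^ 'd ^ 'd"
  lq_Htilde :: "real ^ 'd ^ 'd"

definition sym_mat :: "real ^ 'n ^ 'n \<Rightarrow> bool" where
  "sym_mat N \<longleftrightarrow> transpose N = N"

definition psd_le :: "real ^ 'n ^ 'n \<Rightarrow> real ^ 'n ^ 'n \<Rightarrow> bool" where
  "psd_le N N' \<longleftrightarrow> (\<forall>x. 0 \<le> x \<bullet> ((N' - N) *v x))"

text \<open>An element of \<open>L\<^sup>\<infinity>([0,T])\<close> is represented by a Borel function. Every class has a Borel
  representative, and nothing below depends on its choice.\<close>

definition Linfty :: "real \<Rightarrow> (real \<Rightarrow> 'b::euclidean_space) \<Rightarrow> bool" where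
  "Linfty T f \<longleftrightarrow>
     f \<in> borel_measurable (restrict_space lborel {0..T}) \<and>
     (\<exists>C. AE t in restrict_space lborel {0..T}. norm (f t) \<le> C)"

text \<open>The norm of \<open>S\<^sub>t\<close> is the operator norm; it is bounded by the Frobenius norm (which is \<open>norm\<close> on
  this type), so the hypothesis also covers that reading. \<open>mat c\<close> is \<open>c\<close> times the identity.\<close>

definition lq_coefficients :: "('d::finite, 'k::finite) lq_data \<Rightarrow> bool" where
  "lq_coefficients D \<longleftrightarrow>
     0 < lq_T D \<and>
     Linfty (lq_T D) (lq_A D) \<and> Linfty (lq_T D) (lq_sigma D) \<and> Linfty (lq_T D) (lq_B D) \<and>
     Linfty (lq_T D) (lq_Q D) \<and> Linfty (lq_T D) (lq_Qbar D) \<and> Linfty (lq_T D) (lq_Qtilde D) \<and>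
     (\<forall>t\<in>{0..lq_T D}. sym_mat (lq_Q D t) \<and> sym_mat (lq_Qbar D t) \<and> sym_mat (lq_Qtilde D t)) \<and>
     continuous_on {0..lq_T D} (lq_R D) \<and> (\<forall>t\<in>{0..lq_T D}. sym_mat (lq_R D t)) \<and>
     Linfty (lq_T D) (lq_S D) \<and>
     Linfty (lq_T D) (lq_L D) \<and> Linfty (lq_T D) (lq_q D) \<and> Linfty (lq_T D) (lq_r D) \<and>
     sym_mat (lq_H D) \<and> sym_mat (lq_Hbar D) \<and> sym_mat (lq_Htilde D) \<and>
     psd_le 0 (lq_H D) \<and> psd_le 0 (lq_Hbar D) \<and> psd_le 0 (lq_Htilde D) \<and>
     (\<exists>d1 d2. 0 \<le> d1 \<and> 0 < d2 \<and>
        (\<forall>t\<in>{0..lq_T D}. psd_le (mat d1) (lq_Q D t) \<and> psd_le (mat d2) (lq_R D t)) \<and>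
        (0 < d1 \<longrightarrow> (\<exists>c < d1 * d2. \<forall>t\<in>{0..lq_T D}. (onorm ((*v) (lq_S D t)))\<^sup>2 \<le> c)) \<and>
        (d1 = 0 \<longrightarrow> (\<forall>t\<in>{0..lq_T D}. lq_S D t = 0)))"


section \<open>Stochastic basis\<close>

record ('a, 'd::finite) stoch_basis =
  sb_M :: "'a measure"
  sb_F :: "real \<Rightarrow> 'a measure"
  sb_W :: "real \<Rightarrow> 'a \<Rightarrow> real ^ 'd"
  sb_xi :: "'a \<Rightarrow> real ^ 'd"

text \<open>Generators of the sigma-algebra of a single random variable; as usual a sub-sigma-algebra of
  \<open>M\<close> is a measure of which only the measurable sets matter.\<close>

definition preimages :: "'a measure \<Rightarrow> ('a \<Rightarrow> 'b::topological_space) \<Rightarrow> 'a set set" where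
  "preimages M Y = {Y -` C \<inter> space M | C. C \<in> sets borel}"

definition sigma_process ::
    "'a measure \<Rightarrow> real \<Rightarrow> (real \<Rightarrow> 'a \<Rightarrow> 'b::topological_space) \<Rightarrow> 'a measure" where
  "sigma_process M t Y = sigma (space M) (\<Union>s\<in>{0..t}. preimages M (Y s))"

definition sigma_noise ::
    "('a, 'd::finite) stoch_basis \<Rightarrow> real \<Rightarrow> 'a measure" where
  "sigma_noise P t =
     sigma (space (sb_M P)) (preimages (sb_M P) (sb_xi P) \<union> sets (sigma_process (sb_M P) t (sb_W P)))"

text \<open>At \<open>t = T\<close> there is no time to the right, so right-continuity only concerns \<open>t < T\<close>.\<close>

definition usual_filtration :: "'a measure \<Rightarrow> real \<Rightarrow> (real \<Rightarrow> 'a measure) \<Rightarrow> bool" where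
  "usual_filtration M T F \<longleftrightarrow>
     (\<forall>t\<in>{0..T}. subalgebra M (F t) \<and> null_sets M \<subseteq> sets (F t)) \<and>
     (\<forall>s\<in>{0..T}. \<forall>t\<in>{s..T}. sets (F s) \<subseteq> sets (F t)) \<and>
     (\<forall>t\<in>{0..<T}. (\<Inter>s\<in>{t<..T}. sets (F s)) = sets (F t))"

text \<open>The filtration generated by \<open>\<xi>\<close> and \<open>W\<close>, augmented by null sets and made right-continuous on
  \<open>[0,T]\<close>.\<close>

definition noise_filtration ::
    "('a, 'd::finite) stoch_basis \<Rightarrow> real \<Rightarrow> real \<Rightarrow> 'a measure" where
  "noise_filtration P T t =
     sigma (space (sb_M P))
       (\<Inter>s\<in>{t<..T} \<union> {T}.
          sets (sigma (space (sb_M P)) (sets (sigma_noise P s) \<union> null_sets (sb_M P))))"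

definition brownian_motion ::
    "'a measure \<Rightarrow> real \<Rightarrow> (real \<Rightarrow> 'a measure) \<Rightarrow> (real \<Rightarrow> 'a \<Rightarrow> real ^ 'd::finite) \<Rightarrow> bool" where
  "brownian_motion M T F W \<longleftrightarrow>
     (\<forall>t\<in>{0..T}. W t \<in> borel_measurable (F t)) \<and>
     (AE \<omega> in M. W 0 \<omega> = 0) \<and>
     (AE \<omega> in M. continuous_on {0..T} (\<lambda>t. W t \<omega>)) \<and>
     (\<forall>s t. 0 \<le> s \<and> s < t \<and> t \<le> T \<longrightarrow>
        prob_space.indep_set M (sets (F s)) (preimages M (\<lambda>\<omega>. W t \<omega> - W s \<omega>)) \<and>
        distributed M lborel (\<lambda>\<omega>. W t \<omega> - W s \<omega>)
          (\<lambda>x. ennreal (\<Prod>i\<in>UNIV. normal_density 0 (sqrt (t - s)) (x $ i))))"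

definition stochastic_setting :: "('a, 'd::finite) stoch_basis \<Rightarrow> real \<Rightarrow> bool" where
  "stochastic_setting P T \<longleftrightarrow>
     prob_space (sb_M P) \<and> complete_measure (sb_M P) \<and>
     usual_filtration (sb_M P) T (sb_F P) \<and>
     brownian_motion (sb_M P) T (sb_F P) (sb_W P) \<and>
     sb_xi P \<in> borel_measurable (sb_F P 0) \<and>
     integrable (sb_M P) (\<lambda>\<omega>. (norm (sb_xi P \<omega>))\<^sup>2) \<and>
     prob_space.indep_set (sb_M P) (preimages (sb_M P) (sb_xi P))
       (sets (sigma_process (sb_M P) T (sb_W P))) \<and>
     (\<exists>U :: 'a \<Rightarrow> real. U \<in> borel_measurable (sb_F P 0) \<and>
        distr (sb_M P) borel U = uniform_measure lborel {0..1} \<and>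
        prob_space.indep_set (sb_M P) (preimages (sb_M P) U) (sets (sigma_noise P T)))"


section \<open>Controls and state equation\<close>

definition progressive ::
    "real \<Rightarrow> (real \<Rightarrow> 'a measure) \<Rightarrow> (real \<Rightarrow> 'a \<Rightarrow> 'b::topological_space) \<Rightarrow> bool" where
  "progressive T G Y \<longleftrightarrow>
     (\<forall>t\<in>{0..T}. (\<lambda>(s, \<omega>). Y s \<omega>) \<in> borel_measurable (restrict_space borel {0..t} \<Otimes>\<^sub>M G t))"

definition H2 ::
    "'a measure \<Rightarrow> real \<Rightarrow> (real \<Rightarrow> 'a measure) \<Rightarrow> (real \<Rightarrow> 'a \<Rightarrow> real ^ 'k::finite) set" where
  "H2 M T G = {\<alpha>. progressive T G \<alpha> \<and>
     (\<integral>\<^sup>+\<omega>. (\<integral>\<^sup>+t\<in>{0..T}. ennreal ((norm (\<alpha> t \<omega>))\<^sup>2) \<partial>lborel) \<partial>M) < \<infinity>}"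

abbreviation H2_full where
  "H2_full D P \<equiv> H2 (sb_M P) (lq_T D) (sb_F P)"

abbreviation H2_noise where
  "H2_noise D P \<equiv> H2 (sb_M P) (lq_T D) (noise_filtration P (lq_T D))"

text \<open>The diffusion coefficient is deterministic, so the stochastic integral in the state equation is
  a Wiener integral: the extension by the isometry from deterministic step functions
  \<open>\<Sum>i<n. v i \<cdot> 1_{(p i, p (i+1)]}\<close>. The relation says that \<open>I t\<close> is a version of the integral of
  \<open>g\<close> over \<open>[0,t]\<close> for every \<open>t \<in> [0,T]\<close>.\<close>

definition step_fun :: "nat \<Rightarrow> (nat \<Rightarrow> real) \<Rightarrow> (nat \<Rightarrow> 'b::real_vector) \<Rightarrow> real \<Rightarrow> 'b" where
  "step_fun n p v s = (\<Sum>i<n. if p i < s \<and> s \<le> p (Suc i) then v i else 0)"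

definition step_integral ::
    "(real \<Rightarrow> 'a \<Rightarrow> real ^ 'd) \<Rightarrow> nat \<Rightarrow> (nat \<Rightarrow> real) \<Rightarrow> (nat \<Rightarrow> real ^ 'd ^ 'e) \<Rightarrow>
     real \<Rightarrow> 'a \<Rightarrow> real ^ 'e" where
  "step_integral W n p v t \<omega> = (\<Sum>i<n. v i *v (W (min t (p (Suc i))) \<omega> - W (min t (p i)) \<omega>))"

definition wiener_integral ::
    "'a measure \<Rightarrow> real \<Rightarrow> (real \<Rightarrow> 'a \<Rightarrow> real ^ 'd::finite) \<Rightarrow> (real \<Rightarrow> real ^ 'd ^ 'e::finite) \<Rightarrow>
     (real \<Rightarrow> 'a \<Rightarrow> real ^ 'e) \<Rightarrow> bool" where
  "wiener_integral M T W g I \<longleftrightarrow>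
     (\<forall>t\<in>{0..T}. I t \<in> borel_measurable M) \<and>
     (\<exists>n p v.
        (\<forall>m. (\<forall>i\<le>n m. p m i \<in> {0..T}) \<and> (\<forall>i<n m. p m i \<le> p m (Suc i))) \<and>
        (\<lambda>m. \<integral>\<^sup>+s\<in>{0..T}. ennreal ((norm (step_fun (n m) (p m) (v m) s - g s))\<^sup>2) \<partial>lborel)
          \<longlonglongrightarrow> 0 \<and>
        (\<forall>t\<in>{0..T}.
          (\<lambda>m. \<integral>\<^sup>+\<omega>. ennreal ((norm (step_integral W (n m) (p m) (v m) t \<omega> - I t \<omega>))\<^sup>2) \<partial>M)
            \<longlonglongrightarrow> 0))"

definition state_solution ::
    "('d::finite, 'k::finite) lq_data \<Rightarrow> ('a, 'd) stoch_basis \<Rightarrow>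
     (real \<Rightarrow> 'a \<Rightarrow> real ^ 'k) \<Rightarrow> (real \<Rightarrow> 'a \<Rightarrow> real ^ 'd) \<Rightarrow> bool" where
  "state_solution D P lam x \<longleftrightarrow>
     (\<forall>t\<in>{0..lq_T D}. x t \<in> borel_measurable (sb_F P t)) \<and>
     (AE \<omega> in sb_M P. continuous_on {0..lq_T D} (\<lambda>t. x t \<omega>)) \<and>
     (\<exists>I. wiener_integral (sb_M P) (lq_T D) (sb_W P) (lq_sigma D) I \<and>
        (AE \<omega> in sb_M P. \<forall>t\<in>{0..lq_T D}.
           x t \<omega> = sb_xi P \<omega>
             + (LINT s:{0..t}|lborel. lq_A D s *v x s \<omega> + lq_B D s *v lam s \<omega>) + I t \<omega>))"

text \<open>A choice of the solution \<open>X\<^sup>\<lambda>\<close> for every admissible \<open>\<lambda>\<close>.\<close>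

definition state_map ::
    "('d::finite, 'k::finite) lq_data \<Rightarrow> ('a, 'd) stoch_basis \<Rightarrow>
     ((real \<Rightarrow> 'a \<Rightarrow> real ^ 'k) \<Rightarrow> real \<Rightarrow> 'a \<Rightarrow> real ^ 'd) \<Rightarrow> bool" where
  "state_map D P X \<longleftrightarrow> (\<forall>lam \<in> H2_full D P. state_solution D P lam (X lam))"


section \<open>Payoff and equilibria\<close>

definition payoff ::
    "('d::finite, 'k::finite) lq_data \<Rightarrow> ('a, 'd) stoch_basis \<Rightarrow>
     ((real \<Rightarrow> 'a \<Rightarrow> real ^ 'k) \<Rightarrow> real \<Rightarrow> 'a \<Rightarrow> real ^ 'd) \<Rightarrow>
     (real \<Rightarrow> 'a \<Rightarrow> real ^ 'k) \<Rightarrow> (real \<Rightarrow> 'a \<Rightarrow> real ^ 'd) \<Rightarrow> real" where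
  "payoff D P X lam mu =
     (\<integral>\<omega>.
        (LINT t:{0..lq_T D}|lborel.
             lq_L D t \<bullet> mu t \<omega>
           - 1/2 * ((lq_Qbar D t *v mu t \<omega>) \<bullet> mu t \<omega>)
           - 1/2 * ((lq_Q D t *v X lam t \<omega>) \<bullet> X lam t \<omega>)
           - (lq_Qtilde D t *v X lam t \<omega>) \<bullet> mu t \<omega>
           - lq_q D t \<bullet> X lam t \<omega>
           - 1/2 * ((lq_R D t *v lam t \<omega>) \<bullet> lam t \<omega>)
           - (lq_S D t *v X lam t \<omega>) \<bullet> lam t \<omega>
           - lq_r D t \<bullet> lam t \<omega>)
        - 1/2 * ((lq_Hbar D *v mu (lq_T D) \<omega>) \<bullet> mu (lq_T D) \<omega>)
        - 1/2 * ((lq_H D *v X lam (lq_T D) \<omega>) \<bullet> X lam (lq_T D) \<omega>)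
        - (lq_Htilde D *v X lam (lq_T D) \<omega>) \<bullet> mu (lq_T D) \<omega> \<partial>sb_M P)"

text \<open>The Borel sigma-algebra of \<open>C([0,T])\<close> is generated by the evaluations, so measurability of a
  \<open>C([0,T])\<close>-valued random variable \<open>\<mu>\<close> and \<open>\<sigma>(\<mu>)\<close> are expressed through \<open>(\<mu>\<^sub>t)\<^sub>t\<close>.\<close>

definition correlated_flow ::
    "('d::finite, 'k::finite) lq_data \<Rightarrow> ('a, 'd) stoch_basis \<Rightarrow>
     (real \<Rightarrow> 'a \<Rightarrow> real ^ 'k) \<Rightarrow> (real \<Rightarrow> 'a \<Rightarrow> real ^ 'd) \<Rightarrow> bool" where
  "correlated_flow D P lam mu \<longleftrightarrow>
     lam \<in> H2_full D P \<and>
     (\<forall>\<omega>\<in>space (sb_M P). continuous_on {0..lq_T D} (\<lambda>t. mu t \<omega>)) \<and>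
     (\<forall>t\<in>{0..lq_T D}. mu t \<in> borel_measurable (sb_F P 0)) \<and>
     prob_space.indep_set (sb_M P)
       (sets (sigma_process (sb_M P) (lq_T D) mu)) (sets (sigma_noise P (lq_T D)))"

definition mean_field_CCE ::
    "('d::finite, 'k::finite) lq_data \<Rightarrow> ('a, 'd) stoch_basis \<Rightarrow>
     ((real \<Rightarrow> 'a \<Rightarrow> real ^ 'k) \<Rightarrow> real \<Rightarrow> 'a \<Rightarrow> real ^ 'd) \<Rightarrow>
     (real \<Rightarrow> 'a \<Rightarrow> real ^ 'k) \<Rightarrow> (real \<Rightarrow> 'a \<Rightarrow> real ^ 'd) \<Rightarrow> bool" where
  "mean_field_CCE D P X lam mu \<longleftrightarrow>
     correlated_flow D P lam mu \<and>
     (\<forall>\<beta>\<in>H2_noise D P. payoff D P X lam mu \<ge> payoff D P X \<beta> mu) \<and>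
     (\<forall>t\<in>{0..lq_T D}. AE \<omega> in sb_M P. \<forall>i.
        mu t \<omega> $ i =
        real_cond_exp (sb_M P) (sigma_process (sb_M P) (lq_T D) mu) (\<lambda>\<omega>'. X lam t \<omega>' $ i) \<omega>)"

definition mean_state ::
    "('a, 'd::finite) stoch_basis \<Rightarrow>
     ((real \<Rightarrow> 'a \<Rightarrow> real ^ 'k::finite) \<Rightarrow> real \<Rightarrow> 'a \<Rightarrow> real ^ 'd) \<Rightarrow>
     (real \<Rightarrow> 'a \<Rightarrow> real ^ 'k) \<Rightarrow> real \<Rightarrow> real ^ 'd" where
  "mean_state P X \<beta> t = (\<integral>\<omega>. X \<beta> t \<omega> \<partial>sb_M P)"

text \<open>A deterministic flow \<open>m\<close> enters the payoff as the process \<open>\<lambda>t \<omega>. m t\<close>.\<close>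

definition mean_field_NE ::
    "('d::finite, 'k::finite) lq_data \<Rightarrow> ('a, 'd) stoch_basis \<Rightarrow>
     ((real \<Rightarrow> 'a \<Rightarrow> real ^ 'k) \<Rightarrow> real \<Rightarrow> 'a \<Rightarrow> real ^ 'd) \<Rightarrow>
     (real \<Rightarrow> 'a \<Rightarrow> real ^ 'k) \<Rightarrow> (real \<Rightarrow> real ^ 'd) \<Rightarrow> bool" where
  "mean_field_NE D P X \<alpha> m \<longleftrightarrow>
     \<alpha> \<in> H2_noise D P \<and> continuous_on {0..lq_T D} m \<and>
     (\<forall>\<beta>\<in>H2_noise D P. payoff D P X \<beta> (\<lambda>t \<omega>. m t) \<le> payoff D P X \<alpha> (\<lambda>t \<omega>. m t)) \<and>
     (\<forall>t\<in>{0..lq_T D}. m t = mean_state P X \<alpha> t)"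

definition MFC_maximizer ::
    "('d::finite, 'k::finite) lq_data \<Rightarrow> ('a, 'd) stoch_basis \<Rightarrow>
     ((real \<Rightarrow> 'a \<Rightarrow> real ^ 'k) \<Rightarrow> real \<Rightarrow> 'a \<Rightarrow> real ^ 'd) \<Rightarrow>
     (real \<Rightarrow> 'a \<Rightarrow> real ^ 'k) \<Rightarrow> bool" where
  "MFC_maximizer D P X \<alpha> \<longleftrightarrow>
     \<alpha> \<in> H2_noise D P \<and>
     (\<forall>\<beta>\<in>H2_noise D P.
        payoff D P X \<beta> (\<lambda>t \<omega>. mean_state P X \<beta> t) \<le> payoff D P X \<alpha> (\<lambda>t \<omega>. mean_state P X \<alpha> t))"

definition control_eq ::
    "('d::finite, 'k::finite) lq_data \<Rightarrow> ('a, 'd) stoch_basis \<Rightarrow>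
     (real \<Rightarrow> 'a \<Rightarrow> real ^ 'k) \<Rightarrow> (real \<Rightarrow> 'a \<Rightarrow> real ^ 'k) \<Rightarrow> bool" where
  "control_eq D P \<alpha> \<beta> \<longleftrightarrow>
     (AE (\<omega>, t) in sb_M P \<Otimes>\<^sub>M restrict_space lborel {0..lq_T D}. \<alpha> t \<omega> = \<beta> t \<omega>)"

definition MFC_solution ::
    "('d::finite, 'k::finite) lq_data \<Rightarrow> ('a, 'd) stoch_basis \<Rightarrow>
     ((real \<Rightarrow> 'a \<Rightarrow> real ^ 'k) \<Rightarrow> real \<Rightarrow> 'a \<Rightarrow> real ^ 'd) \<Rightarrow>
     (real \<Rightarrow> 'a \<Rightarrow> real ^ 'k) \<Rightarrow> bool" where
  "MFC_solution D P X \<alpha> \<longleftrightarrow>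
     MFC_maximizer D P X \<alpha> \<and> (\<forall>\<beta>. MFC_maximizer D P X \<beta> \<longrightarrow> control_eq D P \<beta> \<alpha>)"

end

theory Submission
  imports Defs
begin

text \<open>Write a mean field CCE as a perturbation of the optimal control and its mean path, and expand the
  quadratic payoff around the latter. Stationarity of the optimum in the directions adapted to the
  noise extends to all directions adapted to the large filtration: by approximation it suffices to
  consider a control \<open>Z v\<close> on a time interval starting at \<open>a\<close>, and the part of \<open>Z\<close> that is
  orthogonal to the noise up to \<open>a\<close> is orthogonal to the whole noise. The fluctuation of the flow
  is independent of the noise, so that the first-order term vanishes. In the second-order term,
  condition on the flow: by consistency, the deviation of the flow solves the state equation driven
  by the conditional deviation of the control. For each realisation of the flow this is a
  deterministic perturbation of the control problem together with its own mean path, whose curvature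
  is nonnegative and vanishes only at zero because the optimum is unique. The conditionally centred
  rest does not move the flow and is controlled by the coercivity of the cost in the control. So the
  CCE cannot beat the optimum, and in the case of equality both deviations vanish. Then the
  optimality of the CCE against controls adapted to the noise is the Nash property.\<close>

section \<open>Square-integrable functions\<close>

text \<open>Neither \<open>lq_Qbar\<close> nor \<open>lq_Qtilde\<close> controls the other, so the
  quadratic form of the running cost need not be nonnegative at a point. Its sign along a control
  and its own mean path is extracted from the optimum itself, as the second-order condition for the
  maximum of a quadratic polynomial in the size of the perturbation. That condition is available
  only for controls adapted to the noise. Conditioning on the flow leads back to this class: path by
  path the conditional control is a deterministic function, hence adapted to any filtration.
  Orthogonality is obtained by testing: multiplying the state equation by a square-integrable
  variable \<open>Z\<close> and taking expectations gives a deterministic linear equation, whose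
  solution vanishes when its data do. Since the diffusion coefficient does not depend on the
  control, differences of states solve a linear equation without noise, path by path. Processes live
  on the product \<open>N\<close> of the probability space with Lebesgue measure on
  \<open>{0..T}\<close>, where the payoff is a quadratic polynomial of square-integrable
  functions.\<close>

lemma bounded_bilinear_matrix_vector_mult:
  "bounded_bilinear ((*v) :: real ^ 'n ^ 'm \<Rightarrow> real ^ 'n \<Rightarrow> real ^ 'm)"
  unfolding bilinear_conv_bounded_bilinear[symmetric] bilinear_def
  by (intro conjI allI linearI)
    (auto simp: matrix_vector_mult_add_rdistrib matrix_vector_right_distrib
      matrix_vector_mult_scaleR scaleR_matrix_vector_assoc)

lemma borel_measurable_matrix_vector_mult [measurable (raw)]:
  fixes f :: "'x \<Rightarrow> real ^ 'n ^ 'm" and g :: "'x \<Rightarrow> real ^ 'n"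
  assumes "f \<in> borel_measurable M" "g \<in> borel_measurable M"
  shows "(\<lambda>x. f x *v g x) \<in> borel_measurable M"
proof (rule borel_measurable_continuous_Pair[OF assms])
  interpret bounded_bilinear "(*v) :: real ^ 'n ^ 'm \<Rightarrow> real ^ 'n \<Rightarrow> real ^ 'm"
    by (rule bounded_bilinear_matrix_vector_mult)
  show "continuous_on UNIV (\<lambda>x :: (real ^ 'n ^ 'm) \<times> (real ^ 'n). fst x *v snd x)"
    by (intro continuous_on continuous_intros)
qed

lemma matrix_vector_norm_bound:
  "\<exists>C>0. \<forall>(A :: real ^ 'n ^ 'm) x. norm (A *v x) \<le> norm A * norm x * C"
  using bounded_bilinear.pos_bounded[OF bounded_bilinear_matrix_vector_mult] by auto

text \<open>Functions, not classes: a change on a null set keeps the property only together with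
  measurability of the new function, which \<open>sq_int_cong_AE\<close> asks for. On the
  probability space this measurability comes from completeness.\<close>

definition sq_int :: "'x measure \<Rightarrow> ('x \<Rightarrow> 'b::euclidean_space) \<Rightarrow> bool" where
  "sq_int M f \<longleftrightarrow> f \<in> borel_measurable M \<and> integrable M (\<lambda>x. (norm (f x))\<^sup>2)"

lemma sq_int_measurable [measurable_dest]: "sq_int M f \<Longrightarrow> f \<in> borel_measurable M"
  by (simp add: sq_int_def)

lemma sq_int_norm: "sq_int M f \<Longrightarrow> integrable M (\<lambda>x. (norm (f x))\<^sup>2)"
  by (simp add: sq_int_def)

lemma sq_int_bound:
  assumes "sq_int M f" "g \<in> borel_measurable M" "AE x in M. norm (g x) \<le> C * norm (f x)"
  shows "sq_int M g"
  unfolding sq_int_def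
proof
  show "integrable M (\<lambda>x. (norm (g x))\<^sup>2)"
  proof (rule Bochner_Integration.integrable_bound)
    show "integrable M (\<lambda>x. C\<^sup>2 * (norm (f x))\<^sup>2)"
      using sq_int_norm[OF assms(1)] by simp
    show "AE x in M. norm ((norm (g x))\<^sup>2) \<le> norm (C\<^sup>2 * (norm (f x))\<^sup>2)"
      using assms(3)
    proof eventually_elim
      case (elim x)
      then have "(norm (g x))\<^sup>2 \<le> (C * norm (f x))\<^sup>2"
        by (rule power_mono) simp
      then show ?case by (simp add: power_mult_distrib)
    qed
  qed (use assms(2) in measurable)
qed fact

lemma sq_int_cong_AE:
  assumes "sq_int M f" "g \<in> borel_measurable M" "AE x in M. f x = g x"
  shows "sq_int M g"
  by (rule sq_int_bound[OF assms(1,2), where C = 1]) (use assms(3) in auto)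

lemma norm_add_power2: "(norm (a + b))\<^sup>2 \<le> 2 * (norm (a::'b::real_normed_vector))\<^sup>2 + 2 * (norm b)\<^sup>2"
proof -
  have "(norm (a + b))\<^sup>2 \<le> (norm a + norm b)\<^sup>2"
    by (intro power_mono norm_triangle_ineq) simp
  also have "\<dots> \<le> 2 * (norm a)\<^sup>2 + 2 * (norm b)\<^sup>2"
    using sum_squares_bound[of "norm a" "norm b"] by (simp add: power2_sum)
  finally show ?thesis .
qed

lemma sq_int_add:
  assumes "sq_int M f" "sq_int M g"
  shows "sq_int M (\<lambda>x. f x + g x)"
  unfolding sq_int_def
proof
  note [measurable] = assms
  show "(\<lambda>x. f x + g x) \<in> borel_measurable M" by measurable
  show "integrable M (\<lambda>x. (norm (f x + g x))\<^sup>2)"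
  proof (rule Bochner_Integration.integrable_bound)
    show "integrable M (\<lambda>x. 2 * (norm (f x))\<^sup>2 + 2 * (norm (g x))\<^sup>2)"
      using assms by (auto simp: sq_int_norm)
    show "AE x in M. norm ((norm (f x + g x))\<^sup>2) \<le> norm (2 * (norm (f x))\<^sup>2 + 2 * (norm (g x))\<^sup>2)"
      by (intro AE_I2) (simp add: norm_add_power2)
  qed measurable
qed

lemma sq_int_scaleR: "sq_int M f \<Longrightarrow> sq_int M (\<lambda>x. c *\<^sub>R f x)"
  by (rule sq_int_bound[where C = "\<bar>c\<bar>"]) (auto dest: sq_int_measurable)

lemma sq_int_uminus: "sq_int M f \<Longrightarrow> sq_int M (\<lambda>x. - f x)"
  using sq_int_scaleR[of M f "-1"] by simp

lemma sq_int_diff: "sq_int M f \<Longrightarrow> sq_int M g \<Longrightarrow> sq_int M (\<lambda>x. f x - g x)"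
  using sq_int_add[of M f "\<lambda>x. - g x"] sq_int_uminus[of M g] by simp

lemma sq_int_zero [simp]: "sq_int M (\<lambda>x. 0)"
  by (simp add: sq_int_def)

lemma sq_int_sum: "(\<And>i. i \<in> I \<Longrightarrow> sq_int M (f i)) \<Longrightarrow> sq_int M (\<lambda>x. \<Sum>i\<in>I. f i x)"
  by (induction I rule: infinite_finite_induct) (auto intro: sq_int_add)

lemma sq_int_const [simp]: "finite_measure M \<Longrightarrow> sq_int M (\<lambda>x. c)"
  by (auto simp: sq_int_def finite_measure.integrable_const)

lemma sq_int_scale_bounded:
  assumes "sq_int M f" "(g :: _ \<Rightarrow> real) \<in> borel_measurable M" "AE x in M. \<bar>g x\<bar> \<le> C"
  shows "sq_int M (\<lambda>x. g x *\<^sub>R f x)"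
proof (rule sq_int_bound[OF assms(1)])
  show "(\<lambda>x. g x *\<^sub>R f x) \<in> borel_measurable M"
    using assms by measurable
  show "AE x in M. norm (g x *\<^sub>R f x) \<le> C * norm (f x)"
    using assms(3) by eventually_elim (simp add: mult_right_mono)
qed

lemma sq_int_indicator_scaleR:
  "sq_int M f \<Longrightarrow> A \<in> sets M \<Longrightarrow> sq_int M (\<lambda>x. indicator A x *\<^sub>R f x)"
  by (rule sq_int_scale_bounded[where C = 1]) (auto simp: indicator_def)

lemma sq_int_matrix:
  fixes A :: "'x \<Rightarrow> real ^ 'n ^ 'm"
  assumes "sq_int M f" "A \<in> borel_measurable M" "AE x in M. norm (A x) \<le> C"
  shows "sq_int M (\<lambda>x. A x *v f x)"
proof -
  obtain K where K: "K > 0" "\<And>(A :: real ^ 'n ^ 'm) x. norm (A *v x) \<le> norm A * norm x * K"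
    using matrix_vector_norm_bound by metis
  show ?thesis
  proof (rule sq_int_bound[OF assms(1)])
    show "(\<lambda>x. A x *v f x) \<in> borel_measurable M"
      using assms by measurable
    show "AE x in M. norm (A x *v f x) \<le> (C * K) * norm (f x)"
      using assms(3)
    proof eventually_elim
      case (elim x)
      have "norm (A x *v f x) \<le> norm (A x) * norm (f x) * K" by (rule K)
      also have "\<dots> \<le> C * norm (f x) * K"
        using elim K(1) by (intro mult_right_mono) auto
      finally show ?case by (simp add: ac_simps)
    qed
  qed
qed

lemma norm_mult_le_squares: "norm a * norm b \<le> (norm a)\<^sup>2 + (norm b)\<^sup>2"
proof -
  have "0 \<le> norm a * norm b" by simp
  then show ?thesis using sum_squares_bound[of "norm a" "norm b"] by linarith
qed

lemma sq_int_inner: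
  assumes "sq_int M f" "sq_int M g"
  shows "integrable M (\<lambda>x. f x \<bullet> g x)"
proof (rule Bochner_Integration.integrable_bound)
  note [measurable] = assms
  show "integrable M (\<lambda>x. (norm (f x))\<^sup>2 + (norm (g x))\<^sup>2)"
    using assms by (auto simp: sq_int_norm)
  show "(\<lambda>x. f x \<bullet> g x) \<in> borel_measurable M" by measurable
  show "AE x in M. norm (f x \<bullet> g x) \<le> norm ((norm (f x))\<^sup>2 + (norm (g x))\<^sup>2)"
    by (intro AE_I2) (simp add: order_trans[OF Cauchy_Schwarz_ineq2 norm_mult_le_squares])
qed

lemma sq_int_scaleR_fun:
  assumes "sq_int M (f :: _ \<Rightarrow> real)" "sq_int M g"
  shows "integrable M (\<lambda>x. f x *\<^sub>R g x)"
proof (rule Bochner_Integration.integrable_bound)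
  note [measurable] = assms
  show "integrable M (\<lambda>x. (norm (f x))\<^sup>2 + (norm (g x))\<^sup>2)"
    using sq_int_norm[OF assms(1)] sq_int_norm[OF assms(2)] by auto
  show "(\<lambda>x. f x *\<^sub>R g x) \<in> borel_measurable M" by measurable
  show "AE x in M. norm (f x *\<^sub>R g x) \<le> norm ((norm (f x))\<^sup>2 + (norm (g x))\<^sup>2)"
    using norm_mult_le_squares[of "f _" "g _"] by (intro AE_I2) simp
qed

lemma sq_int_integrable:
  assumes "finite_measure M" "sq_int M f"
  shows "integrable M f"
  using sq_int_scaleR_fun[of M "\<lambda>_. 1" f] assms by simp

lemma sq_int_Pair:
  assumes "sq_int M f" "sq_int M g"
  shows "sq_int M (\<lambda>x. (f x, g x))"
  using assms by (auto simp: sq_int_def norm_Pair)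

lemma sq_int_bounded_linear:
  assumes "sq_int M f" "bounded_linear h"
  shows "sq_int M (\<lambda>x. h (f x))"
proof -
  obtain K where K: "\<And>x. norm (h x) \<le> norm x * K"
    using bounded_linear.bounded[OF assms(2)] by blast
  have [measurable]: "h \<in> borel_measurable borel"
    by (intro borel_measurable_continuous_onI linear_continuous_on assms)
  show ?thesis
    by (rule sq_int_bound[OF assms(1), where C = K])
      (use assms(1) K in \<open>auto simp: mult.commute intro!: AE_I2 dest: sq_int_measurable\<close>)
qed

lemma sq_int_fst: "sq_int M f \<Longrightarrow> sq_int M (\<lambda>x. fst (f x))"
  and sq_int_snd: "sq_int M f \<Longrightarrow> sq_int M (\<lambda>x. snd (f x))"
  and sq_int_vec_nth: "sq_int M g \<Longrightarrow> sq_int M (\<lambda>x. g x $ i)"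
  by (erule sq_int_bounded_linear, rule bounded_linear_fst bounded_linear_snd bounded_linear_vec_nth)+

lemma sq_int_vec:
  fixes f :: "'x \<Rightarrow> real ^ 'n"
  assumes "\<And>i. sq_int M (\<lambda>x. f x $ i)"
  shows "sq_int M f"
proof -
  have "sq_int M (\<lambda>x. \<Sum>i\<in>UNIV. (f x $ i) *\<^sub>R (axis i 1 :: real ^ 'n))"
  proof (rule sq_int_sum)
    fix i
    show "sq_int M (\<lambda>x. (f x $ i) *\<^sub>R (axis i 1 :: real ^ 'n))"
      using sq_int_bounded_linear[OF assms[of i] bounded_linear_scaleR_left[of "axis i 1"]] by simp
  qed
  moreover have "(\<Sum>i\<in>UNIV. (f x $ i) *\<^sub>R (axis i 1 :: real ^ 'n)) = f x" for x
    using basis_expansion[of "f x"] by (simp only: scalar_mult_eq_scaleR)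
  ultimately show ?thesis by simp
qed

section \<open>Integral inequalities of Cauchy-Schwarz and Gronwall type\<close>

lemma Cauchy_Schwarz_scaleR:
  fixes f :: "'x \<Rightarrow> real" and g :: "'x \<Rightarrow> 'b::euclidean_space"
  assumes f: "sq_int M f" and g: "sq_int M g"
  shows "(norm (\<integral>x. f x *\<^sub>R g x \<partial>M))\<^sup>2 \<le> (\<integral>x. (f x)\<^sup>2 \<partial>M) * (\<integral>x. (norm (g x))\<^sup>2 \<partial>M)"
proof -
  let ?F = "\<integral>x. (f x)\<^sup>2 \<partial>M" and ?V = "\<integral>x. f x *\<^sub>R g x \<partial>M" and ?G = "\<integral>x. (norm (g x))\<^sup>2 \<partial>M"
  have iF: "integrable M (\<lambda>x. (f x)\<^sup>2)" using sq_int_norm[OF f] by simp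
  have iG: "integrable M (\<lambda>x. (norm (g x))\<^sup>2)" by (rule sq_int_norm[OF g])
  have iV: "integrable M (\<lambda>x. f x *\<^sub>R g x)" by (rule sq_int_scaleR_fun[OF f g])
  have iVV: "integrable M (\<lambda>x. (f x *\<^sub>R g x) \<bullet> ?V)" using iV by (rule integrable_inner_left)
  \<comment> \<open>\<open>?F g - f ?V\<close> is \<open>?F\<close> times the component of
    \<open>g\<close> orthogonal to \<open>f\<close>, so no division is involved. Integrating its
    squared norm gives \<open>?F (?F ?G - |?V|^2) \<ge> 0\<close>; when \<open>?F = 0\<close> the
    function \<open>f\<close> vanishes almost everywhere and both sides are zero.\<close>
  have pt: "(norm (?F *\<^sub>R g x - f x *\<^sub>R ?V))\<^sup>2
      = ?F\<^sup>2 * (norm (g x))\<^sup>2 - 2 * ?F * ((f x *\<^sub>R g x) \<bullet> ?V) + (f x)\<^sup>2 * (norm ?V)\<^sup>2" for x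
    unfolding power2_norm_eq_inner
    by (simp add: inner_diff_left inner_diff_right inner_commute power2_eq_square algebra_simps)
  have "0 \<le> (\<integral>x. (norm (?F *\<^sub>R g x - f x *\<^sub>R ?V))\<^sup>2 \<partial>M)" by simp
  also have "\<dots> = ?F\<^sup>2 * ?G - 2 * ?F * (\<integral>x. (f x *\<^sub>R g x) \<bullet> ?V \<partial>M) + ?F * (norm ?V)\<^sup>2"
    unfolding pt using iF iG iVV by simp
  also have "(\<integral>x. (f x *\<^sub>R g x) \<bullet> ?V \<partial>M) = (norm ?V)\<^sup>2"
    using iV by (subst integral_inner_left) (simp_all add: power2_norm_eq_inner)
  finally have *: "0 \<le> ?F * (?F * ?G - (norm ?V)\<^sup>2)"
    by (simp add: power2_eq_square right_diff_distrib)
  show ?thesis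
  proof (cases "?F = 0")
    case True
    then have "AE x in M. (f x)\<^sup>2 = 0"
      using integral_nonneg_eq_0_iff_AE[OF iF] by simp
    then have "AE x in M. f x *\<^sub>R g x = 0" by eventually_elim simp
    then have "?V = 0" by (rule integral_eq_zero_AE)
    with True show ?thesis by simp
  next
    case False
    moreover have "?F \<ge> 0" by simp
    ultimately have "?F > 0" by linarith
    with * show ?thesis by (simp add: zero_le_mult_iff)
  qed
qed

text \<open>The projection argument of the scalar case carries over with \<open>f\<close> and
  \<open>g\<close> as elements of one space of vector-valued functions, so that the coefficient of
  the projection is the number \<open>?V\<close>.\<close>

lemma Cauchy_Schwarz_inner:
  fixes f g :: "'x \<Rightarrow> 'b::euclidean_space"
  assumes f: "sq_int M f" and g: "sq_int M g"
  shows "(\<integral>x. f x \<bullet> g x \<partial>M)\<^sup>2 \<le> (\<integral>x. (norm (f x))\<^sup>2 \<partial>M) * (\<integral>x. (norm (g x))\<^sup>2 \<partial>M)"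
proof -
  let ?F = "\<integral>x. (norm (f x))\<^sup>2 \<partial>M" and ?V = "\<integral>x. f x \<bullet> g x \<partial>M" and ?G = "\<integral>x. (norm (g x))\<^sup>2 \<partial>M"
  have iF: "integrable M (\<lambda>x. (norm (f x))\<^sup>2)" by (rule sq_int_norm[OF f])
  have iG: "integrable M (\<lambda>x. (norm (g x))\<^sup>2)" by (rule sq_int_norm[OF g])
  have iV: "integrable M (\<lambda>x. f x \<bullet> g x)" by (rule sq_int_inner[OF f g])
  have pt: "(norm (?F *\<^sub>R g x - ?V *\<^sub>R f x))\<^sup>2
      = ?F\<^sup>2 * (norm (g x))\<^sup>2 - 2 * ?F * ?V * (f x \<bullet> g x) + ?V\<^sup>2 * (norm (f x))\<^sup>2" for x
    unfolding power2_norm_eq_inner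
    by (simp add: inner_diff_left inner_diff_right inner_commute power2_eq_square algebra_simps)
  have "0 \<le> (\<integral>x. (norm (?F *\<^sub>R g x - ?V *\<^sub>R f x))\<^sup>2 \<partial>M)" by simp
  also have "\<dots> = ?F\<^sup>2 * ?G - 2 * ?F * ?V * ?V + ?V\<^sup>2 * ?F"
    unfolding pt using iF iG iV by simp
  finally have *: "0 \<le> ?F * (?F * ?G - ?V\<^sup>2)"
    by (simp add: power2_eq_square algebra_simps)
  show ?thesis
  proof (cases "?F = 0")
    case True
    then have "AE x in M. (norm (f x))\<^sup>2 = 0"
      using integral_nonneg_eq_0_iff_AE[OF iF] by simp
    then have "AE x in M. f x \<bullet> g x = 0" by eventually_elim simp
    then have "?V = 0" by (rule integral_eq_zero_AE)
    with True show ?thesis by simp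
  next
    case False
    moreover have "?F \<ge> 0" by simp
    ultimately have "?F > 0" by linarith
    with * show ?thesis by (simp add: zero_le_mult_iff)
  qed
qed

lemma norm_integral_power2_le:
  fixes f :: "'x \<Rightarrow> 'b::euclidean_space"
  assumes fin: "finite_measure M" and f: "sq_int M f"
  shows "(norm (\<integral>x. f x \<partial>M))\<^sup>2 \<le> measure M (space M) * (\<integral>x. (norm (f x))\<^sup>2 \<partial>M)"
  using Cauchy_Schwarz_scaleR[OF sq_int_const[OF fin, of "1::real"] f] by simp

text \<open>Bounding the integral of \<open>v\<close>, instead of \<open>v\<close>, leaves
  \<open>a\<close> an arbitrary nonnegative continuous function; a pointwise bound follows by one
  substitution into the hypothesis. With the integrating factor \<open>exp (- K * s)\<close>, the
  derivative of \<phi> is at most \<open>(exp (- K * s) - 1) * a s\<close>, which is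
  nonpositive.\<close>

lemma gronwall_integral:
  fixes v a :: "real \<Rightarrow> real"
  assumes v: "continuous_on {0..T} v" and a: "continuous_on {0..T} a"
    and a0: "\<And>t. t \<in> {0..T} \<Longrightarrow> 0 \<le> a t" and K: "0 \<le> K"
    and le: "\<And>t. t \<in> {0..T} \<Longrightarrow> v t \<le> a t + K * integral {0..t} v"
    and t: "t \<in> {0..T}"
  shows "integral {0..t} v \<le> exp (K * t) * integral {0..t} a"
proof -
  define \<phi> where "\<phi> s = exp (- K * s) * integral {0..s} v - integral {0..s} a" for s
  have "\<phi> t \<le> \<phi> 0"
  proof (rule DERIV_nonpos_imp_decreasing_open[of 0 t \<phi>])
    show "0 \<le> t" using t by simp
    show "continuous_on {0..t} \<phi>"
    proof (rule continuous_on_subset)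
      show "continuous_on {0..T} \<phi>"
        unfolding \<phi>_def using v a
        by (intro continuous_intros indefinite_integral_continuous_1 integrable_continuous_real)
    qed (use t in auto)
    fix s assume s: "0 < s" "s < t"
    then have sT: "s \<in> {0..T}" and at: "at s within {0..T} = at s"
      using t by (auto intro!: at_within_Icc_at)
    have dv: "((\<lambda>x. integral {0..x} v) has_real_derivative v s) (at s)"
      using integral_has_real_derivative[OF v sT] at by simp
    have da: "((\<lambda>x. integral {0..x} a) has_real_derivative a s) (at s)"
      using integral_has_real_derivative[OF a sT] at by simp
    have "DERIV \<phi> s :> exp (- K * s) * (v s - K * integral {0..s} v) - a s"
      unfolding \<phi>_def by (rule derivative_eq_intros dv da refl | simp)+ (simp add: algebra_simps)
    moreover have "exp (- K * s) * (v s - K * integral {0..s} v) \<le> exp (- K * s) * a s"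
      using le[OF sT] by (intro mult_left_mono) auto
    moreover have "exp (- K * s) * a s \<le> 1 * a s"
      using a0[OF sT] K s by (intro mult_right_mono) auto
    ultimately show "\<exists>y. DERIV \<phi> s :> y \<and> y \<le> 0"
      by (intro exI[of _ "exp (- K * s) * (v s - K * integral {0..s} v) - a s"] conjI; linarith?)
  qed
  then have "exp (- K * t) * integral {0..t} v \<le> integral {0..t} a"
    by (simp add: \<phi>_def)
  then have "exp (K * t) * (exp (- K * t) * integral {0..t} v) \<le> exp (K * t) * integral {0..t} a"
    by (intro mult_left_mono) auto
  moreover have "exp (K * t) * (exp (- K * t) * integral {0..t} v) = integral {0..t} v"
    by (simp add: exp_minus)
  ultimately show ?thesis by (simp only:)
qed

section \<open>The time interval as a finite measure space\<close>

abbreviation leb :: "real \<Rightarrow> real measure" where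
  "leb T \<equiv> restrict_space lborel {0..T}"

lemma finite_measure_leb: "finite_measure (leb T)"
  by (rule finite_measureI) (auto simp: emeasure_restrict_space space_restrict_space emeasure_lborel_Icc_eq)

lemma space_leb [simp]: "space (leb T) = {0..T}"
  by (simp add: space_restrict_space)

lemma sets_leb [measurable_cong]: "sets (leb T) = sets (restrict_space borel {0..T})"
  by (rule sets_restrict_space_cong) simp

lemma measure_leb: "T \<ge> 0 \<Longrightarrow> measure (leb T) {0..T} = T"
  by (subst measure_restrict_space) auto

lemma integral_leb_continuous:
  fixes f :: "real \<Rightarrow> 'b::euclidean_space"
  assumes "continuous_on {0..T} f" "t \<in> {0..T}"
  shows "(\<integral>s. indicator {0..t} s *\<^sub>R f s \<partial>leb T) = integral {0..t} f"
    and "integrable (leb T) f"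
proof -
  have int: "set_integrable lborel {0..T} f"
    by (rule borel_integrable_atLeastAtMost') fact
  then show "integrable (leb T) f"
    by (simp add: integrable_restrict_space set_integrable_def)
  have "(\<integral>s. indicator {0..t} s *\<^sub>R f s \<partial>leb T) = (\<integral>s. indicator {0..T} s *\<^sub>R indicator {0..t} s *\<^sub>R f s \<partial>lborel)"
    by (subst integral_restrict_space) simp_all
  also have "\<dots> = (LINT s:{0..t}|lborel. f s)"
    unfolding set_lebesgue_integral_def using assms(2)
    by (intro Bochner_Integration.integral_cong) (auto simp: indicator_def)
  also have "\<dots> = integral {0..t} f"
    by (intro set_borel_integral_eq_integral borel_integrable_atLeastAtMost')
      (rule continuous_on_subset[OF assms(1)], use assms(2) in auto)
  finally show "(\<integral>s. indicator {0..t} s *\<^sub>R f s \<partial>leb T) = integral {0..t} f" .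
qed

text \<open>Integrals over \<open>{0..t}\<close> are written with an indicator over the fixed space
  \<open>leb T\<close>, so that a single product space serves for all \<open>t\<close> in Fubini
  arguments.\<close>

lemma LINT_leb:
  fixes f :: "real \<Rightarrow> 'b::euclidean_space"
  assumes "t \<in> {0..T}"
  shows "(LINT s:{0..t}|lborel. f s) = (\<integral>s. indicator {0..t} s *\<^sub>R f s \<partial>leb T)"
proof -
  have "(\<integral>s. indicator {0..t} s *\<^sub>R f s \<partial>leb T) = (\<integral>s. indicator {0..T} s *\<^sub>R indicator {0..t} s *\<^sub>R f s \<partial>lborel)"
    by (subst integral_restrict_space) simp_all
  also have "\<dots> = (LINT s:{0..t}|lborel. f s)"
    unfolding set_lebesgue_integral_def using assms
    by (intro Bochner_Integration.integral_cong) (auto simp: indicator_def)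
  finally show ?thesis ..
qed

lemma continuous_on_integral_leb:
  fixes f :: "real \<Rightarrow> 'b::euclidean_space"
  assumes "integrable (leb T) f"
  shows "continuous_on {0..T} (\<lambda>t. \<integral>s. indicator {0..t} s *\<^sub>R f s \<partial>leb T)"
proof -
  have si: "set_integrable lborel {0..T} f"
    using assms by (simp add: integrable_restrict_space set_integrable_def)
  have "f integrable_on {0..T}"
    using set_borel_integral_eq_integral(1)[OF si] .
  then have "continuous_on {0..T} (\<lambda>t. integral {0..t} f)"
    by (rule indefinite_integral_continuous_1)
  moreover have "(\<integral>s. indicator {0..t} s *\<^sub>R f s \<partial>leb T) = integral {0..t} f" if "t \<in> {0..T}" for t
  proof -
    have "set_integrable lborel {0..t} f"
      using si by (rule set_integrable_subset) (use that in auto)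
    then show ?thesis
      using set_borel_integral_eq_integral(2) LINT_leb[OF that] by metis
  qed
  ultimately show ?thesis by (metis (no_types, lifting) continuous_on_cong)
qed

text \<open>\<open>g n\<close> rounds a time down to the grid of mesh \<open>1 / (n+1)\<close> and
  clips it to \<open>{0..T}\<close>. It takes countably many values, so the path at the rounded time
  is jointly measurable, and continuity recovers the path as \<open>n\<close> grows. The first
  factor \<open>G\<close> is arbitrary because the result serves for the sigma-algebra of the flow
  as well as for the full one.\<close>

lemma measurable_continuous_paths:
  fixes f :: "'x \<Rightarrow> real \<Rightarrow> 'b::euclidean_space"
  assumes T: "0 < T"
    and cont: "\<And>x. x \<in> space G \<Longrightarrow> continuous_on {0..T} (f x)"
    and meas: "\<And>t. t \<in> {0..T} \<Longrightarrow> (\<lambda>x. f x t) \<in> borel_measurable G"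
  shows "(\<lambda>(x, t). f x t) \<in> borel_measurable (G \<Otimes>\<^sub>M leb T)"
proof -
  define g :: "nat \<Rightarrow> real \<Rightarrow> real" where "g n t = min T (max 0 (\<lfloor>(n+1) * t\<rfloor> / (n+1)))" for n t
  have g01: "g n t \<in> {0..T}" for n t using T by (auto simp: g_def)
  have lim: "(\<lambda>n. g n t) \<longlonglongrightarrow> t" if "t \<in> {0..T}" for t
  proof -
    have "(\<lambda>n. \<lfloor>(real n+1) * t\<rfloor> / (real n+1)) \<longlonglongrightarrow> t"
    proof (rule tendsto_sandwich[where f = "\<lambda>n. t - 1 / (real n + 1)" and h = "\<lambda>n. t"])
      have "t - 1 / (real n + 1) \<le> \<lfloor>(real n+1) * t\<rfloor> / (real n+1)" for n
      proof -
        have "(real n+1) * t - 1 \<le> \<lfloor>(real n+1) * t\<rfloor>" by linarith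
        then have "((real n+1) * t - 1) / (real n+1) \<le> \<lfloor>(real n+1) * t\<rfloor> / (real n+1)"
          by (rule divide_right_mono) simp
        then show ?thesis by (simp add: diff_divide_distrib)
      qed
      then show "\<forall>\<^sub>F n in sequentially. t - 1 / (real n + 1) \<le> \<lfloor>(real n+1) * t\<rfloor> / (real n+1)"
        by simp
      have "\<lfloor>(real n+1) * t\<rfloor> / (real n+1) \<le> t" for n
      proof -
        have "\<lfloor>(real n+1) * t\<rfloor> \<le> (real n+1) * t" by linarith
        then have "\<lfloor>(real n+1) * t\<rfloor> / (real n+1) \<le> ((real n+1) * t) / (real n+1)"
          by (rule divide_right_mono) simp
        then show ?thesis by simp
      qed
      then show "\<forall>\<^sub>F n in sequentially. \<lfloor>(real n+1) * t\<rfloor> / (real n+1) \<le> t" by simp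
      show "(\<lambda>n. t - 1 / (real n + 1)) \<longlonglongrightarrow> t"
        using tendsto_diff[OF tendsto_const[of t] LIMSEQ_inverse_real_of_nat]
        by (simp add: inverse_eq_divide add.commute)
    qed simp
    then have "(\<lambda>n. min T (max 0 (\<lfloor>(real n+1) * t\<rfloor> / (real n+1)))) \<longlonglongrightarrow> min T (max 0 t)"
      by (intro tendsto_min tendsto_max tendsto_const)
    then show ?thesis using that by (simp add: g_def add.commute)
  qed
  show ?thesis
  proof (rule borel_measurable_LIMSEQ_metric)
    fix n
    have cnt: "countable (range (g n))"
    proof -
      have "range (g n) \<subseteq> (\<lambda>k::int. min T (max 0 (k / (n+1)))) ` UNIV"
        unfolding g_def by (intro image_subsetI) (rule image_eqI, simp_all only: UNIV_I of_nat_add of_nat_1)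
      then show ?thesis by (rule countable_subset) simp
    qed
    have "(\<lambda>z. f (fst z) (g n (snd z))) \<in> borel_measurable (G \<Otimes>\<^sub>M leb T)"
    proof (rule measurable_compose_countable'[where f = "\<lambda>t z. f (fst z) t" and g = "\<lambda>z. g n (snd z)"])
      show "countable (range (g n))" by (rule cnt)
      fix t assume "t \<in> range (g n)"
      then have "t \<in> {0..T}" using g01 by (metis imageE)
      from measurable_compose[OF measurable_fst meas[OF this]]
      show "(\<lambda>z. f (fst z) t) \<in> borel_measurable (G \<Otimes>\<^sub>M leb T)" .
    next
      have "(\<lambda>t. g n t) \<in> borel_measurable borel" unfolding g_def by measurable
      then have "(\<lambda>z. g n (snd z)) \<in> borel_measurable (G \<Otimes>\<^sub>M leb T)"
        by (intro measurable_compose[OF measurable_snd] measurable_restrict_space1)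
           simp
      then show "(\<lambda>z. g n (snd z)) \<in> measurable (G \<Otimes>\<^sub>M leb T) (count_space (range (g n)))"
        by (subst measurable_count_space_eq_countable[OF cnt]) (auto intro!: measurable_sets_borel)
    qed
    then show "(\<lambda>(x, t). f x (g n t)) \<in> borel_measurable (G \<Otimes>\<^sub>M leb T)"
      by (simp add: case_prod_unfold)
  next
    fix z assume z: "z \<in> space (G \<Otimes>\<^sub>M leb T)"
    then have x: "fst z \<in> space G" and t: "snd z \<in> {0..T}" by (auto simp: space_pair_measure)
    have "(\<lambda>n. f (fst z) (g n (snd z))) \<longlonglongrightarrow> f (fst z) (snd z)"
      by (rule continuous_on_tendsto_compose[OF cont[OF x] lim[OF t] t]) (use g01 in auto)
    then show "(\<lambda>n. case z of (x, t) \<Rightarrow> f x (g n t)) \<longlonglongrightarrow> (case z of (x, t) \<Rightarrow> f x t)"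
      by (simp add: case_prod_unfold)
  qed
qed

section \<open>Discretisation of square-integrable paths\<close>

definition block :: "real \<Rightarrow> nat \<Rightarrow> nat \<Rightarrow> real set" where
  "block T n i = {real i * T / real n <.. real (Suc i) * T / real n}"

definition block_avg :: "real \<Rightarrow> nat \<Rightarrow> (real \<Rightarrow> 'b::euclidean_space) \<Rightarrow> nat \<Rightarrow> 'b" where
  "block_avg T n f i = (real n / T) *\<^sub>R (\<integral>s. indicator (block T n i) s *\<^sub>R f s \<partial>leb T)"

text \<open>The average over a block is used on the next block, so that the discretisation of an adapted
  process is adapted.\<close>

definition disc :: "real \<Rightarrow> nat \<Rightarrow> (real \<Rightarrow> 'b::euclidean_space) \<Rightarrow> real \<Rightarrow> 'b" where
  "disc T n f t = (\<Sum>i<n-1. indicator (block T n (Suc i)) t *\<^sub>R block_avg T n f i)"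

lemma block_borel [measurable]: "block T n i \<in> sets borel"
  by (simp add: block_def)

lemma block_subset: "T > 0 \<Longrightarrow> i < n \<Longrightarrow> block T n i \<subseteq> {0..T}"
proof
  fix x assume T: "T > 0" and i: "i < n" and x: "x \<in> block T n i"
  have "0 \<le> real i * T / real n" using T by simp
  moreover have "real (Suc i) * T / real n \<le> real n * T / real n"
    using T i by (intro divide_right_mono mult_right_mono) auto
  moreover have "real n * T / real n = T" using i by simp
  ultimately show "x \<in> {0..T}" using x unfolding block_def by simp
qed

lemma block_Int_Icc [simp]: "T > 0 \<Longrightarrow> i < n \<Longrightarrow> block T n i \<inter> {0..T} = block T n i"
  using block_subset by blast

lemma block_sets_leb: "T > 0 \<Longrightarrow> i < n \<Longrightarrow> block T n i \<in> sets (leb T)"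
  using block_subset[of T i n] by (auto simp: sets_restrict_space_iff)

lemma measure_block:
  assumes "T > 0" "i < n"
  shows "measure (leb T) (block T n i) = T / n"
proof -
  have "measure (leb T) (block T n i) = measure lborel (block T n i)"
    using block_subset[OF assms] by (intro measure_restrict_space) auto
  also have "\<dots> = real (Suc i) * T / n - real i * T / n"
    unfolding block_def using assms by (intro measure_lborel_Ioc) (auto simp: divide_right_mono)
  also have "\<dots> = T / n" by (simp add: diff_divide_distrib[symmetric] algebra_simps)
  finally show ?thesis .
qed

lemma block_disjoint:
  assumes "T > 0" "n > 0" "t \<in> block T n i" "t \<in> block T n j"
  shows "i = j"
proof -
  have *: "i \<le> j" if "t \<in> block T n i" "t \<in> block T n j" for i j
  proof -
    have "real i * T / real n < real (Suc j) * T / real n"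
      using that unfolding block_def by simp
    then have "real i * T < real (Suc j) * T"
      using assms(2) by (simp add: divide_strict_right_mono divide_less_cancel)
    then show ?thesis using assms(1) by simp
  qed
  show ?thesis using *[of i j] *[of j i] assms by auto
qed

lemma disc_on_block:
  assumes "T > 0" "t \<in> block T n (Suc i)" "i < n - 1"
  shows "disc T n f t = block_avg T n f i"
proof -
  have n: "n > 0" using assms(3) by auto
  have "disc T n f t = (\<Sum>j<n-1. if j = i then block_avg T n f i else 0)"
    unfolding disc_def
  proof (rule sum.cong[OF refl])
    fix j
    show "indicator (block T n (Suc j)) t *\<^sub>R block_avg T n f j = (if j = i then block_avg T n f i else 0)"
      using block_disjoint[OF assms(1) n assms(2), of "Suc j"] assms(2)
      by (cases "j = i") (auto simp: indicator_eq_0_iff)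
  qed
  also have "\<dots> = block_avg T n f i" using assms(3) by simp
  finally show ?thesis .
qed

lemma disc_off_blocks:
  assumes "\<And>i. i < n - 1 \<Longrightarrow> t \<notin> block T n (Suc i)"
  shows "disc T n f t = 0"
  using assms unfolding disc_def by (intro sum.neutral) auto

lemma disc_measurable: "disc T n f \<in> borel_measurable (leb T)"
proof -
  have "disc T n f \<in> borel_measurable lborel" unfolding disc_def by measurable
  then show ?thesis by (rule measurable_restrict_space1)
qed

lemma sum_indicator_block_le:
  assumes "T > 0"
  shows "(\<Sum>i<n. indicator (block T n i) t) \<le> (1::real)"
proof -
  have "disjoint_family_on (block T n) {..<n}"
    unfolding disjoint_family_on_def
    using block_disjoint[OF assms, of n] by (metis disjoint_iff lessThan_iff less_nat_zero_code not_gr_zero)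
  then have "(\<Sum>i<n. indicator (block T n i) t) = (indicator (\<Union>i<n. block T n i) t :: real)"
    by (intro indicator_UN_disjoint[symmetric]) auto
  also have "\<dots> \<le> 1" by (rule indicator_le_1)
  finally show ?thesis .
qed

text \<open>Jensen's inequality on one block of length \<open>T / n\<close>, obtained from
  Cauchy-Schwarz against the indicator of the block.\<close>

lemma block_avg_norm:
  assumes T: "T > 0" and i: "i < n" and f: "sq_int (leb T) f"
  shows "(T / n) * (norm (block_avg T n f i))\<^sup>2 \<le> (\<integral>s. indicator (block T n i) s * (norm (f s))\<^sup>2 \<partial>leb T)"
proof -
  have n: "n > 0" using i by simp
  have B: "block T n i \<in> sets (leb T)" by (rule block_sets_leb[OF T i])
  interpret finite_measure "leb T" by (rule finite_measure_leb)
  have ind: "sq_int (leb T) (\<lambda>s. indicator (block T n i) s :: real)"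
    using sq_int_indicator_scaleR[OF sq_int_const[OF finite_measure_leb, where c = "1::real"] B] by simp
  have "(norm (\<integral>s. indicator (block T n i) s *\<^sub>R f s \<partial>leb T))\<^sup>2
      = (norm (\<integral>s. indicator (block T n i) s *\<^sub>R (indicator (block T n i) s *\<^sub>R f s) \<partial>leb T))\<^sup>2"
    by (intro arg_cong[where f = "\<lambda>x. (norm x)\<^sup>2"] Bochner_Integration.integral_cong)
      (auto simp: indicator_def)
  also have "\<dots> \<le> (\<integral>s. (indicator (block T n i) s)\<^sup>2 \<partial>leb T)
      * (\<integral>s. (norm (indicator (block T n i) s *\<^sub>R f s))\<^sup>2 \<partial>leb T)"
    by (rule Cauchy_Schwarz_scaleR[OF ind sq_int_indicator_scaleR[OF f B]])
  also have "(\<integral>s. (indicator (block T n i) s :: real)\<^sup>2 \<partial>leb T) = T / n"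
  proof -
    have "(\<integral>s. (indicator (block T n i) s :: real)\<^sup>2 \<partial>leb T) = (\<integral>s. indicator (block T n i) s \<partial>leb T)"
      by (intro Bochner_Integration.integral_cong) (auto simp: indicator_def)
    also have "\<dots> = measure (leb T) (block T n i)"
      using B T i by simp
    finally show ?thesis using measure_block[OF T i] by simp
  qed
  also have "(\<integral>s. (norm (indicator (block T n i) s *\<^sub>R f s))\<^sup>2 \<partial>leb T)
      = (\<integral>s. indicator (block T n i) s * (norm (f s))\<^sup>2 \<partial>leb T)"
    by (intro Bochner_Integration.integral_cong) (auto simp: indicator_def)
  finally have *: "(norm (\<integral>s. indicator (block T n i) s *\<^sub>R f s \<partial>leb T))\<^sup>2
      \<le> T / n * (\<integral>s. indicator (block T n i) s * (norm (f s))\<^sup>2 \<partial>leb T)" .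
  have "(T / n) * (norm (block_avg T n f i))\<^sup>2
      = (n / T) * (norm (\<integral>s. indicator (block T n i) s *\<^sub>R f s \<partial>leb T))\<^sup>2"
    using T n by (simp add: block_avg_def power_mult_distrib power_divide power2_eq_square field_simps)
  also have "\<dots> \<le> (n / T) * (T / n * (\<integral>s. indicator (block T n i) s * (norm (f s))\<^sup>2 \<partial>leb T))"
    using T by (intro mult_left_mono *) auto
  also have "\<dots> = (\<integral>s. indicator (block T n i) s * (norm (f s))\<^sup>2 \<partial>leb T)"
    using T n by simp
  finally show ?thesis .
qed

lemma disc_sq_int:
  assumes T: "T > 0"
  shows "sq_int (leb T) (disc T n f)"
proof -
  have "sq_int (leb T) (\<lambda>t. \<Sum>i<n-1. indicator (block T n (Suc i)) t *\<^sub>R block_avg T n f i)"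
    by (intro sq_int_sum sq_int_indicator_scaleR sq_int_const finite_measure_leb block_sets_leb T) auto
  then show ?thesis by (simp add: disc_def[abs_def])
qed

text \<open>All blocks have the same length, so moving each average one block to the right does not
  change its contribution to the norm, and Jensen applies block by block. The average over the last
  block is discarded, which only decreases the left side. The bound is uniform in \<open>n\<close>:
  it lets convergence pass from continuous functions to all square-integrable ones, and later it
  provides a dominating function.\<close>

lemma disc_contraction:
  assumes T: "T > 0" and f: "sq_int (leb T) f"
  shows "(\<integral>t. (norm (disc T n f t))\<^sup>2 \<partial>leb T) \<le> (\<integral>t. (norm (f t))\<^sup>2 \<partial>leb T)"
proof -
  interpret finite_measure "leb T" by (rule finite_measure_leb)
  have pt: "(norm (disc T n f t))\<^sup>2
      = (\<Sum>i<n-1. indicator (block T n (Suc i)) t * (norm (block_avg T n f i))\<^sup>2)" for t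
  proof (cases "\<exists>i<n-1. t \<in> block T n (Suc i)")
    case True
    then obtain i where i: "i < n - 1" "t \<in> block T n (Suc i)" by auto
    then have n: "n > 0" by auto
    have "(\<Sum>j<n-1. indicator (block T n (Suc j)) t * (norm (block_avg T n f j))\<^sup>2)
        = (\<Sum>j<n-1. if j = i then (norm (block_avg T n f i))\<^sup>2 else 0)"
    proof (rule sum.cong[OF refl])
      fix j
      show "indicator (block T n (Suc j)) t * (norm (block_avg T n f j))\<^sup>2
          = (if j = i then (norm (block_avg T n f i))\<^sup>2 else 0)"
        using block_disjoint[OF T n i(2), of "Suc j"] i(2)
        by (cases "j = i") (auto simp: indicator_eq_0_iff)
    qed
    also have "\<dots> = (norm (disc T n f t))\<^sup>2"
      unfolding disc_on_block[OF T i(2,1), of f] using i(1) by simp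
    finally show ?thesis ..
  next
    case False
    then have "disc T n f t = 0" by (intro disc_off_blocks) auto
    moreover have "(\<Sum>i<n-1. indicator (block T n (Suc i)) t * (norm (block_avg T n f i))\<^sup>2) = 0"
      using False by (intro sum.neutral) auto
    ultimately show ?thesis by simp
  qed
  have "(\<integral>t. (norm (disc T n f t))\<^sup>2 \<partial>leb T)
      = (\<Sum>i<n-1. (\<integral>t. indicator (block T n (Suc i)) t * (norm (block_avg T n f i))\<^sup>2 \<partial>leb T))"
    unfolding pt using block_sets_leb[OF T, of _ n]
    by (intro Bochner_Integration.integral_sum integrable_mult_left) (auto simp: less_diff_conv emeasure_eq_measure)
  also have "\<dots> = (\<Sum>i<n-1. T / n * (norm (block_avg T n f i))\<^sup>2)"
  proof (rule sum.cong[OF refl])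
    fix i assume "i \<in> {..<n-1}"
    then have i: "Suc i < n" by auto
    show "(\<integral>t. indicator (block T n (Suc i)) t * (norm (block_avg T n f i))\<^sup>2 \<partial>leb T)
        = T / n * (norm (block_avg T n f i))\<^sup>2"
      using measure_block[OF T i] block_sets_leb[OF T i] T i by simp
  qed
  also have "\<dots> \<le> (\<Sum>i<n-1. (\<integral>s. indicator (block T n i) s * (norm (f s))\<^sup>2 \<partial>leb T))"
    by (intro sum_mono block_avg_norm[OF T _ f]) auto
  also have "\<dots> \<le> (\<Sum>i<n. (\<integral>s. indicator (block T n i) s * (norm (f s))\<^sup>2 \<partial>leb T))"
    by (intro sum_mono2) auto
  also have "\<dots> = (\<integral>s. (\<Sum>i<n. indicator (block T n i) s) * (norm (f s))\<^sup>2 \<partial>leb T)"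
    unfolding sum_distrib_right
    by (intro Bochner_Integration.integral_sum[symmetric] integrable_real_mult_indicator[OF _ sq_int_norm[OF f], simplified mult.commute] )
      (use block_sets_leb[OF T] in auto)
  also have "\<dots> \<le> (\<integral>t. (norm (f t))\<^sup>2 \<partial>leb T)"
  proof (rule integral_mono')
    show "integrable (leb T) (\<lambda>t. (norm (f t))\<^sup>2)" by (rule sq_int_norm[OF f])
    show "(\<Sum>i<n. indicator (block T n i) s) * (norm (f s))\<^sup>2 \<le> (norm (f s))\<^sup>2" for s
      using mult_right_mono[OF sum_indicator_block_le[OF T, of n s], of "(norm (f s))\<^sup>2"] by simp
  qed simp
  finally show ?thesis .
qed

lemma disc_diff:
  assumes "T > 0" "integrable (leb T) f" "integrable (leb T) g"
  shows "disc T n (\<lambda>s. f s - g s) t = disc T n f t - disc T n g t"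
proof -
  have avg: "block_avg T n (\<lambda>s. f s - g s) i = block_avg T n f i - block_avg T n g i" if "i < n" for i
  proof -
    have B: "block T n i \<in> sets (leb T)" by (rule block_sets_leb[OF assms(1) that])
    show ?thesis
      unfolding block_avg_def scaleR_diff_right
      using integrable_mult_indicator[OF B assms(2)] integrable_mult_indicator[OF B assms(3)]
      by (simp add: scaleR_diff_right)
  qed
  show ?thesis
    unfolding disc_def sum_subtractf[symmetric]
    by (intro sum.cong refl) (auto simp: avg scaleR_diff_right)
qed

lemma disc_tendsto_continuous:
  fixes f :: "real \<Rightarrow> 'b::euclidean_space"
  assumes T: "T > 0" and f: "continuous_on {0..T} f"
  shows "(\<lambda>n. \<integral>t. (norm (disc T n f t - f t))\<^sup>2 \<partial>leb T) \<longlonglongrightarrow> 0"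
proof -
  interpret finite_measure "leb T" by (rule finite_measure_leb)
  have "compact (f ` {0..T})" by (intro compact_continuous_image f) simp
  then obtain B where B: "\<And>t. t \<in> {0..T} \<Longrightarrow> norm (f t) \<le> B"
    using compact_imp_bounded bounded_iff by (metis imageI)
  have B0: "0 \<le> B" using B[of 0] T by (metis atLeastAtMost_iff less_eq_real_def norm_ge_zero order_trans)
  have intf: "integrable (leb T) f" using integral_leb_continuous(2)[OF f, of 0] T by simp
  have fm: "f \<in> borel_measurable (leb T)" using intf by simp
  have avg: "norm (block_avg T n f i - c) \<le> e"
    if i: "i < n" and c: "\<And>s. s \<in> block T n i \<Longrightarrow> norm (f s - c) \<le> e" for n i c e
  proof -
    have n: "n > 0" using i by simp
    have S: "block T n i \<in> sets (leb T)" by (rule block_sets_leb[OF T i])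
    have m: "measure (leb T) (block T n i) = T / n" by (rule measure_block[OF T i])
    have ic: "integrable (leb T) (\<lambda>s. indicator (block T n i) s *\<^sub>R c)"
      by (intro integrable_mult_indicator S) simp
    have if': "integrable (leb T) (\<lambda>s. indicator (block T n i) s *\<^sub>R f s)"
      by (intro integrable_mult_indicator S intf)
    have "block_avg T n f i - c = (n / T) *\<^sub>R (\<integral>s. indicator (block T n i) s *\<^sub>R (f s - c) \<partial>leb T)"
    proof -
      have "(\<integral>s. indicator (block T n i) s *\<^sub>R (f s - c) \<partial>leb T)
          = (\<integral>s. indicator (block T n i) s *\<^sub>R f s \<partial>leb T) - (T / n) *\<^sub>R c"
      proof -
        have "(\<integral>s. indicator (block T n i) s *\<^sub>R c \<partial>leb T) = (T / n) *\<^sub>R c"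
          using m S T i by (subst integral_scaleR_left) (auto simp: emeasure_eq_measure)
        then show ?thesis unfolding scaleR_diff_right using ic if' by simp
      qed
      then show ?thesis using T n by (simp add: block_avg_def scaleR_diff_right)
    qed
    also have "norm \<dots> \<le> (n / T) * (\<integral>s. indicator (block T n i) s * e \<partial>leb T)"
    proof -
      have "norm (\<integral>s. indicator (block T n i) s *\<^sub>R (f s - c) \<partial>leb T)
          \<le> (\<integral>s. indicator (block T n i) s * e \<partial>leb T)"
      proof (rule order_trans[OF integral_norm_bound integral_mono])
        show "integrable (leb T) (\<lambda>s. norm (indicator (block T n i) s *\<^sub>R (f s - c)))"
          unfolding scaleR_diff_right using ic if' by simp
        show "integrable (leb T) (\<lambda>s. indicator (block T n i) s * e)"
          using S by (simp add: emeasure_eq_measure)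
        show "norm (indicator (block T n i) s *\<^sub>R (f s - c)) \<le> indicator (block T n i) s * e" for s
          using c[of s] by (auto simp: indicator_def)
      qed
      then have "(n / T) * norm (\<integral>s. indicator (block T n i) s *\<^sub>R (f s - c) \<partial>leb T)
          \<le> (n / T) * (\<integral>s. indicator (block T n i) s * e \<partial>leb T)"
        using T by (intro mult_left_mono) auto
      then show ?thesis using T by simp
    qed
    also have "\<dots> = e" using T n m S i by simp
    finally show ?thesis .
  qed
  have bound: "norm (disc T n f t) \<le> B" for n t
  proof (cases "\<exists>i<n-1. t \<in> block T n (Suc i)")
    case True
    then obtain i where i: "i < n - 1" "t \<in> block T n (Suc i)" by auto
    then have "i < n" by auto
    then have "norm (block_avg T n f i - 0) \<le> B"
      by (rule avg) (use B block_subset[OF T] \<open>i < n\<close> in force)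
    then show ?thesis using disc_on_block[OF T i(2,1), of f] by simp
  next
    case False
    then show ?thesis using disc_off_blocks[of n t T f] B0 by auto
  qed
  \<comment> \<open>The time zero is left out: it belongs to no left-open block, and it is a null
    set.\<close>
  have lim: "(\<lambda>n. disc T n f t) \<longlonglongrightarrow> f t" if t: "t \<in> {0<..T}" for t
  proof (rule LIMSEQ_I)
    fix e :: real assume e: "e > 0"
    have "uniformly_continuous_on {0..T} f" by (rule compact_uniformly_continuous[OF f]) simp
    then obtain d where d: "d > 0" "\<And>s t. s \<in> {0..T} \<Longrightarrow> t \<in> {0..T} \<Longrightarrow> dist s t < d \<Longrightarrow> dist (f s) (f t) < e / 2"
      unfolding uniformly_continuous_on_def using e by (metis half_gt_zero)
    \<comment> \<open>\<open>2 * T / d\<close> makes two consecutive blocks together shorter than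
      \<open>d\<close>; \<open>T / t\<close> pushes \<open>t\<close> beyond the first block, on
      which the discretisation is zero.\<close>
    obtain N where N: "real N > 2 * T / d + T / t" using reals_Archimedean2 by blast
    show "\<exists>N. \<forall>n\<ge>N. norm (disc T n f t - f t) < e"
    proof (intro exI allI impI)
      fix n assume n: "n \<ge> N"
      have "2 * T / d > 0" "T / t > 0" using T d(1) t by auto
      moreover have "real N \<le> real n" using n by simp
      ultimately have nn1: "real n > 2 * T / d" and nn2: "real n > T / t" and n0: "real n > 0"
        using N by linarith+
      note nn = nn1 nn2 n0
      have Tn: "2 * T / n < d" "T / n < t"
        using nn d(1) t by (simp_all add: field_simps)
      \<comment> \<open>With blocks numbered from zero, \<open>t\<close> lies in block
        \<open>k - 1\<close>, so the value used there is the average over block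
        \<open>k - 2\<close>.\<close>
      define k where "k = nat \<lceil>t * n / T\<rceil>"
      have pos: "t * n / T > 1" using Tn(2) T nn(3) by (simp add: field_simps)
      have k1: "real k \<ge> t * n / T" "real k < t * n / T + 1"
        using pos unfolding k_def by linarith+
      have k2: "k \<ge> 2" using k1(1) pos by (cases "k \<le> 1") auto
      have "t * n \<le> T * n" using t by (intro mult_right_mono) auto
      then have "t * n / T \<le> n" using T by (simp add: divide_le_eq mult.commute)
      then have "\<lceil>t * n / T\<rceil> \<le> int n" by (subst ceiling_le_iff) simp
      then have kn: "k \<le> n" unfolding k_def by (simp add: nat_le_iff)
      define i where "i = k - 2"
      have ik: "k = Suc (Suc i)" using k2 by (simp add: i_def)
      have "t \<le> real k * T / n" using k1(1) T nn(3) by (simp add: field_simps)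
      moreover have "real (Suc i) * T / n < t"
      proof -
        have "real (Suc i) < t * n / T" using k1(2) by (simp add: ik)
        then have "real (Suc i) * T < t * n" using T by (simp add: field_simps)
        then show ?thesis using nn(3) by (simp add: field_simps)
      qed
      ultimately have tb: "t \<in> block T n (Suc i)" unfolding block_def ik by simp
      have i1: "i < n - 1" using kn ik by auto
      have "norm (block_avg T n f i - f t) \<le> e / 2"
      proof (rule avg)
        show "i < n" using i1 by auto
        fix s assume s: "s \<in> block T n i"
        have sT: "s \<in> {0..T}" using block_subset[OF T] s \<open>i < n\<close> by blast
        have lt: "s \<le> real (Suc i) * T / n" "real i * T / n < s"
          "t \<le> real (Suc (Suc i)) * T / n" "real (Suc i) * T / n < t"
          using s tb unfolding block_def by auto
        have "real (Suc (Suc i)) * T / n = real i * T / n + 2 * T / n"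
          by (simp add: add_divide_distrib[symmetric] algebra_simps)
        then have "\<bar>s - t\<bar> < d" using lt Tn(1) by linarith
        then have "dist (f s) (f t) < e / 2" using d(2)[OF sT, of t] t by (simp add: dist_real_def)
        then show "norm (f s - f t) \<le> e / 2" by (simp add: dist_norm)
      qed
      then show "norm (disc T n f t - f t) < e" using disc_on_block[OF T tb i1, of f] e by simp
    qed
  qed
  have "(\<lambda>n. \<integral>t. (norm (disc T n f t - f t))\<^sup>2 \<partial>leb T) \<longlonglongrightarrow> (\<integral>t. 0 \<partial>leb T)"
  proof (rule integral_dominated_convergence)
    show "(\<lambda>t. (norm (disc T n f t - f t))\<^sup>2) \<in> borel_measurable (leb T)" for n
      using disc_measurable[of T n f] fm by measurable
    show "integrable (leb T) (\<lambda>t. (2 * B)\<^sup>2)" by simp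
    have "AE t in lborel. t \<noteq> (0::real)" by (rule AE_lborel_singleton)
    then have "AE t in leb T. t \<noteq> (0::real)" by (subst AE_restrict_space_iff) auto
    then show "AE t in leb T. (\<lambda>n. (norm (disc T n f t - f t))\<^sup>2) \<longlonglongrightarrow> 0"
    proof (rule AE_mp, intro AE_I2 impI)
      fix t assume "t \<in> space (leb T)" "t \<noteq> 0"
      then have "(\<lambda>n. disc T n f t - f t) \<longlonglongrightarrow> 0" using lim[of t] by (simp add: LIM_zero)
      from tendsto_power[OF tendsto_norm[OF this], of 2]
      show "(\<lambda>n. (norm (disc T n f t - f t))\<^sup>2) \<longlonglongrightarrow> 0" by simp
    qed
    show "AE t in leb T. norm ((norm (disc T n f t - f t))\<^sup>2) \<le> (2 * B)\<^sup>2" for n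
    proof (intro AE_I2)
      fix t assume "t \<in> space (leb T)"
      then have "norm (disc T n f t - f t) \<le> 2 * B"
        using norm_triangle_ineq4[of "disc T n f t" "f t"] bound[of n t] B[of t] by simp
      from power_mono[OF this, of 2]
      show "norm ((norm (disc T n f t - f t))\<^sup>2) \<le> (2 * B)\<^sup>2" by simp
    qed
  qed simp
  then show ?thesis by simp
qed

text \<open>The radial cut-off \<open>cl k\<close> costs little in the square norm and makes the
  function bounded. A measurable function on the line is an almost everywhere limit of continuous
  functions, and cutting these off at the same level keeps them continuous and supplies a constant
  dominating function. The two errors, each below \<open>e / 4\<close>, enter with factor
  two.\<close>

lemma continuous_dense_sq_int:
  fixes f :: "real \<Rightarrow> 'b::euclidean_space"
  assumes f: "sq_int (leb T) f" and e: "e > 0"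
  shows "\<exists>g. continuous_on UNIV g \<and> sq_int (leb T) g \<and> (\<integral>t. (norm (f t - g t))\<^sup>2 \<partial>leb T) < e"
proof -
  interpret finite_measure "leb T" by (rule finite_measure_leb)
  note [measurable] = f
  define cl :: "real \<Rightarrow> 'b \<Rightarrow> 'b" where "cl k x = (k / max k (norm x)) *\<^sub>R x" for k x
  have cont: "continuous_on UNIV (cl k)" if "k > 0" for k
    unfolding cl_def using that by (intro continuous_intros) (auto simp: max_def)
  have cl_id: "cl k x = x" if "norm x \<le> k" "k > 0" for k x
    using that by (simp add: cl_def max_def)
  have cl_norm: "norm (cl k x) \<le> norm x" "norm (cl k x) \<le> k" if "k > 0" for k x
  proof -
    have "k / max k (norm x) \<le> 1" using that by (subst divide_le_eq_1_pos) auto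
    then have "k / max k (norm x) * norm x \<le> 1 * norm x" by (rule mult_right_mono) simp
    then show "norm (cl k x) \<le> norm x" using that by (simp add: cl_def)
    show "norm (cl k x) \<le> k" using that
      by (auto simp: cl_def max_def field_simps)
  qed
  have clm [measurable]: "cl k \<in> borel_measurable borel" if "k > 0" for k
    by (rule borel_measurable_continuous_onI[OF cont[OF that]])
  have "(\<lambda>k. \<integral>t. (norm (f t - cl (real (Suc k)) (f t)))\<^sup>2 \<partial>leb T) \<longlonglongrightarrow> (\<integral>t. 0 \<partial>leb T)"
  proof (rule integral_dominated_convergence)
    show "integrable (leb T) (\<lambda>t. 4 * (norm (f t))\<^sup>2)" using sq_int_norm[OF f] by simp
    show "(\<lambda>t. (norm (f t - cl (real (Suc k)) (f t)))\<^sup>2) \<in> borel_measurable (leb T)" for k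
      using clm[of "real (Suc k)"] by measurable
    show "AE t in leb T. norm ((norm (f t - cl (real (Suc k)) (f t)))\<^sup>2) \<le> 4 * (norm (f t))\<^sup>2" for k
    proof (intro AE_I2)
      fix t
      have "norm (f t - cl (real (Suc k)) (f t)) \<le> 2 * norm (f t)"
        using norm_triangle_ineq4[of "f t" "cl (real (Suc k)) (f t)"] cl_norm(1)[of "real (Suc k)" "f t"] by simp
      from power_mono[OF this, of 2]
      show "norm ((norm (f t - cl (real (Suc k)) (f t)))\<^sup>2) \<le> 4 * (norm (f t))\<^sup>2" by (simp add: power_mult_distrib)
    qed
    show "AE t in leb T. (\<lambda>k. (norm (f t - cl (real (Suc k)) (f t)))\<^sup>2) \<longlonglongrightarrow> 0"
    proof (intro AE_I2 tendsto_eventually)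
      fix t
      obtain N where "norm (f t) \<le> real N" using real_arch_simple by blast
      then have "(norm (f t - cl (real (Suc k)) (f t)))\<^sup>2 = 0" if "k \<ge> N" for k
        using cl_id[of "f t" "real (Suc k)"] that by simp
      then show "\<forall>\<^sub>F k in sequentially. (norm (f t - cl (real (Suc k)) (f t)))\<^sup>2 = 0"
        unfolding eventually_sequentially by blast
    qed
  qed simp
  then have "\<forall>\<^sub>F k in sequentially. (\<integral>t. (norm (f t - cl (real (Suc k)) (f t)))\<^sup>2 \<partial>leb T) < e / 4"
    using e by (intro order_tendstoD(2)[where y = 0]) auto
  then obtain k' where k': "(\<integral>t. (norm (f t - cl (real (Suc k')) (f t)))\<^sup>2 \<partial>leb T) < e / 4"
    unfolding eventually_sequentially by blast
  define k where "k = real (Suc k')"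
  have k: "k > 0" by (simp add: k_def)
  note clk [measurable] = clm[OF k]
  \<comment> \<open>Extension by zero to the whole line, where \<open>measurable_on\<close> unfolds
    to approximation by continuous functions off a negligible set. That set is then enclosed in a
    Borel null set to get back to \<open>leb T\<close>.\<close>
  define fe where "fe t = indicator {0..T} t *\<^sub>R f t" for t
  have "fe \<in> borel_measurable lborel"
    using sq_int_measurable[OF f] unfolding fe_def
    by (subst (asm) borel_measurable_restrict_space_iff) auto
  then have "fe \<in> borel_measurable lebesgue" by (rule measurable_completion)
  then have "fe measurable_on UNIV" by (simp add: measurable_on_iff_borel_measurable)
  then obtain N g where N: "negligible N" and g: "\<And>n. continuous_on UNIV (g n)"
    and lim: "\<And>t. t \<notin> N \<Longrightarrow> (\<lambda>n. g n t) \<longlonglongrightarrow> fe t"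
    unfolding measurable_on_def by auto
  obtain N' where N': "N' \<in> null_sets lborel" "N \<subseteq> N'"
    using N by (auto simp: negligible_iff_null_sets null_sets_completion_iff2)
  have "AE t in lborel. t \<notin> N'" by (rule AE_not_in[OF N'(1)])
  then have ae: "AE t in leb T. t \<notin> N" using N'(2) by (subst AE_restrict_space_iff) auto
  have cg: "continuous_on UNIV (\<lambda>t. cl k (g n t))" for n
    using continuous_on_compose2[OF cont[OF k] g] by simp
  have gm [measurable]: "(\<lambda>t. cl k (g n t)) \<in> borel_measurable (leb T)" for n
  proof -
    have "(\<lambda>t. cl k (g n t)) \<in> borel_measurable lborel"
      using borel_measurable_continuous_onI[OF cg] by simp
    then show ?thesis by (rule measurable_restrict_space1)
  qed
  have "(\<lambda>n. \<integral>t. (norm (cl k (f t) - cl k (g n t)))\<^sup>2 \<partial>leb T) \<longlonglongrightarrow> (\<integral>t. 0 \<partial>leb T)"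
  proof (rule integral_dominated_convergence)
    show "integrable (leb T) (\<lambda>t. (2 * k)\<^sup>2)" by simp
    show "(\<lambda>t. (norm (cl k (f t) - cl k (g n t)))\<^sup>2) \<in> borel_measurable (leb T)" for n
      by measurable
    show "AE t in leb T. norm ((norm (cl k (f t) - cl k (g n t)))\<^sup>2) \<le> (2 * k)\<^sup>2" for n
    proof (intro AE_I2)
      fix t
      have "norm (cl k (f t) - cl k (g n t)) \<le> 2 * k"
        using norm_triangle_ineq4[of "cl k (f t)" "cl k (g n t)"] cl_norm(2)[OF k, of "f t"] cl_norm(2)[OF k, of "g n t"]
        by simp
      from power_mono[OF this, of 2]
      show "norm ((norm (cl k (f t) - cl k (g n t)))\<^sup>2) \<le> (2 * k)\<^sup>2" by simp
    qed
    show "AE t in leb T. (\<lambda>n. (norm (cl k (f t) - cl k (g n t)))\<^sup>2) \<longlonglongrightarrow> 0"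
      using ae
    proof (rule AE_mp, intro AE_I2 impI)
      fix t assume t: "t \<in> space (leb T)" "t \<notin> N"
      then have "(\<lambda>n. g n t) \<longlonglongrightarrow> f t" using lim[of t] by (simp add: fe_def)
      then have "(\<lambda>n. cl k (g n t)) \<longlonglongrightarrow> cl k (f t)"
        using continuous_on_tendsto_compose[OF cont[OF k]] by simp
      then have "(\<lambda>n. cl k (f t) - cl k (g n t)) \<longlonglongrightarrow> cl k (f t) - cl k (f t)"
        by (intro tendsto_diff tendsto_const)
      from tendsto_power[OF tendsto_norm[OF this], of 2]
      show "(\<lambda>n. (norm (cl k (f t) - cl k (g n t)))\<^sup>2) \<longlonglongrightarrow> 0" by simp
    qed
  qed simp
  then have "\<forall>\<^sub>F n in sequentially. (\<integral>t. (norm (cl k (f t) - cl k (g n t)))\<^sup>2 \<partial>leb T) < e / 4"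
    using e by (intro order_tendstoD(2)[where y = 0]) auto
  then obtain n where n: "(\<integral>t. (norm (cl k (f t) - cl k (g n t)))\<^sup>2 \<partial>leb T) < e / 4"
    unfolding eventually_sequentially by blast
  have sqcl: "sq_int (leb T) (\<lambda>t. cl k (f t))"
    by (rule sq_int_bound[OF f, where C = 1]) (use cl_norm(1)[OF k] in auto)
  have sqg: "sq_int (leb T) (\<lambda>t. cl k (g n t))"
    by (rule sq_int_bound[OF sq_int_const[OF finite_measure_leb, where c = k], where C = 1])
      (use cl_norm(2)[OF k] k in auto)
  have "(\<integral>t. (norm (f t - cl k (g n t)))\<^sup>2 \<partial>leb T)
      \<le> (\<integral>t. 2 * (norm (f t - cl k (f t)))\<^sup>2 + 2 * (norm (cl k (f t) - cl k (g n t)))\<^sup>2 \<partial>leb T)"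
  proof (rule integral_mono)
    show "(norm (f t - cl k (g n t)))\<^sup>2 \<le> 2 * (norm (f t - cl k (f t)))\<^sup>2 + 2 * (norm (cl k (f t) - cl k (g n t)))\<^sup>2" for t
      using norm_add_power2[of "f t - cl k (f t)" "cl k (f t) - cl k (g n t)"] by simp
  qed (use f sqcl sqg in \<open>auto intro!: Bochner_Integration.integrable_add sq_int_norm sq_int_diff\<close>)
  also have "\<dots> = 2 * (\<integral>t. (norm (f t - cl k (f t)))\<^sup>2 \<partial>leb T) + 2 * (\<integral>t. (norm (cl k (f t) - cl k (g n t)))\<^sup>2 \<partial>leb T)"
    using sq_int_norm[OF sq_int_diff[OF f sqcl]] sq_int_norm[OF sq_int_diff[OF sqcl sqg]] by simp
  also have "\<dots> < e" using k' n by (simp add: k_def)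
  finally show ?thesis using cg sqg by (intro exI[of _ "\<lambda>t. cl k (g n t)"]) auto
qed

lemma disc_tendsto:
  fixes f :: "real \<Rightarrow> 'b::euclidean_space"
  assumes T: "T > 0" and f: "sq_int (leb T) f"
  shows "(\<lambda>n. \<integral>t. (norm (disc T n f t - f t))\<^sup>2 \<partial>leb T) \<longlonglongrightarrow> 0"
proof (rule LIMSEQ_I)
  fix e :: real assume e: "e > 0"
  \<comment> \<open>The error splits into \<open>disc\<close> of \<open>f - g\<close>, the error for
    \<open>g\<close>, and \<open>g - f\<close>, with weights 2, 4 and 4. The contraction bounds the
    first by the distance of \<open>f\<close> and \<open>g\<close>, so ten twelfths of
    \<open>e\<close> are spent.\<close>
  obtain g where g: "continuous_on UNIV g" "sq_int (leb T) g" "(\<integral>t. (norm (f t - g t))\<^sup>2 \<partial>leb T) < e / 12"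
    using continuous_dense_sq_int[OF f, of "e / 12"] e by auto
  have lim: "(\<lambda>n. \<integral>t. (norm (disc T n g t - g t))\<^sup>2 \<partial>leb T) \<longlonglongrightarrow> 0"
    by (rule disc_tendsto_continuous[OF T continuous_on_subset[OF g(1)]]) simp
  have "e / 12 > 0" using e by simp
  from LIMSEQ_D[OF lim this]
  obtain N where N: "\<And>n. n \<ge> N \<Longrightarrow> norm ((\<integral>t. (norm (disc T n g t - g t))\<^sup>2 \<partial>leb T) - 0) < e / 12"
    by auto
  show "\<exists>N. \<forall>n\<ge>N. norm ((\<integral>t. (norm (disc T n f t - f t))\<^sup>2 \<partial>leb T) - 0) < e"
  proof (intro exI allI impI)
    fix n assume n: "n \<ge> N"
    have fg: "sq_int (leb T) (\<lambda>t. f t - g t)" by (rule sq_int_diff[OF f g(2)])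
    have dfg: "sq_int (leb T) (\<lambda>t. disc T n (\<lambda>t. f t - g t) t)" by (rule disc_sq_int[OF T])
    have dg: "sq_int (leb T) (\<lambda>t. disc T n g t - g t)" by (rule sq_int_diff[OF disc_sq_int[OF T] g(2)])
    have df: "sq_int (leb T) (\<lambda>t. disc T n f t - f t)" by (rule sq_int_diff[OF disc_sq_int[OF T] f])
    have i: "integrable (leb T) f" "integrable (leb T) g"
      by (intro sq_int_integrable finite_measure_leb f g)+
    have "(\<integral>t. (norm (disc T n f t - f t))\<^sup>2 \<partial>leb T)
        \<le> (\<integral>t. 2 * (norm (disc T n (\<lambda>t. f t - g t) t))\<^sup>2
              + (4 * (norm (disc T n g t - g t))\<^sup>2 + 4 * (norm (f t - g t))\<^sup>2) \<partial>leb T)"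
    proof (rule integral_mono)
      fix t
      have "disc T n f t - f t = disc T n (\<lambda>t. f t - g t) t + ((disc T n g t - g t) + (g t - f t))"
        using disc_diff[OF T i] by simp
      then have "(norm (disc T n f t - f t))\<^sup>2 \<le> 2 * (norm (disc T n (\<lambda>t. f t - g t) t))\<^sup>2
          + 2 * (norm ((disc T n g t - g t) + (g t - f t)))\<^sup>2"
        by (metis norm_add_power2)
      moreover have "(norm ((disc T n g t - g t) + (g t - f t)))\<^sup>2
          \<le> 2 * (norm (disc T n g t - g t))\<^sup>2 + 2 * (norm (f t - g t))\<^sup>2"
        using norm_add_power2[of "disc T n g t - g t" "g t - f t"] by (simp add: norm_minus_commute)
      ultimately show "(norm (disc T n f t - f t))\<^sup>2 \<le> 2 * (norm (disc T n (\<lambda>t. f t - g t) t))\<^sup>2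
              + (4 * (norm (disc T n g t - g t))\<^sup>2 + 4 * (norm (f t - g t))\<^sup>2)" by linarith
    qed (use fg dfg dg df in \<open>auto intro!: Bochner_Integration.integrable_add sq_int_norm\<close>)
    also have "\<dots> = 2 * (\<integral>t. (norm (disc T n (\<lambda>t. f t - g t) t))\<^sup>2 \<partial>leb T)
        + (4 * (\<integral>t. (norm (disc T n g t - g t))\<^sup>2 \<partial>leb T) + 4 * (\<integral>t. (norm (f t - g t))\<^sup>2 \<partial>leb T))"
      using sq_int_norm[OF fg] sq_int_norm[OF dfg] sq_int_norm[OF dg] by simp
    also have "\<dots> < 2 * (e / 12) + (4 * (e / 12) + 4 * (e / 12))"
      using disc_contraction[OF T fg, of n] g(3) N[OF n] by auto
    also have "\<dots> < e" using e by simp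
    finally show "norm ((\<integral>t. (norm (disc T n f t - f t))\<^sup>2 \<partial>leb T) - 0) < e" by simp
  qed
qed

section \<open>Orthogonality and the noise filtration\<close>

text \<open>Says that the conditional expectation of \<open>Z\<close> given \<open>H\<close> is
  zero, in the form of test sets that suits Dynkin's argument on a generating system.\<close>

definition orth :: "'a measure \<Rightarrow> 'a measure \<Rightarrow> ('a \<Rightarrow> real) \<Rightarrow> bool" where
  "orth M H Z \<longleftrightarrow> integrable M Z \<and> (\<forall>A\<in>sets H. (\<integral>x. indicator A x * Z x \<partial>M) = 0)"

lemma preimages_Pow: "preimages M Y \<subseteq> Pow (space M)"
  by (auto simp: preimages_def)

lemma borel_measurable_iff_preimages:
  "space H = space M \<Longrightarrow> Y \<in> borel_measurable H \<longleftrightarrow> preimages M Y \<subseteq> sets H"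
  by (auto simp: preimages_def measurable_def)

lemma preimages_Int:
  assumes "A \<in> preimages M Y" "B \<in> preimages M Y"
  shows "A \<inter> B \<in> preimages M Y"
proof -
  obtain E E' where E: "E \<in> sets borel" "E' \<in> sets borel" "A = Y -` E \<inter> space M" "B = Y -` E' \<inter> space M"
    using assms unfolding preimages_def by blast
  then have "A \<inter> B = Y -` (E \<inter> E') \<inter> space M" "E \<inter> E' \<in> sets borel" by auto
  then show ?thesis unfolding preimages_def by blast
qed

lemma measurable_mono_sets:
  "f \<in> measurable A N \<Longrightarrow> space A = space B \<Longrightarrow> sets A \<subseteq> sets B \<Longrightarrow> f \<in> measurable B N"
  by (rule measurable_from_subalg[of B A]) (simp_all add: subalgebra_def)

lemma preimages_sigma_sets: "sigma_sets (space M) (preimages M Y) = preimages M Y"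
proof -
  have *: "sets (vimage_algebra (space M) Y borel) = preimages M Y"
    unfolding preimages_def by (rule sets_vimage_algebra2) auto
  show ?thesis
    using sets.sigma_sets_eq[of "vimage_algebra (space M) Y borel"] unfolding * by simp
qed

text \<open>The sets on which \<open>Z\<close> integrates to zero form a lambda-system; the
  vanishing total integral is what gives closure under complements.\<close>

lemma orth_sigma_sets:
  fixes Z :: "'a \<Rightarrow> real"
  assumes G: "Int_stable G" "G \<subseteq> sets M"
    and Z: "integrable M Z" "(\<integral>x. Z x \<partial>M) = 0"
    and gen: "\<And>A. A \<in> G \<Longrightarrow> (\<integral>x. indicator A x * Z x \<partial>M) = 0"
    and A: "A \<in> sigma_sets (space M) G"
  shows "(\<integral>x. indicator A x * Z x \<partial>M) = 0"
proof -
  have GP: "G \<subseteq> Pow (space M)" using G(2) sets.space_closed by blast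
  have in_M: "sigma_sets (space M) G \<subseteq> sets M" by (rule sets.sigma_sets_subset[OF G(2)])
  have int: "integrable M (\<lambda>x. indicator A x * Z x)" if "A \<in> sets M" for A
    using integrable_mult_indicator[OF that Z(1)] by simp
  from G(1) GP A show ?thesis
  proof (induction rule: sigma_sets_induct_disjoint)
    case (basic A)
    then show ?case by (rule gen)
  next
    case empty
    then show ?case by simp
  next
    case (compl A)
    then have AM: "A \<in> sets M" using in_M by blast
    have "(\<integral>x. indicator (space M - A) x * Z x \<partial>M) = (\<integral>x. Z x - indicator A x * Z x \<partial>M)"
      by (intro Bochner_Integration.integral_cong) (auto simp: indicator_def)
    also have "\<dots> = 0" using int[OF AM] Z compl by simp
    finally show ?case .
  next
    case (union A)
    then have AM: "A i \<in> sets M" for i using in_M by blast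
    have "(LINT x:(\<Union>i. A i)|M. Z x) = (\<Sum>i. (LINT x:(A i)|M. Z x))"
    proof (rule lebesgue_integral_countable_add[OF AM])
      show "\<And>i j. i \<noteq> j \<Longrightarrow> A i \<inter> A j = {}"
        using union(1) by (auto simp: disjoint_family_on_def)
      have U: "(\<Union>i. A i) \<in> sets M" using AM by auto
      show "set_integrable M (\<Union>i. A i) Z"
        using integrable_mult_indicator[OF U Z(1)] by (simp add: set_integrable_def)
    qed
    moreover have "(LINT x:(A i)|M. Z x) = 0" for i
      using union(3)[of i] by (simp add: set_lebesgue_integral_def)
    ultimately show ?case by (simp add: set_lebesgue_integral_def)
  qed
qed

text \<open>Test sets show that the conditional expectation of \<open>Z\<close> vanishes.
  Square-integrability of \<open>Z\<close> and \<open>g\<close> makes the product integrable, so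
  that \<open>Z\<close> may be replaced by its conditional expectation. Vectors are handled
  coordinate by coordinate.\<close>

lemma orth_integral:
  fixes g :: "'a \<Rightarrow> 'b::euclidean_space"
  assumes M: "prob_space M" and H: "subalgebra M H" and Z: "orth M H Z" "sq_int M Z"
    and g: "sq_int M g" "g \<in> borel_measurable H"
  shows "(\<integral>x. Z x *\<^sub>R g x \<partial>M) = 0"
proof -
  interpret prob_space M by fact
  interpret finite_measure_subalgebra M H by standard fact
  have iZ: "integrable M Z" using Z(1) by (simp add: orth_def)
  have ce: "AE x in M. real_cond_exp M H Z x = 0"
    by (rule real_cond_exp_charact)
      (use Z(1) in \<open>auto simp: orth_def set_lebesgue_integral_def\<close>)
  have *: "(\<integral>x. h x * Z x \<partial>M) = 0" if h: "sq_int M h" "h \<in> borel_measurable H" for h :: "'a \<Rightarrow> real"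
  proof -
    have "integrable M (\<lambda>x. h x * Z x)" using sq_int_scaleR_fun[OF h(1) Z(2)] by simp
    then have "(\<integral>x. h x * Z x \<partial>M) = (\<integral>x. h x * real_cond_exp M H Z x \<partial>M)"
      using h(2) iZ by (intro real_cond_exp_intg(2)[symmetric]) auto
    also have "\<dots> = 0" using ce by (intro integral_eq_zero_AE) auto
    finally show ?thesis .
  qed
  show ?thesis
  proof (rule euclidean_eqI)
    fix b :: 'b assume "b \<in> Basis"
    have "(\<integral>x. Z x *\<^sub>R g x \<partial>M) \<bullet> b = (\<integral>x. (Z x *\<^sub>R g x) \<bullet> b \<partial>M)"
      using sq_int_scaleR_fun[OF Z(2) g(1)] by (intro integral_inner_left[symmetric])
    also have "\<dots> = (\<integral>x. (g x \<bullet> b) * Z x \<partial>M)"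
      by (intro Bochner_Integration.integral_cong) (auto simp: mult.commute)
    also have "\<dots> = 0"
      using sq_int_bounded_linear[OF g(1) bounded_linear_inner_left[of b]] g(2)
      by (intro *) auto
    finally show "(\<integral>x. Z x *\<^sub>R g x \<partial>M) \<bullet> b = 0 \<bullet> b" by simp
  qed
qed

text \<open>The preimages under a function already form a sigma-algebra, so independence of the two
  set systems passes to the variables. \<open>B\<close> is a mere set system, since the independence
  of increments is stated with \<open>preimages\<close>.\<close>

lemma (in prob_space) indep_set_expectation:
  fixes U V :: "'a \<Rightarrow> real"
  assumes A: "subalgebra M A" and U: "U \<in> borel_measurable A" "integrable M U"
    and V: "V \<in> borel_measurable M" "preimages M V \<subseteq> B" "integrable M V"
    and ind: "indep_set (sets A) B"
  shows "(\<integral>x. U x * V x \<partial>M) = (\<integral>x. U x \<partial>M) * (\<integral>x. V x \<partial>M)"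
proof (rule indep_var_lebesgue_integral[OF _ U(2) V(3)])
  have sU: "preimages M U \<subseteq> sets A"
    using U(1) A by (subst borel_measurable_iff_preimages[symmetric]) (auto simp: subalgebra_def)
  have UM: "U \<in> borel_measurable M" by (rule measurable_from_subalg[OF A U(1)])
  have "indep_set (preimages M U) (preimages M V)"
  proof (rule indep_setI)
    show "preimages M U \<subseteq> events" using sU A by (auto simp: subalgebra_def)
    show "preimages M V \<subseteq> events" using V(1) by (auto simp: preimages_def)
    fix a b assume "a \<in> preimages M U" "b \<in> preimages M V"
    then show "prob (a \<inter> b) = prob a * prob b"
      using sU V(2) by (intro indep_setD[OF ind]) auto
  qed
  then show "indep_var borel U borel V"
    unfolding indep_var_eq using UM V(1) preimages_sigma_sets[of M U] preimages_sigma_sets[of M V]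
    by (simp add: preimages_def)
qed

section \<open>Moments of Gaussian vectors with independent coordinates\<close>

lemma integral_prod_cart:
  fixes g :: "'d::finite \<Rightarrow> real \<Rightarrow> real"
  assumes g: "\<And>i. integrable lborel (g i)"
  shows "integrable lborel (\<lambda>x :: real ^ 'd. \<Prod>i\<in>UNIV. g i (x $ i))"
    and "(\<integral>x. (\<Prod>i\<in>UNIV. g i (x $ i)) \<partial>(lborel :: (real ^ 'd) measure)) = (\<Prod>i\<in>UNIV. \<integral>u. g i u \<partial>lborel)"
proof -
  interpret L: product_sigma_finite "\<lambda>_ :: real ^ 'd. lborel :: real measure" ..
  have B: "(Basis :: (real ^ 'd) set) = range (\<lambda>i. axis i 1)"
    by (auto simp: Basis_vec_def)
  have inj: "inj (\<lambda>i. axis i 1 :: real ^ 'd)" by (auto simp: inj_def axis_eq_axis)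
  have gm [measurable]: "g i \<in> borel_measurable borel" for i
    using g[of i] by auto
  \<comment> \<open>Lebesgue measure on \<open>real ^ 'd\<close> is the image of a product measure
    indexed by \<open>Basis\<close>; \<open>axis_index\<close> translates basis vectors back to
    coordinates.\<close>
  have eq: "(\<Prod>i\<in>UNIV. g i ((\<Sum>b\<in>Basis. h b *\<^sub>R b) $ i)) = (\<Prod>b\<in>Basis. g (axis_index b) (h b))"
    for h :: "real ^ 'd \<Rightarrow> real"
  proof -
    have "(\<Prod>b\<in>Basis. g (axis_index b) (h b)) = (\<Prod>i\<in>UNIV. g i (h (axis i 1)))"
      unfolding B by (subst prod.reindex[OF inj]) simp
    moreover have "(\<Sum>b\<in>Basis. h b *\<^sub>R b) $ i = h (axis i 1)" for i
    proof -
      have "(\<Sum>b\<in>Basis. h b *\<^sub>R b) $ i = (\<Sum>b\<in>Basis. h b *\<^sub>R b) \<bullet> axis i 1"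
        by (simp add: inner_axis)
      also have "\<dots> = h (axis i 1)"
        by (rule inner_sum_left_Basis) (simp add: B)
      finally show ?thesis .
    qed
    ultimately show ?thesis by simp
  qed
  have pm: "(\<lambda>x :: real ^ 'd. \<Prod>i\<in>UNIV. g i (x $ i)) \<in> borel_measurable borel"
    by measurable
  have sm: "(\<lambda>f. \<Sum>b\<in>Basis. f b *\<^sub>R b) \<in> measurable (\<Pi>\<^sub>M b\<in>(Basis :: (real ^ 'd) set). lborel) borel"
    by measurable
  have "integrable (\<Pi>\<^sub>M b\<in>(Basis :: (real ^ 'd) set). lborel) (\<lambda>h. \<Prod>b\<in>Basis. g (axis_index b) (h b))"
    using g by (intro L.product_integrable_prod) auto
  then show "integrable lborel (\<lambda>x :: real ^ 'd. \<Prod>i\<in>UNIV. g i (x $ i))"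
    by (subst lborel_eq, subst integrable_distr_eq[OF sm pm]) (simp only: eq)
  have "(\<integral>x. (\<Prod>i\<in>UNIV. g i (x $ i)) \<partial>(lborel :: (real ^ 'd) measure))
      = (\<integral>h. (\<Prod>b\<in>Basis. g (axis_index b) (h b)) \<partial>(\<Pi>\<^sub>M b\<in>(Basis :: (real ^ 'd) set). lborel))"
    by (subst lborel_eq[where 'a = "real ^ 'd"], subst integral_distr[OF sm pm]) (simp only: eq)
  also have "\<dots> = (\<Prod>b\<in>(Basis :: (real ^ 'd) set). \<integral>u. g (axis_index b) u \<partial>lborel)"
    using g by (intro L.product_integral_prod) auto
  also have "\<dots> = (\<Prod>i\<in>UNIV. \<integral>u. g i u \<partial>lborel)"
    unfolding B by (subst prod.reindex[OF inj]) simp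
  finally show "(\<integral>x. (\<Prod>i\<in>UNIV. g i (x $ i)) \<partial>(lborel :: (real ^ 'd) measure)) = (\<Prod>i\<in>UNIV. \<integral>u. g i u \<partial>lborel)" .
qed

text \<open>A monomial in the coordinates is absorbed into the one-dimensional factors, so each
  moment is a product of one-dimensional moments: \<open>g1\<close> carries a factor
  \<open>u\<close> in coordinate \<open>k\<close>, and \<open>g2\<close> one in \<open>k\<close> and
  one in \<open>l\<close>. For distinct coordinates a vanishing first moment occurs in the product;
  for equal ones the variance does.\<close>

lemma gaussian_vector_moments:
  fixes D :: "'a \<Rightarrow> real ^ 'd::finite"
  assumes M: "prob_space M" and s: "\<sigma> > 0"
    and D: "distributed M lborel D (\<lambda>x. ennreal (\<Prod>i\<in>UNIV. normal_density 0 \<sigma> (x $ i)))"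
  shows "integrable M (\<lambda>\<omega>. D \<omega> $ k)" "(\<integral>\<omega>. D \<omega> $ k \<partial>M) = 0"
    "integrable M (\<lambda>\<omega>. (D \<omega> $ k) * (D \<omega> $ l))"
    "(\<integral>\<omega>. (D \<omega> $ k) * (D \<omega> $ l) \<partial>M) = (if k = l then \<sigma>\<^sup>2 else 0)"
proof -
  let ?n = "normal_density 0 \<sigma>"
  have nn: "0 \<le> (\<Prod>i\<in>UNIV. ?n (x $ i))" for x :: "real ^ 'd"
    by (intro prod_nonneg) simp
  have i0: "integrable lborel ?n" "(\<integral>u. ?n u \<partial>lborel) = 1"
    using s by auto
  have i1: "integrable lborel (\<lambda>u. ?n u * u)" "(\<integral>u. ?n u * u \<partial>lborel) = 0"
    using integrable_normal_moment_nz_1[OF s, of 0] integral_normal_moment_nz_1[OF s, of 0] by auto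
  have i2: "integrable lborel (\<lambda>u. ?n u * u\<^sup>2)" "(\<integral>u. ?n u * u\<^sup>2 \<partial>lborel) = \<sigma>\<^sup>2"
    using integrable_normal_moment[OF s, of 0 2] integral_normal_moment_even[OF s, of 0 1] s by (auto simp: power2_eq_square)
  define g1 where "g1 i u = (if i = k then ?n u * u else ?n u)" for i u
  have g1: "integrable lborel (g1 i)" for i using i0 i1 by (cases "i = k") (auto simp: g1_def[abs_def])
  have p1: "(\<Prod>i\<in>UNIV. g1 i (x $ i)) = (\<Prod>i\<in>UNIV. ?n (x $ i)) * x $ k" for x :: "real ^ 'd"
  proof -
    have "(\<Prod>i\<in>UNIV. g1 i (x $ i)) = (\<Prod>i\<in>UNIV. ?n (x $ i) * (if i = k then x $ i else 1))"
      by (intro prod.cong) (auto simp: g1_def)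
    also have "\<dots> = (\<Prod>i\<in>UNIV. ?n (x $ i)) * x $ k"
      by (subst prod.distrib) simp
    finally show ?thesis .
  qed
  have "(\<integral>u. g1 k u \<partial>lborel) = 0" using i1 by (simp add: g1_def)
  then have "(\<Prod>i\<in>UNIV. \<integral>u. g1 i u \<partial>lborel) = 0"
    by (intro prod_zero finite bexI[of _ k]) auto
  then have "(\<integral>x. (\<Prod>i\<in>UNIV. ?n (x $ i)) * x $ k \<partial>(lborel :: (real ^ 'd) measure)) = 0"
    "integrable lborel (\<lambda>x :: real ^ 'd. (\<Prod>i\<in>UNIV. ?n (x $ i)) * x $ k)"
    using integral_prod_cart[of g1, OF g1] unfolding p1 by auto
  then show "(\<integral>\<omega>. D \<omega> $ k \<partial>M) = 0" "integrable M (\<lambda>\<omega>. D \<omega> $ k)"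
    using distributed_integral[OF D, of "\<lambda>x. x $ k"] distributed_integrable[OF D, of "\<lambda>x. x $ k"] nn by auto
  define g2 where "g2 i u = ?n u * ((if i = k then u else 1) * (if i = l then u else 1))" for i u
  have g2: "integrable lborel (g2 i)" for i
    using i0 i1 i2 by (cases "i = k"; cases "i = l") (auto simp: g2_def[abs_def] power2_eq_square)
  have p2: "(\<Prod>i\<in>UNIV. g2 i (x $ i)) = (\<Prod>i\<in>UNIV. ?n (x $ i)) * (x $ k * x $ l)" for x :: "real ^ 'd"
    by (simp add: g2_def prod.distrib)
  have "(\<Prod>i\<in>UNIV. \<integral>u. g2 i u \<partial>lborel) = (if k = l then \<sigma>\<^sup>2 else 0)"
  proof (cases "k = l")
    case True
    have "(\<Prod>i\<in>UNIV. \<integral>u. g2 i u \<partial>lborel) = (\<Prod>i\<in>UNIV. if i = k then \<sigma>\<^sup>2 else 1)"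
      using i2(2) i0(2) True by (intro prod.cong) (auto simp: g2_def power2_eq_square)
    then show ?thesis using True by simp
  next
    case False
    then have "(\<integral>u. g2 k u \<partial>lborel) = 0" using i1 by (simp add: g2_def)
    then have "(\<Prod>i\<in>UNIV. \<integral>u. g2 i u \<partial>lborel) = 0"
      by (intro prod_zero finite bexI[of _ k]) auto
    then show ?thesis using False by simp
  qed
  then have "(\<integral>x. (\<Prod>i\<in>UNIV. ?n (x $ i)) * (x $ k * x $ l) \<partial>(lborel :: (real ^ 'd) measure)) = (if k = l then \<sigma>\<^sup>2 else 0)"
    "integrable lborel (\<lambda>x :: real ^ 'd. (\<Prod>i\<in>UNIV. ?n (x $ i)) * (x $ k * x $ l))"
    using integral_prod_cart[of g2, OF g2] unfolding p2 by auto
  then show "(\<integral>\<omega>. (D \<omega> $ k) * (D \<omega> $ l) \<partial>M) = (if k = l then \<sigma>\<^sup>2 else 0)"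
    "integrable M (\<lambda>\<omega>. (D \<omega> $ k) * (D \<omega> $ l))"
    using distributed_integral[OF D, of "\<lambda>x. x $ k * x $ l"] distributed_integrable[OF D, of "\<lambda>x. x $ k * x $ l"] nn
    by auto
qed

section \<open>The stochastic basis and the noise filtration\<close>

locale noise_basis =
  fixes P :: "('a, 'd::finite) stoch_basis" and T :: real
  assumes T_pos: "0 < T" and setting: "stochastic_setting P T"
begin

abbreviation "M \<equiv> sb_M P"
abbreviation "W \<equiv> sb_W P"
abbreviation "\<xi> \<equiv> sb_xi P"
abbreviation "F \<equiv> sb_F P"
abbreviation "F1 \<equiv> noise_filtration P T"

lemma prob_space_M: "prob_space M" using setting by (simp add: stochastic_setting_def)

sublocale prob_space M by (rule prob_space_M)

lemma complete_M: "complete_measure M" using setting by (simp add: stochastic_setting_def)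

lemma T0: "0 \<in> {0..T}" "T \<in> {0..T}" using T_pos by auto

lemma F_subalgebra: "t \<in> {0..T} \<Longrightarrow> subalgebra M (F t)"
  and F_null: "t \<in> {0..T} \<Longrightarrow> null_sets M \<subseteq> sets (F t)"
  and F_mono: "0 \<le> s \<Longrightarrow> s \<le> t \<Longrightarrow> t \<le> T \<Longrightarrow> sets (F s) \<subseteq> sets (F t)"
  and F_right: "t \<in> {0..<T} \<Longrightarrow> (\<Inter>s\<in>{t<..T}. sets (F s)) = sets (F t)"
  using setting by (auto simp: stochastic_setting_def usual_filtration_def)

lemma F_space: "t \<in> {0..T} \<Longrightarrow> space (F t) = space M"
  and F_sets: "t \<in> {0..T} \<Longrightarrow> sets (F t) \<subseteq> sets M"
  using F_subalgebra[of t] by (auto simp: subalgebra_def)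

lemma measurable_F: "f \<in> borel_measurable (F t) \<Longrightarrow> t \<in> {0..T} \<Longrightarrow> f \<in> borel_measurable M"
  using measurable_from_subalg[OF F_subalgebra] by blast

lemma bm: "brownian_motion M T F W" using setting by (simp add: stochastic_setting_def)

lemma W_adapted: "t \<in> {0..T} \<Longrightarrow> W t \<in> borel_measurable (F t)"
  and W_0: "AE \<omega> in M. W 0 \<omega> = 0"
  and W_indep: "0 \<le> s \<Longrightarrow> s < t \<Longrightarrow> t \<le> T \<Longrightarrow> indep_set (sets (F s)) (preimages M (\<lambda>\<omega>. W t \<omega> - W s \<omega>))"
  and W_dist: "0 \<le> s \<Longrightarrow> s < t \<Longrightarrow> t \<le> T \<Longrightarrow> distributed M lborel (\<lambda>\<omega>. W t \<omega> - W s \<omega>)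
          (\<lambda>x. ennreal (\<Prod>i\<in>UNIV. normal_density 0 (sqrt (t - s)) (x $ i)))"
  using bm by (auto simp: brownian_motion_def)

lemma W_measurable: "t \<in> {0..T} \<Longrightarrow> W t \<in> borel_measurable M"
  using W_adapted measurable_F by blast

lemma xi_F0: "\<xi> \<in> borel_measurable (F 0)"
  using setting unfolding stochastic_setting_def by (elim conjE)

lemma xi_sq: "sq_int M \<xi>"
  unfolding sq_int_def
proof
  show "\<xi> \<in> borel_measurable M" by (rule measurable_F[OF xi_F0 T0(1)])
  show "integrable M (\<lambda>\<omega>. (norm (\<xi> \<omega>))\<^sup>2)"
    using setting unfolding stochastic_setting_def by (elim conjE)
qed

lemma sigma_process_sets:
  "sets (sigma_process M t Y) = sigma_sets (space M) (\<Union>s\<in>{0..t}. preimages M (Y s))"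
  unfolding sigma_process_def using preimages_Pow[of M] by (intro sets_measure_of) auto

lemma sigma_process_space [simp]: "space (sigma_process M t Y) = space M"
  by (simp add: sigma_process_def space_measure_of_conv)

lemma sigma_process_Pow: "sets (sigma_process M t Y) \<subseteq> Pow (space M)"
  using sets.space_closed[of "sigma_process M t Y"] by simp

lemma sigma_noise_sets:
  "sets (sigma_noise P t) = sigma_sets (space M) (preimages M \<xi> \<union> sets (sigma_process M t W))"
  unfolding sigma_noise_def using preimages_Pow[of M \<xi>] sigma_process_Pow[of t W]
  by (intro sets_measure_of Un_least)

lemma sigma_noise_space [simp]: "space (sigma_noise P t) = space M"
  by (simp add: sigma_noise_def space_measure_of_conv)

lemma sigma_process_least:
  assumes "space H = space M" "\<And>s. 0 \<le> s \<Longrightarrow> s \<le> t \<Longrightarrow> Y s \<in> borel_measurable H"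
  shows "sets (sigma_process M t Y) \<subseteq> sets H"
proof -
  have "preimages M (Y s) \<subseteq> sets H" if "0 \<le> s" "s \<le> t" for s
    using assms(2)[OF that] borel_measurable_iff_preimages[OF assms(1)] by blast
  then have "sigma_sets (space H) (\<Union>s\<in>{0..t}. preimages M (Y s)) \<subseteq> sets H"
    by (intro sets.sigma_sets_subset UN_least) auto
  then show ?thesis by (simp add: sigma_process_sets assms(1))
qed

lemma sigma_process_measurable: "0 \<le> s \<Longrightarrow> s \<le> t \<Longrightarrow> Y s \<in> borel_measurable (sigma_process M t Y)"
  unfolding borel_measurable_iff_preimages[OF sigma_process_space] sigma_process_sets by (rule subsetI, rule sigma_sets.Basic) auto

lemma sigma_noise_least:
  assumes "space H = space M" "\<xi> \<in> borel_measurable H" "\<And>s. 0 \<le> s \<Longrightarrow> s \<le> t \<Longrightarrow> W s \<in> borel_measurable H"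
  shows "sets (sigma_noise P t) \<subseteq> sets H"
proof -
  have "sigma_sets (space H) (preimages M \<xi> \<union> sets (sigma_process M t W)) \<subseteq> sets H"
    using sigma_process_least[where Y = W, OF assms(1,3)] assms(2)
      borel_measurable_iff_preimages[OF assms(1), of \<xi>]
    by (intro sets.sigma_sets_subset Un_least) auto
  then show ?thesis by (simp add: sigma_noise_sets assms(1))
qed

lemma sigma_noise_xi: "\<xi> \<in> borel_measurable (sigma_noise P t)"
  unfolding borel_measurable_iff_preimages[OF sigma_noise_space] sigma_noise_sets by (rule subsetI, rule sigma_sets.Basic) auto

lemma sigma_noise_W: "0 \<le> s \<Longrightarrow> s \<le> t \<Longrightarrow> W s \<in> borel_measurable (sigma_noise P t)"
proof -
  assume "0 \<le> s" "s \<le> t"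
  then have "preimages M (W s) \<subseteq> sets (sigma_process M t W)"
    using sigma_process_measurable[of s t W] by (subst borel_measurable_iff_preimages[symmetric]) auto
  then show ?thesis
    unfolding borel_measurable_iff_preimages[OF sigma_noise_space] sigma_noise_sets by (intro subsetI sigma_sets.Basic) auto
qed

lemma sigma_noise_F:
  assumes t: "t \<in> {0..T}"
  shows "sets (sigma_noise P t) \<subseteq> sets (F t)"
proof (rule sigma_noise_least)
  have m: "f \<in> borel_measurable (F s) \<Longrightarrow> 0 \<le> s \<Longrightarrow> s \<le> t \<Longrightarrow> f \<in> borel_measurable (F t)" for s and f :: "'a \<Rightarrow> real ^ 'd"
    using F_mono[of s t] F_space[of s] F_space[of t] t by (intro measurable_from_subalg[of "F t" "F s"]) (auto simp: subalgebra_def)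
  show "space (F t) = space M" by (rule F_space[OF t])
  show "\<xi> \<in> borel_measurable (F t)" using m[OF xi_F0] t by auto
  show "\<And>s. 0 \<le> s \<Longrightarrow> s \<le> t \<Longrightarrow> W s \<in> borel_measurable (F t)" using m[OF W_adapted] t by auto
qed

lemma sigma_noise_subalgebra: "t \<in> {0..T} \<Longrightarrow> subalgebra M (sigma_noise P t)"
  using sigma_noise_F[of t] F_sets[of t] by (auto simp: subalgebra_def)

lemma sigma_noise_mono: "s \<le> t \<Longrightarrow> sets (sigma_noise P s) \<subseteq> sets (sigma_noise P t)"
  by (rule sigma_noise_least) (auto intro: sigma_noise_xi sigma_noise_W)

lemma aug_sets: "t \<in> {0..T} \<Longrightarrow> sets (sigma (space M) (sets (sigma_noise P t) \<union> null_sets M))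
    = sigma_sets (space M) (sets (sigma_noise P t) \<union> null_sets M)"
  using sigma_noise_subalgebra[of t] sets.space_closed[of M]
  by (intro sets_measure_of) (auto simp: subalgebra_def null_sets_def)

lemma F1_space [simp]: "space (F1 t) = space M"
  by (simp add: noise_filtration_def space_measure_of_conv)

text \<open>The index \<open>T\<close> is always present, so the intersection is never taken over
  the empty family; at \<open>t = T\<close> it is the completed noise up to
  \<open>T\<close>.\<close>

lemma F1_sets:
  "t \<in> {0..T} \<Longrightarrow> sets (F1 t) = sigma_sets (space M) (\<Inter>s\<in>{t<..T} \<union> {T}. sigma_sets (space M) (sets (sigma_noise P s) \<union> null_sets M))"
proof -
  assume t: "t \<in> {0..T}"
  have eq: "(\<Inter>s\<in>{t<..T} \<union> {T}. sets (sigma (space M) (sets (sigma_noise P s) \<union> null_sets M)))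
     = (\<Inter>s\<in>{t<..T} \<union> {T}. sigma_sets (space M) (sets (sigma_noise P s) \<union> null_sets M))"
    using t T_pos by (intro INF_cong refl aug_sets) auto
  have "(\<Inter>s\<in>{t<..T} \<union> {T}. sets (sigma (space M) (sets (sigma_noise P s) \<union> null_sets M))) \<subseteq> Pow (space M)"
    using sets.space_closed[of "sigma (space M) (sets (sigma_noise P T) \<union> null_sets M)"]
    by (auto simp: space_measure_of_conv)
  then show ?thesis unfolding noise_filtration_def by (subst sets_measure_of) (simp_all only: eq)
qed

lemma sigma_noise_F1:
  assumes t: "t \<in> {0..T}"
  shows "sets (sigma_noise P t) \<subseteq> sets (F1 t)"
proof
  fix A assume A: "A \<in> sets (sigma_noise P t)"
  show "A \<in> sets (F1 t)" unfolding F1_sets[OF t]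
  proof (rule sigma_sets.Basic, rule INT_I)
    fix s assume "s \<in> {t<..T} \<union> {T}"
    then have "A \<in> sets (sigma_noise P s)" using A t sigma_noise_mono[of t s] by auto
    then show "A \<in> sigma_sets (space M) (sets (sigma_noise P s) \<union> null_sets M)"
      by (intro sigma_sets.Basic) auto
  qed
qed

lemma F1_mono:
  assumes st: "0 \<le> s" "s \<le> t" "t \<le> T"
  shows "sets (F1 s) \<subseteq> sets (F1 t)"
proof -
  have s: "s \<in> {0..T}" and t: "t \<in> {0..T}" using st by auto
  show ?thesis
    unfolding F1_sets[OF s] F1_sets[OF t]
    by (rule sigma_sets_mono', rule INT_anti_mono) (use st in auto)
qed

lemma F1_T_sets: "sets (F1 T) = sigma_sets (space M) (sets (sigma_noise P T) \<union> null_sets M)"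
proof -
  have "sets (F1 T) = sigma_sets (space M) (sigma_sets (space M) (sets (sigma_noise P T) \<union> null_sets M))"
    using F1_sets[OF T0(2)] by simp
  also have "\<dots> = sigma_sets (space M) (sets (sigma_noise P T) \<union> null_sets M)"
    using sigma_noise_subalgebra[OF T0(2)] sets.space_closed[of M]
    by (intro sigma_sets_sigma_sets_eq) (auto simp: subalgebra_def null_sets_def)
  finally show ?thesis .
qed

text \<open>Each \<open>F s\<close> contains the noise up to \<open>s\<close> and the null sets, and
  right-continuity of \<open>F\<close> turns the intersection over later times into
  \<open>F t\<close>. At \<open>t = T\<close> there is no later time and the inclusion holds
  directly.\<close>

lemma F1_F: "t \<in> {0..T} \<Longrightarrow> sets (F1 t) \<subseteq> sets (F t)"
proof -
  assume t: "t \<in> {0..T}"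
  have s: "sigma_sets (space M) (sets (sigma_noise P s) \<union> null_sets M) \<subseteq> sets (F s)" if "s \<in> {0..T}" for s
    using sets.sigma_sets_subset[of "sets (sigma_noise P s) \<union> null_sets M" "F s"]
      sigma_noise_F[OF that] F_null[OF that] unfolding F_space[OF that] by (metis Un_least)
  have "(\<Inter>s\<in>{t<..T} \<union> {T}. sigma_sets (space M) (sets (sigma_noise P s) \<union> null_sets M)) \<subseteq> sets (F t)"
  proof (cases "t < T")
    case True
    have "(\<Inter>s\<in>{t<..T} \<union> {T}. sigma_sets (space M) (sets (sigma_noise P s) \<union> null_sets M)) \<subseteq> (\<Inter>s\<in>{t<..T}. sets (F s))"
    proof (rule INT_greatest)
      fix r assume r: "r \<in> {t<..T}"
      then have "(\<Inter>s\<in>{t<..T} \<union> {T}. sigma_sets (space M) (sets (sigma_noise P s) \<union> null_sets M))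
          \<subseteq> sigma_sets (space M) (sets (sigma_noise P r) \<union> null_sets M)" by blast
      also have "\<dots> \<subseteq> sets (F r)" by (rule s) (use r t in auto)
      finally show "(\<Inter>s\<in>{t<..T} \<union> {T}. sigma_sets (space M) (sets (sigma_noise P s) \<union> null_sets M)) \<subseteq> sets (F r)" .
    qed
    also have "\<dots> = sets (F t)" using F_right[of t] t True by auto
    finally show ?thesis .
  next
    case False
    then have "t = T" using t by auto
    then show ?thesis using s[OF T0(2)] by auto
  qed
  then have "sigma_sets (space (F t)) (\<Inter>s\<in>{t<..T} \<union> {T}. sigma_sets (space M) (sets (sigma_noise P s) \<union> null_sets M)) \<subseteq> sets (F t)"
    by (rule sets.sigma_sets_subset)
  then show ?thesis unfolding F1_sets[OF t] using F_space[OF t] by simp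
qed

lemma F1_subalgebra: "t \<in> {0..T} \<Longrightarrow> subalgebra M (F1 t)"
  using F1_F[of t] F_sets[of t] by (auto simp: subalgebra_def)

text \<open>Null sets contribute nothing to the integrals, and together with the noise events they
  form an intersection-stable system that generates \<open>F1 T\<close>.\<close>

lemma orth_F1:
  assumes "orth M (sigma_noise P T) Z"
  shows "orth M (F1 T) Z"
  unfolding orth_def
proof (intro conjI ballI)
  show Z: "integrable M Z" using assms by (simp add: orth_def)
  have sub: "sets (sigma_noise P T) \<subseteq> sets M"
    using sigma_noise_subalgebra[OF T0(2)] by (simp add: subalgebra_def)
  fix A assume "A \<in> sets (F1 T)"
  then have A: "A \<in> sigma_sets (space M) (sets (sigma_noise P T) \<union> null_sets M)"
    by (simp add: F1_T_sets)
  show "(\<integral>x. indicator A x * Z x \<partial>M) = 0"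
  proof (rule orth_sigma_sets[OF _ _ Z _ _ A])
    show "Int_stable (sets (sigma_noise P T) \<union> null_sets M)"
      using sub by (auto simp: Int_stable_def intro: null_set_Int1 null_set_Int2)
    show "sets (sigma_noise P T) \<union> null_sets M \<subseteq> sets M" using sub by auto
    have "space M \<in> sets (sigma_noise P T)"
      using sets.top[of "sigma_noise P T"] by simp
    then have "(\<integral>x. indicator (space M) x * Z x \<partial>M) = 0" using assms by (auto simp: orth_def)
    moreover have "(\<integral>x. indicator (space M) x * Z x \<partial>M) = (\<integral>x. Z x \<partial>M)"
      by (intro Bochner_Integration.integral_cong) auto
    ultimately show "(\<integral>x. Z x \<partial>M) = 0" by simp
    fix B assume "B \<in> sets (sigma_noise P T) \<union> null_sets M"
    then show "(\<integral>x. indicator B x * Z x \<partial>M) = 0"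
    proof
      assume "B \<in> null_sets M"
      then have "AE x in M. x \<notin> B" by (rule AE_not_in)
      then show ?thesis by (intro integral_eq_zero_AE) (auto elim: eventually_mono)
    qed (use assms in \<open>auto simp: orth_def\<close>)
  qed
qed

text \<open>The increments of \<open>W\<close> after time \<open>a\<close> are independent of \<open>F a\<close>, so a variable known at
  time \<open>a\<close> cannot be detected by the later noise unless the noise up to \<open>a\<close> detects it.\<close>

lemma immersion:
  assumes a: "a \<in> {0..T}" and Z: "Z \<in> borel_measurable (F a)" "orth M (sigma_noise P a) Z"
  shows "orth M (sigma_noise P T) Z"
proof -
  \<comment> \<open>\<open>G J\<close> joins the noise up to \<open>a\<close> with the values of
    \<open>W\<close> at the times in \<open>J\<close>. Finite sets \<open>J\<close> of times after
    \<open>a\<close> suffice to generate the noise up to \<open>T\<close>.\<close>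
  define G where "G J = sigma (space M) (sets (sigma_noise P a) \<union> (\<Union>u\<in>J. preimages M (W u)))" for J
  have GP: "sets (sigma_noise P a) \<union> (\<Union>u\<in>J. preimages M (W u)) \<subseteq> Pow (space M)" for J
    using preimages_Pow[of M] sets.space_closed[of "sigma_noise P a"] by auto
  have Gs: "sets (G J) = sigma_sets (space M) (sets (sigma_noise P a) \<union> (\<Union>u\<in>J. preimages M (W u)))" for J
    unfolding G_def by (rule sets_measure_of[OF GP])
  have Gsp [simp]: "space (G J) = space M" for J by (simp add: G_def space_measure_of_conv)
  have Ga: "sets (sigma_noise P a) \<subseteq> sets (G J)" for J unfolding Gs by auto
  have GW: "W u \<in> borel_measurable (G J)" if "u \<in> J" for u J
    unfolding borel_measurable_iff_preimages[OF Gsp] Gs using that by auto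
  have Gl: "sets (G J) \<subseteq> sets K"
    if "space K = space M" "sets (sigma_noise P a) \<subseteq> sets K" "\<And>u. u \<in> J \<Longrightarrow> W u \<in> borel_measurable K" for J K
  proof -
    have "preimages M (W u) \<subseteq> sets K" if "u \<in> J" for u
      using borel_measurable_iff_preimages[OF \<open>space K = space M\<close>, of "W u"] \<open>\<And>u. u \<in> J \<Longrightarrow> W u \<in> borel_measurable K\<close>[OF that] by blast
    then have "sigma_sets (space K) (sets (sigma_noise P a) \<union> (\<Union>u\<in>J. preimages M (W u))) \<subseteq> sets K"
      using that(2) by (intro sets.sigma_sets_subset Un_least UN_least) auto
    then show ?thesis by (simp add: Gs that(1))
  qed
  have iZ: "integrable M Z" using Z(2) by (simp add: orth_def)
  have WF: "W u \<in> borel_measurable (F v)" if "0 \<le> u" "u \<le> v" "v \<le> T" for u v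
    using measurable_from_subalg[of "F v" "F u" "W u" borel] W_adapted[of u] F_mono[of u v] F_space[of u] F_space[of v] that
    by (auto simp: subalgebra_def)
  have GF: "sets (G J) \<subseteq> sets (F v)" if "a \<le> v" "v \<le> T" "\<And>u. u \<in> J \<Longrightarrow> a \<le> u \<and> u \<le> v" for J v
  proof (rule Gl)
    have v: "v \<in> {0..T}" using that a by auto
    show "space (F v) = space M" by (rule F_space[OF v])
    show "sets (sigma_noise P a) \<subseteq> sets (F v)"
      using sigma_noise_F[OF a] F_mono[of a v] a that by (auto simp: subset_iff)
    show "W u \<in> borel_measurable (F v)" if "u \<in> J" for u
      using WF[of u v] \<open>\<And>u. u \<in> J \<Longrightarrow> a \<le> u \<and> u \<le> v\<close>[OF that] a v by auto
  qed
  have main: "finite J \<Longrightarrow> J \<subseteq> {a<..T} \<Longrightarrow> orth M (G J) Z" for J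
  proof (induction J rule: finite_linorder_max_induct)
    case empty
    have "sets (G {}) \<subseteq> sets (sigma_noise P a)" by (rule Gl) auto
    then show ?case using Z(2) by (auto simp: orth_def)
  next
    case (insert b J)
    \<comment> \<open>The last time already treated, or \<open>a\<close> if there is none. The
      increment from \<open>u\<close> to \<open>b\<close> is independent of \<open>F u\<close>,
      which contains \<open>G J\<close> and makes \<open>Z\<close> measurable.\<close>
    define u where "u = Max (insert a J)"
    have fin: "finite (insert a J)" using insert by simp
    have u_in: "u \<in> insert a J" unfolding u_def by (rule Max_in[OF fin]) simp
    have u_ge: "\<And>v. v \<in> insert a J \<Longrightarrow> v \<le> u" unfolding u_def by (rule Max_ge[OF fin])
    have ub: "u < b" using u_in insert by auto
    have bT: "b \<le> T" "a < b" using insert by auto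
    have au: "a \<le> u" "0 \<le> u" using u_ge a by force+
    have H: "orth M (G J) Z" using insert by auto
    define D where "D \<omega> = W b \<omega> - W u \<omega>" for \<omega>
    have ind: "indep_set (sets (F u)) (preimages M D)"
      unfolding D_def[abs_def] using W_indep[OF au(2) ub bT(1)] .
    have DM: "D \<in> borel_measurable M"
      unfolding D_def using W_measurable[of u] W_measurable[of b] au ub bT by auto
    have GJF: "sets (G J) \<subseteq> sets (F u)"
      using au ub bT insert u_ge by (intro GF) auto
    have uT: "u \<in> {0..T}" using au ub bT by auto
    have FM: "sets (F u) \<subseteq> sets M" by (rule F_sets[OF uT])
    have preM: "preimages M D \<subseteq> sets M"
      using borel_measurable_iff_preimages[of M M D] DM by simp
    \<comment> \<open>Intersections of an event of \<open>G J\<close> with an event of the increment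
      \<open>D\<close> form a system closed under intersections. It generates enough to make
      \<open>W b = D + W u\<close> measurable.\<close>
    define \<G> where "\<G> = {A \<inter> C | A C. A \<in> sets (G J) \<and> C \<in> preimages M D}"
    define K where "K = sigma (space M) \<G>"
    have \<G>M: "\<G> \<subseteq> sets M" unfolding \<G>_def using GJF FM preM by auto
    have \<G>P: "\<G> \<subseteq> Pow (space M)" using \<G>M sets.space_closed by blast
    have Ks: "sets K = sigma_sets (space M) \<G>" unfolding K_def by (rule sets_measure_of[OF \<G>P])
    have Ksp: "space K = space M" by (simp add: K_def space_measure_of_conv)
    have spG: "space M \<in> sets (G J)" using sets.top[of "G J"] by simp
    have spD: "space M \<in> preimages M D" unfolding preimages_def by (auto intro!: exI[of _ UNIV])
    have GJK: "sets (G J) \<subseteq> sets K"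
    proof
      fix A assume "A \<in> sets (G J)"
      then have "A \<inter> space M \<in> \<G>" "A \<inter> space M = A"
        using spD sets.sets_into_space[of A "G J"] unfolding \<G>_def by auto
      then show "A \<in> sets K" unfolding Ks by (auto intro: sigma_sets.Basic)
    qed
    have DK: "D \<in> borel_measurable K"
      unfolding borel_measurable_iff_preimages[OF Ksp]
    proof
      fix C assume "C \<in> preimages M D"
      then have "space M \<inter> C \<in> \<G>" "space M \<inter> C = C"
        using spG preimages_Pow[of M D] unfolding \<G>_def by auto
      then show "C \<in> sets K" unfolding Ks by (auto intro: sigma_sets.Basic)
    qed
    have K_mono: "f \<in> borel_measurable K" if "f \<in> borel_measurable (G J)" for f :: "'a \<Rightarrow> real ^ 'd"
      using that by (rule measurable_mono_sets) (simp_all add: GJK Ksp)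
    have "W u \<in> borel_measurable (G J)"
    proof (cases "u \<in> J")
      case False
      then have "u = a" using u_in by simp
      then have "W u \<in> borel_measurable (sigma_noise P a)" using sigma_noise_W[of a a] a by auto
      then show ?thesis by (rule measurable_mono_sets) (simp_all add: Ga)
    qed (rule GW)
    then have "W u \<in> borel_measurable K" by (rule K_mono)
    then have "(\<lambda>\<omega>. D \<omega> + W u \<omega>) \<in> borel_measurable K" using DK by measurable
    then have "W b \<in> borel_measurable K" by (simp add: D_def)
    then have sub: "sets (G (insert b J)) \<subseteq> sets K"
      using GJK Ga[of J] K_mono[OF GW] Ksp by (intro Gl) auto
    show ?case unfolding orth_def
    proof (intro conjI ballI iZ)
      fix A assume "A \<in> sets (G (insert b J))"
      then have A: "A \<in> sigma_sets (space M) \<G>" using sub Ks by auto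
      show "(\<integral>x. indicator A x * Z x \<partial>M) = 0"
      proof (rule orth_sigma_sets[OF _ \<G>M iZ _ _ A])
        show "Int_stable \<G>" unfolding Int_stable_def
        proof (intro ballI)
          fix B B' assume "B \<in> \<G>" "B' \<in> \<G>"
          then obtain A C A' C' where AC: "B = A \<inter> C" "B' = A' \<inter> C'" "A \<in> sets (G J)" "A' \<in> sets (G J)"
            "C \<in> preimages M D" "C' \<in> preimages M D" unfolding \<G>_def by blast
          have "C \<inter> C' \<in> preimages M D"
            using AC(5,6) by (rule preimages_Int)
          then have "(A \<inter> A') \<inter> (C \<inter> C') \<in> \<G>"
            unfolding \<G>_def using sets.Int[OF AC(3,4)] by blast
          moreover have "B \<inter> B' = (A \<inter> A') \<inter> (C \<inter> C')" unfolding AC(1,2) by blast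
          ultimately show "B \<inter> B' \<in> \<G>" by simp
        qed
        have "(\<integral>x. indicator (space M) x * Z x \<partial>M) = 0" using H spG by (auto simp: orth_def)
        moreover have "(\<integral>x. indicator (space M) x * Z x \<partial>M) = (\<integral>x. Z x \<partial>M)"
          by (intro Bochner_Integration.integral_cong) auto
        ultimately show "(\<integral>x. Z x \<partial>M) = 0" by simp
        fix B assume "B \<in> \<G>"
        then obtain A C where AC: "B = A \<inter> C" "A \<in> sets (G J)" "C \<in> preimages M D" unfolding \<G>_def by blast
        have AM: "A \<in> sets M" "A \<in> sets (F u)" "C \<in> sets M" using AC GJF FM preM by auto
        \<comment> \<open>\<open>A\<close> and \<open>Z\<close> belong to \<open>F u\<close> and
          \<open>C\<close> to the increment, so the expectation factors; the first factor is zero by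
          the induction hypothesis.\<close>
        have "(\<integral>x. indicator B x * Z x \<partial>M) = (\<integral>x. (indicator A x * Z x) * indicator C x \<partial>M)"
          by (intro Bochner_Integration.integral_cong) (auto simp: AC(1) indicator_def)
        also have "\<dots> = (\<integral>x. indicator A x * Z x \<partial>M) * (\<integral>x. indicator C x \<partial>M)"
        proof (rule indep_set_expectation[OF F_subalgebra[OF uT] _ _ _ _ _ ind])
          have "Z \<in> borel_measurable (F u)"
            using Z(1) by (rule measurable_mono_sets) (use F_mono[of a u] F_space[OF a] F_space[OF uT] a au uT in auto)
          then show "(\<lambda>x. indicator A x * Z x) \<in> borel_measurable (F u)" using AM(2) by measurable
          show "integrable M (\<lambda>x. indicator A x * Z x)"
            using integrable_mult_indicator[OF AM(1) iZ] by simp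
          show "(\<lambda>x. indicator C x :: real) \<in> borel_measurable M" using AM(3) by measurable
          show "integrable M (\<lambda>x. indicator C x :: real)" using AM(3) by (simp add: emeasure_eq_measure)
          obtain E where E: "E \<in> sets borel" "C = D -` E \<inter> space M" using AC(3) unfolding preimages_def by blast
          show "preimages M (\<lambda>x. indicator C x :: real) \<subseteq> preimages M D"
          proof
            fix R assume "R \<in> preimages M (\<lambda>x. indicator C x :: real)"
            then obtain S where S: "S \<in> sets borel" "R = (\<lambda>x. indicator C x :: real) -` S \<inter> space M"
              unfolding preimages_def by blast
            have "R = D -` ((\<lambda>y. indicator E y :: real) -` S) \<inter> space M"
              unfolding S(2) using E(2) by (auto simp: indicator_def)
            moreover have "(\<lambda>y. indicator E y :: real) -` S \<in> sets borel"
            proof -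
              have "(\<lambda>y. indicator E y :: real) \<in> borel_measurable borel" using E(1) by measurable
              from measurable_sets[OF this S(1)] show ?thesis by simp
            qed
            ultimately show "R \<in> preimages M D" unfolding preimages_def by blast
          qed
        qed
        also have "\<dots> = 0" using H AC(2) by (auto simp: orth_def)
        finally show "(\<integral>x. indicator B x * Z x \<partial>M) = 0" .
      qed
    qed
  qed
  \<comment> \<open>Two finite sets of times lie in their finite union, so this union of
    sigma-algebras is closed under intersections, although it need not be a sigma-algebra
    itself.\<close>
  define \<U> where "\<U> = (\<Union>J\<in>{J. finite J \<and> J \<subseteq> {a<..T}}. sets (G J))"
  have \<U>_M: "\<U> \<subseteq> sets M"
    unfolding \<U>_def
  proof (rule UN_least)
    fix J assume "J \<in> {J. finite J \<and> J \<subseteq> {a<..T}}"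
    then have "sets (G J) \<subseteq> sets (F T)" using a by (intro GF) auto
    then show "sets (G J) \<subseteq> sets M" using F_sets[OF T0(2)] by (rule order_trans)
  qed
  show ?thesis unfolding orth_def
  proof (intro conjI ballI iZ)
    fix A assume A: "A \<in> sets (sigma_noise P T)"
    define K where "K = sigma (space M) \<U>"
    have \<U>P: "\<U> \<subseteq> Pow (space M)" using \<U>_M sets.space_closed by blast
    have Ks: "sets K = sigma_sets (space M) \<U>" unfolding K_def by (rule sets_measure_of[OF \<U>P])
    have Ksp: "space K = space M" by (simp add: K_def space_measure_of_conv)
    have GK: "sets (G J) \<subseteq> sets K" if "finite J" "J \<subseteq> {a<..T}" for J
      unfolding Ks using that by (auto simp: \<U>_def)
    have mK: "f \<in> borel_measurable K" if "f \<in> borel_measurable (G J)" "finite J" "J \<subseteq> {a<..T}" for f :: "'a \<Rightarrow> real ^ 'd" and J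
      using that(1) by (rule measurable_mono_sets) (simp_all add: GK[OF that(2,3)] Ksp)
    have m0: "f \<in> borel_measurable (G {})" if "f \<in> borel_measurable (sigma_noise P a)" for f :: "'a \<Rightarrow> real ^ 'd"
      using that by (rule measurable_mono_sets) (simp_all add: Ga)
    have "sets (sigma_noise P T) \<subseteq> sets K"
    proof (rule sigma_noise_least[OF Ksp])
      show "\<xi> \<in> borel_measurable K" by (rule mK[OF m0[OF sigma_noise_xi]]) auto
      fix s assume s: "0 \<le> s" "s \<le> T"
      show "W s \<in> borel_measurable K"
      proof (cases "s \<le> a")
        case True
        show ?thesis by (rule mK[OF m0[OF sigma_noise_W[OF s(1) True]]]) auto
      next
        case False
        show ?thesis by (rule mK[OF GW[of s "{s}"]]) (use False s in auto)
      qed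
    qed
    then have A': "A \<in> sigma_sets (space M) \<U>" using A Ks by auto
    show "(\<integral>x. indicator A x * Z x \<partial>M) = 0"
    proof (rule orth_sigma_sets[OF _ \<U>_M iZ _ _ A'])
      show "Int_stable \<U>" unfolding Int_stable_def
      proof (intro ballI)
        fix B B' assume "B \<in> \<U>" "B' \<in> \<U>"
        then obtain J J' where J: "finite J" "J \<subseteq> {a<..T}" "finite J'" "J' \<subseteq> {a<..T}" "B \<in> sets (G J)" "B' \<in> sets (G J')"
          unfolding \<U>_def by blast
        have mono: "sets (G I) \<subseteq> sets (G (J \<union> J'))" if "I \<subseteq> J \<union> J'" for I
          using that GW Ga by (intro Gl) auto
        have "B \<in> sets (G (J \<union> J'))" "B' \<in> sets (G (J \<union> J'))" using J mono[of J] mono[of J'] by auto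
        then have "B \<inter> B' \<in> sets (G (J \<union> J'))" by (rule sets.Int)
        then show "B \<inter> B' \<in> \<U>" using J unfolding \<U>_def by (intro UN_I[of "J \<union> J'"]) auto
      qed
      have "space M \<in> sets (sigma_noise P a)" using sets.top[of "sigma_noise P a"] by simp
      then have "(\<integral>x. indicator (space M) x * Z x \<partial>M) = 0" using Z(2) by (auto simp: orth_def)
      moreover have "(\<integral>x. indicator (space M) x * Z x \<partial>M) = (\<integral>x. Z x \<partial>M)"
        by (intro Bochner_Integration.integral_cong) auto
      ultimately show "(\<integral>x. Z x \<partial>M) = 0" by simp
      fix B assume "B \<in> \<U>"
      then show "(\<integral>x. indicator B x * Z x \<partial>M) = 0" using main unfolding \<U>_def orth_def by blast
    qed
  qed
qed

end

section \<open>Wiener integrals\<close>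

lemma preimages_compose:
  assumes "g \<in> borel_measurable borel"
  shows "preimages M (\<lambda>x. g (Y x)) \<subseteq> preimages M Y"
proof
  fix A assume "A \<in> preimages M (\<lambda>x. g (Y x))"
  then obtain C where C: "C \<in> sets borel" "A = (\<lambda>x. g (Y x)) -` C \<inter> space M"
    unfolding preimages_def by blast
  have "g -` C \<in> sets borel" using measurable_sets[OF assms C(1)] by simp
  moreover have "A = Y -` (g -` C) \<inter> space M" using C(2) by auto
  ultimately show "A \<in> preimages M Y" unfolding preimages_def by blast
qed

lemma borel_measurable_vec_nth: "(\<lambda>x :: real ^ 'n. x $ i) \<in> borel_measurable borel"
  by (intro borel_measurable_continuous_onI linear_continuous_on bounded_linear_vec_nth)

lemma power2_norm_diff_inner:
  "(norm (a - b))\<^sup>2 = (a \<bullet> a - a \<bullet> b) - (b \<bullet> a - b \<bullet> (b :: 'b::real_inner))"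
  unfolding power2_norm_eq_inner by (simp add: inner_diff_left inner_diff_right)

lemma integral_inner_add_right:
  assumes "sq_int N f" "sq_int N g" "sq_int N h"
  shows "(\<integral>x. f x \<bullet> (g x + h x) \<partial>N) = (\<integral>x. f x \<bullet> g x \<partial>N) + (\<integral>x. f x \<bullet> h x \<partial>N)"
  unfolding inner_add_right
  by (rule Bochner_Integration.integral_add[OF sq_int_inner[OF assms(1,2)] sq_int_inner[OF assms(1,3)]])

lemma integral_inner_add_left:
  assumes "sq_int N f" "sq_int N g" "sq_int N h"
  shows "(\<integral>x. (g x + h x) \<bullet> f x \<partial>N) = (\<integral>x. g x \<bullet> f x \<partial>N) + (\<integral>x. h x \<bullet> f x \<partial>N)"
  unfolding inner_add_left
  by (rule Bochner_Integration.integral_add[OF sq_int_inner[OF assms(2,1)] sq_int_inner[OF assms(3,1)]])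

context noise_basis
begin

lemma increment_moments:
  assumes "0 \<le> s" "s < t" "t \<le> T"
  shows "sq_int M (\<lambda>\<omega>. W t \<omega> - W s \<omega>)" "(\<integral>\<omega>. (W t \<omega> - W s \<omega>) $ k \<partial>M) = 0"
    "(\<integral>\<omega>. (W t \<omega> - W s \<omega>) $ k * (W t \<omega> - W s \<omega>) $ l \<partial>M) = (if k = l then t - s else 0)"
proof -
  have sg: "sqrt (t - s) > 0" using assms by simp
  note m = gaussian_vector_moments[OF prob_space_M sg W_dist[OF assms]]
  have meas: "(\<lambda>\<omega>. W t \<omega> - W s \<omega>) \<in> borel_measurable M"
    using W_measurable[of s] W_measurable[of t] assms by auto
  show "sq_int M (\<lambda>\<omega>. W t \<omega> - W s \<omega>)"
  proof (rule sq_int_vec)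
    fix i
    show "sq_int M (\<lambda>\<omega>. (W t \<omega> - W s \<omega>) $ i)"
      unfolding sq_int_def
    proof
      show "(\<lambda>\<omega>. (W t \<omega> - W s \<omega>) $ i) \<in> borel_measurable M"
        using borel_measurable_vec_nth[of i] measurable_compose[OF meas] by blast
      show "integrable M (\<lambda>\<omega>. (norm ((W t \<omega> - W s \<omega>) $ i))\<^sup>2)"
        using m(3)[of i i] by (simp add: power2_eq_square)
    qed
  qed
  show "(\<integral>\<omega>. (W t \<omega> - W s \<omega>) $ k \<partial>M) = 0" by (rule m(2))
  show "(\<integral>\<omega>. (W t \<omega> - W s \<omega>) $ k * (W t \<omega> - W s \<omega>) $ l \<partial>M) = (if k = l then t - s else 0)"
    using m(4)[of k l] assms by simp
qed

text \<open>For positive \<open>t\<close> this is the increment from time zero. As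
  \<open>W 0\<close> vanishes only almost surely, it is removed by a change on a null set, and
  \<open>t = 0\<close> is a case of its own.\<close>

lemma W_moments:
  assumes t: "t \<in> {0..T}"
  shows "sq_int M (W t)" "(\<integral>\<omega>. W t \<omega> $ k \<partial>M) = 0"
    "(\<integral>\<omega>. W t \<omega> $ k * W t \<omega> $ l \<partial>M) = (if k = l then t else 0)"
proof -
  have Wm [measurable]: "W t \<in> borel_measurable M" by (rule W_measurable[OF t])
  have Wk [measurable]: "(\<lambda>\<omega>. W t \<omega> $ i) \<in> borel_measurable M" for i
    using measurable_compose[OF Wm borel_measurable_vec_nth[of i]] .
  have "sq_int M (W t) \<and> (\<integral>\<omega>. W t \<omega> $ k \<partial>M) = 0 \<and> (\<integral>\<omega>. W t \<omega> $ k * W t \<omega> $ l \<partial>M) = (if k = l then t else 0)"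
  proof (cases "t = 0")
    case True
    then have ae: "AE \<omega> in M. W t \<omega> = 0" using W_0 by simp
    then have "AE \<omega> in M. 0 = W t \<omega>" by eventually_elim simp
    then have "sq_int M (W t)" by (rule sq_int_cong_AE[OF sq_int_zero Wm])
    moreover have "(\<integral>\<omega>. W t \<omega> $ k \<partial>M) = 0" "(\<integral>\<omega>. W t \<omega> $ k * W t \<omega> $ l \<partial>M) = 0"
      using ae by (auto intro!: integral_eq_zero_AE elim!: eventually_mono)
    ultimately show ?thesis using True by simp
  next
    case False
    then have t': "0 \<le> (0::real)" "0 < t" "t \<le> T" using t by auto
    note m = increment_moments[OF t']
    have ae: "AE \<omega> in M. W t \<omega> - W 0 \<omega> = W t \<omega>" using W_0 by eventually_elim simp
    have meas: "(\<lambda>\<omega>. W t \<omega> - W 0 \<omega>) \<in> borel_measurable M" using m(1) by (rule sq_int_measurable)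
    have mk: "(\<lambda>\<omega>. (W t \<omega> - W 0 \<omega>) $ i) \<in> borel_measurable M" for i
      using measurable_compose[OF meas borel_measurable_vec_nth[of i]] .
    have "sq_int M (W t)" by (rule sq_int_cong_AE[OF m(1) Wm ae])
    moreover have "(\<integral>\<omega>. W t \<omega> $ k \<partial>M) = (\<integral>\<omega>. (W t \<omega> - W 0 \<omega>) $ k \<partial>M)"
      by (rule integral_cong_AE[OF Wk mk]) (use ae in \<open>auto elim!: eventually_mono\<close>)
    moreover have "(\<integral>\<omega>. W t \<omega> $ k * W t \<omega> $ l \<partial>M) = (\<integral>\<omega>. (W t \<omega> - W 0 \<omega>) $ k * (W t \<omega> - W 0 \<omega>) $ l \<partial>M)"
      by (rule integral_cong_AE[OF borel_measurable_times[OF Wk Wk] borel_measurable_times[OF mk mk]])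
        (use ae in \<open>auto elim!: eventually_mono\<close>)
    ultimately show ?thesis using m(2)[of k] m(3)[of k l] by simp
  qed
  then show "sq_int M (W t)" "(\<integral>\<omega>. W t \<omega> $ k \<partial>M) = 0"
    "(\<integral>\<omega>. W t \<omega> $ k * W t \<omega> $ l \<partial>M) = (if k = l then t else 0)" by blast+
qed

text \<open>For \<open>s \<le> t\<close> write \<open>W t = W s + D\<close>: the increment
  \<open>D\<close> is centred and independent of \<open>F s\<close>, so only the second moment of
  \<open>W s\<close> remains. The other order follows by exchanging the factors.\<close>

lemma W_cov:
  assumes s: "s \<in> {0..T}" and t: "t \<in> {0..T}"
  shows "(\<integral>\<omega>. W s \<omega> $ k * W t \<omega> $ l \<partial>M) = (if k = l then min s t else 0)"
proof -
  have le: "(\<integral>\<omega>. W s \<omega> $ k * W t \<omega> $ l \<partial>M) = (if k = l then s else 0)"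
    if s: "s \<in> {0..T}" and t: "t \<in> {0..T}" and st: "s \<le> t" for s t k l
  proof (cases "s = t")
    case True
    then show ?thesis using W_moments(3)[OF s] by simp
  next
    case False
    then have st': "0 \<le> s" "s < t" "t \<le> T" using st s t by auto
    define D where "D \<omega> = W t \<omega> - W s \<omega>" for \<omega>
    have D: "sq_int M D" "(\<integral>\<omega>. D \<omega> $ l \<partial>M) = 0"
      using increment_moments[OF st'] by (auto simp: D_def[abs_def])
    have Wk: "sq_int M (\<lambda>\<omega>. W s \<omega> $ k)" "sq_int M (\<lambda>\<omega>. W s \<omega> $ l)"
      by (intro sq_int_vec_nth W_moments(1)[OF s])+
    have Dl: "sq_int M (\<lambda>\<omega>. D \<omega> $ l)" by (rule sq_int_vec_nth[OF D(1)])
    have "(\<integral>\<omega>. W s \<omega> $ k * D \<omega> $ l \<partial>M) = (\<integral>\<omega>. W s \<omega> $ k \<partial>M) * (\<integral>\<omega>. D \<omega> $ l \<partial>M)"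
    proof (rule indep_set_expectation[OF F_subalgebra[OF s]])
      show "indep_set (sets (F s)) (preimages M D)"
        unfolding D_def[abs_def] by (rule W_indep[OF st'])
      show "(\<lambda>\<omega>. W s \<omega> $ k) \<in> borel_measurable (F s)"
        using measurable_compose[OF W_adapted[OF s] borel_measurable_vec_nth[of k]] .
      show "preimages M (\<lambda>\<omega>. D \<omega> $ l) \<subseteq> preimages M D"
        by (rule preimages_compose) simp
      show "(\<lambda>\<omega>. D \<omega> $ l) \<in> borel_measurable M" using Dl by (rule sq_int_measurable)
    qed (use Wk Dl finite_measure_axioms in \<open>auto intro: sq_int_integrable\<close>)
    then have c0: "(\<integral>\<omega>. W s \<omega> $ k * D \<omega> $ l \<partial>M) = 0" using D(2) by simp
    have "(\<integral>\<omega>. W s \<omega> $ k * W t \<omega> $ l \<partial>M) = (\<integral>\<omega>. W s \<omega> $ k * W s \<omega> $ l + W s \<omega> $ k * D \<omega> $ l \<partial>M)"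
      by (intro Bochner_Integration.integral_cong) (auto simp: D_def algebra_simps)
    also have "\<dots> = (\<integral>\<omega>. W s \<omega> $ k * W s \<omega> $ l \<partial>M) + (\<integral>\<omega>. W s \<omega> $ k * D \<omega> $ l \<partial>M)"
      using sq_int_inner[OF Wk(1) Wk(2)] sq_int_inner[OF Wk(1) Dl] by (intro Bochner_Integration.integral_add) auto
    finally show ?thesis using c0 W_moments(3)[OF s] by simp
  qed
  show ?thesis
  proof (cases "s \<le> t")
    case True
    then show ?thesis using le[OF s t] by simp
  next
    case False
    then have "(\<integral>\<omega>. W t \<omega> $ l * W s \<omega> $ k \<partial>M) = (if l = k then t else 0)" using le[OF t s] by simp
    then show ?thesis using False by (auto simp: mult.commute)
  qed
qed

text \<open>Pairs of a Wiener integral of a step function and its integrand. The family is closed under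
  sums without any bookkeeping of partitions, so the isometry follows by bilinearity.\<close>

inductive wstep :: "('a \<Rightarrow> real ^ 'e::finite) \<Rightarrow> (real \<Rightarrow> real ^ 'd ^ 'e) \<Rightarrow> bool" where
  base: "c \<in> {0..T} \<Longrightarrow> wstep (\<lambda>\<omega>. w *v W c \<omega>) (\<lambda>s. indicator {0<..c} s *\<^sub>R w)"
| add: "wstep S \<phi> \<Longrightarrow> wstep S' \<phi>' \<Longrightarrow> wstep (\<lambda>\<omega>. S \<omega> + S' \<omega>) (\<lambda>s. \<phi> s + \<phi>' s)"

lemma wstep_props:
  assumes "wstep S \<phi>"
  shows "sq_int M S \<and> sq_int (leb T) \<phi> \<and> S \<in> borel_measurable (sigma_noise P T) \<and> (\<integral>\<omega>. S \<omega> \<partial>M) = 0"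
  using assms
proof induction
  case (base c w)
  have Wc: "sq_int M (W c)" by (rule W_moments(1)[OF base])
  have intW: "integrable M (W c)" by (rule sq_int_integrable[OF finite_measure_axioms Wc])
  have "(\<integral>\<omega>. W c \<omega> \<partial>M) = 0"
  proof (rule vec_eq_iff[THEN iffD2, rule_format])
    fix i
    have "(\<integral>\<omega>. W c \<omega> \<partial>M) $ i = (\<integral>\<omega>. W c \<omega> $ i \<partial>M)"
      using integral_bounded_linear[OF bounded_linear_vec_nth intW, of i] by simp
    then show "(\<integral>\<omega>. W c \<omega> \<partial>M) $ i = 0 $ i" using W_moments(2)[OF base] by simp
  qed
  then have "(\<integral>\<omega>. w *v W c \<omega> \<partial>M) = 0"
    using integral_bounded_linear[OF matrix_vector_mul_bounded_linear intW, of w] by simp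
  moreover have "sq_int M (\<lambda>\<omega>. w *v W c \<omega>)"
    by (rule sq_int_bounded_linear[OF Wc matrix_vector_mul_bounded_linear])
  moreover have "sq_int (leb T) (\<lambda>s. indicator {0<..c} s *\<^sub>R w)"
    by (intro sq_int_indicator_scaleR sq_int_const finite_measure_leb)
      (use base in \<open>auto simp: sets_restrict_space_iff\<close>)
  moreover have "(\<lambda>\<omega>. w *v W c \<omega>) \<in> borel_measurable (sigma_noise P T)"
    using sigma_noise_W[of c T] base by (intro borel_measurable_matrix_vector_mult) auto
  ultimately show ?case by blast
next
  case (add S \<phi> S' \<phi>')
  then have i: "integrable M S" "integrable M S'"
    using sq_int_integrable[OF finite_measure_axioms] by auto
  show ?case using add.IH i by (auto intro: sq_int_add)
qed

lemma leb_indicator_inner: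
  assumes "c \<in> {0..T}" "c' \<in> {0..T}"
  shows "(\<integral>s. (indicator {0<..c} s *\<^sub>R w) \<bullet> (indicator {0<..c'} s *\<^sub>R w') \<partial>leb T) = min c c' * (w \<bullet> w')"
proof -
  interpret L: finite_measure "leb T" by (rule finite_measure_leb)
  have S: "{0<..min c c'} \<in> sets (leb T)" "{0<..min c c'} \<inter> {0..T} = {0<..min c c'}"
    using assms by (auto simp: sets_restrict_space_iff)
  have "(\<integral>s. (indicator {0<..c} s *\<^sub>R w) \<bullet> (indicator {0<..c'} s *\<^sub>R w') \<partial>leb T)
      = (\<integral>s. indicator {0<..min c c'} s * (w \<bullet> w') \<partial>leb T)"
    by (intro Bochner_Integration.integral_cong) (auto simp: indicator_def)
  also have "\<dots> = measure (leb T) {0<..min c c'} * (w \<bullet> w')" using S by simp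
  also have "measure (leb T) {0<..min c c'} = measure lborel {0<..min c c'}"
    by (rule measure_restrict_space) (use assms in auto)
  also have "\<dots> = min c c'" using assms by simp
  finally show ?thesis .
qed

text \<open>The covariance of the coordinates is diagonal, so the triple sum collapses to the
  entrywise inner product of the matrices \<open>w\<close> and \<open>w'\<close>.\<close>

lemma wstep_inner_base:
  assumes c: "c \<in> {0..T}" "c' \<in> {0..T}"
  shows "(\<integral>\<omega>. (w *v W c \<omega>) \<bullet> (w' *v W c' \<omega>) \<partial>M) = min c c' * (w \<bullet> (w' :: real ^ 'd ^ 'e::finite))"
proof -
  have i: "integrable M (\<lambda>\<omega>. W c \<omega> $ k * W c' \<omega> $ l)" for k l
    using sq_int_inner[OF sq_int_vec_nth[OF W_moments(1)[OF c(1)]] sq_int_vec_nth[OF W_moments(1)[OF c(2)]], of k l]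
    by simp
  have pt: "(w *v W c \<omega>) \<bullet> (w' *v W c' \<omega>)
      = (\<Sum>e\<in>UNIV. \<Sum>k\<in>UNIV. \<Sum>l\<in>UNIV. (w $ e $ k * w' $ e $ l) * (W c \<omega> $ k * W c' \<omega> $ l))" for \<omega>
    by (simp add: inner_vec_def matrix_vector_mult_def sum_product algebra_simps)
  have "(\<integral>\<omega>. (w *v W c \<omega>) \<bullet> (w' *v W c' \<omega>) \<partial>M)
      = (\<Sum>e\<in>UNIV. \<Sum>k\<in>UNIV. \<Sum>l\<in>UNIV. (w $ e $ k * w' $ e $ l) * (\<integral>\<omega>. W c \<omega> $ k * W c' \<omega> $ l \<partial>M))"
    unfolding pt using i by simp
  also have "\<dots> = (\<Sum>e\<in>UNIV. \<Sum>k\<in>UNIV. \<Sum>l\<in>UNIV. if k = l then min c c' * (w $ e $ k * w' $ e $ k) else 0)"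
    unfolding W_cov[OF c] by (intro sum.cong refl) auto
  also have "\<dots> = (\<Sum>e\<in>UNIV. \<Sum>k\<in>UNIV. min c c' * (w $ e $ k * w' $ e $ k))"
    by simp
  also have "\<dots> = min c c' * (w \<bullet> w')"
    by (simp add: inner_vec_def sum_distrib_left)
  finally show ?thesis .
qed

lemma wstep_inner:
  assumes "wstep S \<phi>" "wstep S' \<phi>'"
  shows "(\<integral>\<omega>. S \<omega> \<bullet> S' \<omega> \<partial>M) = (\<integral>s. \<phi> s \<bullet> \<phi>' s \<partial>leb T)"
  using assms(1)
proof induction
  case (base c w)
  have wb: "wstep (\<lambda>\<omega>. w *v W c \<omega>) (\<lambda>s. indicator {0<..c} s *\<^sub>R w)" by (rule wstep.base[OF base])
  show ?case using assms(2)
  proof induction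
    case (base c' w')
    show ?case
      by (rule trans[OF wstep_inner_base[OF \<open>c \<in> {0..T}\<close> base] leb_indicator_inner[OF \<open>c \<in> {0..T}\<close> base, symmetric]])
  next
    case (add S1 \<phi>1 S2 \<phi>2)
    have p: "sq_int M (\<lambda>\<omega>. w *v W c \<omega>)" "sq_int M S1" "sq_int M S2"
      "sq_int (leb T) (\<lambda>s. indicator {0<..c} s *\<^sub>R w)" "sq_int (leb T) \<phi>1" "sq_int (leb T) \<phi>2"
      using wstep_props[OF wb] wstep_props[OF add.hyps(1)] wstep_props[OF add.hyps(2)] by auto
    show ?case
      unfolding integral_inner_add_right[OF p(1-3)] integral_inner_add_right[OF p(4-6)]
      using add.IH by (simp only:)
  qed
next
  case (add S1 \<phi>1 S2 \<phi>2)
  have p: "sq_int M S'" "sq_int M S1" "sq_int M S2" "sq_int (leb T) \<phi>'" "sq_int (leb T) \<phi>1" "sq_int (leb T) \<phi>2"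
    using wstep_props[OF assms(2)] wstep_props[OF add.hyps(1)] wstep_props[OF add.hyps(2)] by auto
  show ?case
    unfolding integral_inner_add_left[OF p(1-3)] integral_inner_add_left[OF p(4-6)]
    using add.IH by (simp only:)
qed

lemma wstep_isometry:
  assumes "wstep S \<phi>" "wstep S' \<phi>'"
  shows "(\<integral>\<omega>. (norm (S \<omega> - S' \<omega>))\<^sup>2 \<partial>M) = (\<integral>s. (norm (\<phi> s - \<phi>' s))\<^sup>2 \<partial>leb T)"
proof -
  have sq: "sq_int M S" "sq_int M S'" "sq_int (leb T) \<phi>" "sq_int (leb T) \<phi>'"
    using wstep_props[OF assms(1)] wstep_props[OF assms(2)] by auto
  have "(\<integral>\<omega>. (norm (S \<omega> - S' \<omega>))\<^sup>2 \<partial>M)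
      = ((\<integral>\<omega>. S \<omega> \<bullet> S \<omega> \<partial>M) - (\<integral>\<omega>. S \<omega> \<bullet> S' \<omega> \<partial>M)) - ((\<integral>\<omega>. S' \<omega> \<bullet> S \<omega> \<partial>M) - (\<integral>\<omega>. S' \<omega> \<bullet> S' \<omega> \<partial>M))"
    unfolding power2_norm_diff_inner using sq by (simp add: sq_int_inner)
  also have "\<dots> = ((\<integral>s. \<phi> s \<bullet> \<phi> s \<partial>leb T) - (\<integral>s. \<phi> s \<bullet> \<phi>' s \<partial>leb T))
      - ((\<integral>s. \<phi>' s \<bullet> \<phi> s \<partial>leb T) - (\<integral>s. \<phi>' s \<bullet> \<phi>' s \<partial>leb T))"
    by (simp only: wstep_inner[OF assms(1,1)] wstep_inner[OF assms(1,2)] wstep_inner[OF assms(2,1)] wstep_inner[OF assms(2,2)])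
  also have "\<dots> = (\<integral>s. (norm (\<phi> s - \<phi>' s))\<^sup>2 \<partial>leb T)"
    unfolding power2_norm_diff_inner using sq by (simp add: sq_int_inner)
  finally show ?thesis .
qed

lemma wstep_zero: "wstep (\<lambda>\<omega>. 0) (\<lambda>s. 0)"
  using wstep.base[OF T0(1), of 0] by simp

lemma wstep_step_integral:
  assumes t: "t \<in> {0..T}"
  shows "(\<forall>i\<le>n. p i \<in> {0..T}) \<Longrightarrow> (\<forall>i<n. p i \<le> p (Suc i)) \<Longrightarrow>
    wstep (step_integral W n p v t) (\<lambda>s. indicator {0<..t} s *\<^sub>R step_fun n p v s)"
proof (induction n)
  case 0
  have "step_integral W 0 p v t = (\<lambda>\<omega>. 0)" "step_fun 0 p v = (\<lambda>s. 0)"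
    by (simp_all add: fun_eq_iff step_integral_def step_fun_def)
  then show ?case using wstep_zero by simp
next
  case (Suc n)
  have IH: "wstep (step_integral W n p v t) (\<lambda>s. indicator {0<..t} s *\<^sub>R step_fun n p v s)"
    by (rule Suc.IH) (use Suc.prems in auto)
  have p: "p n \<in> {0..T}" "p (Suc n) \<in> {0..T}" "p n \<le> p (Suc n)" using Suc.prems by auto
  have a: "min t (p n) \<in> {0..T}" "min t (p (Suc n)) \<in> {0..T}" using p t by auto
  \<comment> \<open>The integral over the last interval, stopped at \<open>t\<close>, is a
    difference of two integrals started at zero; this is how general steps arise from the base
    case.\<close>
  have "wstep (\<lambda>\<omega>. v n *v W (min t (p (Suc n))) \<omega> + (- v n) *v W (min t (p n)) \<omega>)
    (\<lambda>s. indicator {0<..min t (p (Suc n))} s *\<^sub>R v n + indicator {0<..min t (p n)} s *\<^sub>R (- v n))"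
    by (intro wstep.add wstep.base a)
  from wstep.add[OF IH this]
  have "wstep (\<lambda>\<omega>. step_integral W n p v t \<omega> + (v n *v W (min t (p (Suc n))) \<omega> + (- v n) *v W (min t (p n)) \<omega>))
    (\<lambda>s. indicator {0<..t} s *\<^sub>R step_fun n p v s +
      (indicator {0<..min t (p (Suc n))} s *\<^sub>R v n + indicator {0<..min t (p n)} s *\<^sub>R (- v n)))" .
  moreover have "(\<lambda>\<omega>. step_integral W n p v t \<omega> + (v n *v W (min t (p (Suc n))) \<omega> + (- v n) *v W (min t (p n)) \<omega>))
      = step_integral W (Suc n) p v t"
  proof
    fix \<omega>
    have neg: "(- v n) *v x = - (v n *v x)" for x
      by (simp add: vec_eq_iff matrix_vector_mult_def sum_negf)
    show "step_integral W n p v t \<omega> + (v n *v W (min t (p (Suc n))) \<omega> + (- v n) *v W (min t (p n)) \<omega>)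
      = step_integral W (Suc n) p v t \<omega>"
      unfolding step_integral_def neg by (simp add: matrix_vector_mult_diff_distrib)
  qed
  moreover have "(\<lambda>s. indicator {0<..t} s *\<^sub>R step_fun n p v s +
      (indicator {0<..min t (p (Suc n))} s *\<^sub>R v n + indicator {0<..min t (p n)} s *\<^sub>R (- v n)))
    = (\<lambda>s. indicator {0<..t} s *\<^sub>R step_fun (Suc n) p v s)"
  proof
    fix s
    have "indicator {0<..min t (p (Suc n))} s *\<^sub>R v n + indicator {0<..min t (p n)} s *\<^sub>R (- v n)
      = indicator {0<..t} s *\<^sub>R (if p n < s \<and> s \<le> p (Suc n) then v n else 0)"
      using p by (auto simp: indicator_def)
    then show "indicator {0<..t} s *\<^sub>R step_fun n p v s +
      (indicator {0<..min t (p (Suc n))} s *\<^sub>R v n + indicator {0<..min t (p n)} s *\<^sub>R (- v n))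
     = indicator {0<..t} s *\<^sub>R step_fun (Suc n) p v s"
      by (simp add: step_fun_def scaleR_add_right)
  qed
  ultimately show ?case by simp
qed

text \<open>One step function close to \<open>g\<close> also has its integral close to
  \<open>I\<close> at time \<open>t\<close>, and restricting it to \<open>{0<..t}\<close> does not
  increase the error. This hides the partitions of the definition from the later arguments.
  Square-integrability of \<open>I t\<close> comes out because it differs from \<open>S\<close> by a
  square-integrable variable.\<close>

lemma wiener_approx:
  fixes g :: "real \<Rightarrow> real ^ 'd ^ 'e::finite"
  assumes I: "wiener_integral M T W g I" and g: "sq_int (leb T) g"
    and t: "t \<in> {0..T}" and e: "e > 0"
  obtains S \<phi> where "wstep S \<phi>" "sq_int M (I t)" "(\<integral>\<omega>. (norm (S \<omega> - I t \<omega>))\<^sup>2 \<partial>M) < e"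
    "(\<integral>s. (norm (\<phi> s - indicator {0<..t} s *\<^sub>R g s))\<^sup>2 \<partial>leb T) < e"
proof -
  obtain n p v where part: "\<And>m. (\<forall>i\<le>n m. p m i \<in> {0..T}) \<and> (\<forall>i<n m. p m i \<le> p m (Suc i))"
    and lim1: "(\<lambda>m. \<integral>\<^sup>+s\<in>{0..T}. ennreal ((norm (step_fun (n m) (p m) (v m) s - g s))\<^sup>2) \<partial>lborel) \<longlonglongrightarrow> 0"
    and lim2: "(\<lambda>m. \<integral>\<^sup>+\<omega>. ennreal ((norm (step_integral W (n m) (p m) (v m) t \<omega> - I t \<omega>))\<^sup>2) \<partial>M) \<longlonglongrightarrow> 0"
    and Im: "I t \<in> borel_measurable M"
    using I t unfolding wiener_integral_def by blast
  have "\<forall>\<^sub>F m in sequentially. (\<integral>\<^sup>+s\<in>{0..T}. ennreal ((norm (step_fun (n m) (p m) (v m) s - g s))\<^sup>2) \<partial>lborel) < ennreal e"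
    by (rule order_tendstoD(2)[OF lim1]) (use e in simp)
  moreover have "\<forall>\<^sub>F m in sequentially. (\<integral>\<^sup>+\<omega>. ennreal ((norm (step_integral W (n m) (p m) (v m) t \<omega> - I t \<omega>))\<^sup>2) \<partial>M) < ennreal e"
    by (rule order_tendstoD(2)[OF lim2]) (use e in simp)
  ultimately have "\<forall>\<^sub>F m in sequentially.
      (\<integral>\<^sup>+s\<in>{0..T}. ennreal ((norm (step_fun (n m) (p m) (v m) s - g s))\<^sup>2) \<partial>lborel) < ennreal e \<and>
      (\<integral>\<^sup>+\<omega>. ennreal ((norm (step_integral W (n m) (p m) (v m) t \<omega> - I t \<omega>))\<^sup>2) \<partial>M) < ennreal e"
    by (rule eventually_conj)
  then obtain m where m1: "(\<integral>\<^sup>+s\<in>{0..T}. ennreal ((norm (step_fun (n m) (p m) (v m) s - g s))\<^sup>2) \<partial>lborel) < ennreal e"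
    and m2: "(\<integral>\<^sup>+\<omega>. ennreal ((norm (step_integral W (n m) (p m) (v m) t \<omega> - I t \<omega>))\<^sup>2) \<partial>M) < ennreal e"
    using eventually_happens'[OF sequentially_bot] by blast
  define S where "S = step_integral W (n m) (p m) (v m) t"
  define f where "f = step_fun (n m) (p m) (v m)"
  define \<phi> where "\<phi> s = indicator {0<..t} s *\<^sub>R f s" for s
  have w: "wstep S \<phi>"
    unfolding S_def \<phi>_def[abs_def] f_def using part[of m] by (intro wstep_step_integral[OF t]) auto
  have wT: "wstep (step_integral W (n m) (p m) (v m) T) (\<lambda>s. indicator {0<..T} s *\<^sub>R f s)"
    unfolding f_def using part[of m] by (intro wstep_step_integral[OF T0(2)]) auto
  \<comment> \<open>The intervals of a step function are left-open and lie in \<open>{0..T}\<close>,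
    so zero belongs to none of them and the restriction to \<open>{0<..T}\<close> loses
    nothing.\<close>
  have f0: "f 0 = 0"
  proof -
    have "\<not> (p m i < 0)" if "i < n m" for i using part[of m] that by (auto simp: not_less)
    then show ?thesis unfolding f_def step_fun_def by (intro sum.neutral) auto
  qed
  have f_eq: "indicator {0<..T} s *\<^sub>R f s = f s" if "s \<in> {0..T}" for s
    using that f0 by (cases "s = 0") (auto simp: indicator_def)
  have sf: "sq_int (leb T) f"
  proof -
    have "sq_int (leb T) (\<lambda>s. indicator {0<..T} s *\<^sub>R f s)" using wstep_props[OF wT] by blast
    moreover have "f \<in> borel_measurable (leb T) \<longleftrightarrow> (\<lambda>s. indicator {0<..T} s *\<^sub>R f s) \<in> borel_measurable (leb T)"
      by (rule measurable_cong) (simp add: f_eq)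
    moreover have "integrable (leb T) (\<lambda>s. (norm (f s))\<^sup>2) \<longleftrightarrow> integrable (leb T) (\<lambda>s. (norm (indicator {0<..T} s *\<^sub>R f s))\<^sup>2)"
      by (rule Bochner_Integration.integrable_cong) (simp_all add: f_eq)
    ultimately show ?thesis unfolding sq_int_def by blast
  qed
  have "ennreal (\<integral>s. (norm (f s - g s))\<^sup>2 \<partial>leb T) = (\<integral>\<^sup>+s. ennreal ((norm (f s - g s))\<^sup>2) \<partial>leb T)"
    by (rule nn_integral_eq_integral[OF sq_int_norm[OF sq_int_diff[OF sf g]], symmetric]) simp
  also have "\<dots> = (\<integral>\<^sup>+s\<in>{0..T}. ennreal ((norm (f s - g s))\<^sup>2) \<partial>lborel)"
    by (rule nn_integral_restrict_space) simp
  also have "\<dots> < ennreal e" using m1 by (simp add: f_def)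
  finally have fe: "(\<integral>s. (norm (f s - g s))\<^sup>2 \<partial>leb T) < e" using e by (simp add: ennreal_less_iff)
  have s1: "sq_int (leb T) (\<lambda>s. f s - g s)" by (rule sq_int_diff[OF sf g])
  have "(\<integral>s. (norm (\<phi> s - indicator {0<..t} s *\<^sub>R g s))\<^sup>2 \<partial>leb T) \<le> (\<integral>s. (norm (f s - g s))\<^sup>2 \<partial>leb T)"
  proof (rule integral_mono')
    show "integrable (leb T) (\<lambda>s. (norm (f s - g s))\<^sup>2)" by (rule sq_int_norm[OF s1])
    show "(norm (\<phi> s - indicator {0<..t} s *\<^sub>R g s))\<^sup>2 \<le> (norm (f s - g s))\<^sup>2" for s
      by (auto simp: \<phi>_def indicator_def)
  qed simp
  with fe have c2: "(\<integral>s. (norm (\<phi> s - indicator {0<..t} s *\<^sub>R g s))\<^sup>2 \<partial>leb T) < e" by simp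
  have SM: "sq_int M S" using wstep_props[OF w] by blast
  have Sm: "S \<in> borel_measurable M" by (rule sq_int_measurable[OF SM])
  have int: "integrable M (\<lambda>\<omega>. (norm (S \<omega> - I t \<omega>))\<^sup>2)"
  proof (rule integrableI_nonneg)
    show "(\<lambda>\<omega>. (norm (S \<omega> - I t \<omega>))\<^sup>2) \<in> borel_measurable M" using Sm Im by measurable
    show "(\<integral>\<^sup>+\<omega>. ennreal ((norm (S \<omega> - I t \<omega>))\<^sup>2) \<partial>M) < \<infinity>"
      using m2 unfolding S_def by (rule order_less_trans) simp
  qed simp
  have dSI: "sq_int M (\<lambda>\<omega>. S \<omega> - I t \<omega>)"
    unfolding sq_int_def using int Sm Im by simp
  have sI: "sq_int M (I t)" using sq_int_diff[OF SM dSI] by simp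
  have "ennreal (\<integral>\<omega>. (norm (S \<omega> - I t \<omega>))\<^sup>2 \<partial>M) = (\<integral>\<^sup>+\<omega>. ennreal ((norm (S \<omega> - I t \<omega>))\<^sup>2) \<partial>M)"
    by (rule nn_integral_eq_integral[symmetric]) (auto intro: int)
  also have "\<dots> < ennreal e" using m2 by (simp add: S_def)
  finally have "(\<integral>\<omega>. (norm (S \<omega> - I t \<omega>))\<^sup>2 \<partial>M) < e" using e by (simp add: ennreal_less_iff)
  from that[OF w sI this c2] show thesis .
qed

lemma norm_power2_diff_chain:
  "(norm (a - d))\<^sup>2 \<le> 2 * (norm (a - b))\<^sup>2 + 4 * (norm (b - c))\<^sup>2 + 4 * (norm (c - (d :: 'b::real_normed_vector)))\<^sup>2"
  using norm_add_power2[of "a - b" "b - d"] norm_add_power2[of "b - c" "c - d"] by simp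

lemma wiener_sq_int:
  assumes "wiener_integral M T W g I" "sq_int (leb T) g" "t \<in> {0..T}"
  shows "sq_int M (I t)"
  using wiener_approx[OF assms zero_less_one] by blast

text \<open>The Wiener integral is given as a relation, and each control may come with its own
  integral process. The step functions approximating the two processes are close to the same
  integrand, and the isometry makes their integrals close to each other.\<close>

lemma wiener_unique:
  fixes g :: "real \<Rightarrow> real ^ 'd ^ 'e::finite"
  assumes I: "wiener_integral M T W g I" and I': "wiener_integral M T W g I'"
    and g: "sq_int (leb T) g" and t: "t \<in> {0..T}"
  shows "AE \<omega> in M. I t \<omega> = I' t \<omega>"
proof -
  have sI: "sq_int M (I t)" "sq_int M (I' t)" using wiener_sq_int I I' g t by blast+
  have gt: "sq_int (leb T) (\<lambda>s. indicator {0<..t} s *\<^sub>R g s)"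
    by (rule sq_int_indicator_scaleR[OF g]) (use t in \<open>auto simp: sets_restrict_space_iff\<close>)
  have i: "integrable M (\<lambda>\<omega>. (norm (I t \<omega> - I' t \<omega>))\<^sup>2)" by (rule sq_int_norm[OF sq_int_diff[OF sI]])
  have "(\<integral>\<omega>. (norm (I t \<omega> - I' t \<omega>))\<^sup>2 \<partial>M) \<le> 0 + e" if e: "e > 0" for e
  proof -
    \<comment> \<open>The squared distance of the two step integrands is at most
      \<open>e / 10\<close> and enters with weight 4; the two approximation errors enter with
      weights 2 and 4.\<close>
    have e': "e / 40 > 0" using e by simp
    obtain S \<phi> where S1: "wstep S \<phi>" and "sq_int M (I t)" and S2: "(\<integral>\<omega>. (norm (S \<omega> - I t \<omega>))\<^sup>2 \<partial>M) < e / 40"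
      and S3: "(\<integral>s. (norm (\<phi> s - indicator {0<..t} s *\<^sub>R g s))\<^sup>2 \<partial>leb T) < e / 40"
      by (rule wiener_approx[OF I g t e'])
    obtain S' \<phi>' where S'1: "wstep S' \<phi>'" and "sq_int M (I' t)" and S'2: "(\<integral>\<omega>. (norm (S' \<omega> - I' t \<omega>))\<^sup>2 \<partial>M) < e / 40"
      and S'3: "(\<integral>s. (norm (\<phi>' s - indicator {0<..t} s *\<^sub>R g s))\<^sup>2 \<partial>leb T) < e / 40"
      by (rule wiener_approx[OF I' g t e'])
    have sq: "sq_int M S" "sq_int M S'" "sq_int (leb T) \<phi>" "sq_int (leb T) \<phi>'"
      using wstep_props[OF S1] wstep_props[OF S'1] by auto
    have a: "integrable M (\<lambda>\<omega>. (norm (S \<omega> - I t \<omega>))\<^sup>2)" "integrable M (\<lambda>\<omega>. (norm (S \<omega> - S' \<omega>))\<^sup>2)"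
      "integrable M (\<lambda>\<omega>. (norm (S' \<omega> - I' t \<omega>))\<^sup>2)"
      by (intro sq_int_norm sq_int_diff sI sq)+
    have b: "integrable (leb T) (\<lambda>s. (norm (\<phi> s - indicator {0<..t} s *\<^sub>R g s))\<^sup>2)"
      "integrable (leb T) (\<lambda>s. (norm (\<phi>' s - indicator {0<..t} s *\<^sub>R g s))\<^sup>2)"
      "integrable (leb T) (\<lambda>s. (norm (\<phi> s - \<phi>' s))\<^sup>2)"
      by (intro sq_int_norm sq_int_diff gt sq)+
    have "(\<integral>s. (norm (\<phi> s - \<phi>' s))\<^sup>2 \<partial>leb T) \<le> (\<integral>s. 2 * (norm (\<phi> s - indicator {0<..t} s *\<^sub>R g s))\<^sup>2
        + 2 * (norm (\<phi>' s - indicator {0<..t} s *\<^sub>R g s))\<^sup>2 \<partial>leb T)"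
    proof (rule integral_mono)
      fix s
      show "(norm (\<phi> s - \<phi>' s))\<^sup>2 \<le> 2 * (norm (\<phi> s - indicator {0<..t} s *\<^sub>R g s))\<^sup>2
        + 2 * (norm (\<phi>' s - indicator {0<..t} s *\<^sub>R g s))\<^sup>2"
        using norm_add_power2[of "\<phi> s - indicator {0<..t} s *\<^sub>R g s" "indicator {0<..t} s *\<^sub>R g s - \<phi>' s"]
        by (simp add: norm_minus_commute)
    qed (use b in auto)
    also have "\<dots> = 2 * (\<integral>s. (norm (\<phi> s - indicator {0<..t} s *\<^sub>R g s))\<^sup>2 \<partial>leb T)
        + 2 * (\<integral>s. (norm (\<phi>' s - indicator {0<..t} s *\<^sub>R g s))\<^sup>2 \<partial>leb T)"
      using b by simp
    finally have \<phi>\<phi>: "(\<integral>s. (norm (\<phi> s - \<phi>' s))\<^sup>2 \<partial>leb T) \<le> e / 10" using S3 S'3 by simp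
    have "(\<integral>\<omega>. (norm (I t \<omega> - I' t \<omega>))\<^sup>2 \<partial>M)
        \<le> (\<integral>\<omega>. 2 * (norm (S \<omega> - I t \<omega>))\<^sup>2 + 4 * (norm (S \<omega> - S' \<omega>))\<^sup>2 + 4 * (norm (S' \<omega> - I' t \<omega>))\<^sup>2 \<partial>M)"
    proof (rule integral_mono[OF i])
      fix \<omega>
      show "(norm (I t \<omega> - I' t \<omega>))\<^sup>2 \<le> 2 * (norm (S \<omega> - I t \<omega>))\<^sup>2 + 4 * (norm (S \<omega> - S' \<omega>))\<^sup>2 + 4 * (norm (S' \<omega> - I' t \<omega>))\<^sup>2"
        using norm_power2_diff_chain[of "I t \<omega>" "I' t \<omega>" "S \<omega>" "S' \<omega>"] by (simp add: norm_minus_commute)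
    qed (use a in auto)
    also have "\<dots> = 2 * (\<integral>\<omega>. (norm (S \<omega> - I t \<omega>))\<^sup>2 \<partial>M) + 4 * (\<integral>\<omega>. (norm (S \<omega> - S' \<omega>))\<^sup>2 \<partial>M)
        + 4 * (\<integral>\<omega>. (norm (S' \<omega> - I' t \<omega>))\<^sup>2 \<partial>M)"
      using a by simp
    also have "\<dots> \<le> e" using S2 S'2 \<phi>\<phi> e unfolding wstep_isometry[OF S1 S'1] by simp
    finally show ?thesis by simp
  qed
  then have "(\<integral>\<omega>. (norm (I t \<omega> - I' t \<omega>))\<^sup>2 \<partial>M) \<le> 0" by (rule field_le_epsilon)
  then have "(\<integral>\<omega>. (norm (I t \<omega> - I' t \<omega>))\<^sup>2 \<partial>M) = 0" by (simp add: order_antisym)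
  then have "AE \<omega> in M. (norm (I t \<omega> - I' t \<omega>))\<^sup>2 = 0"
    using integral_nonneg_eq_0_iff_AE[OF i] by simp
  then show ?thesis by eventually_elim simp
qed

text \<open>A bound uniform in \<open>t\<close> is enough, so a single approximation with error 1
  replaces the exact isometry: \<open>2 * 1 + 2 * (2 * 1 + 2 * c)\<close> with \<open>c\<close> the
  squared norm of \<open>g\<close>.\<close>

lemma wiener_sq_bound:
  fixes g :: "real \<Rightarrow> real ^ 'd ^ 'e::finite"
  assumes I: "wiener_integral M T W g I" and g: "sq_int (leb T) g" and t: "t \<in> {0..T}"
  shows "(\<integral>\<omega>. (norm (I t \<omega>))\<^sup>2 \<partial>M) \<le> 6 + 4 * (\<integral>s. (norm (g s))\<^sup>2 \<partial>leb T)"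
proof -
  obtain S \<phi> where S1: "wstep S \<phi>" and "sq_int M (I t)" and S2: "(\<integral>\<omega>. (norm (S \<omega> - I t \<omega>))\<^sup>2 \<partial>M) < 1"
      and S3: "(\<integral>s. (norm (\<phi> s - indicator {0<..t} s *\<^sub>R g s))\<^sup>2 \<partial>leb T) < 1"
      by (rule wiener_approx[OF I g t zero_less_one])
  have sI: "sq_int M (I t)" by (rule wiener_sq_int[OF I g t])
  have sq: "sq_int M S" "sq_int (leb T) \<phi>" using wstep_props[OF S1] by auto
  have gt: "sq_int (leb T) (\<lambda>s. indicator {0<..t} s *\<^sub>R g s)"
    by (rule sq_int_indicator_scaleR[OF g]) (use t in \<open>auto simp: sets_restrict_space_iff\<close>)
  have a: "integrable M (\<lambda>\<omega>. (norm (S \<omega> - I t \<omega>))\<^sup>2)" "integrable M (\<lambda>\<omega>. (norm (S \<omega>))\<^sup>2)"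
    by (intro sq_int_norm sq_int_diff sI sq)+
  have b: "integrable (leb T) (\<lambda>s. (norm (\<phi> s - indicator {0<..t} s *\<^sub>R g s))\<^sup>2)"
    "integrable (leb T) (\<lambda>s. (norm (g s))\<^sup>2)"
    by (intro sq_int_norm sq_int_diff gt sq g)+
  have "(\<integral>\<omega>. (norm (I t \<omega>))\<^sup>2 \<partial>M) \<le> (\<integral>\<omega>. 2 * (norm (S \<omega> - I t \<omega>))\<^sup>2 + 2 * (norm (S \<omega>))\<^sup>2 \<partial>M)"
  proof (rule integral_mono[OF sq_int_norm[OF sI]])
    fix \<omega>
    show "(norm (I t \<omega>))\<^sup>2 \<le> 2 * (norm (S \<omega> - I t \<omega>))\<^sup>2 + 2 * (norm (S \<omega>))\<^sup>2"
      using norm_add_power2[of "I t \<omega> - S \<omega>" "S \<omega>"] by (simp add: norm_minus_commute)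
  qed (use a in auto)
  also have "\<dots> = 2 * (\<integral>\<omega>. (norm (S \<omega> - I t \<omega>))\<^sup>2 \<partial>M) + 2 * (\<integral>\<omega>. (norm (S \<omega>))\<^sup>2 \<partial>M)"
    using a by simp
  also have "(\<integral>\<omega>. (norm (S \<omega>))\<^sup>2 \<partial>M) = (\<integral>s. (norm (\<phi> s))\<^sup>2 \<partial>leb T)"
    using wstep_isometry[OF S1 wstep_zero] by simp
  also have "(\<integral>s. (norm (\<phi> s))\<^sup>2 \<partial>leb T)
      \<le> (\<integral>s. 2 * (norm (\<phi> s - indicator {0<..t} s *\<^sub>R g s))\<^sup>2 + 2 * (norm (g s))\<^sup>2 \<partial>leb T)"
  proof (rule integral_mono[OF sq_int_norm[OF sq(2)]])
    fix s
    have "(norm (indicator {0<..t} s *\<^sub>R g s))\<^sup>2 \<le> (norm (g s))\<^sup>2" by (auto simp: indicator_def)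
    moreover have "(norm (\<phi> s))\<^sup>2 \<le> 2 * (norm (\<phi> s - indicator {0<..t} s *\<^sub>R g s))\<^sup>2
        + 2 * (norm (indicator {0<..t} s *\<^sub>R g s))\<^sup>2"
      using norm_add_power2[of "\<phi> s - indicator {0<..t} s *\<^sub>R g s" "indicator {0<..t} s *\<^sub>R g s"]
      by (simp only: diff_add_cancel)
    ultimately show "(norm (\<phi> s))\<^sup>2 \<le> 2 * (norm (\<phi> s - indicator {0<..t} s *\<^sub>R g s))\<^sup>2 + 2 * (norm (g s))\<^sup>2"
      by linarith
  qed (use b in auto)
  also have "\<dots> = 2 * (\<integral>s. (norm (\<phi> s - indicator {0<..t} s *\<^sub>R g s))\<^sup>2 \<partial>leb T) + 2 * (\<integral>s. (norm (g s))\<^sup>2 \<partial>leb T)"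
    using b by simp
  finally show ?thesis using S2 S3 by simp
qed

text \<open>Orthogonality to all step integrals survives the limit by Cauchy-Schwarz. The two uses
  are \<open>Z = 1\<close>, for the mean, and \<open>Z\<close> orthogonal to the noise.\<close>

lemma wiener_orth:
  fixes g :: "real \<Rightarrow> real ^ 'd ^ 'e::finite"
  assumes I: "wiener_integral M T W g I" and g: "sq_int (leb T) g" and t: "t \<in> {0..T}"
    and Z: "sq_int M Z" "\<And>S \<phi>. wstep (S :: 'a \<Rightarrow> real ^ 'e) \<phi> \<Longrightarrow> (\<integral>\<omega>. Z \<omega> *\<^sub>R S \<omega> \<partial>M) = 0"
  shows "(\<integral>\<omega>. Z \<omega> *\<^sub>R I t \<omega> \<partial>M) = 0"
proof -
  let ?z = "\<integral>\<omega>. (Z \<omega>)\<^sup>2 \<partial>M" and ?V = "\<integral>\<omega>. Z \<omega> *\<^sub>R I t \<omega> \<partial>M"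
  have sI: "sq_int M (I t)" by (rule wiener_sq_int[OF I g t])
  have "(norm ?V)\<^sup>2 \<le> 0 + e" if e: "e > 0" for e
  proof -
    have z0: "?z \<ge> 0" by simp
    \<comment> \<open>Chosen so that \<open>?z * d \<le> e\<close>; adding one keeps the denominator
      positive when \<open>?z = 0\<close>.\<close>
    define d where "d = e / (?z + 1)"
    have z1: "?z + 1 > 0" using z0 by linarith
    have "e * ?z \<le> e * (?z + 1)" using e by (intro mult_left_mono) auto
    then have "e * ?z / (?z + 1) \<le> e" using z1 by (simp only: pos_divide_le_eq)
    then have d: "d > 0" "?z * d \<le> e" using divide_pos_pos[OF e z1] by (simp_all add: d_def mult.commute)
    obtain S \<phi> where S1: "wstep S \<phi>" and "sq_int M (I t)" and S2: "(\<integral>\<omega>. (norm (S \<omega> - I t \<omega>))\<^sup>2 \<partial>M) < d"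
      and S3: "(\<integral>s. (norm (\<phi> s - indicator {0<..t} s *\<^sub>R g s))\<^sup>2 \<partial>leb T) < d"
      by (rule wiener_approx[OF I g t d(1)])
    have sS: "sq_int M S" using wstep_props[OF S1] by blast
    have "(\<integral>\<omega>. Z \<omega> *\<^sub>R (S \<omega> - I t \<omega>) \<partial>M) = - ?V"
      unfolding scaleR_diff_right using sq_int_scaleR_fun[OF Z(1) sS] sq_int_scaleR_fun[OF Z(1) sI] Z(2)[OF S1]
      by simp
    then have "(norm ?V)\<^sup>2 \<le> ?z * (\<integral>\<omega>. (norm (S \<omega> - I t \<omega>))\<^sup>2 \<partial>M)"
      using Cauchy_Schwarz_scaleR[OF Z(1) sq_int_diff[OF sS sI]] by simp
    also have "\<dots> \<le> ?z * d" using S2 z0 by (intro mult_left_mono) auto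
    finally show ?thesis using d(2) by simp
  qed
  then have "(norm ?V)\<^sup>2 \<le> 0" by (rule field_le_epsilon)
  then show ?thesis by simp
qed

lemma wiener_orth_noise:
  assumes "wiener_integral M T W g I" "sq_int (leb T) g" "t \<in> {0..T}"
    and "sq_int M Z" "orth M (sigma_noise P T) Z"
  shows "(\<integral>\<omega>. Z \<omega> *\<^sub>R I t \<omega> \<partial>M) = 0"
  by (rule wiener_orth[OF assms(1-4)])
    (use orth_integral[OF prob_space_M sigma_noise_subalgebra[OF T0(2)] assms(5,4)] wstep_props in blast)

lemma wiener_mean:
  assumes "wiener_integral M T W g I" "sq_int (leb T) g" "t \<in> {0..T}"
  shows "(\<integral>\<omega>. I t \<omega> \<partial>M) = 0"
proof -
  have "(\<integral>\<omega>. 1 *\<^sub>R I t \<omega> \<partial>M) = 0"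
    by (rule wiener_orth[OF assms sq_int_const[OF finite_measure_axioms]]) (auto dest: wstep_props)
  then show ?thesis by simp
qed

end

section \<open>Processes on the product space\<close>

declare sets_leb [measurable_cong del]

lemma Icc_T_sets_leb [simp]: "{0..T} \<in> sets (leb T)"
  by (metis sets.top space_leb)

text \<open>Solutions of the state equation are later chosen path by path; completeness makes them
  measurable as soon as they agree almost surely with something measurable.\<close>

lemma (in complete_measure) borel_measurable_AE_eq:
  fixes f g :: "'a \<Rightarrow> 'b::topological_space"
  assumes f: "f \<in> borel_measurable M" and ae: "AE x in M. f x = g x"
  shows "g \<in> borel_measurable M"
proof (rule measurableI)
  fix A :: "'b set" assume A: "A \<in> sets borel"
  have "AE x in M. x \<in> f -` A \<inter> space M \<longleftrightarrow> x \<in> g -` A \<inter> space M"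
    using ae by eventually_elim auto
  then show "g -` A \<inter> space M \<in> sets M" by (rule in_sets_AE) (auto intro: measurable_sets[OF f A])
qed simp

lemma borel_measurable_norm_power2:
  fixes f :: "'x \<Rightarrow> 'b::euclidean_space"
  assumes "f \<in> borel_measurable K"
  shows "(\<lambda>z. (norm (f z))\<^sup>2) \<in> borel_measurable K"
  using assms by measurable

lemma measurable_pair_mono_sets:
  assumes "f \<in> borel_measurable (G \<Otimes>\<^sub>M K)" "space G = space H" "sets G \<subseteq> sets H"
  shows "f \<in> borel_measurable (H \<Otimes>\<^sub>M K)"
proof -
  have "(\<lambda>z. (fst z, snd z)) \<in> measurable (H \<Otimes>\<^sub>M K) (G \<Otimes>\<^sub>M K)"
  proof (rule measurable_Pair)
    have "(\<lambda>x. x) \<in> measurable H G" using assms(2,3) by (auto simp: measurable_def)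
    then show "(\<lambda>z. fst z) \<in> measurable (H \<Otimes>\<^sub>M K) G"
      using measurable_compose[OF measurable_fst] by blast
  qed simp
  from measurable_compose[OF this assms(1)] show ?thesis by simp
qed

context noise_basis
begin

sublocale L: finite_measure "leb T" by (rule finite_measure_leb)

sublocale pr: pair_sigma_finite M "leb T" ..

abbreviation "L \<equiv> leb T"
abbreviation "N \<equiv> M \<Otimes>\<^sub>M leb T"

lemma finite_measure_N: "finite_measure N"
proof (rule finite_measureI)
  have "emeasure N (space N) = emeasure M (space M) * emeasure L (space L)"
    unfolding space_pair_measure by (rule L.emeasure_pair_measure_Times) auto
  also have "\<dots> \<noteq> \<infinity>"
    using L.emeasure_finite[of "space L"] emeasure_finite[of "space M"] by (simp add: ennreal_mult_eq_top_iff)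
  finally show "emeasure N (space N) \<noteq> \<infinity>" .
qed

lemma AE_N_time:
  assumes "AE t in L. Q t"
  shows "AE z in N. Q (snd z)"
proof -
  obtain B where B: "{t \<in> space L. \<not> Q t} \<subseteq> B" "emeasure L B = 0" "B \<in> sets L"
    using AE_E[OF assms] by blast
  have "emeasure N (space M \<times> B) = emeasure M (space M) * emeasure L B"
    by (rule L.emeasure_pair_measure_Times) (use B in auto)
  then have "space M \<times> B \<in> null_sets N" using B by auto
  then show ?thesis by (rule AE_I') (use B(1) in \<open>auto simp: space_pair_measure\<close>)
qed

lemma AE_N_omega:
  assumes "AE \<omega> in M. Q \<omega>"
  shows "AE z in N. Q (fst z)"
proof -
  obtain B where B: "{\<omega> \<in> space M. \<not> Q \<omega>} \<subseteq> B" "emeasure M B = 0" "B \<in> sets M"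
    using AE_E[OF assms] by blast
  have "emeasure N (B \<times> space L) = emeasure M B * emeasure L (space L)"
    by (rule L.emeasure_pair_measure_Times) (use B in auto)
  then have "B \<times> space L \<in> null_sets N" using B by auto
  then show ?thesis by (rule AE_I') (use B(1) in \<open>auto simp: space_pair_measure\<close>)
qed

lemma l2_path_measurable: "f \<in> borel_measurable N \<Longrightarrow> \<omega> \<in> space M \<Longrightarrow> (\<lambda>t. f (\<omega>, t)) \<in> borel_measurable L"
  by (rule measurable_Pair2)

lemma l2_time_measurable: "f \<in> borel_measurable N \<Longrightarrow> t \<in> {0..T} \<Longrightarrow> (\<lambda>\<omega>. f (\<omega>, t)) \<in> borel_measurable M"
  by (rule measurable_Pair1[where ?M2.0 = L]) auto

lemma l2_AE_path:
  assumes "sq_int N f"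
  shows "AE \<omega> in M. sq_int L (\<lambda>t. f (\<omega>, t))"
  using pr.AE_integrable_fst'[OF sq_int_norm[OF assms]]
proof (rule AE_mp, intro AE_I2 impI)
  fix \<omega> assume \<omega>: "\<omega> \<in> space M" "integrable L (\<lambda>t. (norm (f (\<omega>, t)))\<^sup>2)"
  show "sq_int L (\<lambda>t. f (\<omega>, t))"
    unfolding sq_int_def using l2_path_measurable[OF sq_int_measurable[OF assms] \<omega>(1)] \<omega>(2) by blast
qed

lemma l2_AE_time:
  assumes "sq_int N f"
  shows "AE t in L. sq_int M (\<lambda>\<omega>. f (\<omega>, t))"
proof -
  have "integrable N (case_prod (\<lambda>\<omega> t. (norm (f (\<omega>, t)))\<^sup>2))"
    using sq_int_norm[OF assms] by (simp add: case_prod_unfold)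
  from pr.AE_integrable_snd[OF this] show ?thesis
  proof (rule AE_mp, intro AE_I2 impI)
    fix t assume t: "t \<in> space L" "integrable M (\<lambda>\<omega>. (norm (f (\<omega>, t)))\<^sup>2)"
    show "sq_int M (\<lambda>\<omega>. f (\<omega>, t))"
      unfolding sq_int_def using l2_time_measurable[OF sq_int_measurable[OF assms], of t] t by auto
  qed
qed

lemma sq_int_path_integral:
  fixes f :: "'a \<times> real \<Rightarrow> 'b::euclidean_space"
  assumes f: "sq_int N f"
  shows "sq_int M (\<lambda>\<omega>. \<integral>t. f (\<omega>, t) \<partial>L)"
  unfolding sq_int_def
proof
  have fm: "case_prod (\<lambda>\<omega> t. f (\<omega>, t)) \<in> borel_measurable N"
    using sq_int_measurable[OF f] by simp
  show m: "(\<lambda>\<omega>. \<integral>t. f (\<omega>, t) \<partial>L) \<in> borel_measurable M"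
    by (rule L.borel_measurable_lebesgue_integral[OF fm])
  show "integrable M (\<lambda>\<omega>. (norm (\<integral>t. f (\<omega>, t) \<partial>L))\<^sup>2)"
  proof (rule Bochner_Integration.integrable_bound)
    show "integrable M (\<lambda>\<omega>. T * (\<integral>t. (norm (f (\<omega>, t)))\<^sup>2 \<partial>L))"
      using pr.integrable_fst'[OF sq_int_norm[OF f]] by simp
    show "(\<lambda>\<omega>. (norm (\<integral>t. f (\<omega>, t) \<partial>L))\<^sup>2) \<in> borel_measurable M" using m by measurable
    show "AE \<omega> in M. norm ((norm (\<integral>t. f (\<omega>, t) \<partial>L))\<^sup>2) \<le> norm (T * (\<integral>t. (norm (f (\<omega>, t)))\<^sup>2 \<partial>L))"
      using l2_AE_path[OF f]
    proof eventually_elim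
      case (elim \<omega>)
      have "measure L (space L) = T" using measure_leb[of T] T_pos by simp
      then show ?case
        using norm_integral_power2_le[OF finite_measure_leb elim] T_pos by (simp add: abs_of_nonneg)
    qed
  qed
qed

text \<open>Functions of this form are the data of the deterministic equations that arise when the
  state equation is tested against \<open>Z\<close>. Cauchy-Schwarz at almost every time bounds them
  by the second moments of \<open>f\<close>, which are integrable in time by Fubini.\<close>

lemma sq_int_time_integral:
  fixes f :: "'a \<times> real \<Rightarrow> 'b::euclidean_space"
  assumes f: "sq_int N f" and Z: "sq_int M Z"
  shows "sq_int L (\<lambda>t. \<integral>\<omega>. Z \<omega> *\<^sub>R f (\<omega>, t) \<partial>M)"
  unfolding sq_int_def
proof
  have fm: "f \<in> borel_measurable N" by (rule sq_int_measurable[OF f])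
  have "(\<lambda>(t, \<omega>). f (\<omega>, t)) \<in> borel_measurable (L \<Otimes>\<^sub>M M)"
    using measurable_compose[OF measurable_pair_swap' fm] by (simp add: case_prod_unfold)
  then have [measurable]: "(\<lambda>z. f (snd z, fst z)) \<in> borel_measurable (L \<Otimes>\<^sub>M M)"
    by (simp add: case_prod_unfold)
  have [measurable]: "Z \<in> borel_measurable M" by (rule sq_int_measurable[OF Z])
  have "case_prod (\<lambda>t \<omega>. Z \<omega> *\<^sub>R f (\<omega>, t)) \<in> borel_measurable (L \<Otimes>\<^sub>M M)"
    unfolding case_prod_unfold by measurable
  then show m: "(\<lambda>t. \<integral>\<omega>. Z \<omega> *\<^sub>R f (\<omega>, t) \<partial>M) \<in> borel_measurable L"
    by (rule borel_measurable_lebesgue_integral)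
  show "integrable L (\<lambda>t. (norm (\<integral>\<omega>. Z \<omega> *\<^sub>R f (\<omega>, t) \<partial>M))\<^sup>2)"
  proof (rule Bochner_Integration.integrable_bound)
    have "integrable N (case_prod (\<lambda>\<omega> t. (norm (f (\<omega>, t)))\<^sup>2))"
      using sq_int_norm[OF f] by (simp add: case_prod_unfold)
    from pr.integrable_snd[OF this]
    show "integrable L (\<lambda>t. (\<integral>\<omega>. (Z \<omega>)\<^sup>2 \<partial>M) * (\<integral>\<omega>. (norm (f (\<omega>, t)))\<^sup>2 \<partial>M))" by simp
    show "(\<lambda>t. (norm (\<integral>\<omega>. Z \<omega> *\<^sub>R f (\<omega>, t) \<partial>M))\<^sup>2) \<in> borel_measurable L" using m by measurable
    show "AE t in L. norm ((norm (\<integral>\<omega>. Z \<omega> *\<^sub>R f (\<omega>, t) \<partial>M))\<^sup>2)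
        \<le> norm ((\<integral>\<omega>. (Z \<omega>)\<^sup>2 \<partial>M) * (\<integral>\<omega>. (norm (f (\<omega>, t)))\<^sup>2 \<partial>M))"
      using l2_AE_time[OF f]
    proof eventually_elim
      case (elim t)
      have "0 \<le> (\<integral>\<omega>. (Z \<omega>)\<^sup>2 \<partial>M) * (\<integral>\<omega>. (norm (f (\<omega>, t)))\<^sup>2 \<partial>M)"
        by (intro mult_nonneg_nonneg integral_nonneg_AE) auto
      then show ?case using Cauchy_Schwarz_scaleR[OF Z elim] by simp
    qed
  qed
qed

lemma sq_int_N_I:
  assumes f: "f \<in> borel_measurable N"
    and i: "\<And>t. t \<in> {0..T} \<Longrightarrow> integrable M (\<lambda>\<omega>. (norm (f (\<omega>, t)))\<^sup>2)"
    and C: "\<And>t. t \<in> {0..T} \<Longrightarrow> (\<integral>\<omega>. (norm (f (\<omega>, t)))\<^sup>2 \<partial>M) \<le> C"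
  shows "sq_int N f"
  unfolding sq_int_def
proof
  show "integrable N (\<lambda>z. (norm (f z))\<^sup>2)"
  proof (rule integrableI_nonneg)
    have "(\<integral>\<^sup>+z. ennreal ((norm (f z))\<^sup>2) \<partial>N) = (\<integral>\<^sup>+t. (\<integral>\<^sup>+\<omega>. ennreal ((norm (f (\<omega>, t)))\<^sup>2) \<partial>M) \<partial>L)"
      by (intro pr.nn_integral_snd[symmetric] measurable_compose[OF borel_measurable_norm_power2[OF f] measurable_ennreal])
    also have "\<dots> \<le> (\<integral>\<^sup>+t. ennreal C \<partial>L)"
    proof (rule nn_integral_mono)
      fix t assume "t \<in> space L"
      then have t: "t \<in> {0..T}" by simp
      have "(\<integral>\<^sup>+\<omega>. ennreal ((norm (f (\<omega>, t)))\<^sup>2) \<partial>M) = ennreal (\<integral>\<omega>. (norm (f (\<omega>, t)))\<^sup>2 \<partial>M)"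
        by (rule nn_integral_eq_integral[OF i[OF t]]) simp
      also have "\<dots> \<le> ennreal C" using C[OF t] by (rule ennreal_leI)
      finally show "(\<integral>\<^sup>+\<omega>. ennreal ((norm (f (\<omega>, t)))\<^sup>2) \<partial>M) \<le> ennreal C" .
    qed
    also have "\<dots> < \<infinity>"
    proof -
      have "emeasure L (space L) < \<top>" using L.emeasure_finite[of "space L"] by (simp only: less_top[symmetric] infinity_ennreal_def) simp
      then show ?thesis by (simp add: ennreal_mult_less_top)
    qed
    finally show "(\<integral>\<^sup>+z. ennreal ((norm (f z))\<^sup>2) \<partial>N) < \<infinity>" .
  qed (simp_all add: borel_measurable_norm_power2[OF f])
qed fact

lemma sq_int_N_omega: "sq_int M Z \<Longrightarrow> sq_int N (\<lambda>z. Z (fst z))"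
  by (rule sq_int_N_I[where C = "\<integral>\<omega>. (norm (Z \<omega>))\<^sup>2 \<partial>M"])
    (auto intro: sq_int_norm measurable_compose[OF measurable_fst sq_int_measurable])

lemma sq_int_N_time:
  assumes u: "sq_int L u"
  shows "sq_int N (\<lambda>z. u (snd z))"
  unfolding sq_int_def
proof
  show m: "(\<lambda>z. u (snd z)) \<in> borel_measurable N"
    by (rule measurable_compose[OF measurable_snd sq_int_measurable[OF u]])
  show "integrable N (\<lambda>z. (norm (u (snd z)))\<^sup>2)"
  proof (rule integrableI_nonneg)
    have "(\<integral>\<^sup>+z. ennreal ((norm (u (snd z)))\<^sup>2) \<partial>N) = (\<integral>\<^sup>+\<omega>. (\<integral>\<^sup>+t. ennreal ((norm (u t))\<^sup>2) \<partial>L) \<partial>M)"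
      by (subst L.nn_integral_fst[OF measurable_compose[OF borel_measurable_norm_power2[OF m] measurable_ennreal], symmetric]) simp
    also have "\<dots> = ennreal (\<integral>t. (norm (u t))\<^sup>2 \<partial>L)"
      using nn_integral_eq_integral[OF sq_int_norm[OF u]] by (simp add: emeasure_space_1)
    also have "\<dots> < \<infinity>" by simp
    finally show "(\<integral>\<^sup>+z. ennreal ((norm (u (snd z)))\<^sup>2) \<partial>N) < \<infinity>" .
  qed (simp_all add: borel_measurable_norm_power2[OF m])
qed

lemma integrable_N_bounded_time:
  fixes A :: "real \<Rightarrow> real ^ 'n ^ 'm"
  assumes "A \<in> borel_measurable L" "AE t in L. norm (A t) \<le> C"
  shows "(\<lambda>z. A (snd z)) \<in> borel_measurable N" "AE z in N. norm (A (snd z)) \<le> C"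
  using measurable_compose[OF measurable_snd assms(1)] AE_N_time[OF assms(2)] by auto

lemma sq_int_N_matrix:
  fixes A :: "real \<Rightarrow> real ^ 'n ^ 'm"
  assumes f: "sq_int N f" and A: "A \<in> borel_measurable L" "AE t in L. norm (A t) \<le> C"
  shows "sq_int N (\<lambda>z. A (snd z) *v f z)"
  by (rule sq_int_matrix[OF f integrable_N_bounded_time[OF A]])

lemma Icc_sets_L: "t \<in> {0..T} \<Longrightarrow> {0..t} \<in> sets L"
  by (auto simp: sets_restrict_space_iff)

lemma sq_int_N_indicator_time:
  assumes f: "sq_int N f" and S: "S \<in> sets L"
  shows "sq_int N (\<lambda>z. indicator S (snd z) *\<^sub>R f z)"
  by (rule sq_int_scale_bounded[OF f, where C = 1])
    (use measurable_compose[OF measurable_snd, of "indicator S" L "borel :: real measure" M] S in \<open>auto simp: indicator_def\<close>)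

text \<open>The coefficient \<open>A\<close> is deterministic, so testing against \<open>Z\<close>
  commutes with multiplication by \<open>A s\<close>, and Fubini exchanges it with the time
  integral. Thus a tested linear equation is again a linear equation with the same
  coefficients.\<close>

lemma drift_Fubini:
  fixes A :: "real \<Rightarrow> real ^ 'n::finite ^ 'm::finite"
  assumes f: "sq_int N f" and A: "A \<in> borel_measurable L" "AE t in L. norm (A t) \<le> C"
    and Z: "sq_int M Z" and S: "S \<in> sets L"
  shows "(\<integral>\<omega>. Z \<omega> *\<^sub>R (\<integral>s. indicator S s *\<^sub>R (A s *v f (\<omega>, s)) \<partial>L) \<partial>M)
    = (\<integral>s. indicator S s *\<^sub>R (A s *v (\<integral>\<omega>. Z \<omega> *\<^sub>R f (\<omega>, s) \<partial>M)) \<partial>L)"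
proof -
  define g where "g z = indicator S (snd z) *\<^sub>R (A (snd z) *v f z)" for z
  have g: "sq_int N g" unfolding g_def by (rule sq_int_N_indicator_time[OF sq_int_N_matrix[OF f A] S])
  have Zg: "integrable N (\<lambda>z. Z (fst z) *\<^sub>R g z)" by (rule sq_int_scaleR_fun[OF sq_int_N_omega[OF Z] g])
  have c: "integrable N (case_prod (\<lambda>\<omega> s. Z \<omega> *\<^sub>R g (\<omega>, s)))" using Zg by (simp add: case_prod_unfold)
  have "(\<integral>\<omega>. Z \<omega> *\<^sub>R (\<integral>s. g (\<omega>, s) \<partial>L) \<partial>M) = (\<integral>\<omega>. (\<integral>s. Z \<omega> *\<^sub>R g (\<omega>, s) \<partial>L) \<partial>M)"
    by simp
  also have "\<dots> = (\<integral>s. (\<integral>\<omega>. Z \<omega> *\<^sub>R g (\<omega>, s) \<partial>M) \<partial>L)"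
    by (rule pr.Fubini_integral[OF c, symmetric])
  also have "\<dots> = (\<integral>s. indicator S s *\<^sub>R (A s *v (\<integral>\<omega>. Z \<omega> *\<^sub>R f (\<omega>, s) \<partial>M)) \<partial>L)"
  proof (rule integral_cong_AE)
    show "(\<lambda>s. \<integral>\<omega>. Z \<omega> *\<^sub>R g (\<omega>, s) \<partial>M) \<in> borel_measurable L"
      by (rule sq_int_measurable[OF sq_int_time_integral[OF g Z]])
    have "(\<lambda>s. A s *v (\<integral>\<omega>. Z \<omega> *\<^sub>R f (\<omega>, s) \<partial>M)) \<in> borel_measurable L"
      by (rule borel_measurable_matrix_vector_mult[OF A(1) sq_int_measurable[OF sq_int_time_integral[OF f Z]]])
    then show "(\<lambda>s. indicator S s *\<^sub>R (A s *v (\<integral>\<omega>. Z \<omega> *\<^sub>R f (\<omega>, s) \<partial>M))) \<in> borel_measurable L"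
      using S by measurable
    show "AE s in L. (\<integral>\<omega>. Z \<omega> *\<^sub>R g (\<omega>, s) \<partial>M) = indicator S s *\<^sub>R (A s *v (\<integral>\<omega>. Z \<omega> *\<^sub>R f (\<omega>, s) \<partial>M))"
      using l2_AE_time[OF f]
    proof eventually_elim
      case (elim s)
      have i: "integrable M (\<lambda>\<omega>. Z \<omega> *\<^sub>R f (\<omega>, s))" by (rule sq_int_scaleR_fun[OF Z elim])
      have "(\<integral>\<omega>. Z \<omega> *\<^sub>R g (\<omega>, s) \<partial>M) = (\<integral>\<omega>. indicator S s *\<^sub>R (A s *v (Z \<omega> *\<^sub>R f (\<omega>, s))) \<partial>M)"
        by (intro Bochner_Integration.integral_cong) (simp_all add: g_def matrix_vector_mult_scaleR)
      also have "\<dots> = indicator S s *\<^sub>R (\<integral>\<omega>. A s *v (Z \<omega> *\<^sub>R f (\<omega>, s)) \<partial>M)"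
        by simp
      also have "(\<integral>\<omega>. A s *v (Z \<omega> *\<^sub>R f (\<omega>, s)) \<partial>M) = A s *v (\<integral>\<omega>. Z \<omega> *\<^sub>R f (\<omega>, s) \<partial>M)"
        by (rule integral_bounded_linear[OF matrix_vector_mul_bounded_linear i])
      finally show ?case .
    qed
  qed
  finally show ?thesis by (simp add: g_def)
qed

text \<open>Discontinuous paths are replaced by zero. With every path continuous, joint
  measurability is available; the exceptional set is null, and completeness keeps each time slice
  measurable.\<close>

lemma continuous_modification:
  fixes Y :: "real \<Rightarrow> 'a \<Rightarrow> 'b::euclidean_space"
  assumes c: "AE \<omega> in M. continuous_on {0..T} (\<lambda>t. Y t \<omega>)"
    and m: "\<And>t. t \<in> {0..T} \<Longrightarrow> Y t \<in> borel_measurable M"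
  obtains y where "\<And>\<omega>. continuous_on {0..T} (y \<omega>)" "\<And>t. t \<in> {0..T} \<Longrightarrow> (\<lambda>\<omega>. y \<omega> t) \<in> borel_measurable M"
    "(\<lambda>z. y (fst z) (snd z)) \<in> borel_measurable N" "AE \<omega> in M. \<forall>t\<in>{0..T}. Y t \<omega> = y \<omega> t"
proof
  define y where "y \<omega> = (if continuous_on {0..T} (\<lambda>t. Y t \<omega>) then (\<lambda>t. Y t \<omega>) else (\<lambda>t. 0))" for \<omega>
  show cy: "continuous_on {0..T} (y \<omega>)" for \<omega> by (simp add: y_def)
  show ae: "AE \<omega> in M. \<forall>t\<in>{0..T}. Y t \<omega> = y \<omega> t"
    using c by eventually_elim (simp add: y_def)
  show my: "(\<lambda>\<omega>. y \<omega> t) \<in> borel_measurable M" if t: "t \<in> {0..T}" for t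
    by (rule complete_measure.borel_measurable_AE_eq[OF complete_M m[OF t]])
      (use ae t in \<open>auto elim!: eventually_mono\<close>)
  show "(\<lambda>z. y (fst z) (snd z)) \<in> borel_measurable N"
    using measurable_continuous_paths[OF T_pos, of M y] cy my by (simp add: case_prod_unfold)
qed

end

section \<open>Controls and the state equation\<close>

lemma Linfty_leb:
  assumes "Linfty T f"
  obtains C where "C \<ge> 0" "f \<in> borel_measurable (leb T)" "AE t in leb T. norm (f t) \<le> C"
proof -
  obtain C where C: "f \<in> borel_measurable (leb T)" "AE t in leb T. norm (f t) \<le> C"
    using assms unfolding Linfty_def by blast
  from C(2) have "AE t in leb T. norm (f t) \<le> max C 0" by eventually_elim simp
  with C(1) that[of "max C 0"] show thesis by simp
qed

section \<open>Square-integrable progressive controls\<close>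

context noise_basis
begin

text \<open>Common ground of \<open>F\<close> and \<open>F1\<close>, so that facts on controls are
  shown for both at once.\<close>

definition filtration :: "(real \<Rightarrow> 'a measure) \<Rightarrow> bool" where
  "filtration G \<longleftrightarrow> (\<forall>t\<in>{0..T}. subalgebra M (G t)) \<and> (\<forall>s\<in>{0..T}. \<forall>t\<in>{s..T}. sets (G s) \<subseteq> sets (G t))"

lemma filtration_F: "filtration F" and filtration_F1: "filtration F1"
  using F_subalgebra F_mono F1_subalgebra F1_mono by (auto simp: filtration_def)

text \<open>Progressive measurability is stated with time as the first coordinate, whereas the
  product space \<open>N\<close> has the sample point first; swapping the coordinates adapts one to
  the other.\<close>

lemma progressive_at:
  fixes \<alpha> :: "real \<Rightarrow> 'a \<Rightarrow> real ^ 'k::finite"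
  assumes "progressive T G \<alpha>" "t \<in> {0..T}"
  shows "(\<lambda>z. \<alpha> (snd z) (fst z)) \<in> borel_measurable (G t \<Otimes>\<^sub>M leb t)"
proof -
  have "(\<lambda>(s, \<omega>). \<alpha> s \<omega>) \<in> borel_measurable (restrict_space borel {0..t} \<Otimes>\<^sub>M G t)"
    using assms by (auto simp: progressive_def)
  then have "(\<lambda>(s, \<omega>). \<alpha> s \<omega>) \<in> borel_measurable (leb t \<Otimes>\<^sub>M G t)"
    by (subst measurable_cong_sets[OF sets_pair_measure_cong[OF sets_leb refl] refl])
  from measurable_compose[OF measurable_pair_swap' this]
  show ?thesis by (simp add: case_prod_unfold)
qed

lemma H2_iff:
  fixes \<alpha> :: "real \<Rightarrow> 'a \<Rightarrow> real ^ 'k::finite"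
  assumes G: "filtration G"
  shows "\<alpha> \<in> H2 M T G \<longleftrightarrow> progressive T G \<alpha> \<and> sq_int N (\<lambda>z. \<alpha> (snd z) (fst z))"
proof (cases "progressive T G \<alpha>")
  case True
  have sub: "subalgebra M (G T)" using G T0 by (auto simp: filtration_def)
  have m: "(\<lambda>z. \<alpha> (snd z) (fst z)) \<in> borel_measurable N"
    by (rule measurable_pair_mono_sets[OF progressive_at[OF True T0(2)]]) (use sub in \<open>auto simp: subalgebra_def\<close>)
  note m2 = borel_measurable_norm_power2[OF m]
  have "(\<integral>\<^sup>+\<omega>. (\<integral>\<^sup>+t\<in>{0..T}. ennreal ((norm (\<alpha> t \<omega>))\<^sup>2) \<partial>lborel) \<partial>M)
      = (\<integral>\<^sup>+\<omega>. (\<integral>\<^sup>+t. ennreal ((norm (\<alpha> t \<omega>))\<^sup>2) \<partial>leb T) \<partial>M)"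
    by (subst nn_integral_restrict_space) simp_all
  also have "\<dots> = (\<integral>\<^sup>+z. ennreal ((norm (\<alpha> (snd z) (fst z)))\<^sup>2) \<partial>N)"
    by (subst L.nn_integral_fst[OF measurable_compose[OF m2 measurable_ennreal], symmetric]) simp
  finally show ?thesis
    using True m m2 by (simp add: H2_def sq_int_def integrable_iff_bounded)
qed (simp add: H2_def)

lemma progressive_lin:
  fixes \<alpha> \<beta> :: "real \<Rightarrow> 'a \<Rightarrow> real ^ 'k::finite"
  assumes "progressive T G \<alpha>" "progressive T G \<beta>"
  shows "progressive T G (\<lambda>t \<omega>. \<alpha> t \<omega> + c *\<^sub>R \<beta> t \<omega>)"
  unfolding progressive_def
proof
  fix t assume "t \<in> {0..T}"
  then have "(\<lambda>z. \<alpha> (fst z) (snd z)) \<in> borel_measurable (restrict_space borel {0..t} \<Otimes>\<^sub>M G t)"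
    "(\<lambda>z. \<beta> (fst z) (snd z)) \<in> borel_measurable (restrict_space borel {0..t} \<Otimes>\<^sub>M G t)"
    using assms by (simp_all add: progressive_def case_prod_unfold)
  from borel_measurable_add[OF this(1) borel_measurable_scaleR[OF borel_measurable_const[of c] this(2)]]
  show "(\<lambda>(s, \<omega>). \<alpha> s \<omega> + c *\<^sub>R \<beta> s \<omega>) \<in> borel_measurable (restrict_space borel {0..t} \<Otimes>\<^sub>M G t)"
    by (simp add: case_prod_unfold)
qed

lemma H2_lin:
  assumes G: "filtration G" and "\<alpha> \<in> H2 M T G" "\<beta> \<in> H2 M T G"
  shows "(\<lambda>t \<omega>. \<alpha> t \<omega> + c *\<^sub>R \<beta> t \<omega>) \<in> H2 M T G"
  using assms(2,3) unfolding H2_iff[OF G] by (auto intro!: progressive_lin sq_int_add sq_int_scaleR)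

lemma H2_deterministic:
  assumes G: "filtration G" and u: "sq_int (leb T) u"
  shows "(\<lambda>t \<omega>. u t) \<in> H2 M T G"
  unfolding H2_iff[OF G]
proof
  show "sq_int N (\<lambda>z. u (snd z))" by (rule sq_int_N_time[OF u])
  show "progressive T G (\<lambda>t \<omega>. u t)" unfolding progressive_def
  proof
    fix t assume t: "t \<in> {0..T}"
    have um: "u \<in> borel_measurable (restrict_space borel {0..T})"
      using sq_int_measurable[OF u] by (subst measurable_cong_sets[OF sets_leb[symmetric] refl])
    have "u \<in> borel_measurable (restrict_space (restrict_space borel {0..T}) {0..t})"
      by (rule measurable_restrict_space1[OF um])
    moreover have "restrict_space (restrict_space borel {0..T}) {0..t} = restrict_space borel {0..t}"
      using t by (subst restrict_restrict_space) (auto simp: Int_absorb2 Int_absorb1)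
    ultimately have "u \<in> borel_measurable (restrict_space borel {0..t})" by simp
    from measurable_compose[OF measurable_fst this]
    show "(\<lambda>(s, \<omega>). u s) \<in> borel_measurable (restrict_space borel {0..t} \<Otimes>\<^sub>M G t)"
      by (simp add: case_prod_unfold)
  qed
qed

lemma H2_F1_F: "H2 M T F1 \<subseteq> (H2 M T F :: (real \<Rightarrow> 'a \<Rightarrow> real ^ 'k::finite) set)"
proof
  fix \<alpha> :: "real \<Rightarrow> 'a \<Rightarrow> real ^ 'k" assume \<alpha>: "\<alpha> \<in> H2 M T F1"
  have "progressive T F \<alpha>" unfolding progressive_def
  proof
    fix t assume t: "t \<in> {0..T}"
    have "(\<lambda>(s, \<omega>). \<alpha> s \<omega>) \<in> borel_measurable (restrict_space borel {0..t} \<Otimes>\<^sub>M F1 t)"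
      using \<alpha> t unfolding H2_iff[OF filtration_F1] progressive_def by blast
    from measurable_compose[OF measurable_pair_swap' this]
    have "(\<lambda>z. \<alpha> (snd z) (fst z)) \<in> borel_measurable (F1 t \<Otimes>\<^sub>M restrict_space borel {0..t})"
      by (simp add: case_prod_unfold)
    then have "(\<lambda>z. \<alpha> (snd z) (fst z)) \<in> borel_measurable (F t \<Otimes>\<^sub>M restrict_space borel {0..t})"
      by (rule measurable_pair_mono_sets) (use F1_F[OF t] F_space[OF t] in auto)
    from measurable_compose[OF measurable_pair_swap' this]
    show "(\<lambda>(s, \<omega>). \<alpha> s \<omega>) \<in> borel_measurable (restrict_space borel {0..t} \<Otimes>\<^sub>M F t)"
      by (simp add: case_prod_unfold)
  qed
  then show "\<alpha> \<in> H2 M T F" using \<alpha> unfolding H2_iff[OF filtration_F] H2_iff[OF filtration_F1] by blast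
qed

end

section \<open>The linear state equation\<close>

locale lq_setting = noise_basis P "lq_T D"
  for P :: "('a, 'd::finite) stoch_basis" and D :: "('d, 'k::finite) lq_data" +
  fixes X :: "(real \<Rightarrow> 'a \<Rightarrow> real ^ 'k) \<Rightarrow> real \<Rightarrow> 'a \<Rightarrow> real ^ 'd"
  assumes coefficients: "lq_coefficients D" and state: "state_map D P X"
begin

abbreviation "T \<equiv> lq_T D"
abbreviation "A \<equiv> lq_A D"
abbreviation "B \<equiv> lq_B D"

lemma A_bound: obtains C where "C \<ge> 0" "A \<in> borel_measurable L" "AE t in L. norm (A t) \<le> C"
  by (rule Linfty_leb[of T A]) (use coefficients in \<open>auto simp: lq_coefficients_def\<close>)

lemma B_bound: obtains C where "C \<ge> 0" "B \<in> borel_measurable L" "AE t in L. norm (B t) \<le> C"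
  by (rule Linfty_leb[of T B]) (use coefficients in \<open>auto simp: lq_coefficients_def\<close>)

lemma sigma_sq_int: "sq_int L (lq_sigma D)"
proof -
  obtain C where C: "C \<ge> 0" "lq_sigma D \<in> borel_measurable L" "AE t in L. norm (lq_sigma D t) \<le> C"
    by (rule Linfty_leb[of T "lq_sigma D"]) (use coefficients in \<open>auto simp: lq_coefficients_def\<close>)
  show ?thesis
    by (rule sq_int_bound[OF sq_int_const[OF finite_measure_leb, where c = C] C(2), where C = 1]) (use C in auto)
qed

definition drift :: "(real \<Rightarrow> real ^ 'd) \<Rightarrow> (real \<Rightarrow> real ^ 'k) \<Rightarrow> real \<Rightarrow> real ^ 'd" where
  "drift x u t = (\<integral>s. indicator {0..t} s *\<^sub>R (A s *v x s + B s *v u s) \<partial>L)"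

lemma sq_int_continuous:
  fixes x :: "real \<Rightarrow> 'b::euclidean_space"
  assumes "continuous_on {0..T} x"
  shows "sq_int L x"
proof -
  have "continuous_on {0..T} (\<lambda>t. (norm (x t))\<^sup>2)" using assms by (intro continuous_intros)
  then show ?thesis
    using integral_leb_continuous(2)[OF _ T0(1)] assms unfolding sq_int_def by (metis borel_measurable_integrable)
qed

lemma A_sq_int: "sq_int L x \<Longrightarrow> sq_int L (\<lambda>s. A s *v x s)"
  by (rule A_bound) (rule sq_int_matrix)

lemma B_sq_int: "sq_int L u \<Longrightarrow> sq_int L (\<lambda>s. B s *v u s)"
  by (rule B_bound) (rule sq_int_matrix)

lemma drift_integrable: "sq_int L x \<Longrightarrow> sq_int L u \<Longrightarrow> integrable L (\<lambda>s. A s *v x s + B s *v u s)"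
  by (intro sq_int_integrable[OF finite_measure_leb] sq_int_add A_sq_int B_sq_int)

lemma drift_continuous: "sq_int L x \<Longrightarrow> sq_int L u \<Longrightarrow> continuous_on {0..T} (drift x u)"
  unfolding drift_def[abs_def] by (intro continuous_on_integral_leb drift_integrable)

lemma drift_lin:
  assumes "sq_int L x" "sq_int L u" "sq_int L x'" "sq_int L u'" "t \<in> {0..T}"
  shows "drift (\<lambda>s. x s + c *\<^sub>R x' s) (\<lambda>s. u s + c *\<^sub>R u' s) t = drift x u t + c *\<^sub>R drift x' u' t"
proof -
  note S = Icc_sets_L[OF assms(5)]
  have i: "integrable L (\<lambda>s. indicator {0..t} s *\<^sub>R (A s *v x s + B s *v u s))"
    "integrable L (\<lambda>s. indicator {0..t} s *\<^sub>R (A s *v x' s + B s *v u' s))"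
    by (intro integrable_mult_indicator S drift_integrable assms)+
  have "drift (\<lambda>s. x s + c *\<^sub>R x' s) (\<lambda>s. u s + c *\<^sub>R u' s) t
      = (\<integral>s. indicator {0..t} s *\<^sub>R (A s *v x s + B s *v u s)
          + c *\<^sub>R (indicator {0..t} s *\<^sub>R (A s *v x' s + B s *v u' s)) \<partial>L)"
    unfolding drift_def
    by (intro Bochner_Integration.integral_cong refl)
      (simp add: matrix_vector_right_distrib matrix_vector_mult_scaleR scaleR_add_right mult.commute)
  also have "\<dots> = drift x u t + c *\<^sub>R drift x' u' t"
    unfolding drift_def using i by (simp del: scaleR_scaleR)
  finally show ?thesis .
qed

text \<open>The constants are uniform in path and control, and the control part is bounded by its
  integral over all of \<open>{0..T}\<close>. That integral does not depend on \<open>t\<close>, so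
  it enters Gronwall's inequality as a constant.\<close>

lemma drift_bound:
  obtains KA KB where "KA \<ge> 0" "KB \<ge> 0"
    "\<And>x u t. continuous_on {0..T} x \<Longrightarrow> sq_int L u \<Longrightarrow> t \<in> {0..T} \<Longrightarrow>
      norm (drift x u t) \<le> KA * integral {0..t} (\<lambda>s. norm (x s)) + KB * (\<integral>s. norm (u s) \<partial>L)"
proof -
  obtain CA where CA: "CA \<ge> 0" "A \<in> borel_measurable L" "AE t in L. norm (A t) \<le> CA" by (rule A_bound)
  obtain CB where CB: "CB \<ge> 0" "B \<in> borel_measurable L" "AE t in L. norm (B t) \<le> CB" by (rule B_bound)
  obtain K1 where K1: "K1 > 0" "\<And>(A :: real ^ 'd ^ 'd) x. norm (A *v x) \<le> norm A * norm x * K1"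
    using matrix_vector_norm_bound by metis
  obtain K2 where K2: "K2 > 0" "\<And>(A :: real ^ 'k ^ 'd) x. norm (A *v x) \<le> norm A * norm x * K2"
    using matrix_vector_norm_bound by metis
  show thesis
  proof (rule that[of "CA * K1" "CB * K2"])
    show "0 \<le> CA * K1" "0 \<le> CB * K2" using CA CB K1 K2 by auto
    fix x :: "real \<Rightarrow> real ^ 'd" and u :: "real \<Rightarrow> real ^ 'k" and t
    assume x: "continuous_on {0..T} x" and u: "sq_int L u" and t: "t \<in> {0..T}"
    note S = Icc_sets_L[OF t]
    have sx: "sq_int L x" by (rule sq_int_continuous[OF x])
    have cn: "continuous_on {0..T} (\<lambda>s. norm (x s))" using x by (intro continuous_intros)
    have ix: "integrable L (\<lambda>s. indicator {0..t} s *\<^sub>R norm (x s))"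
      by (intro integrable_mult_indicator S integrable_norm sq_int_integrable[OF finite_measure_leb sx])
    have iu: "integrable L (\<lambda>s. norm (u s))"
      by (intro integrable_norm sq_int_integrable[OF finite_measure_leb u])
    have i: "integrable L (\<lambda>s. indicator {0..t} s *\<^sub>R (A s *v x s + B s *v u s))"
      by (intro integrable_mult_indicator S drift_integrable sx u)
    have "norm (drift x u t) \<le> (\<integral>s. norm (indicator {0..t} s *\<^sub>R (A s *v x s + B s *v u s)) \<partial>L)"
      unfolding drift_def by (rule integral_norm_bound)
    also have "\<dots> \<le> (\<integral>s. (CA * K1) * (indicator {0..t} s *\<^sub>R norm (x s)) + (CB * K2) * norm (u s) \<partial>L)"
    proof (rule integral_mono_AE)
      show "integrable L (\<lambda>s. norm (indicator {0..t} s *\<^sub>R (A s *v x s + B s *v u s)))"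
        using i by (rule integrable_norm)
      show "integrable L (\<lambda>s. (CA * K1) * (indicator {0..t} s *\<^sub>R norm (x s)) + (CB * K2) * norm (u s))"
        using ix iu by simp
      show "AE s in L. norm (indicator {0..t} s *\<^sub>R (A s *v x s + B s *v u s))
          \<le> (CA * K1) * (indicator {0..t} s *\<^sub>R norm (x s)) + (CB * K2) * norm (u s)"
        using CA(3) CB(3)
      proof eventually_elim
        case (elim s)
        have a: "norm (A s *v x s) \<le> (CA * K1) * norm (x s)"
        proof -
          have "norm (A s *v x s) \<le> norm (A s) * norm (x s) * K1" by (rule K1)
          also have "\<dots> \<le> CA * norm (x s) * K1" using elim K1 by (intro mult_right_mono) auto
          finally show ?thesis by (simp add: ac_simps)
        qed
        have b: "norm (B s *v u s) \<le> (CB * K2) * norm (u s)"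
        proof -
          have "norm (B s *v u s) \<le> norm (B s) * norm (u s) * K2" by (rule K2)
          also have "\<dots> \<le> CB * norm (u s) * K2" using elim K2 by (intro mult_right_mono) auto
          finally show ?thesis by (simp add: ac_simps)
        qed
        have b0: "0 \<le> (CB * K2) * norm (u s)" using CB K2 by simp
        show ?case
        proof (cases "s \<in> {0..t}")
          case True
          then show ?thesis using norm_triangle_ineq[of "A s *v x s" "B s *v u s"] a b by simp
        next
          case False
          then show ?thesis using b0 by simp
        qed
      qed
    qed
    also have "\<dots> = (CA * K1) * (\<integral>s. indicator {0..t} s *\<^sub>R norm (x s) \<partial>L) + (CB * K2) * (\<integral>s. norm (u s) \<partial>L)"
      using ix iu by simp
    also have "(\<integral>s. indicator {0..t} s *\<^sub>R norm (x s) \<partial>L) = integral {0..t} (\<lambda>s. norm (x s))"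
      by (rule integral_leb_continuous(1)[OF cn t])
    finally show "norm (drift x u t) \<le> (CA * K1) * integral {0..t} (\<lambda>s. norm (x s)) + (CB * K2) * (\<integral>s. norm (u s) \<partial>L)" .
  qed
qed

section \<open>The noise-free equation solved by differences of states\<close>

definition ode :: "(real \<Rightarrow> real ^ 'k) \<Rightarrow> (real \<Rightarrow> real ^ 'd) \<Rightarrow> bool" where
  "ode u y \<longleftrightarrow> continuous_on {0..T} y \<and> (\<forall>t\<in>{0..T}. y t = drift y u t)"

lemma ode_bound:
  obtains K where "K \<ge> 0"
    "\<And>u y t. sq_int L u \<Longrightarrow> ode u y \<Longrightarrow> t \<in> {0..T} \<Longrightarrow> (norm (y t))\<^sup>2 \<le> K * (\<integral>s. (norm (u s))\<^sup>2 \<partial>L)"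
proof -
  obtain KA KB where KA: "KA \<ge> 0" and KB: "KB \<ge> 0"
    and dr: "\<And>x u t. continuous_on {0..T} x \<Longrightarrow> sq_int L u \<Longrightarrow> t \<in> {0..T} \<Longrightarrow>
      norm (drift x u t) \<le> KA * integral {0..t} (\<lambda>s. norm (x s)) + KB * (\<integral>s. norm (u s) \<partial>L)"
    by (rule drift_bound) blast
  \<comment> \<open>Gronwall with the constant inhomogeneity \<open>c\<close> gives
    \<open>norm (y t) \<le> c + KA * (exp (KA * T) * T * c)\<close>, where \<open>c\<close> is
    \<open>KB\<close> times the integral of \<open>norm (u s)\<close>. Squaring and Cauchy-Schwarz
    in time produce the further factor \<open>T\<close>.\<close>
  define R where "R = KB * (1 + KA * (exp (KA * T) * T))"
  have R0: "R \<ge> 0" unfolding R_def using KA KB T_pos by simp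
  show thesis
  proof (rule that[of "R\<^sup>2 * T"])
    show "0 \<le> R\<^sup>2 * T" using T_pos by simp
    fix u y t assume u: "sq_int L u" and y: "ode u y" and t: "t \<in> {0..T}"
    define c where "c = KB * (\<integral>s. norm (u s) \<partial>L)"
    have c0: "c \<ge> 0" unfolding c_def using KB by (intro mult_nonneg_nonneg integral_nonneg_AE) auto
    have cy: "continuous_on {0..T} y" using y by (simp add: ode_def)
    have le: "norm (y s) \<le> c + KA * integral {0..s} (\<lambda>s. norm (y s))" if "s \<in> {0..T}" for s
      using dr[OF cy u that] y that by (simp add: ode_def c_def)
    have "integral {0..t} (\<lambda>s. norm (y s)) \<le> exp (KA * t) * integral {0..t} (\<lambda>s. c)"
    proof (rule gronwall_integral[where T = T and a = "\<lambda>s. c" and K = KA])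
      show "continuous_on {0..T} (\<lambda>s. norm (y s))" using cy by (rule continuous_on_norm)
    qed (use c0 KA le t in simp_all)
    also have "\<dots> = exp (KA * t) * t * c" using t by simp
    also have "\<dots> \<le> exp (KA * T) * T * c"
    proof -
      have "KA * t \<le> KA * T" using t KA by (intro mult_left_mono) auto
      then have "exp (KA * t) * t \<le> exp (KA * T) * T" using t by (intro mult_mono) auto
      then show ?thesis using c0 by (rule mult_right_mono)
    qed
    finally have "KA * integral {0..t} (\<lambda>s. norm (y s)) \<le> KA * (exp (KA * T) * T * c)"
      using KA by (rule mult_left_mono)
    with le[OF t] have "norm (y t) \<le> c + KA * (exp (KA * T) * T * c)" by linarith
    also have "\<dots> = R * (\<integral>s. norm (u s) \<partial>L)" by (simp add: R_def c_def algebra_simps)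
    finally have "(norm (y t))\<^sup>2 \<le> (R * (\<integral>s. norm (u s) \<partial>L))\<^sup>2" by (intro power_mono) auto
    also have "\<dots> = R\<^sup>2 * (norm (\<integral>s. norm (u s) \<partial>L))\<^sup>2" by (simp add: power_mult_distrib)
    also have "\<dots> \<le> R\<^sup>2 * (T * (\<integral>s. (norm (u s))\<^sup>2 \<partial>L))"
    proof (rule mult_left_mono)
      have su: "sq_int L (\<lambda>s. norm (u s))"
        by (rule sq_int_bound[OF u, where C = 1]) (use sq_int_measurable[OF u] in auto)
      show "(norm (\<integral>s. norm (u s) \<partial>L))\<^sup>2 \<le> T * (\<integral>s. (norm (u s))\<^sup>2 \<partial>L)"
        using norm_integral_power2_le[OF finite_measure_leb su] measure_leb[of T] T_pos by simp
    qed simp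
    finally show "(norm (y t))\<^sup>2 \<le> R\<^sup>2 * T * (\<integral>s. (norm (u s))\<^sup>2 \<partial>L)" by (simp add: mult.assoc)
  qed
qed

lemma ode_zero: "ode (\<lambda>_. 0) y \<Longrightarrow> t \<in> {0..T} \<Longrightarrow> y t = 0"
proof -
  assume a: "ode (\<lambda>_. 0) y" "t \<in> {0..T}"
  obtain K where K: "\<And>u y t. sq_int L u \<Longrightarrow> ode u y \<Longrightarrow> t \<in> {0..T} \<Longrightarrow> (norm (y t))\<^sup>2 \<le> K * (\<integral>s. (norm (u s))\<^sup>2 \<partial>L)"
    by (rule ode_bound) blast
  from K[OF sq_int_zero a] show "y t = 0" by simp
qed

lemma ode_lin:
  assumes "ode u y" "ode v z" "sq_int L u" "sq_int L v"
  shows "ode (\<lambda>s. u s + c *\<^sub>R v s) (\<lambda>s. y s + c *\<^sub>R z s)"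
proof -
  have c: "continuous_on {0..T} y" "continuous_on {0..T} z" using assms by (auto simp: ode_def)
  show ?thesis
    unfolding ode_def
  proof (intro conjI ballI)
    show "continuous_on {0..T} (\<lambda>s. y s + c *\<^sub>R z s)" using c by (intro continuous_intros)
    fix t assume t: "t \<in> {0..T}"
    show "y t + c *\<^sub>R z t = drift (\<lambda>s. y s + c *\<^sub>R z s) (\<lambda>s. u s + c *\<^sub>R v s) t"
      using drift_lin[OF sq_int_continuous[OF c(1)] assms(3) sq_int_continuous[OF c(2)] assms(4) t, of c]
        assms(1,2) t by (simp add: ode_def)
  qed
qed

lemma ode_unique:
  assumes "ode u y" "ode u z" "sq_int L u" "t \<in> {0..T}"
  shows "y t = z t"
proof -
  have "ode (\<lambda>s. u s + (-1) *\<^sub>R u s) (\<lambda>s. y s + (-1) *\<^sub>R z s)" by (rule ode_lin[OF assms(1,2,3,3)])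
  then have "ode (\<lambda>_. 0) (\<lambda>s. y s + (-1) *\<^sub>R z s)" by simp
  from ode_zero[OF this assms(4)] show ?thesis by simp
qed

lemma state_solution: "lam \<in> H2 M T F \<Longrightarrow> state_solution D P lam (X lam)"
  using state by (auto simp: state_map_def)

lemma H2_AE_path: "lam \<in> H2 M T F \<Longrightarrow> AE \<omega> in M. sq_int L (\<lambda>t. lam t \<omega>)"
  unfolding H2_iff[OF filtration_F] by (auto dest: l2_AE_path)

lemma state_equation:
  assumes lam: "lam \<in> H2 M T F"
  obtains I where "wiener_integral M T W (lq_sigma D) I"
    "AE \<omega> in M. continuous_on {0..T} (\<lambda>t. X lam t \<omega>) \<and> sq_int L (\<lambda>t. lam t \<omega>) \<and>
      (\<forall>t\<in>{0..T}. X lam t \<omega> = \<xi> \<omega> + drift (\<lambda>t. X lam t \<omega>) (\<lambda>t. lam t \<omega>) t + I t \<omega>)"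
proof -
  have "\<exists>I. wiener_integral M T W (lq_sigma D) I \<and> (AE \<omega> in M. \<forall>t\<in>{0..T}. X lam t \<omega> = \<xi> \<omega>
             + (LINT s:{0..t}|lborel. A s *v X lam s \<omega> + B s *v lam s \<omega>) + I t \<omega>)"
    and c: "AE \<omega> in M. continuous_on {0..T} (\<lambda>t. X lam t \<omega>)"
    using state_solution[OF lam] unfolding state_solution_def by blast+
  then obtain I where I: "wiener_integral M T W (lq_sigma D) I"
    "AE \<omega> in M. \<forall>t\<in>{0..T}. X lam t \<omega> = \<xi> \<omega>
             + (LINT s:{0..t}|lborel. A s *v X lam s \<omega> + B s *v lam s \<omega>) + I t \<omega>"
    by blast
  from I(2) c H2_AE_path[OF lam] have "AE \<omega> in M. continuous_on {0..T} (\<lambda>t. X lam t \<omega>) \<and> sq_int L (\<lambda>t. lam t \<omega>) \<and>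
      (\<forall>t\<in>{0..T}. X lam t \<omega> = \<xi> \<omega> + drift (\<lambda>t. X lam t \<omega>) (\<lambda>t. lam t \<omega>) t + I t \<omega>)"
    by eventually_elim (simp add: drift_def LINT_leb)
  with I(1) that show thesis by blast
qed

text \<open>Equality at a fixed time holds off a null set depending on that time; a countable dense
  set of times and continuity give one null set for all. Rationals of the open interval also
  approach both endpoints, since \<open>T\<close> is positive.\<close>

lemma AE_continuous_eq:
  fixes f g :: "real \<Rightarrow> 'a \<Rightarrow> 'b::t2_space"
  assumes "AE \<omega> in M. continuous_on {0..T} (\<lambda>t. f t \<omega>)" "AE \<omega> in M. continuous_on {0..T} (\<lambda>t. g t \<omega>)"
    and eq: "\<And>t. t \<in> {0..T} \<Longrightarrow> AE \<omega> in M. f t \<omega> = g t \<omega>"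
  shows "AE \<omega> in M. \<forall>t\<in>{0..T}. f t \<omega> = g t \<omega>"
proof -
  define Q where "Q = {0<..<T} \<inter> \<rat>"
  have cQ: "countable Q" unfolding Q_def using countable_rat by (rule countable_Int2)
  have "AE \<omega> in M. \<forall>t\<in>Q. f t \<omega> = g t \<omega>"
    using cQ by (subst AE_ball_countable) (auto intro!: eq simp: Q_def)
  with assms(1,2) show ?thesis
  proof eventually_elim
    case (elim \<omega>)
    have cl: "{0..T} \<subseteq> closure Q"
    proof
      fix t assume t: "t \<in> {0..T}"
      show "t \<in> closure Q" unfolding closure_approachable
      proof (intro allI impI)
        fix e :: real assume e: "e > 0"
        have "max 0 (t - e) < min T (t + e)" using t e T_pos by auto
        then obtain q where "q \<in> \<rat>" "max 0 (t - e) < q" "q < min T (t + e)"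
          using Rats_dense_in_real by blast
        then show "\<exists>q\<in>Q. dist q t < e"
          by (intro bexI[of _ q]) (auto simp: Q_def dist_real_def)
      qed
    qed
    show ?case
    proof
      fix t assume t: "t \<in> {0..T}"
      then obtain q where q: "\<And>n::nat. q n \<in> Q" "q \<longlonglongrightarrow> t"
        using cl closure_sequential by (metis subsetD)
      have qT: "q n \<in> {0..T}" for n using q(1)[of n] by (auto simp: Q_def)
      have "(\<lambda>n. f (q n) \<omega>) \<longlonglongrightarrow> f t \<omega>"
        using continuous_on_tendsto_compose[OF elim(1) q(2) t] qT by simp
      moreover have "(\<lambda>n. g (q n) \<omega>) \<longlonglongrightarrow> g t \<omega>"
        using continuous_on_tendsto_compose[OF elim(2) q(2) t] qT by simp
      moreover have "(\<lambda>n. f (q n) \<omega>) = (\<lambda>n. g (q n) \<omega>)" using elim(3) q(1) by auto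
      ultimately show "f t \<omega> = g t \<omega>" by (metis LIMSEQ_unique)
    qed
  qed
qed

text \<open>The diffusion coefficient does not depend on the control, so both states contain
  versions of the same Wiener integral. Every other term of the state equation is almost surely
  continuous in time, hence so are the two integral processes; they agree at all times at once and
  cancel.\<close>

lemma state_difference:
  assumes lam: "lam \<in> H2 M T F" and lam': "lam' \<in> H2 M T F"
  shows "AE \<omega> in M. sq_int L (\<lambda>t. lam t \<omega> - lam' t \<omega>) \<and>
    ode (\<lambda>t. lam t \<omega> - lam' t \<omega>) (\<lambda>t. X lam t \<omega> - X lam' t \<omega>)"
proof -
  obtain I where I: "wiener_integral M T W (lq_sigma D) I"
    "AE \<omega> in M. continuous_on {0..T} (\<lambda>t. X lam t \<omega>) \<and> sq_int L (\<lambda>t. lam t \<omega>) \<and>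
      (\<forall>t\<in>{0..T}. X lam t \<omega> = \<xi> \<omega> + drift (\<lambda>t. X lam t \<omega>) (\<lambda>t. lam t \<omega>) t + I t \<omega>)"
    by (rule state_equation[OF lam])
  obtain I' where I': "wiener_integral M T W (lq_sigma D) I'"
    "AE \<omega> in M. continuous_on {0..T} (\<lambda>t. X lam' t \<omega>) \<and> sq_int L (\<lambda>t. lam' t \<omega>) \<and>
      (\<forall>t\<in>{0..T}. X lam' t \<omega> = \<xi> \<omega> + drift (\<lambda>t. X lam' t \<omega>) (\<lambda>t. lam' t \<omega>) t + I' t \<omega>)"
    by (rule state_equation[OF lam'])
  have cont: "continuous_on {0..T} (\<lambda>t. J t)"
    if "continuous_on {0..T} x" "sq_int L u" "\<forall>t\<in>{0..T}. x t = e + drift x u t + J t" for x u e and J :: "real \<Rightarrow> real ^ 'd"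
  proof -
    have "continuous_on {0..T} (\<lambda>t. x t - e - drift x u t)"
      using that(1) drift_continuous[OF sq_int_continuous[OF that(1)] that(2)] by (intro continuous_intros)
    then show ?thesis by (rule continuous_on_eq) (use that(3) in auto)
  qed
  have "AE \<omega> in M. \<forall>t\<in>{0..T}. I t \<omega> = I' t \<omega>"
  proof (rule AE_continuous_eq)
    show "AE \<omega> in M. continuous_on {0..T} (\<lambda>t. I t \<omega>)" using I(2) by eventually_elim (rule cont, auto)
    show "AE \<omega> in M. continuous_on {0..T} (\<lambda>t. I' t \<omega>)" using I'(2) by eventually_elim (rule cont, auto)
    show "AE \<omega> in M. I t \<omega> = I' t \<omega>" if "t \<in> {0..T}" for t
      by (rule wiener_unique[OF I(1) I'(1) sigma_sq_int that])
  qed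
  with I(2) I'(2) show ?thesis
  proof eventually_elim
    case (elim \<omega>)
    have c: "continuous_on {0..T} (\<lambda>t. X lam t \<omega>)" "continuous_on {0..T} (\<lambda>t. X lam' t \<omega>)"
      and s: "sq_int L (\<lambda>t. lam t \<omega>)" "sq_int L (\<lambda>t. lam' t \<omega>)" using elim by auto
    have "X lam t \<omega> - X lam' t \<omega> = drift (\<lambda>t. X lam t \<omega> - X lam' t \<omega>) (\<lambda>t. lam t \<omega> - lam' t \<omega>) t" if t: "t \<in> {0..T}" for t
      using drift_lin[OF sq_int_continuous[OF c(1)] s(1) sq_int_continuous[OF c(2)] s(2) t, of "-1"] elim t by simp
    then show ?case
      using c s by (auto simp: ode_def intro!: sq_int_diff continuous_intros)
  qed
qed

text \<open>A solution is read off the given state map: the difference between the states of the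
  control \<open>u\<close> and of the zero control is one, for almost every sample point. The claim
  does not mention the sample point, and the space has mass one.\<close>

lemma ode_exists:
  assumes u: "sq_int L u"
  shows "\<exists>y. ode u y"
proof -
  have H: "(\<lambda>t (\<omega>::'a). u t) \<in> H2 M T F" "(\<lambda>t (\<omega>::'a). 0) \<in> H2 M T F"
    by (intro H2_deterministic filtration_F u sq_int_zero)+
  have "AE \<omega> in M. \<exists>y. ode u y"
    using state_difference[OF H] by eventually_elim auto
  then show ?thesis by (simp add: AE_const)
qed

text \<open>For square-integrable \<open>u\<close>, uniqueness confines the effect of the choice to
  times outside \<open>{0..T}\<close>. The value zero in the other case makes all paths continuous,
  also on the null set of sample points where a control is not square-integrable in time.\<close>

definition sol :: "(real \<Rightarrow> real ^ 'k) \<Rightarrow> real \<Rightarrow> real ^ 'd" where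
  "sol u = (if sq_int L u then SOME y. ode u y else (\<lambda>_. 0))"

lemma sol_ode: "sq_int L u \<Longrightarrow> ode u (sol u)"
  unfolding sol_def using someI_ex[OF ode_exists] by simp

lemma sol_continuous: "continuous_on {0..T} (sol u)"
  using sol_ode[of u] by (cases "sq_int L u") (auto simp: ode_def sol_def)

lemma sol_eq: "sq_int L u \<Longrightarrow> ode u y \<Longrightarrow> t \<in> {0..T} \<Longrightarrow> y t = sol u t"
  using ode_unique sol_ode by blast

lemma sol_lin:
  assumes "sq_int L u" "sq_int L v" "t \<in> {0..T}"
  shows "sol (\<lambda>s. u s + c *\<^sub>R v s) t = sol u t + c *\<^sub>R sol v t"
  by (rule sol_eq[symmetric, OF _ ode_lin[OF sol_ode sol_ode]]) (use assms in \<open>auto intro: sq_int_add sq_int_scaleR\<close>)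

lemma sol_zero: "t \<in> {0..T} \<Longrightarrow> sol (\<lambda>_. 0) t = 0"
  using ode_zero[OF sol_ode] by simp

lemma sol_scale: "sq_int L v \<Longrightarrow> t \<in> {0..T} \<Longrightarrow> sol (\<lambda>s. c *\<^sub>R v s) t = c *\<^sub>R sol v t"
  using sol_lin[of "\<lambda>_. 0" v t c] sol_zero[of t] by simp

section \<open>Square-integrable versions of the state and the tested state equation\<close>

definition state_version :: "(real \<Rightarrow> 'a \<Rightarrow> real ^ 'k) \<Rightarrow> ('a \<Rightarrow> real \<Rightarrow> real ^ 'd) \<Rightarrow> bool" where
  "state_version lam x \<longleftrightarrow> (\<forall>\<omega>. continuous_on {0..T} (x \<omega>)) \<and> (\<forall>t\<in>{0..T}. sq_int M (\<lambda>\<omega>. x \<omega> t)) \<and>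
     sq_int N (\<lambda>z. x (fst z) (snd z)) \<and> (AE \<omega> in M. \<forall>t\<in>{0..T}. X lam t \<omega> = x \<omega> t)"

lemma control_l2: "lam \<in> H2 M T F \<Longrightarrow> sq_int N (\<lambda>z. lam (snd z) (fst z))"
  unfolding H2_iff[OF filtration_F] by blast

lemma sq_int_norm_fun: "sq_int K f \<Longrightarrow> sq_int K (\<lambda>z. norm (f z))"
  by (rule sq_int_bound[where C = 1]) (auto dest: sq_int_measurable)

text \<open>Gronwall is applied path by path, with the Wiener integral as part of a continuous
  inhomogeneity. This bounds the path by \<open>norm (i \<omega> t) + c \<omega>\<close>, where the
  random variable \<open>c\<close> is square-integrable and the second moment of \<open>i\<close> is
  bounded uniformly in time.\<close>

lemma state_version_exists:
  assumes lam: "lam \<in> H2 M T F"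
  shows "\<exists>x. state_version lam x"
proof -
  obtain I where I: "wiener_integral M T W (lq_sigma D) I"
    and eq: "AE \<omega> in M. continuous_on {0..T} (\<lambda>t. X lam t \<omega>) \<and> sq_int L (\<lambda>t. lam t \<omega>) \<and>
      (\<forall>t\<in>{0..T}. X lam t \<omega> = \<xi> \<omega> + drift (\<lambda>t. X lam t \<omega>) (\<lambda>t. lam t \<omega>) t + I t \<omega>)"
    by (rule state_equation[OF lam])
  have cX: "AE \<omega> in M. continuous_on {0..T} (\<lambda>t. X lam t \<omega>)" using eq by eventually_elim simp
  have mX: "X lam t \<in> borel_measurable M" if "t \<in> {0..T}" for t
    using state_solution[OF lam] that measurable_F unfolding state_solution_def by blast
  obtain x where x: "\<And>\<omega>. continuous_on {0..T} (x \<omega>)" "\<And>t. t \<in> {0..T} \<Longrightarrow> (\<lambda>\<omega>. x \<omega> t) \<in> borel_measurable M"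
    "(\<lambda>z. x (fst z) (snd z)) \<in> borel_measurable N" "AE \<omega> in M. \<forall>t\<in>{0..T}. X lam t \<omega> = x \<omega> t"
    using continuous_modification[OF cX mX] by blast
  have cI: "AE \<omega> in M. continuous_on {0..T} (\<lambda>t. I t \<omega>)"
    using eq
  proof eventually_elim
    case (elim \<omega>)
    have "continuous_on {0..T} (\<lambda>t. X lam t \<omega> - \<xi> \<omega> - drift (\<lambda>t. X lam t \<omega>) (\<lambda>t. lam t \<omega>) t)"
      using elim drift_continuous[OF sq_int_continuous] by (intro continuous_intros) auto
    then show ?case by (rule continuous_on_eq) (use elim in auto)
  qed
  have mI: "I t \<in> borel_measurable M" if "t \<in> {0..T}" for t
    using I that unfolding wiener_integral_def by blast
  obtain i where i: "\<And>\<omega>. continuous_on {0..T} (i \<omega>)" "\<And>t. t \<in> {0..T} \<Longrightarrow> (\<lambda>\<omega>. i \<omega> t) \<in> borel_measurable M"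
    "(\<lambda>z. i (fst z) (snd z)) \<in> borel_measurable N" "AE \<omega> in M. \<forall>t\<in>{0..T}. I t \<omega> = i \<omega> t"
    using continuous_modification[OF cI mI] by blast
  define Ci where "Ci = 6 + 4 * (\<integral>s. (norm (lq_sigma D s))\<^sup>2 \<partial>leb T)"
  have i_sq: "sq_int M (\<lambda>\<omega>. i \<omega> t)" "(\<integral>\<omega>. (norm (i \<omega> t))\<^sup>2 \<partial>M) \<le> Ci" if t: "t \<in> {0..T}" for t
  proof -
    have ae: "AE \<omega> in M. I t \<omega> = i \<omega> t" using i(4) by eventually_elim (use t in auto)
    have sI: "sq_int M (I t)" by (rule wiener_sq_int[OF I sigma_sq_int t])
    show si: "sq_int M (\<lambda>\<omega>. i \<omega> t)" by (rule sq_int_cong_AE[OF sI i(2)[OF t] ae])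
    have "(\<integral>\<omega>. (norm (i \<omega> t))\<^sup>2 \<partial>M) = (\<integral>\<omega>. (norm (I t \<omega>))\<^sup>2 \<partial>M)"
      by (rule integral_cong_AE)
        (use ae sq_int_measurable[OF si] sq_int_measurable[OF sI] in \<open>auto intro!: borel_measurable_norm_power2 elim!: eventually_mono\<close>)
    then show "(\<integral>\<omega>. (norm (i \<omega> t))\<^sup>2 \<partial>M) \<le> Ci" using wiener_sq_bound[OF I sigma_sq_int t] by (simp add: Ci_def)
  qed
  have iN: "sq_int N (\<lambda>z. i (fst z) (snd z))"
    by (rule sq_int_N_I[OF i(3), where C = Ci]) (use i_sq sq_int_norm in auto)
  obtain KA KB where KA: "KA \<ge> 0" and KB: "KB \<ge> 0"
    and dr: "\<And>x u t. continuous_on {0..T} x \<Longrightarrow> sq_int L u \<Longrightarrow> t \<in> {0..T} \<Longrightarrow>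
      norm (drift x u t) \<le> KA * integral {0..t} (\<lambda>s. norm (x s)) + KB * (\<integral>s. norm (u s) \<partial>L)"
    by (rule drift_bound) blast
  define \<Lambda> where "\<Lambda> \<omega> = (\<integral>s. norm (lam s \<omega>) \<partial>L)" for \<omega>
  define \<I> where "\<I> \<omega> = (\<integral>s. norm (i \<omega> s) \<partial>L)" for \<omega>
  have s\<Lambda>: "sq_int M \<Lambda>" unfolding \<Lambda>_def[abs_def]
    using sq_int_path_integral[OF sq_int_norm_fun[OF control_l2[OF lam]]] by simp
  have s\<I>: "sq_int M \<I>" unfolding \<I>_def[abs_def]
    using sq_int_path_integral[OF sq_int_norm_fun[OF iN]] by simp
  define E where "E = KA * exp (KA * T)"
  have E0: "E \<ge> 0" using KA by (simp add: E_def)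
  \<comment> \<open>The part of the inhomogeneity that is constant in time, plus Gronwall's factor
    \<open>E\<close> times a bound for the integral of the whole inhomogeneity over
    \<open>{0..T}\<close>.\<close>
  define c where "c \<omega> = (norm (\<xi> \<omega>) + KB * \<Lambda> \<omega>) + E * (T * (norm (\<xi> \<omega>) + KB * \<Lambda> \<omega>) + \<I> \<omega>)" for \<omega>
  have c_sq: "sq_int M c"
  proof -
    have n: "sq_int M (\<lambda>\<omega>. norm (\<xi> \<omega>))" by (rule sq_int_norm_fun[OF xi_sq])
    have a: "sq_int M (\<lambda>\<omega>. norm (\<xi> \<omega>) + KB *\<^sub>R \<Lambda> \<omega>)" by (intro sq_int_add n sq_int_scaleR s\<Lambda>)
    have "sq_int M (\<lambda>\<omega>. (norm (\<xi> \<omega>) + KB *\<^sub>R \<Lambda> \<omega>) + E *\<^sub>R (T *\<^sub>R (norm (\<xi> \<omega>) + KB *\<^sub>R \<Lambda> \<omega>) + \<I> \<omega>))"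
      by (intro sq_int_add sq_int_scaleR n s\<Lambda> s\<I> a)
    then show ?thesis by (simp add: c_def[abs_def])
  qed
  have bd: "AE \<omega> in M. \<forall>t\<in>{0..T}. norm (x \<omega> t) \<le> norm (i \<omega> t) + c \<omega>"
    using eq x(4) i(4)
  proof eventually_elim
    case (elim \<omega>)
    have u: "sq_int L (\<lambda>s. lam s \<omega>)" using elim by blast
    have xeq: "x \<omega> t = \<xi> \<omega> + drift (x \<omega>) (\<lambda>s. lam s \<omega>) t + i \<omega> t" if t: "t \<in> {0..T}" for t
    proof -
      have "drift (\<lambda>t. X lam t \<omega>) (\<lambda>t. lam t \<omega>) t = drift (x \<omega>) (\<lambda>s. lam s \<omega>) t"
        unfolding drift_def by (intro Bochner_Integration.integral_cong refl) (use elim t in auto)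
      then show ?thesis using elim t by auto
    qed
    define a where "a t = norm (i \<omega> t) + (norm (\<xi> \<omega>) + KB * \<Lambda> \<omega>)" for t
    have \<Lambda>0: "\<Lambda> \<omega> \<ge> 0" unfolding \<Lambda>_def by (rule integral_nonneg_AE) simp
    have ca: "continuous_on {0..T} a" unfolding a_def by (intro continuous_intros i(1))
    have cn: "continuous_on {0..T} (\<lambda>s. norm (x \<omega> s))" by (intro continuous_intros x(1))
    have le: "norm (x \<omega> t) \<le> a t + KA * integral {0..t} (\<lambda>s. norm (x \<omega> s))" if t: "t \<in> {0..T}" for t
    proof -
      have "norm (x \<omega> t) \<le> norm (\<xi> \<omega>) + norm (drift (x \<omega>) (\<lambda>s. lam s \<omega>) t) + norm (i \<omega> t)"
        unfolding xeq[OF t]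
        using norm_triangle_ineq[of "\<xi> \<omega> + drift (x \<omega>) (\<lambda>s. lam s \<omega>) t" "i \<omega> t"]
          norm_triangle_ineq[of "\<xi> \<omega>" "drift (x \<omega>) (\<lambda>s. lam s \<omega>) t"] by linarith
      then show ?thesis using dr[OF x(1)[of \<omega>] u t] by (simp add: a_def \<Lambda>_def)
    qed
    have int_a: "integral {0..t} a \<le> T * (norm (\<xi> \<omega>) + KB * \<Lambda> \<omega>) + \<I> \<omega>" if t: "t \<in> {0..T}" for t
    proof -
      have ci: "continuous_on {0..T} (\<lambda>s. norm (i \<omega> s))" by (intro continuous_intros i(1))
      have "integral {0..t} a \<le> integral {0..T} a"
        by (rule integral_subset_le)
          (use t ca KB \<Lambda>0 in \<open>auto intro!: integrable_continuous_real continuous_on_subset[OF ca] simp: a_def\<close>)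
      also have "\<dots> = (\<integral>s. indicator {0..T} s *\<^sub>R a s \<partial>L)"
        by (rule integral_leb_continuous(1)[OF ca T0(2), symmetric])
      also have "\<dots> = (\<integral>s. norm (i \<omega> s) + (norm (\<xi> \<omega>) + KB * \<Lambda> \<omega>) \<partial>L)"
        by (intro Bochner_Integration.integral_cong) (auto simp: a_def)
      also have "\<dots> = \<I> \<omega> + T * (norm (\<xi> \<omega>) + KB * \<Lambda> \<omega>)"
        using integral_leb_continuous(2)[OF ci T0(1)] measure_leb[of T] T_pos
        by (simp add: \<I>_def)
      finally show ?thesis by simp
    qed
    show ?case
    proof
      fix t assume t: "t \<in> {0..T}"
      have a0: "0 \<le> a s" for s unfolding a_def using KB \<Lambda>0 by simp
      have "integral {0..t} (\<lambda>s. norm (x \<omega> s)) \<le> exp (KA * t) * integral {0..t} a"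
        by (rule gronwall_integral[OF cn ca a0 KA le t])
      also have "\<dots> \<le> exp (KA * T) * (T * (norm (\<xi> \<omega>) + KB * \<Lambda> \<omega>) + \<I> \<omega>)"
      proof (rule mult_mono)
        show "exp (KA * t) \<le> exp (KA * T)" using t KA by (simp add: mult_left_mono)
        show "0 \<le> integral {0..t} a"
          by (rule integral_nonneg) (use t a0 in \<open>auto intro!: integrable_continuous_real continuous_on_subset[OF ca]\<close>)
      qed (use int_a[OF t] in auto)
      finally have "KA * integral {0..t} (\<lambda>s. norm (x \<omega> s)) \<le> KA * (exp (KA * T) * (T * (norm (\<xi> \<omega>) + KB * \<Lambda> \<omega>) + \<I> \<omega>))"
        using KA by (rule mult_left_mono)
      then show "norm (x \<omega> t) \<le> norm (i \<omega> t) + c \<omega>"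
        using le[OF t] by (simp add: a_def c_def E_def mult.assoc)
    qed
  qed
  have x_sq: "sq_int M (\<lambda>\<omega>. x \<omega> t) \<and> (\<integral>\<omega>. (norm (x \<omega> t))\<^sup>2 \<partial>M) \<le> 2 * Ci + 2 * (\<integral>\<omega>. (norm (c \<omega>))\<^sup>2 \<partial>M)"
    if t: "t \<in> {0..T}" for t
  proof -
    have n: "sq_int M (\<lambda>\<omega>. norm (i \<omega> t))" by (rule sq_int_norm_fun[OF i_sq(1)[OF t]])
    have b: "AE \<omega> in M. norm (x \<omega> t) \<le> norm (norm (i \<omega> t) + c \<omega>)"
      using bd by eventually_elim (use t in force)
    have sx: "sq_int M (\<lambda>\<omega>. x \<omega> t)"
      by (rule sq_int_bound[OF sq_int_add[OF n c_sq] x(2)[OF t], where C = 1]) (use b in simp)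
    have "(\<integral>\<omega>. (norm (x \<omega> t))\<^sup>2 \<partial>M) \<le> (\<integral>\<omega>. 2 * (norm (norm (i \<omega> t)))\<^sup>2 + 2 * (norm (c \<omega>))\<^sup>2 \<partial>M)"
    proof (rule integral_mono_AE[OF sq_int_norm[OF sx]])
      show "integrable M (\<lambda>\<omega>. 2 * (norm (norm (i \<omega> t)))\<^sup>2 + 2 * (norm (c \<omega>))\<^sup>2)"
        using sq_int_norm[OF n] sq_int_norm[OF c_sq] by simp
      show "AE \<omega> in M. (norm (x \<omega> t))\<^sup>2 \<le> 2 * (norm (norm (i \<omega> t)))\<^sup>2 + 2 * (norm (c \<omega>))\<^sup>2"
        using b
      proof eventually_elim
        case (elim \<omega>)
        then have "(norm (x \<omega> t))\<^sup>2 \<le> (norm (norm (i \<omega> t) + c \<omega>))\<^sup>2" by (intro power_mono) auto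
        also have "\<dots> \<le> 2 * (norm (norm (i \<omega> t)))\<^sup>2 + 2 * (norm (c \<omega>))\<^sup>2" by (rule norm_add_power2)
        finally show ?case .
      qed
    qed
    also have "\<dots> = 2 * (\<integral>\<omega>. (norm (i \<omega> t))\<^sup>2 \<partial>M) + 2 * (\<integral>\<omega>. (norm (c \<omega>))\<^sup>2 \<partial>M)"
      using sq_int_norm[OF i_sq(1)[OF t]] sq_int_norm[OF c_sq] by simp
    finally show ?thesis using sx i_sq(2)[OF t] by simp
  qed
  have "sq_int N (\<lambda>z. x (fst z) (snd z))"
    by (rule sq_int_N_I[OF x(3), where C = "2 * Ci + 2 * (\<integral>\<omega>. (norm (c \<omega>))\<^sup>2 \<partial>M)"])
      (use x_sq sq_int_norm in auto)
  then have "state_version lam x" unfolding state_version_def using x x_sq by blast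
  then show ?thesis by blast
qed

lemma state_versionD:
  assumes "state_version lam x"
  shows "continuous_on {0..T} (x \<omega>)" "t \<in> {0..T} \<Longrightarrow> sq_int M (\<lambda>\<omega>. x \<omega> t)"
    "sq_int N (\<lambda>z. x (fst z) (snd z))" "AE \<omega> in M. \<forall>t\<in>{0..T}. X lam t \<omega> = x \<omega> t"
  using assms unfolding state_version_def by blast+

text \<open>Paths are square-integrable only almost surely, so the drift splits into its state and
  control integrals off a null set; each of the two has a jointly measurable integrand and commutes
  with testing by Fubini.\<close>

lemma drift_test:
  assumes x: "sq_int N (\<lambda>z. x (fst z) (snd z))" and u: "sq_int N (\<lambda>z. u (fst z) (snd z))"
    and Z: "sq_int M Z" and t: "t \<in> {0..T}"
  shows "(\<integral>\<omega>. Z \<omega> *\<^sub>R drift (x \<omega>) (u \<omega>) t \<partial>M)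
      = drift (\<lambda>s. \<integral>\<omega>. Z \<omega> *\<^sub>R x \<omega> s \<partial>M) (\<lambda>s. \<integral>\<omega>. Z \<omega> *\<^sub>R u \<omega> s \<partial>M) t"
    and "sq_int M (\<lambda>\<omega>. drift (x \<omega>) (u \<omega>) t)"
proof -
  note S = Icc_sets_L[OF t]
  obtain CA where CA: "CA \<ge> 0" "A \<in> borel_measurable L" "AE t in L. norm (A t) \<le> CA" by (rule A_bound)
  obtain CB where CB: "CB \<ge> 0" "B \<in> borel_measurable L" "AE t in L. norm (B t) \<le> CB" by (rule B_bound)
  have sA: "sq_int N (\<lambda>z. indicator {0..t} (snd z) *\<^sub>R (A (snd z) *v x (fst z) (snd z)))"
    by (rule sq_int_N_indicator_time[OF sq_int_N_matrix[OF x CA(2,3)] S])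
  have sB: "sq_int N (\<lambda>z. indicator {0..t} (snd z) *\<^sub>R (B (snd z) *v u (fst z) (snd z)))"
    by (rule sq_int_N_indicator_time[OF sq_int_N_matrix[OF u CB(2,3)] S])
  have pA: "sq_int M (\<lambda>\<omega>. \<integral>s. indicator {0..t} s *\<^sub>R (A s *v x \<omega> s) \<partial>L)"
    using sq_int_path_integral[OF sA] by simp
  have pB: "sq_int M (\<lambda>\<omega>. \<integral>s. indicator {0..t} s *\<^sub>R (B s *v u \<omega> s) \<partial>L)"
    using sq_int_path_integral[OF sB] by simp
  have split: "drift f g t = (\<integral>s. indicator {0..t} s *\<^sub>R (A s *v f s) \<partial>L) + (\<integral>s. indicator {0..t} s *\<^sub>R (B s *v g s) \<partial>L)"
    if "sq_int L f" "sq_int L g" for f g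
    unfolding drift_def scaleR_add_right
    by (intro Bochner_Integration.integral_add integrable_mult_indicator S
        sq_int_integrable[OF finite_measure_leb] A_sq_int B_sq_int that)
  have xp: "AE \<omega> in M. sq_int L (x \<omega>)" and up: "AE \<omega> in M. sq_int L (u \<omega>)"
    using l2_AE_path[OF x] l2_AE_path[OF u] by simp_all
  have ae: "AE \<omega> in M. (\<integral>s. indicator {0..t} s *\<^sub>R (A s *v x \<omega> s) \<partial>L)
      + (\<integral>s. indicator {0..t} s *\<^sub>R (B s *v u \<omega> s) \<partial>L) = drift (x \<omega>) (u \<omega>) t"
    using xp up by eventually_elim (simp add: split)
  have m: "(\<lambda>\<omega>. drift (x \<omega>) (u \<omega>) t) \<in> borel_measurable M"
    by (rule complete_measure.borel_measurable_AE_eq[OF complete_M sq_int_measurable[OF sq_int_add[OF pA pB]] ae])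
  show "sq_int M (\<lambda>\<omega>. drift (x \<omega>) (u \<omega>) t)" by (rule sq_int_cong_AE[OF sq_int_add[OF pA pB] m ae])
  have ex: "sq_int L (\<lambda>s. \<integral>\<omega>. Z \<omega> *\<^sub>R x \<omega> s \<partial>M)" and eu: "sq_int L (\<lambda>s. \<integral>\<omega>. Z \<omega> *\<^sub>R u \<omega> s \<partial>M)"
    using sq_int_time_integral[OF x Z] sq_int_time_integral[OF u Z] by simp_all
  have "(\<integral>\<omega>. Z \<omega> *\<^sub>R drift (x \<omega>) (u \<omega>) t \<partial>M)
      = (\<integral>\<omega>. Z \<omega> *\<^sub>R (\<integral>s. indicator {0..t} s *\<^sub>R (A s *v x \<omega> s) \<partial>L)
        + Z \<omega> *\<^sub>R (\<integral>s. indicator {0..t} s *\<^sub>R (B s *v u \<omega> s) \<partial>L) \<partial>M)"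
  proof (rule integral_cong_AE)
    show "(\<lambda>\<omega>. Z \<omega> *\<^sub>R drift (x \<omega>) (u \<omega>) t) \<in> borel_measurable M"
      by (rule borel_measurable_scaleR[OF sq_int_measurable[OF Z] m])
    show "(\<lambda>\<omega>. Z \<omega> *\<^sub>R (\<integral>s. indicator {0..t} s *\<^sub>R (A s *v x \<omega> s) \<partial>L)
        + Z \<omega> *\<^sub>R (\<integral>s. indicator {0..t} s *\<^sub>R (B s *v u \<omega> s) \<partial>L)) \<in> borel_measurable M"
      by (intro borel_measurable_add borel_measurable_scaleR sq_int_measurable[OF Z] sq_int_measurable[OF pA] sq_int_measurable[OF pB])
  qed (use ae in \<open>eventually_elim, simp add: scaleR_add_right[symmetric]\<close>)
  also have "\<dots> = (\<integral>\<omega>. Z \<omega> *\<^sub>R (\<integral>s. indicator {0..t} s *\<^sub>R (A s *v x \<omega> s) \<partial>L) \<partial>M)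
        + (\<integral>\<omega>. Z \<omega> *\<^sub>R (\<integral>s. indicator {0..t} s *\<^sub>R (B s *v u \<omega> s) \<partial>L) \<partial>M)"
    by (intro Bochner_Integration.integral_add sq_int_scaleR_fun Z pA pB)
  also have "\<dots> = drift (\<lambda>s. \<integral>\<omega>. Z \<omega> *\<^sub>R x \<omega> s \<partial>M) (\<lambda>s. \<integral>\<omega>. Z \<omega> *\<^sub>R u \<omega> s \<partial>M) t"
    unfolding split[OF ex eu]
    using drift_Fubini[OF x CA(2,3) Z S] drift_Fubini[OF u CB(2,3) Z S] by simp
  finally show "(\<integral>\<omega>. Z \<omega> *\<^sub>R drift (x \<omega>) (u \<omega>) t \<partial>M)
      = drift (\<lambda>s. \<integral>\<omega>. Z \<omega> *\<^sub>R x \<omega> s \<partial>M) (\<lambda>s. \<integral>\<omega>. Z \<omega> *\<^sub>R u \<omega> s \<partial>M) t" .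
qed

text \<open>Taking expectations against \<open>Z\<close> turns the state equation into a
  deterministic equation with tested data. With \<open>Z = 1\<close> it becomes the equation of the
  mean path; for a noise-adapted control and \<open>Z\<close> orthogonal to the noise all data
  vanish, the control at almost every time.\<close>

lemma state_version_test:
  assumes lam: "lam \<in> H2 M T F" and x: "state_version lam x"
  obtains I where "wiener_integral M T W (lq_sigma D) I"
    "\<And>Z t. sq_int M Z \<Longrightarrow> t \<in> {0..T} \<Longrightarrow> (\<integral>\<omega>. Z \<omega> *\<^sub>R x \<omega> t \<partial>M) = (\<integral>\<omega>. Z \<omega> *\<^sub>R \<xi> \<omega> \<partial>M)
      + drift (\<lambda>s. \<integral>\<omega>. Z \<omega> *\<^sub>R x \<omega> s \<partial>M) (\<lambda>s. \<integral>\<omega>. Z \<omega> *\<^sub>R lam s \<omega> \<partial>M) t + (\<integral>\<omega>. Z \<omega> *\<^sub>R I t \<omega> \<partial>M)"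
proof -
  obtain I where I: "wiener_integral M T W (lq_sigma D) I"
    and eq: "AE \<omega> in M. continuous_on {0..T} (\<lambda>t. X lam t \<omega>) \<and> sq_int L (\<lambda>t. lam t \<omega>) \<and>
      (\<forall>t\<in>{0..T}. X lam t \<omega> = \<xi> \<omega> + drift (\<lambda>t. X lam t \<omega>) (\<lambda>t. lam t \<omega>) t + I t \<omega>)"
    by (rule state_equation[OF lam])
  note xD = state_versionD[OF x]
  show thesis
  proof (rule that[OF I])
    fix Z :: "'a \<Rightarrow> real" and t assume Z: "sq_int M Z" and t: "t \<in> {0..T}"
    note dt = drift_test[where x = x and u = "\<lambda>\<omega> s. lam s \<omega>", OF xD(3) control_l2[OF lam] Z t]
    have sI: "sq_int M (I t)" by (rule wiener_sq_int[OF I sigma_sq_int t])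
    have ae: "AE \<omega> in M. x \<omega> t = (\<xi> \<omega> + drift (x \<omega>) (\<lambda>s. lam s \<omega>) t) + I t \<omega>"
      using eq xD(4)
    proof eventually_elim
      case (elim \<omega>)
      have "drift (\<lambda>t. X lam t \<omega>) (\<lambda>t. lam t \<omega>) t = drift (x \<omega>) (\<lambda>s. lam s \<omega>) t"
        unfolding drift_def by (intro Bochner_Integration.integral_cong refl) (use elim t in auto)
      then show ?case using elim t by auto
    qed
    have "(\<integral>\<omega>. Z \<omega> *\<^sub>R x \<omega> t \<partial>M) = (\<integral>\<omega>. (Z \<omega> *\<^sub>R \<xi> \<omega> + Z \<omega> *\<^sub>R drift (x \<omega>) (\<lambda>s. lam s \<omega>) t) + Z \<omega> *\<^sub>R I t \<omega> \<partial>M)"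
    proof (rule integral_cong_AE)
      show "(\<lambda>\<omega>. Z \<omega> *\<^sub>R x \<omega> t) \<in> borel_measurable M"
        by (intro borel_measurable_scaleR sq_int_measurable[OF Z] sq_int_measurable[OF xD(2)[OF t]])
      show "(\<lambda>\<omega>. (Z \<omega> *\<^sub>R \<xi> \<omega> + Z \<omega> *\<^sub>R drift (x \<omega>) (\<lambda>s. lam s \<omega>) t) + Z \<omega> *\<^sub>R I t \<omega>) \<in> borel_measurable M"
        by (intro borel_measurable_add borel_measurable_scaleR sq_int_measurable[OF Z] sq_int_measurable[OF dt(2)]
            sq_int_measurable[OF sI] sq_int_measurable[OF xi_sq])
    qed (use ae in \<open>eventually_elim, simp add: scaleR_add_right\<close>)
    also have "\<dots> = ((\<integral>\<omega>. Z \<omega> *\<^sub>R \<xi> \<omega> \<partial>M) + (\<integral>\<omega>. Z \<omega> *\<^sub>R drift (x \<omega>) (\<lambda>s. lam s \<omega>) t \<partial>M)) + (\<integral>\<omega>. Z \<omega> *\<^sub>R I t \<omega> \<partial>M)"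
      using sq_int_scaleR_fun[OF Z xi_sq] sq_int_scaleR_fun[OF Z dt(2)] sq_int_scaleR_fun[OF Z sI] by simp
    finally show "(\<integral>\<omega>. Z \<omega> *\<^sub>R x \<omega> t \<partial>M) = (\<integral>\<omega>. Z \<omega> *\<^sub>R \<xi> \<omega> \<partial>M)
      + drift (\<lambda>s. \<integral>\<omega>. Z \<omega> *\<^sub>R x \<omega> s \<partial>M) (\<lambda>s. \<integral>\<omega>. Z \<omega> *\<^sub>R lam s \<omega> \<partial>M) t + (\<integral>\<omega>. Z \<omega> *\<^sub>R I t \<omega> \<partial>M)"
      unfolding dt(1) by simp
  qed
qed

lemma state_mean_continuous:
  assumes lam: "lam \<in> H2 M T F" and x: "state_version lam x"
  shows "continuous_on {0..T} (\<lambda>t. \<integral>\<omega>. x \<omega> t \<partial>M)"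
proof -
  obtain I where I: "wiener_integral M T W (lq_sigma D) I"
    and test: "\<And>Z t. sq_int M Z \<Longrightarrow> t \<in> {0..T} \<Longrightarrow> (\<integral>\<omega>. Z \<omega> *\<^sub>R x \<omega> t \<partial>M) = (\<integral>\<omega>. Z \<omega> *\<^sub>R \<xi> \<omega> \<partial>M)
      + drift (\<lambda>s. \<integral>\<omega>. Z \<omega> *\<^sub>R x \<omega> s \<partial>M) (\<lambda>s. \<integral>\<omega>. Z \<omega> *\<^sub>R lam s \<omega> \<partial>M) t + (\<integral>\<omega>. Z \<omega> *\<^sub>R I t \<omega> \<partial>M)"
    by (rule state_version_test[OF lam x]) blast
  have one: "sq_int M (\<lambda>_. 1 :: real)" by (rule sq_int_const[OF finite_measure_axioms])
  have e: "sq_int L (\<lambda>s. \<integral>\<omega>. x \<omega> s \<partial>M)" "sq_int L (\<lambda>s. \<integral>\<omega>. lam s \<omega> \<partial>M)"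
    using sq_int_time_integral[OF state_versionD(3)[OF x] one] sq_int_time_integral[OF control_l2[OF lam] one] by simp_all
  have "continuous_on {0..T} (\<lambda>t. (\<integral>\<omega>. \<xi> \<omega> \<partial>M) + drift (\<lambda>s. \<integral>\<omega>. x \<omega> s \<partial>M) (\<lambda>s. \<integral>\<omega>. lam s \<omega> \<partial>M) t)"
    by (intro continuous_intros drift_continuous e)
  then show ?thesis
    by (rule continuous_on_eq) (use test[OF one] wiener_mean[OF I sigma_sq_int] in simp)
qed

text \<open>The exceptional times are those at which the control is not square-integrable. They do
  not depend on \<open>Z\<close>, which is why the quantifier over \<open>Z\<close> may stand
  inside.\<close>

lemma orth_control:
  assumes \<alpha>: "\<alpha> \<in> H2 M T F1"
  shows "AE t in L. \<forall>Z. sq_int M Z \<longrightarrow> orth M (sigma_noise P T) Z \<longrightarrow> (\<integral>\<omega>. Z \<omega> *\<^sub>R \<alpha> t \<omega> \<partial>M) = 0"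
proof -
  have \<alpha>F: "\<alpha> \<in> H2 M T F" using \<alpha> H2_F1_F by blast
  have am: "(\<lambda>z. \<alpha> (snd z) (fst z)) \<in> borel_measurable (F1 T \<Otimes>\<^sub>M L)"
    using \<alpha> unfolding H2_iff[OF filtration_F1] by (blast intro: progressive_at[OF _ T0(2)])
  show ?thesis
    using l2_AE_time[OF control_l2[OF \<alpha>F]]
  proof (rule AE_mp, intro AE_I2 impI allI)
    fix t Z assume t: "t \<in> space L" "sq_int M (\<lambda>\<omega>. \<alpha> (snd (\<omega>, t)) (fst (\<omega>, t)))"
      and Z: "sq_int M Z" "orth M (sigma_noise P T) Z"
    have "(\<lambda>\<omega>. \<alpha> t \<omega>) \<in> borel_measurable (F1 T)" using measurable_Pair1[OF am t(1)] by simp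
    then show "(\<integral>\<omega>. Z \<omega> *\<^sub>R \<alpha> t \<omega> \<partial>M) = 0"
      using t(2) by (intro orth_integral[OF prob_space_M F1_subalgebra[OF T0(2)] orth_F1[OF Z(2)] Z(1)]) simp_all
  qed
qed

text \<open>Testing with \<open>Z\<close> removes the initial value, the control at almost every
  time, and the Wiener integral. What remains is the homogeneous linear equation with zero initial
  value, whose only solution is zero; so the claim holds at every time and not just at almost every
  time.\<close>

lemma orth_state:
  assumes \<alpha>: "\<alpha> \<in> H2 M T F1" and x: "state_version \<alpha> x"
    and Z: "sq_int M Z" "orth M (sigma_noise P T) Z" and t: "t \<in> {0..T}"
  shows "(\<integral>\<omega>. Z \<omega> *\<^sub>R x \<omega> t \<partial>M) = 0"
proof -
  have \<alpha>F: "\<alpha> \<in> H2 M T F" using \<alpha> H2_F1_F by blast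
  have a0: "AE s in L. (\<integral>\<omega>. Z \<omega> *\<^sub>R \<alpha> s \<omega> \<partial>M) = 0"
    using orth_control[OF \<alpha>] by eventually_elim (use Z in blast)
  obtain I where I: "wiener_integral M T W (lq_sigma D) I"
    and test: "\<And>Z t. sq_int M Z \<Longrightarrow> t \<in> {0..T} \<Longrightarrow> (\<integral>\<omega>. Z \<omega> *\<^sub>R x \<omega> t \<partial>M) = (\<integral>\<omega>. Z \<omega> *\<^sub>R \<xi> \<omega> \<partial>M)
      + drift (\<lambda>s. \<integral>\<omega>. Z \<omega> *\<^sub>R x \<omega> s \<partial>M) (\<lambda>s. \<integral>\<omega>. Z \<omega> *\<^sub>R \<alpha> s \<omega> \<partial>M) t + (\<integral>\<omega>. Z \<omega> *\<^sub>R I t \<omega> \<partial>M)"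
    by (rule state_version_test[OF \<alpha>F x]) blast
  define e where "e t = (\<integral>\<omega>. Z \<omega> *\<^sub>R x \<omega> t \<partial>M)" for t
  have e: "sq_int L e" unfolding e_def[abs_def] using sq_int_time_integral[OF state_versionD(3)[OF x] Z(1)] by simp
  have \<xi>0: "(\<integral>\<omega>. Z \<omega> *\<^sub>R \<xi> \<omega> \<partial>M) = 0"
    by (rule orth_integral[OF prob_space_M sigma_noise_subalgebra[OF T0(2)] Z(2,1) xi_sq sigma_noise_xi])
  have e_eq: "e t = drift e (\<lambda>_. 0) t" if t: "t \<in> {0..T}" for t
  proof -
    have "drift e (\<lambda>s. \<integral>\<omega>. Z \<omega> *\<^sub>R \<alpha> s \<omega> \<partial>M) t = drift e (\<lambda>_. 0) t"
      unfolding drift_def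
    proof (rule integral_cong_AE)
      have *: "sq_int L (\<lambda>s. \<integral>\<omega>. Z \<omega> *\<^sub>R \<alpha> s \<omega> \<partial>M)" using sq_int_time_integral[OF control_l2[OF \<alpha>F] Z(1)] by simp
      show "(\<lambda>s. indicator {0..t} s *\<^sub>R (A s *v e s + B s *v (\<integral>\<omega>. Z \<omega> *\<^sub>R \<alpha> s \<omega> \<partial>M))) \<in> borel_measurable L"
        "(\<lambda>s. indicator {0..t} s *\<^sub>R (A s *v e s + B s *v 0)) \<in> borel_measurable L"
        by (intro borel_measurable_integrable integrable_mult_indicator Icc_sets_L[OF t] drift_integrable e * sq_int_zero)+
    qed (use a0 in \<open>eventually_elim, simp\<close>)
    moreover have "e t = drift e (\<lambda>s. \<integral>\<omega>. Z \<omega> *\<^sub>R \<alpha> s \<omega> \<partial>M) t"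
      using test[OF Z(1) t] \<xi>0 wiener_orth_noise[OF I sigma_sq_int t Z] by (simp add: e_def[abs_def])
    ultimately show ?thesis by simp
  qed
  have "ode (\<lambda>_. 0) e" unfolding ode_def
  proof (intro conjI ballI e_eq)
    show "continuous_on {0..T} e"
      by (rule continuous_on_eq[OF drift_continuous[OF e sq_int_zero]]) (use e_eq in auto)
  qed
  then show ?thesis using ode_zero[of e t] t by (simp add: e_def)
qed

lemma sol_bound:
  obtains K where "K \<ge> 0"
    "\<And>u t. sq_int L u \<Longrightarrow> t \<in> {0..T} \<Longrightarrow> (norm (sol u t))\<^sup>2 \<le> K * (\<integral>s. (norm (u s))\<^sup>2 \<partial>L)"
  by (rule ode_bound) (use sol_ode in blast)

lemma state_diff_sol:
  assumes "lam \<in> H2 M T F" "lam' \<in> H2 M T F"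
  shows "AE \<omega> in M. \<forall>t\<in>{0..T}. X lam t \<omega> - X lam' t \<omega> = sol (\<lambda>s. lam s \<omega> - lam' s \<omega>) t"
  using state_difference[OF assms] by eventually_elim (auto intro: sol_eq)

lemma H2_zero: "(\<lambda>t \<omega>. 0) \<in> H2 M T F"
  by (rule H2_deterministic[OF filtration_F sq_int_zero])

text \<open>A solution chosen path by path is not visibly measurable, but it agrees almost surely
  with the difference of the states of \<beta> and of the zero control. That testing commutes with
  \<open>sol\<close> follows from uniqueness: both sides solve the equation driven by the tested
  control.\<close>

lemma sol_process:
  assumes \<beta>: "\<beta> \<in> H2 M T F"
  shows "t \<in> {0..T} \<Longrightarrow> sq_int M (\<lambda>\<omega>. sol (\<lambda>s. \<beta> s \<omega>) t)"
    and "sq_int N (\<lambda>z. sol (\<lambda>s. \<beta> s (fst z)) (snd z))"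
    and "t \<in> {0..T} \<Longrightarrow> sq_int M Z \<Longrightarrow>
      (\<integral>\<omega>. Z \<omega> *\<^sub>R sol (\<lambda>s. \<beta> s \<omega>) t \<partial>M) = sol (\<lambda>s. \<integral>\<omega>. Z \<omega> *\<^sub>R \<beta> s \<omega> \<partial>M) t"
proof -
  obtain x where x: "state_version \<beta> x" using state_version_exists[OF \<beta>] ..
  obtain x0 where x0: "state_version (\<lambda>t \<omega>. 0) x0" using state_version_exists[OF H2_zero] ..
  have ae: "AE \<omega> in M. \<forall>t\<in>{0..T}. x \<omega> t - x0 \<omega> t = sol (\<lambda>s. \<beta> s \<omega>) t"
    using state_diff_sol[OF \<beta> H2_zero] state_versionD(4)[OF x] state_versionD(4)[OF x0]
    by eventually_elim auto
  show sM: "sq_int M (\<lambda>\<omega>. sol (\<lambda>s. \<beta> s \<omega>) t)" if t: "t \<in> {0..T}" for t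
  proof -
    have d: "sq_int M (\<lambda>\<omega>. x \<omega> t - x0 \<omega> t)"
      by (rule sq_int_diff[OF state_versionD(2)[OF x t] state_versionD(2)[OF x0 t]])
    have ae': "AE \<omega> in M. x \<omega> t - x0 \<omega> t = sol (\<lambda>s. \<beta> s \<omega>) t" using ae by eventually_elim (use t in auto)
    show ?thesis
      by (rule sq_int_cong_AE[OF d complete_measure.borel_measurable_AE_eq[OF complete_M sq_int_measurable[OF d] ae'] ae'])
  qed
  show sN: "sq_int N (\<lambda>z. sol (\<lambda>s. \<beta> s (fst z)) (snd z))"
  proof (rule sq_int_cong_AE[OF sq_int_diff[OF state_versionD(3)[OF x] state_versionD(3)[OF x0]]])
    show "(\<lambda>z. sol (\<lambda>s. \<beta> s (fst z)) (snd z)) \<in> borel_measurable N"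
      using measurable_continuous_paths[OF T_pos, of M "\<lambda>\<omega>. sol (\<lambda>s. \<beta> s \<omega>)"] sol_continuous sq_int_measurable[OF sM]
      by (simp add: case_prod_unfold)
    have "AE z in N. \<forall>t\<in>{0..T}. x (fst z) t - x0 (fst z) t = sol (\<lambda>s. \<beta> s (fst z)) t"
      by (rule AE_N_omega[OF ae])
    then show "AE z in N. x (fst z) (snd z) - x0 (fst z) (snd z) = sol (\<lambda>s. \<beta> s (fst z)) (snd z)"
      by (rule AE_mp) (auto intro!: AE_I2 simp: space_pair_measure)
  qed
  assume t: "t \<in> {0..T}" and Z: "sq_int M Z"
  note bN = control_l2[OF \<beta>]
  define e where "e t = (\<integral>\<omega>. Z \<omega> *\<^sub>R sol (\<lambda>s. \<beta> s \<omega>) t \<partial>M)" for t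
  define v where "v s = (\<integral>\<omega>. Z \<omega> *\<^sub>R \<beta> s \<omega> \<partial>M)" for s
  have e: "sq_int L e" and v: "sq_int L v"
    unfolding e_def[abs_def] v_def[abs_def] using sq_int_time_integral[OF sN Z] sq_int_time_integral[OF bN Z] by simp_all
  have e_eq: "e t = drift e v t" if t: "t \<in> {0..T}" for t
  proof -
    have ae2: "AE \<omega> in M. sol (\<lambda>s. \<beta> s \<omega>) t = drift (sol (\<lambda>s. \<beta> s \<omega>)) (\<lambda>s. \<beta> s \<omega>) t"
      using H2_AE_path[OF \<beta>] by eventually_elim (use sol_ode t in \<open>auto simp: ode_def\<close>)
    note dt = drift_test[where x = "\<lambda>\<omega>. sol (\<lambda>s. \<beta> s \<omega>)" and u = "\<lambda>\<omega> s. \<beta> s \<omega>", OF sN bN Z t]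
    have "e t = (\<integral>\<omega>. Z \<omega> *\<^sub>R drift (sol (\<lambda>s. \<beta> s \<omega>)) (\<lambda>s. \<beta> s \<omega>) t \<partial>M)"
      unfolding e_def
    proof (rule integral_cong_AE)
      show "(\<lambda>\<omega>. Z \<omega> *\<^sub>R sol (\<lambda>s. \<beta> s \<omega>) t) \<in> borel_measurable M"
        by (intro borel_measurable_scaleR sq_int_measurable[OF Z] sq_int_measurable[OF sM[OF t]])
      show "(\<lambda>\<omega>. Z \<omega> *\<^sub>R drift (sol (\<lambda>s. \<beta> s \<omega>)) (\<lambda>s. \<beta> s \<omega>) t) \<in> borel_measurable M"
        by (intro borel_measurable_scaleR sq_int_measurable[OF Z] sq_int_measurable[OF dt(2)])
    qed (use ae2 in \<open>eventually_elim, simp\<close>)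
    then show ?thesis using dt(1) by (simp add: e_def[abs_def] v_def[abs_def])
  qed
  have "ode v e" unfolding ode_def
  proof (intro conjI ballI e_eq)
    show "continuous_on {0..T} e"
      by (rule continuous_on_eq[OF drift_continuous[OF e v]]) (use e_eq in auto)
  qed
  from sol_eq[OF v this t] show "(\<integral>\<omega>. Z \<omega> *\<^sub>R sol (\<lambda>s. \<beta> s \<omega>) t \<partial>M) = sol (\<lambda>s. \<integral>\<omega>. Z \<omega> *\<^sub>R \<beta> s \<omega> \<partial>M) t"
    by (simp add: e_def v_def[abs_def])
qed

end

section \<open>Consistent flows\<close>

text \<open>The first two facts are conditional Jensen's inequality for the square.\<close>

lemma cond_exp_sq_int:
  fixes f :: "'x \<Rightarrow> real"
  assumes K: "finite_measure K" and H: "subalgebra K H" and f: "sq_int K f"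
  shows "sq_int K (real_cond_exp K H f)"
    and "(\<integral>x. (real_cond_exp K H f x)\<^sup>2 \<partial>K) \<le> (\<integral>x. (f x)\<^sup>2 \<partial>K)"
    and "sq_int K h \<Longrightarrow> h \<in> borel_measurable H \<Longrightarrow> (\<integral>x. h x * real_cond_exp K H f x \<partial>K) = (\<integral>x. h x * f x \<partial>K)"
proof -
  interpret finite_measure K by fact
  interpret finite_measure_subalgebra K H by standard fact
  have if': "integrable K f" by (rule sq_int_integrable[OF K f])
  have i2: "integrable K (\<lambda>x. (f x)\<^sup>2)" using sq_int_norm[OF f] by simp
  have cv: "convex_on UNIV (\<lambda>x :: real. x\<^sup>2)" by (rule convex_power2)
  have ir: "integrable K (\<lambda>x. (real_cond_exp K H f x)\<^sup>2)"
    by (rule integrable_convex_cond_exp[OF if' _ _ i2 cv]) auto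
  show "sq_int K (real_cond_exp K H f)" unfolding sq_int_def using ir by simp
  have "(\<integral>x. (real_cond_exp K H f x)\<^sup>2 \<partial>K) \<le> (\<integral>x. real_cond_exp K H (\<lambda>x. (f x)\<^sup>2) x \<partial>K)"
    by (rule integral_mono_AE[OF ir real_cond_exp_int(1)[OF i2]])
      (rule real_cond_exp_jensens_inequality(2)[OF if' _ _ i2 cv], auto)
  also have "\<dots> = (\<integral>x. (f x)\<^sup>2 \<partial>K)" by (rule real_cond_exp_int(2)[OF i2])
  finally show "(\<integral>x. (real_cond_exp K H f x)\<^sup>2 \<partial>K) \<le> (\<integral>x. (f x)\<^sup>2 \<partial>K)" .
  assume h: "sq_int K h" "h \<in> borel_measurable H"
  have "integrable K (\<lambda>x. h x * f x)" using sq_int_scaleR_fun[OF h(1) f] by simp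
  then show "(\<integral>x. h x * real_cond_exp K H f x \<partial>K) = (\<integral>x. h x * f x \<partial>K)"
    by (rule real_cond_exp_intg(2)) (use h f in \<open>auto dest: sq_int_measurable\<close>)
qed

lemma borel_measurable_vecI:
  fixes f :: "'x \<Rightarrow> real ^ 'n"
  assumes "\<And>i. (\<lambda>x. f x $ i) \<in> borel_measurable M"
  shows "f \<in> borel_measurable M"
proof -
  have "(\<lambda>x. \<Sum>i\<in>UNIV. (f x $ i) *\<^sub>R (axis i 1 :: real ^ 'n)) \<in> borel_measurable M"
    using assms by measurable
  moreover have "(\<Sum>i\<in>UNIV. (f x $ i) *\<^sub>R (axis i 1 :: real ^ 'n)) = f x" for x
    using basis_expansion[of "f x"] by (simp only: scalar_mult_eq_scaleR)
  ultimately show ?thesis by simp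
qed

lemma borel_measurable_nth: "f \<in> borel_measurable M \<Longrightarrow> (\<lambda>x. f x $ i :: real) \<in> borel_measurable M"
  by (rule measurable_compose[OF _ borel_measurable_vec_nth])

text \<open>Built coordinate by coordinate. The measure is taken finite because it will be the
  product measure \<open>N\<close>, whose mass is \<open>T\<close>.\<close>

lemma cond_exp_vec:
  fixes f :: "'x \<Rightarrow> real ^ 'n"
  assumes K: "finite_measure K" and H: "subalgebra K H" and f: "sq_int K f"
  obtains g :: "'x \<Rightarrow> real ^ 'n" where "g \<in> borel_measurable H" "sq_int K g"
    "\<And>\<phi>. sq_int K \<phi> \<Longrightarrow> \<phi> \<in> borel_measurable H \<Longrightarrow> (\<integral>x. \<phi> x \<bullet> (f x - g x) \<partial>K) = 0"
proof
  interpret finite_measure K by fact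
  interpret finite_measure_subalgebra K H by standard fact
  define g :: "'x \<Rightarrow> real ^ 'n" where "g x = (\<chi> i. real_cond_exp K H (\<lambda>y. f y $ i) x)" for x
  note fi = sq_int_vec_nth[OF f]
  show "g \<in> borel_measurable H" by (rule borel_measurable_vecI) (simp add: g_def)
  show sg: "sq_int K g" by (rule sq_int_vec) (simp add: g_def cond_exp_sq_int(1)[OF K H fi])
  fix \<phi> :: "'x \<Rightarrow> real ^ 'n" assume \<phi>: "sq_int K \<phi>" "\<phi> \<in> borel_measurable H"
  have i: "integrable K (\<lambda>x. \<phi> x $ i * f x $ i)" "integrable K (\<lambda>x. \<phi> x $ i * g x $ i)" for i
    using sq_int_scaleR_fun[OF sq_int_vec_nth[OF \<phi>(1)] fi, of i i]
      sq_int_scaleR_fun[OF sq_int_vec_nth[OF \<phi>(1)] sq_int_vec_nth[OF sg], of i i] by simp_all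
  have "(\<integral>x. \<phi> x \<bullet> (f x - g x) \<partial>K) = (\<Sum>i\<in>UNIV. (\<integral>x. \<phi> x $ i * f x $ i \<partial>K) - (\<integral>x. \<phi> x $ i * g x $ i \<partial>K))"
    using i by (simp add: inner_vec_def right_diff_distrib)
  also have "\<dots> = 0"
  proof (intro sum.neutral ballI)
    fix i
    show "(\<integral>x. \<phi> x $ i * f x $ i \<partial>K) - (\<integral>x. \<phi> x $ i * g x $ i \<partial>K) = 0"
      using cond_exp_sq_int(3)[OF K H fi sq_int_vec_nth[OF \<phi>(1)] borel_measurable_nth[OF \<phi>(2)], of i i]
      by (simp add: g_def)
  qed
  finally show "(\<integral>x. \<phi> x \<bullet> (f x - g x) \<partial>K) = 0" .
qed

text \<open>A function that is measurable for \<open>H\<close> and orthogonal to \<open>H\<close> is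
  orthogonal to itself.\<close>

lemma AE_zero_if_orth:
  fixes h :: "'x \<Rightarrow> 'b::euclidean_space"
  assumes M: "prob_space M" and H: "subalgebra M H" and h: "sq_int M h" "h \<in> borel_measurable H"
    and z: "\<And>C. C \<in> sets H \<Longrightarrow> (\<integral>x. indicator C x *\<^sub>R h x \<partial>M) = 0"
  shows "AE x in M. h x = 0"
proof -
  interpret prob_space M by fact
  have "AE x in M. h x \<bullet> b = 0" for b
  proof -
    have sb: "sq_int M (\<lambda>x. h x \<bullet> b)" by (rule sq_int_bounded_linear[OF h(1) bounded_linear_inner_left])
    have mb: "(\<lambda>x. h x \<bullet> b) \<in> borel_measurable H" using h(2) by measurable
    have "orth M H (\<lambda>x. h x \<bullet> b)" unfolding orth_def
    proof (intro conjI ballI)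
      show "integrable M (\<lambda>x. h x \<bullet> b)" by (rule sq_int_integrable[OF finite_measure_axioms sb])
      fix C assume C: "C \<in> sets H"
      then have CM: "C \<in> sets M" using H by (auto simp: subalgebra_def)
      have "(\<integral>x. indicator C x * (h x \<bullet> b) \<partial>M) = (\<integral>x. (indicator C x *\<^sub>R h x) \<bullet> b \<partial>M)" by simp
      also have "\<dots> = (\<integral>x. indicator C x *\<^sub>R h x \<partial>M) \<bullet> b"
        by (intro integral_inner_left integrable_mult_indicator CM sq_int_integrable[OF finite_measure_axioms h(1)])
      finally show "(\<integral>x. indicator C x * (h x \<bullet> b) \<partial>M) = 0" using z[OF C] by simp
    qed
    from orth_integral[OF M H this sb sb mb] have "(\<integral>x. (h x \<bullet> b)\<^sup>2 \<partial>M) = 0" by (simp add: power2_eq_square)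
    then have "AE x in M. (h x \<bullet> b)\<^sup>2 = 0"
      using integral_nonneg_eq_0_iff_AE[OF sq_int_norm[OF sb]] by simp
    then show ?thesis by eventually_elim simp
  qed
  then have "AE x in M. \<forall>b\<in>Basis. h x \<bullet> b = 0" by (subst AE_finite_all) auto
  then show ?thesis by eventually_elim (auto intro: euclidean_eqI)
qed

context lq_setting
begin

lemma sq_int_N_dominated:
  assumes f: "f \<in> borel_measurable N" and g: "sq_int N g"
    and i: "\<And>t. t \<in> {0..T} \<Longrightarrow> sq_int M (\<lambda>\<omega>. f (\<omega>, t)) \<and> sq_int M (\<lambda>\<omega>. g (\<omega>, t)) \<and>
      (\<integral>\<omega>. (norm (f (\<omega>, t)))\<^sup>2 \<partial>M) \<le> (\<integral>\<omega>. (norm (g (\<omega>, t)))\<^sup>2 \<partial>M)"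
  shows "sq_int N f"
  unfolding sq_int_def
proof
  show "integrable N (\<lambda>z. (norm (f z))\<^sup>2)"
  proof (rule integrableI_nonneg)
    note nf = measurable_compose[OF borel_measurable_norm_power2[OF f] measurable_ennreal]
    note ng = measurable_compose[OF borel_measurable_norm_power2[OF sq_int_measurable[OF g]] measurable_ennreal]
    have "(\<integral>\<^sup>+z. ennreal ((norm (f z))\<^sup>2) \<partial>N) = (\<integral>\<^sup>+t. (\<integral>\<^sup>+\<omega>. ennreal ((norm (f (\<omega>, t)))\<^sup>2) \<partial>M) \<partial>L)"
      by (rule pr.nn_integral_snd[OF nf, symmetric])
    also have "\<dots> \<le> (\<integral>\<^sup>+t. (\<integral>\<^sup>+\<omega>. ennreal ((norm (g (\<omega>, t)))\<^sup>2) \<partial>M) \<partial>L)"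
    proof (rule nn_integral_mono)
      fix t assume "t \<in> space L"
      then have t: "t \<in> {0..T}" by simp
      have "(\<integral>\<^sup>+\<omega>. ennreal ((norm (f (\<omega>, t)))\<^sup>2) \<partial>M) = ennreal (\<integral>\<omega>. (norm (f (\<omega>, t)))\<^sup>2 \<partial>M)"
        using i[OF t] by (intro nn_integral_eq_integral sq_int_norm) auto
      also have "\<dots> \<le> ennreal (\<integral>\<omega>. (norm (g (\<omega>, t)))\<^sup>2 \<partial>M)" using i[OF t] by (intro ennreal_leI) auto
      also have "\<dots> = (\<integral>\<^sup>+\<omega>. ennreal ((norm (g (\<omega>, t)))\<^sup>2) \<partial>M)"
        using i[OF t] by (intro nn_integral_eq_integral[symmetric] sq_int_norm) auto
      finally show "(\<integral>\<^sup>+\<omega>. ennreal ((norm (f (\<omega>, t)))\<^sup>2) \<partial>M) \<le> (\<integral>\<^sup>+\<omega>. ennreal ((norm (g (\<omega>, t)))\<^sup>2) \<partial>M)" .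
    qed
    also have "\<dots> = (\<integral>\<^sup>+z. ennreal ((norm (g z))\<^sup>2) \<partial>N)"
      by (rule pr.nn_integral_snd[OF ng])
    also have "\<dots> < \<infinity>"
      using nn_integral_eq_integral[OF sq_int_norm[OF g]] by simp
    finally show "(\<integral>\<^sup>+z. ennreal ((norm (f z))\<^sup>2) \<partial>N) < \<infinity>" .
  qed (simp_all add: borel_measurable_norm_power2[OF f])
qed fact

end

section \<open>Deviation of a consistent flow from the mean path of a noise-adapted control\<close>

locale consistent_flow = lq_setting P D X
  for P :: "('a, 'd::finite) stoch_basis" and D :: "('d, 'k::finite) lq_data" and X +
  fixes \<alpha> lam :: "real \<Rightarrow> 'a \<Rightarrow> real ^ 'k" and mu :: "real \<Rightarrow> 'a \<Rightarrow> real ^ 'd"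
    and xa x :: "'a \<Rightarrow> real \<Rightarrow> real ^ 'd"
  assumes \<alpha>: "\<alpha> \<in> H2 M T F1" and lam: "lam \<in> H2 M T F"
    and xa: "state_version \<alpha> xa" and x: "state_version lam x"
    and mu_cont: "\<And>\<omega>. \<omega> \<in> space M \<Longrightarrow> continuous_on {0..T} (\<lambda>t. mu t \<omega>)"
    and mu_F0: "\<And>t. t \<in> {0..T} \<Longrightarrow> mu t \<in> borel_measurable (F 0)"
    and mu_indep: "indep_set (sets (sigma_process M T mu)) (sets (sigma_noise P T))"
    and consistent: "\<And>t. t \<in> {0..T} \<Longrightarrow>
      AE \<omega> in M. \<forall>i. mu t \<omega> $ i = real_cond_exp M (sigma_process M T mu) (\<lambda>\<omega>'. X lam t \<omega>' $ i) \<omega>"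
begin

abbreviation "G \<equiv> sigma_process M T mu"
text \<open>Relative to the reference control \<alpha> and its mean path \<open>m\<close>, the
  deviations are \<delta> for the flow, \<beta> for the control and \<open>Y\<close> for the state.
  \<open>Y\<close> is defined through \<open>sol\<close>, so it is the difference of the states only
  almost surely.\<close>

definition "m t = (\<integral>\<omega>. xa \<omega> t \<partial>M)"
definition "\<delta> \<omega> t = mu t \<omega> - m t"
definition "\<beta> t \<omega> = lam t \<omega> - \<alpha> t \<omega>"
definition "Y \<omega> = sol (\<lambda>s. \<beta> s \<omega>)"

lemma \<alpha>_F: "\<alpha> \<in> H2 M T F" using \<alpha> H2_F1_F by blast

lemma \<beta>_F: "\<beta> \<in> H2 M T F"
  using H2_lin[OF filtration_F lam \<alpha>_F, of "-1"] by (simp add: \<beta>_def[abs_def])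

lemma Y_eq: "AE \<omega> in M. \<forall>t\<in>{0..T}. x \<omega> t = xa \<omega> t + Y \<omega> t"
  using state_diff_sol[OF lam \<alpha>_F] state_versionD(4)[OF xa] state_versionD(4)[OF x]
  by eventually_elim (auto simp: Y_def \<beta>_def algebra_simps)

lemma Y_sq: "t \<in> {0..T} \<Longrightarrow> sq_int M (\<lambda>\<omega>. Y \<omega> t)" "sq_int N (\<lambda>z. Y (fst z) (snd z))"
  unfolding Y_def using sol_process(1,2)[OF \<beta>_F] by blast+

lemma Y_test: "t \<in> {0..T} \<Longrightarrow> sq_int M Z \<Longrightarrow> (\<integral>\<omega>. Z \<omega> *\<^sub>R Y \<omega> t \<partial>M) = sol (\<lambda>s. \<integral>\<omega>. Z \<omega> *\<^sub>R \<beta> s \<omega> \<partial>M) t"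
  unfolding Y_def by (rule sol_process(3)[OF \<beta>_F])

lemma G_subalgebra: "subalgebra M G"
  unfolding subalgebra_def
proof
  have "sets G \<subseteq> sets (F 0)"
    by (rule sigma_process_least) (use mu_F0 F_space[OF T0(1)] in auto)
  then show "sets G \<subseteq> sets M" using F_sets[OF T0(1)] by blast
qed simp

lemma mu_G: "t \<in> {0..T} \<Longrightarrow> mu t \<in> borel_measurable G"
  using sigma_process_measurable[of t T mu] by auto

lemma m_continuous: "continuous_on {0..T} m"
  unfolding m_def[abs_def] by (rule state_mean_continuous[OF \<alpha>_F xa])

lemma \<delta>_continuous: "\<omega> \<in> space M \<Longrightarrow> continuous_on {0..T} (\<delta> \<omega>)"
  unfolding \<delta>_def[abs_def] by (intro continuous_intros mu_cont m_continuous)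

lemma \<delta>_G: "t \<in> {0..T} \<Longrightarrow> (\<lambda>\<omega>. \<delta> \<omega> t) \<in> borel_measurable G"
  unfolding \<delta>_def using mu_G[of t] by simp

lemma \<delta>_GL: "(\<lambda>z. \<delta> (fst z) (snd z)) \<in> borel_measurable (G \<Otimes>\<^sub>M L)"
  using measurable_continuous_paths[OF T_pos, of G \<delta>] \<delta>_continuous \<delta>_G by (simp add: case_prod_unfold)

lemma GL_N: "f \<in> borel_measurable (G \<Otimes>\<^sub>M L) \<Longrightarrow> f \<in> borel_measurable N"
  by (rule measurable_pair_mono_sets) (use G_subalgebra in \<open>auto simp: subalgebra_def\<close>)

lemma consistent_x:
  assumes t: "t \<in> {0..T}"
  shows "AE \<omega> in M. mu t \<omega> $ i = real_cond_exp M G (\<lambda>\<omega>'. x \<omega>' t $ i) \<omega>"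
proof -
  interpret finite_measure_subalgebra M G by standard (rule G_subalgebra)
  have ae: "AE \<omega> in M. X lam t \<omega> $ i = x \<omega> t $ i"
    using state_versionD(4)[OF x] by eventually_elim (use t in auto)
  have mX: "X lam t \<in> borel_measurable M"
    using state_solution[OF lam] t measurable_F unfolding state_solution_def by blast
  have "AE \<omega> in M. real_cond_exp M G (\<lambda>\<omega>'. X lam t \<omega>' $ i) \<omega> = real_cond_exp M G (\<lambda>\<omega>'. x \<omega>' t $ i) \<omega>"
    by (rule real_cond_exp_cong[OF ae borel_measurable_nth[OF mX] borel_measurable_nth[OF sq_int_measurable[OF state_versionD(2)[OF x t]]]])
  with consistent[OF t] show ?thesis by eventually_elim auto
qed

text \<open>Consistency presents each coordinate of \<open>mu t\<close> as a conditional
  expectation, so conditional Jensen bounds its second moment by that of the state. The bound at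
  each time is what makes the flow square-integrable on \<open>N\<close>.\<close>

lemma mu_sq:
  assumes t: "t \<in> {0..T}"
  shows "sq_int M (mu t)" "(\<integral>\<omega>. (norm (mu t \<omega>))\<^sup>2 \<partial>M) \<le> (\<integral>\<omega>. (norm (x \<omega> t))\<^sup>2 \<partial>M)"
    "sq_int M h \<Longrightarrow> h \<in> borel_measurable G \<Longrightarrow> (\<integral>\<omega>. h \<omega> * mu t \<omega> $ i \<partial>M) = (\<integral>\<omega>. h \<omega> * x \<omega> t $ i \<partial>M)"
proof -
  note xi = sq_int_vec_nth[OF state_versionD(2)[OF x t]]
  note ce = cond_exp_sq_int[OF finite_measure_axioms G_subalgebra xi]
  have mM: "mu t \<in> borel_measurable M" by (rule measurable_from_subalg[OF G_subalgebra mu_G[OF t]])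
  have mi: "sq_int M (\<lambda>\<omega>. mu t \<omega> $ i)" for i
    by (rule sq_int_cong_AE[OF ce(1) borel_measurable_nth[OF mM]]) (use consistent_x[OF t, of i] in \<open>eventually_elim, simp\<close>)
  show "sq_int M (mu t)" by (rule sq_int_vec[OF mi])
  have eq: "(\<integral>\<omega>. (mu t \<omega> $ i)\<^sup>2 \<partial>M) \<le> (\<integral>\<omega>. (x \<omega> t $ i)\<^sup>2 \<partial>M)" for i
  proof -
    have "(\<integral>\<omega>. (mu t \<omega> $ i)\<^sup>2 \<partial>M) = (\<integral>\<omega>. (real_cond_exp M G (\<lambda>\<omega>'. x \<omega>' t $ i) \<omega>)\<^sup>2 \<partial>M)"
      by (rule integral_cong_AE)
        (use consistent_x[OF t, of i] sq_int_measurable[OF mi[of i]] sq_int_measurable[OF ce(1)[of i]] in \<open>auto elim!: eventually_mono\<close>)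
    then show ?thesis using ce(2)[of i] by simp
  qed
  have sumsq: "(norm v)\<^sup>2 = (\<Sum>i\<in>UNIV. (v $ i)\<^sup>2)" for v :: "real ^ 'd"
    unfolding power2_norm_eq_inner by (simp add: inner_vec_def power2_eq_square)
  have "integrable M (\<lambda>\<omega>. (mu t \<omega> $ i)\<^sup>2)" "integrable M (\<lambda>\<omega>. (x \<omega> t $ i)\<^sup>2)" for i
    using sq_int_norm[OF mi[of i]] sq_int_norm[OF xi[of i]] by simp_all
  then show "(\<integral>\<omega>. (norm (mu t \<omega>))\<^sup>2 \<partial>M) \<le> (\<integral>\<omega>. (norm (x \<omega> t))\<^sup>2 \<partial>M)"
    unfolding sumsq using eq by (simp add: sum_mono)
  assume h: "sq_int M h" "h \<in> borel_measurable G"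
  have "(\<integral>\<omega>. h \<omega> * mu t \<omega> $ i \<partial>M) = (\<integral>\<omega>. h \<omega> * real_cond_exp M G (\<lambda>\<omega>'. x \<omega>' t $ i) \<omega> \<partial>M)"
    by (rule integral_cong_AE)
      (use consistent_x[OF t, of i] sq_int_measurable[OF mi[of i]] sq_int_measurable[OF ce(1)[of i]] sq_int_measurable[OF h(1)]
        in \<open>auto elim!: eventually_mono\<close>)
  then show "(\<integral>\<omega>. h \<omega> * mu t \<omega> $ i \<partial>M) = (\<integral>\<omega>. h \<omega> * x \<omega> t $ i \<partial>M)" using ce(3)[OF h] by simp
qed

lemma mu_N: "sq_int N (\<lambda>z. mu (snd z) (fst z))"
proof (rule sq_int_N_dominated[OF _ state_versionD(3)[OF x]])
  have "(\<lambda>z. mu (snd z) (fst z)) \<in> borel_measurable (G \<Otimes>\<^sub>M L)"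
    using measurable_continuous_paths[OF T_pos, of G "\<lambda>\<omega> t. mu t \<omega>"] mu_cont mu_G by (simp add: case_prod_unfold)
  then show "(\<lambda>z. mu (snd z) (fst z)) \<in> borel_measurable N" by (rule GL_N)
qed (use mu_sq state_versionD(2)[OF x] in simp)

lemma m_sq: "sq_int L m" by (rule sq_int_continuous[OF m_continuous])

lemma \<delta>_sq: "t \<in> {0..T} \<Longrightarrow> sq_int M (\<lambda>\<omega>. \<delta> \<omega> t)" "sq_int N (\<lambda>z. \<delta> (fst z) (snd z))"
  unfolding \<delta>_def
  using sq_int_diff[OF mu_sq(1) sq_int_const[OF finite_measure_axioms]] sq_int_diff[OF mu_N sq_int_N_time[OF m_sq]] by blast+

text \<open>Independence of flow and noise enters in this form: a centred function of the flow is
  uncorrelated with every noise event, so the orthogonality results for noise-adapted objects apply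
  to it.\<close>

lemma indep_orth:
  assumes h: "sq_int M h" "h \<in> borel_measurable G"
  shows "orth M (sigma_noise P T) (\<lambda>\<omega>. h \<omega> - (\<integral>\<omega>'. h \<omega>' \<partial>M))"
  unfolding orth_def
proof (intro conjI ballI)
  have ih: "integrable M h" by (rule sq_int_integrable[OF finite_measure_axioms h(1)])
  show "integrable M (\<lambda>\<omega>. h \<omega> - (\<integral>\<omega>'. h \<omega>' \<partial>M))" using ih by simp
  fix C assume C: "C \<in> sets (sigma_noise P T)"
  then have CM: "C \<in> sets M" using sigma_noise_subalgebra[OF T0(2)] by (auto simp: subalgebra_def)
  have iC: "integrable M (\<lambda>\<omega>. indicator C \<omega> :: real)" using CM by (simp add: emeasure_eq_measure)
  have "(\<integral>\<omega>. h \<omega> * indicator C \<omega> \<partial>M) = (\<integral>\<omega>. h \<omega> \<partial>M) * (\<integral>\<omega>. indicator C \<omega> \<partial>M)"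
  proof (rule indep_set_expectation[OF G_subalgebra h(2) ih _ _ iC mu_indep])
    show "(\<lambda>\<omega>. indicator C \<omega> :: real) \<in> borel_measurable M" using CM by measurable
    show "preimages M (\<lambda>\<omega>. indicator C \<omega> :: real) \<subseteq> sets (sigma_noise P T)"
      using C by (subst borel_measurable_iff_preimages[symmetric]) auto
  qed
  moreover have "(\<integral>\<omega>. indicator C \<omega> * (h \<omega> - (\<integral>\<omega>'. h \<omega>' \<partial>M)) \<partial>M)
      = (\<integral>\<omega>. h \<omega> * indicator C \<omega> \<partial>M) - (\<integral>\<omega>. h \<omega> \<partial>M) * (\<integral>\<omega>. indicator C \<omega> \<partial>M)"
  proof -
    have "integrable M (\<lambda>\<omega>. h \<omega> * indicator C \<omega>)" by (rule integrable_real_mult_indicator[OF CM ih])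
    then show ?thesis using iC by (simp add: right_diff_distrib mult.commute)
  qed
  ultimately show "(\<integral>\<omega>. indicator C \<omega> * (h \<omega> - (\<integral>\<omega>'. h \<omega>' \<partial>M)) \<partial>M) = 0" by simp
qed

lemma sq_int_centered: "sq_int M h \<Longrightarrow> sq_int M (\<lambda>\<omega>. h \<omega> - (\<integral>\<omega>'. h \<omega>' \<partial>M))"
  by (intro sq_int_diff sq_int_const finite_measure_axioms)

text \<open>After centring, \<open>h\<close> is orthogonal to the noise and therefore to the
  reference state, which is driven by the noise alone; only the product of the means is
  left.\<close>

lemma xa_indep:
  assumes h: "sq_int M h" "h \<in> borel_measurable G" and t: "t \<in> {0..T}"
  shows "(\<integral>\<omega>. h \<omega> *\<^sub>R xa \<omega> t \<partial>M) = (\<integral>\<omega>. h \<omega> \<partial>M) *\<^sub>R m t"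
proof -
  note xt = state_versionD(2)[OF xa t]
  have "(\<integral>\<omega>. (h \<omega> - (\<integral>\<omega>'. h \<omega>' \<partial>M)) *\<^sub>R xa \<omega> t \<partial>M) = 0"
    by (rule orth_state[OF \<alpha> xa sq_int_centered[OF h(1)] indep_orth[OF h] t])
  moreover have "(\<integral>\<omega>. (h \<omega> - (\<integral>\<omega>'. h \<omega>' \<partial>M)) *\<^sub>R xa \<omega> t \<partial>M)
      = (\<integral>\<omega>. h \<omega> *\<^sub>R xa \<omega> t \<partial>M) - (\<integral>\<omega>. h \<omega> \<partial>M) *\<^sub>R m t"
    using sq_int_scaleR_fun[OF h(1) xt] sq_int_integrable[OF finite_measure_axioms xt]
    by (simp add: scaleR_diff_left m_def)
  ultimately show ?thesis by simp
qed

text \<open>Consistency makes \<open>mu t\<close> the conditional expectation of the state given the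
  flow, and independence makes \<open>m t\<close> that of the reference state. Subtracting, \<delta>
  is the conditional expectation of \<open>Y\<close>.\<close>

lemma defect_orth:
  assumes h: "sq_int M h" "h \<in> borel_measurable G" and t: "t \<in> {0..T}"
  shows "(\<integral>\<omega>. h \<omega> *\<^sub>R (Y \<omega> t - \<delta> \<omega> t) \<partial>M) = 0"
proof -
  note xt = state_versionD(2)[OF x t] and xat = state_versionD(2)[OF xa t]
  note i = sq_int_scaleR_fun[OF h(1) xt] sq_int_scaleR_fun[OF h(1) xat] sq_int_scaleR_fun[OF h(1) mu_sq(1)[OF t]]
    sq_int_integrable[OF finite_measure_axioms h(1)]
  have "(\<integral>\<omega>. h \<omega> *\<^sub>R mu t \<omega> \<partial>M) = (\<integral>\<omega>. h \<omega> *\<^sub>R x \<omega> t \<partial>M)"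
  proof (rule vec_eq_iff[THEN iffD2, rule_format])
    fix k
    have "(\<integral>\<omega>. h \<omega> *\<^sub>R mu t \<omega> \<partial>M) $ k = (\<integral>\<omega>. (h \<omega> *\<^sub>R mu t \<omega>) $ k \<partial>M)"
      by (rule integral_bounded_linear[OF bounded_linear_vec_nth i(3), symmetric])
    also have "\<dots> = (\<integral>\<omega>. (h \<omega> *\<^sub>R x \<omega> t) $ k \<partial>M)" using mu_sq(3)[OF t h] by simp
    also have "\<dots> = (\<integral>\<omega>. h \<omega> *\<^sub>R x \<omega> t \<partial>M) $ k"
      by (rule integral_bounded_linear[OF bounded_linear_vec_nth i(1)])
    finally show "(\<integral>\<omega>. h \<omega> *\<^sub>R mu t \<omega> \<partial>M) $ k = (\<integral>\<omega>. h \<omega> *\<^sub>R x \<omega> t \<partial>M) $ k" .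
  qed
  moreover have "(\<integral>\<omega>. h \<omega> *\<^sub>R (Y \<omega> t - \<delta> \<omega> t) \<partial>M)
      = (\<integral>\<omega>. (h \<omega> *\<^sub>R x \<omega> t - h \<omega> *\<^sub>R xa \<omega> t) - (h \<omega> *\<^sub>R mu t \<omega> - h \<omega> *\<^sub>R m t) \<partial>M)"
  proof (rule integral_cong_AE)
    show "(\<lambda>\<omega>. h \<omega> *\<^sub>R (Y \<omega> t - \<delta> \<omega> t)) \<in> borel_measurable M"
      by (intro borel_measurable_scaleR borel_measurable_diff sq_int_measurable[OF h(1)] sq_int_measurable[OF Y_sq(1)[OF t]] sq_int_measurable[OF \<delta>_sq(1)[OF t]])
    show "(\<lambda>\<omega>. (h \<omega> *\<^sub>R x \<omega> t - h \<omega> *\<^sub>R xa \<omega> t) - (h \<omega> *\<^sub>R mu t \<omega> - h \<omega> *\<^sub>R m t)) \<in> borel_measurable M"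
      using i by (intro borel_measurable_integrable) simp
    show "AE \<omega> in M. h \<omega> *\<^sub>R (Y \<omega> t - \<delta> \<omega> t) = (h \<omega> *\<^sub>R x \<omega> t - h \<omega> *\<^sub>R xa \<omega> t) - (h \<omega> *\<^sub>R mu t \<omega> - h \<omega> *\<^sub>R m t)"
      using Y_eq by eventually_elim (use t in \<open>auto simp: \<delta>_def algebra_simps\<close>)
  qed
  ultimately show ?thesis using i xa_indep[OF h t] by simp
qed

lemma mean_\<delta>:
  assumes t: "t \<in> {0..T}"
  shows "(\<integral>\<omega>. \<delta> \<omega> t \<partial>M) = (\<integral>\<omega>. Y \<omega> t \<partial>M)"
  using defect_orth[OF sq_int_const[OF finite_measure_axioms] _ t, of 1]
    sq_int_integrable[OF finite_measure_axioms Y_sq(1)[OF t]] sq_int_integrable[OF finite_measure_axioms \<delta>_sq(1)[OF t]]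
  by simp

lemma defect_orth_inner:
  assumes h: "sq_int M h" "h \<in> borel_measurable G" and t: "t \<in> {0..T}"
  shows "(\<integral>\<omega>. h \<omega> \<bullet> (Y \<omega> t - \<delta> \<omega> t) \<partial>M) = 0"
proof -
  have hi: "(\<integral>\<omega>. h \<omega> $ i * (Y \<omega> t - \<delta> \<omega> t) $ i \<partial>M) = 0"
    and ii: "integrable M (\<lambda>\<omega>. h \<omega> $ i * (Y \<omega> t - \<delta> \<omega> t) $ i)" for i
  proof -
    have s: "sq_int M (\<lambda>\<omega>. Y \<omega> t - \<delta> \<omega> t)" by (intro sq_int_diff Y_sq \<delta>_sq t)
    have I: "integrable M (\<lambda>\<omega>. h \<omega> $ i *\<^sub>R (Y \<omega> t - \<delta> \<omega> t))"
      by (rule sq_int_scaleR_fun[OF sq_int_vec_nth[OF h(1)] s])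
    have "(\<integral>\<omega>. (h \<omega> $ i *\<^sub>R (Y \<omega> t - \<delta> \<omega> t)) $ i \<partial>M) = (\<integral>\<omega>. h \<omega> $ i *\<^sub>R (Y \<omega> t - \<delta> \<omega> t) \<partial>M) $ i"
      by (rule integral_bounded_linear[OF bounded_linear_vec_nth I])
    then show "(\<integral>\<omega>. h \<omega> $ i * (Y \<omega> t - \<delta> \<omega> t) $ i \<partial>M) = 0"
      using defect_orth[OF sq_int_vec_nth[OF h(1)] borel_measurable_nth[OF h(2)] t, of i] by simp
    show "integrable M (\<lambda>\<omega>. h \<omega> $ i * (Y \<omega> t - \<delta> \<omega> t) $ i)"
      using integrable_bounded_linear[OF bounded_linear_vec_nth I, of i] by simp
  qed
  have "(\<integral>\<omega>. h \<omega> \<bullet> (Y \<omega> t - \<delta> \<omega> t) \<partial>M) = (\<integral>\<omega>. (\<Sum>i\<in>UNIV. h \<omega> $ i * (Y \<omega> t - \<delta> \<omega> t) $ i) \<partial>M)"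
    by (simp only: inner_vec_def inner_real_def)
  also have "\<dots> = (\<Sum>i\<in>UNIV. (\<integral>\<omega>. h \<omega> $ i * (Y \<omega> t - \<delta> \<omega> t) $ i \<partial>M))"
    using ii by (rule Bochner_Integration.integral_sum)
  finally show ?thesis using hi by simp
qed

text \<open>Joint measurability with respect to the flow and time makes each time slice of
  \<open>h\<close> a function of the flow, so the statement at a fixed time applies under the time
  integral.\<close>

lemma defect_orth_N:
  assumes h: "sq_int N h" "h \<in> borel_measurable (G \<Otimes>\<^sub>M L)"
  shows "(\<integral>z. h z \<bullet> (Y (fst z) (snd z) - \<delta> (fst z) (snd z)) \<partial>N) = 0"
proof -
  have i: "integrable N (\<lambda>z. h z \<bullet> (Y (fst z) (snd z) - \<delta> (fst z) (snd z)))"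
    by (intro sq_int_inner h(1) sq_int_diff Y_sq \<delta>_sq)
  then have c: "integrable N (case_prod (\<lambda>\<omega> t. h (\<omega>, t) \<bullet> (Y \<omega> t - \<delta> \<omega> t)))" by (simp add: case_prod_unfold)
  have "(\<integral>z. h z \<bullet> (Y (fst z) (snd z) - \<delta> (fst z) (snd z)) \<partial>N) = (\<integral>t. (\<integral>\<omega>. h (\<omega>, t) \<bullet> (Y \<omega> t - \<delta> \<omega> t) \<partial>M) \<partial>L)"
    using pr.integral_snd[OF c] by (simp add: case_prod_unfold)
  also have "\<dots> = 0"
  proof (rule integral_eq_zero_AE)
    show "AE t in L. (\<integral>\<omega>. h (\<omega>, t) \<bullet> (Y \<omega> t - \<delta> \<omega> t) \<partial>M) = 0"
      using l2_AE_time[OF h(1)]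
    proof (rule AE_mp, intro AE_I2 impI)
      fix t assume t: "t \<in> space L" "sq_int M (\<lambda>\<omega>. h (\<omega>, t))"
      have "(\<lambda>\<omega>. h (\<omega>, t)) \<in> borel_measurable G" by (rule measurable_Pair1[OF h(2) t(1)])
      then show "(\<integral>\<omega>. h (\<omega>, t) \<bullet> (Y \<omega> t - \<delta> \<omega> t) \<partial>M) = 0" using defect_orth_inner[OF t(2)] t(1) by simp
    qed
  qed
  finally show ?thesis .
qed

text \<open>The conditional control is a conditional expectation on the product space, which makes it
  jointly measurable.\<close>

lemma conditional_control:
  obtains b :: "'a \<Rightarrow> real \<Rightarrow> real ^ 'k" where "(\<lambda>z. b (fst z) (snd z)) \<in> borel_measurable (G \<Otimes>\<^sub>M L)"
    "sq_int N (\<lambda>z. b (fst z) (snd z))"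
    "\<And>\<phi>. sq_int N \<phi> \<Longrightarrow> \<phi> \<in> borel_measurable (G \<Otimes>\<^sub>M L) \<Longrightarrow> (\<integral>z. \<phi> z \<bullet> (\<beta> (snd z) (fst z) - b (fst z) (snd z)) \<partial>N) = 0"
    "AE \<omega> in M. sq_int L (b \<omega>) \<and> (\<forall>t\<in>{0..T}. \<delta> \<omega> t = sol (b \<omega>) t)"
proof -
  have sub: "subalgebra N (G \<Otimes>\<^sub>M L)"
    unfolding subalgebra_def
  proof
    show "sets (G \<Otimes>\<^sub>M L) \<subseteq> sets N"
    proof
      fix S assume S: "S \<in> sets (G \<Otimes>\<^sub>M L)"
      have "(indicator S :: _ \<Rightarrow> real) \<in> borel_measurable (G \<Otimes>\<^sub>M L)" using S by measurable
      then have "(indicator S :: _ \<Rightarrow> real) \<in> borel_measurable N"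
        by (rule measurable_pair_mono_sets) (use G_subalgebra in \<open>auto simp: subalgebra_def\<close>)
      moreover have "S \<subseteq> space N" using sets.sets_into_space[OF S] by (simp add: space_pair_measure)
      ultimately show "S \<in> sets N" by (simp add: borel_measurable_indicator_iff Int_absorb2)
    qed
  qed (simp add: space_pair_measure)
  obtain g where g: "g \<in> borel_measurable (G \<Otimes>\<^sub>M L)" "sq_int N g"
    "\<And>\<phi>. sq_int N \<phi> \<Longrightarrow> \<phi> \<in> borel_measurable (G \<Otimes>\<^sub>M L) \<Longrightarrow> (\<integral>z. \<phi> z \<bullet> (\<beta> (snd z) (fst z) - g z) \<partial>N) = 0"
    using cond_exp_vec[OF finite_measure_N sub control_l2[OF \<beta>_F]] by blast
  define b where "b \<omega> s = g (\<omega>, s)" for \<omega> s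
  have g_eq: "g = (\<lambda>z. b (fst z) (snd z))" by (simp add: b_def)
  note bm = g(1)[unfolded g_eq] and bs = g(2)[unfolded g_eq] and bo = g(3)[unfolded g_eq]
  \<comment> \<open>Measurability for the flow is needed here: the defect \<open>h\<close> of the
    equation is shown to vanish by testing it against events of the flow only.\<close>
  have drift_G: "(\<lambda>\<omega>. drift (\<delta> \<omega>) (b \<omega>) t) \<in> borel_measurable G" if t: "t \<in> {0..T}" for t
  proof -
    have A: "A \<in> borel_measurable L" by (rule A_bound)
    have B: "B \<in> borel_measurable L" by (rule B_bound)
    have ind: "(\<lambda>s. indicator {0..t} s :: real) \<in> borel_measurable L" using Icc_sets_L[OF t] by measurable
    have "case_prod (\<lambda>\<omega> s. indicator {0..t} s *\<^sub>R (A s *v \<delta> \<omega> s + B s *v b \<omega> s)) \<in> borel_measurable (G \<Otimes>\<^sub>M L)"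
      unfolding case_prod_unfold
      by (intro borel_measurable_scaleR borel_measurable_add borel_measurable_matrix_vector_mult \<delta>_GL bm
          measurable_compose[OF measurable_snd A] measurable_compose[OF measurable_snd B] measurable_compose[OF measurable_snd ind])
    then show ?thesis unfolding drift_def by (rule L.borel_measurable_lebesgue_integral)
  qed
  have point: "AE \<omega> in M. \<delta> \<omega> t = drift (\<delta> \<omega>) (b \<omega>) t" if t: "t \<in> {0..T}" for t
  proof -
    note dt = drift_test[where x = \<delta> and u = b, OF \<delta>_sq(2) bs _ t]
    have one: "sq_int M (\<lambda>_. 1 :: real)" by (rule sq_int_const[OF finite_measure_axioms])
    define h where "h \<omega> = \<delta> \<omega> t - drift (\<delta> \<omega>) (b \<omega>) t" for \<omega>
    have hs: "sq_int M h" unfolding h_def[abs_def] by (intro sq_int_diff \<delta>_sq(1)[OF t] dt(2)[OF one])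
    have hG: "h \<in> borel_measurable G" unfolding h_def[abs_def] by (intro borel_measurable_diff \<delta>_G[OF t] drift_G[OF t])
    have "AE \<omega> in M. h \<omega> = 0"
    proof (rule AE_zero_if_orth[OF prob_space_M G_subalgebra hs hG])
      fix C assume C: "C \<in> sets G"
      then have CM: "C \<in> sets M" using G_subalgebra by (auto simp: subalgebra_def)
      define Z :: "'a \<Rightarrow> real" where "Z \<omega> = indicator C \<omega>" for \<omega>
      have Z: "sq_int M Z" unfolding Z_def[abs_def] using sq_int_indicator_scaleR[OF one CM] by simp
      have ZG: "Z \<in> borel_measurable G" unfolding Z_def[abs_def] using C by measurable
      define e where "e s = (\<integral>\<omega>. Z \<omega> *\<^sub>R \<delta> \<omega> s \<partial>M)" for s
      define v where "v s = (\<integral>\<omega>. Z \<omega> *\<^sub>R \<beta> s \<omega> \<partial>M)" for s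
      define v' where "v' s = (\<integral>\<omega>. Z \<omega> *\<^sub>R b \<omega> s \<partial>M)" for s
      have vs: "sq_int L v" "sq_int L v'" "sq_int L e"
        unfolding v_def[abs_def] v'_def[abs_def] e_def[abs_def]
        using sq_int_time_integral[OF control_l2[OF \<beta>_F] Z] sq_int_time_integral[OF bs Z] sq_int_time_integral[OF \<delta>_sq(2) Z] by simp_all
      \<comment> \<open>Against events of the flow \<delta> and \<open>Y\<close> have the same
        integrals, and \<open>Y\<close> solves the equation driven by \<beta>; so the tested
        \<delta> solves the equation driven by the tested \<beta>.\<close>
      have e_sol: "e s = sol v s" if s: "s \<in> {0..T}" for s
      proof -
        have "e s = (\<integral>\<omega>. Z \<omega> *\<^sub>R Y \<omega> s \<partial>M)"
          using defect_orth[OF Z ZG s] sq_int_scaleR_fun[OF Z Y_sq(1)[OF s]] sq_int_scaleR_fun[OF Z \<delta>_sq(1)[OF s]]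
          by (simp add: e_def scaleR_diff_right)
        then show ?thesis using Y_test[OF s Z] by (simp add: v_def[abs_def])
      qed
      \<comment> \<open>The conditional control is characterised by integrals over the product
        space, so its agreement with \<beta> after testing is obtained for almost every time. The
        test function \<open>Z\<close> times \<zeta> turns the orthogonality into the vanishing of
        the norm of \<zeta>.\<close>
      have vv: "AE s in L. v s = v' s"
      proof -
        define \<zeta> where "\<zeta> s = v s - v' s" for s
        have \<zeta>: "sq_int L \<zeta>" unfolding \<zeta>_def[abs_def] by (rule sq_int_diff[OF vs(1,2)])
        define \<phi> where "\<phi> z = Z (fst z) *\<^sub>R \<zeta> (snd z)" for z
        have \<phi>m: "\<phi> \<in> borel_measurable (G \<Otimes>\<^sub>M L)"
          unfolding \<phi>_def[abs_def]
          by (intro borel_measurable_scaleR measurable_compose[OF measurable_fst ZG] measurable_compose[OF measurable_snd sq_int_measurable[OF \<zeta>]])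
        have \<phi>s: "sq_int N \<phi>"
          by (rule sq_int_bound[OF sq_int_N_time[OF \<zeta>] GL_N[OF \<phi>m], where C = 1])
            (auto simp: \<phi>_def Z_def indicator_def)
        have i: "integrable N (\<lambda>z. \<phi> z \<bullet> (\<beta> (snd z) (fst z) - b (fst z) (snd z)))"
          by (intro sq_int_inner \<phi>s sq_int_diff control_l2[OF \<beta>_F] bs)
        then have c: "integrable N (case_prod (\<lambda>\<omega> s. \<phi> (\<omega>, s) \<bullet> (\<beta> s \<omega> - b \<omega> s)))" by (simp add: case_prod_unfold)
        have "0 = (\<integral>z. \<phi> z \<bullet> (\<beta> (snd z) (fst z) - b (fst z) (snd z)) \<partial>N)"
          using bo[OF \<phi>s \<phi>m] by simp
        also have "\<dots> = (\<integral>s. (\<integral>\<omega>. \<phi> (\<omega>, s) \<bullet> (\<beta> s \<omega> - b \<omega> s) \<partial>M) \<partial>L)"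
          using pr.integral_snd[OF c] by (simp add: case_prod_unfold)
        also have "\<dots> = (\<integral>s. (norm (\<zeta> s))\<^sup>2 \<partial>L)"
        proof (rule integral_cong_AE)
          show "(\<lambda>s. \<integral>\<omega>. \<phi> (\<omega>, s) \<bullet> (\<beta> s \<omega> - b \<omega> s) \<partial>M) \<in> borel_measurable L"
            by (rule borel_measurable_integrable[OF pr.integrable_snd[OF c]])
          show "(\<lambda>s. (norm (\<zeta> s))\<^sup>2) \<in> borel_measurable L" by (rule borel_measurable_norm_power2[OF sq_int_measurable[OF \<zeta>]])
          show "AE s in L. (\<integral>\<omega>. \<phi> (\<omega>, s) \<bullet> (\<beta> s \<omega> - b \<omega> s) \<partial>M) = (norm (\<zeta> s))\<^sup>2"
            using l2_AE_time[OF control_l2[OF \<beta>_F]] l2_AE_time[OF bs]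
          proof eventually_elim
            case (elim s)
            have ib: "integrable M (\<lambda>\<omega>. Z \<omega> *\<^sub>R \<beta> s \<omega>)" "integrable M (\<lambda>\<omega>. Z \<omega> *\<^sub>R b \<omega> s)"
              using sq_int_scaleR_fun[OF Z] elim by simp_all
            then have id: "integrable M (\<lambda>\<omega>. Z \<omega> *\<^sub>R (\<beta> s \<omega> - b \<omega> s))" by (simp add: scaleR_diff_right)
            have "(\<integral>\<omega>. \<phi> (\<omega>, s) \<bullet> (\<beta> s \<omega> - b \<omega> s) \<partial>M) = (\<integral>\<omega>. (Z \<omega> *\<^sub>R (\<beta> s \<omega> - b \<omega> s)) \<bullet> \<zeta> s \<partial>M)"
              by (simp add: \<phi>_def inner_commute)
            also have "\<dots> = (\<integral>\<omega>. Z \<omega> *\<^sub>R (\<beta> s \<omega> - b \<omega> s) \<partial>M) \<bullet> \<zeta> s" by (rule integral_inner_left[OF id])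
            also have "(\<integral>\<omega>. Z \<omega> *\<^sub>R (\<beta> s \<omega> - b \<omega> s) \<partial>M) = \<zeta> s"
              using ib by (simp add: scaleR_diff_right \<zeta>_def v_def v'_def)
            finally show ?case by (simp add: power2_norm_eq_inner)
          qed
        qed
        finally have "AE s in L. (norm (\<zeta> s))\<^sup>2 = 0"
          using integral_nonneg_eq_0_iff_AE[OF sq_int_norm[OF \<zeta>]] by simp
        then show ?thesis by eventually_elim (simp add: \<zeta>_def)
      qed
      have "e t = drift (sol v) v t" using e_sol[OF t] sol_ode[OF vs(1)] t by (simp add: ode_def)
      also have "\<dots> = drift e v' t"
        unfolding drift_def
      proof (rule integral_cong_AE)
        show "(\<lambda>s. indicator {0..t} s *\<^sub>R (A s *v sol v s + B s *v v s)) \<in> borel_measurable L"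
          "(\<lambda>s. indicator {0..t} s *\<^sub>R (A s *v e s + B s *v v' s)) \<in> borel_measurable L"
          by (intro borel_measurable_integrable integrable_mult_indicator Icc_sets_L[OF t] drift_integrable vs
              sq_int_continuous[OF sol_continuous])+
        show "AE s in L. indicator {0..t} s *\<^sub>R (A s *v sol v s + B s *v v s) = indicator {0..t} s *\<^sub>R (A s *v e s + B s *v v' s)"
          using vv
        proof eventually_elim
          case (elim s)
          then show ?case using e_sol[of s] t by (cases "s \<in> {0..t}") auto
        qed
      qed
      also have "\<dots> = (\<integral>\<omega>. Z \<omega> *\<^sub>R drift (\<delta> \<omega>) (b \<omega>) t \<partial>M)"
        unfolding dt(1)[OF Z] e_def[abs_def] v'_def[abs_def] ..
      finally have eq: "(\<integral>\<omega>. Z \<omega> *\<^sub>R \<delta> \<omega> t \<partial>M) = (\<integral>\<omega>. Z \<omega> *\<^sub>R drift (\<delta> \<omega>) (b \<omega>) t \<partial>M)" by (simp add: e_def)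
      have "(\<integral>\<omega>. Z \<omega> *\<^sub>R h \<omega> \<partial>M) = 0"
        unfolding h_def scaleR_diff_right
        using eq sq_int_scaleR_fun[OF Z \<delta>_sq(1)[OF t]] sq_int_scaleR_fun[OF Z dt(2)[OF one]] by simp
      then show "(\<integral>\<omega>. indicator C \<omega> *\<^sub>R h \<omega> \<partial>M) = 0" by (simp add: Z_def)
    qed
    then show ?thesis by eventually_elim (simp add: h_def)
  qed
  have bp: "AE \<omega> in M. sq_int L (b \<omega>)" using l2_AE_path[OF bs] by simp
  \<comment> \<open>Both sides are almost surely continuous in time, so the null sets of the single
    times merge into one.\<close>
  have "AE \<omega> in M. \<forall>t\<in>{0..T}. \<delta> \<omega> t = drift (\<delta> \<omega>) (b \<omega>) t"
  proof (rule AE_continuous_eq[OF _ _ point])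
    show "AE \<omega> in M. continuous_on {0..T} (\<delta> \<omega>)" by (intro AE_I2 \<delta>_continuous)
    then show "AE \<omega> in M. continuous_on {0..T} (drift (\<delta> \<omega>) (b \<omega>))"
      using bp by eventually_elim (rule drift_continuous[OF sq_int_continuous])
  qed
  with bp AE_space have "AE \<omega> in M. sq_int L (b \<omega>) \<and> (\<forall>t\<in>{0..T}. \<delta> \<omega> t = sol (b \<omega>) t)"
  proof eventually_elim
    case (elim \<omega>)
    have "ode (b \<omega>) (\<delta> \<omega>)" unfolding ode_def using elim \<delta>_continuous by blast
    then show ?case using sol_eq elim by blast
  qed
  from that[OF bm bs bo this] show thesis by blast
qed

end

section \<open>The payoff as a quadratic functional\<close>

type_synonym ('d, 'k) triple = "(real ^ 'd) \<times> (real ^ 'k) \<times> (real ^ 'd)"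
type_synonym 'd duple = "(real ^ 'd) \<times> (real ^ 'd)"

context lq_setting
begin

definition cost_lin :: "real \<Rightarrow> ('d, 'k) triple" where
  "cost_lin t = (- lq_q D t, - lq_r D t, lq_L D t)"

text \<open>On \<open>w = (x, u, m)\<close>, the running reward is \<open>cost_lin t \<bullet> w - cost_op t w \<bullet> w\<close>; the
  operator is not symmetric.\<close>

definition cost_op :: "real \<Rightarrow> ('d, 'k) triple \<Rightarrow> ('d, 'k) triple" where
  "cost_op t w = ((1/2) *\<^sub>R (lq_Q D t *v fst w),
     (1/2) *\<^sub>R (lq_R D t *v fst (snd w)) + lq_S D t *v fst w,
     (1/2) *\<^sub>R (lq_Qbar D t *v snd (snd w)) + lq_Qtilde D t *v fst w)"

definition cost_end :: "'d duple \<Rightarrow> 'd duple" where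
  "cost_end w = ((1/2) *\<^sub>R (lq_H D *v fst w), (1/2) *\<^sub>R (lq_Hbar D *v snd w) + lq_Htilde D *v fst w)"

lemma cost_op_linear: "bounded_linear (cost_op t)"
  unfolding linear_conv_bounded_linear[symmetric]
  by (rule linearI) (simp_all add: cost_op_def matrix_vector_right_distrib matrix_vector_mult_scaleR scaleR_add_right)

lemma cost_end_linear: "bounded_linear cost_end"
  unfolding linear_conv_bounded_linear[symmetric]
  by (rule linearI) (simp_all add: cost_end_def matrix_vector_right_distrib matrix_vector_mult_scaleR scaleR_add_right)

lemma R_bound: obtains C where "C \<ge> 0" "lq_R D \<in> borel_measurable L" "AE t in L. norm (lq_R D t) \<le> C"
proof -
  have c: "continuous_on {0..T} (lq_R D)" using coefficients by (simp add: lq_coefficients_def)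
  have "compact (lq_R D ` {0..T})" by (intro compact_continuous_image c) simp
  then obtain C where C: "\<And>t. t \<in> {0..T} \<Longrightarrow> norm (lq_R D t) \<le> C"
    using compact_imp_bounded bounded_iff by (metis imageI)
  have "lq_R D \<in> borel_measurable L" using sq_int_continuous[OF c] by (rule sq_int_measurable)
  moreover have "AE t in L. norm (lq_R D t) \<le> max C 0" using C by (intro AE_I2) (auto simp: le_max_iff_disj)
  ultimately show thesis using that[of "max C 0"] by simp
qed

lemma mat_bound:
  assumes "C \<ge> 0" "AE t in L. norm (E t) \<le> C"
  shows "\<exists>K\<ge>0. AE t in L. \<forall>v. norm ((E t :: real ^ 'n ^ 'm) *v v) \<le> K * norm v"
proof -
  obtain K where K: "K > 0" "\<And>(A :: real ^ 'n ^ 'm) x. norm (A *v x) \<le> norm A * norm x * K"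
    using matrix_vector_norm_bound by metis
  have "AE t in L. \<forall>v. norm (E t *v v) \<le> (C * K) * norm v"
    using assms(2)
  proof eventually_elim
    case (elim t)
    show ?case
    proof
      fix v
      have "norm (E t *v v) \<le> norm (E t) * norm v * K" by (rule K)
      also have "\<dots> \<le> C * norm v * K" using elim K(1) by (intro mult_right_mono) auto
      finally show "norm (E t *v v) \<le> (C * K) * norm v" by (simp add: ac_simps)
    qed
  qed
  then show ?thesis using assms(1) K(1) by (intro exI[of _ "C * K"]) auto
qed

lemma cost_coeffs_measurable:
  "lq_Q D \<in> borel_measurable L" "lq_Qbar D \<in> borel_measurable L" "lq_Qtilde D \<in> borel_measurable L"
  "lq_S D \<in> borel_measurable L" "lq_R D \<in> borel_measurable L"
  using coefficients R_bound unfolding lq_coefficients_def Linfty_def by blast+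

lemma cost_op_bound:
  obtains K where "K \<ge> 0" "AE t in L. \<forall>w. norm (cost_op t w) \<le> K * norm w"
proof -
  have ex: "\<exists>K\<ge>0. AE t in L. \<forall>v. norm (lq_Q D t *v v) \<le> K * norm v"
    "\<exists>K\<ge>0. AE t in L. \<forall>v. norm (lq_Qbar D t *v v) \<le> K * norm v"
    "\<exists>K\<ge>0. AE t in L. \<forall>v. norm (lq_Qtilde D t *v v) \<le> K * norm v"
    "\<exists>K\<ge>0. AE t in L. \<forall>v. norm (lq_S D t *v v) \<le> K * norm v"
  proof -
    have l: "Linfty T (lq_Q D)" "Linfty T (lq_Qbar D)" "Linfty T (lq_Qtilde D)" "Linfty T (lq_S D)"
      using coefficients by (auto simp: lq_coefficients_def)
    show "\<exists>K\<ge>0. AE t in L. \<forall>v. norm (lq_Q D t *v v) \<le> K * norm v" by (rule Linfty_leb[OF l(1)]) (rule mat_bound)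
    show "\<exists>K\<ge>0. AE t in L. \<forall>v. norm (lq_Qbar D t *v v) \<le> K * norm v" by (rule Linfty_leb[OF l(2)]) (rule mat_bound)
    show "\<exists>K\<ge>0. AE t in L. \<forall>v. norm (lq_Qtilde D t *v v) \<le> K * norm v" by (rule Linfty_leb[OF l(3)]) (rule mat_bound)
    show "\<exists>K\<ge>0. AE t in L. \<forall>v. norm (lq_S D t *v v) \<le> K * norm v" by (rule Linfty_leb[OF l(4)]) (rule mat_bound)
  qed
  obtain K1 where K1: "K1 \<ge> 0" "AE t in L. \<forall>v. norm (lq_Q D t *v v) \<le> K1 * norm v" using ex(1) by blast
  obtain K2 where K2: "K2 \<ge> 0" "AE t in L. \<forall>v. norm (lq_Qbar D t *v v) \<le> K2 * norm v" using ex(2) by blast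
  obtain K3 where K3: "K3 \<ge> 0" "AE t in L. \<forall>v. norm (lq_Qtilde D t *v v) \<le> K3 * norm v" using ex(3) by blast
  obtain K4 where K4: "K4 \<ge> 0" "AE t in L. \<forall>v. norm (lq_S D t *v v) \<le> K4 * norm v" using ex(4) by blast
  obtain K5 where K5: "K5 \<ge> 0" "AE t in L. \<forall>v. norm (lq_R D t *v v) \<le> K5 * norm v"
  proof -
    have "\<exists>K\<ge>0. AE t in L. \<forall>v. norm (lq_R D t *v v) \<le> K * norm v" by (rule R_bound) (rule mat_bound)
    then show thesis using that by blast
  qed
  define K where "K = K1 + K2 + K3 + K4 + K5"
  have "AE t in L. \<forall>w. norm (cost_op t w) \<le> K * norm w"
    using K1(2) K2(2) K3(2) K4(2) K5(2)
  proof eventually_elim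
    case (elim t)
    show ?case
    proof
      fix w :: "('d, 'k) triple"
      have n: "norm (fst w) \<le> norm w" "norm (fst (snd w)) \<le> norm w" "norm (snd (snd w)) \<le> norm w"
        using norm_fst_le[of "fst w" "snd w"] norm_snd_le[of "snd w" "fst w"] norm_fst_le[of "fst (snd w)" "snd (snd w)"]
          norm_snd_le[of "snd (snd w)" "fst (snd w)"] by auto
      have m: "norm (lq_Q D t *v fst w) \<le> K1 * norm w" "norm (lq_Qbar D t *v snd (snd w)) \<le> K2 * norm w"
        "norm (lq_Qtilde D t *v fst w) \<le> K3 * norm w" "norm (lq_S D t *v fst w) \<le> K4 * norm w"
        "norm (lq_R D t *v fst (snd w)) \<le> K5 * norm w"
        by (rule order_trans[OF spec[OF elim(1)] mult_left_mono[OF n(1) K1(1)]]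
            order_trans[OF spec[OF elim(2)] mult_left_mono[OF n(3) K2(1)]]
            order_trans[OF spec[OF elim(3)] mult_left_mono[OF n(1) K3(1)]]
            order_trans[OF spec[OF elim(4)] mult_left_mono[OF n(1) K4(1)]]
            order_trans[OF spec[OF elim(5)] mult_left_mono[OF n(2) K5(1)]])+
      have "norm (cost_op t w) \<le> norm ((1/2) *\<^sub>R (lq_Q D t *v fst w))
          + (norm ((1/2) *\<^sub>R (lq_R D t *v fst (snd w)) + lq_S D t *v fst w)
          + norm ((1/2) *\<^sub>R (lq_Qbar D t *v snd (snd w)) + lq_Qtilde D t *v fst w))"
        unfolding cost_op_def by (intro order_trans[OF norm_Pair_le] add_left_mono norm_Pair_le)
      also have "\<dots> \<le> norm (lq_Q D t *v fst w) + ((norm (lq_R D t *v fst (snd w)) + norm (lq_S D t *v fst w))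
          + (norm (lq_Qbar D t *v snd (snd w)) + norm (lq_Qtilde D t *v fst w)))"
      proof (intro add_mono)
        have half: "norm ((1/2) *\<^sub>R v) \<le> norm v" for v :: "'z::real_normed_vector" by simp
        show "norm ((1/2) *\<^sub>R (lq_Q D t *v fst w)) \<le> norm (lq_Q D t *v fst w)" by (rule half)
        show "norm ((1/2) *\<^sub>R (lq_R D t *v fst (snd w)) + lq_S D t *v fst w)
            \<le> norm (lq_R D t *v fst (snd w)) + norm (lq_S D t *v fst w)"
          by (intro order_trans[OF norm_triangle_ineq] add_right_mono half)
        show "norm ((1/2) *\<^sub>R (lq_Qbar D t *v snd (snd w)) + lq_Qtilde D t *v fst w)
            \<le> norm (lq_Qbar D t *v snd (snd w)) + norm (lq_Qtilde D t *v fst w)"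
          by (intro order_trans[OF norm_triangle_ineq] add_right_mono half)
      qed
      also have "\<dots> \<le> K * norm w" using m by (simp add: K_def algebra_simps)
      finally show "norm (cost_op t w) \<le> K * norm w" .
    qed
  qed
  moreover have "K \<ge> 0" using K1 K2 K3 K4 K5 by (simp add: K_def)
  ultimately show thesis using that by blast
qed

lemma cost_op_measurable:
  assumes f: "f \<in> borel_measurable (H \<Otimes>\<^sub>M L)"
  shows "(\<lambda>z. cost_op (snd z) (f z)) \<in> borel_measurable (H \<Otimes>\<^sub>M L)"
proof -
  note c = cost_coeffs_measurable[THEN measurable_compose[OF measurable_snd]]
  have f1: "(\<lambda>z. fst (f z)) \<in> borel_measurable (H \<Otimes>\<^sub>M L)" "(\<lambda>z. fst (snd (f z))) \<in> borel_measurable (H \<Otimes>\<^sub>M L)"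
    "(\<lambda>z. snd (snd (f z))) \<in> borel_measurable (H \<Otimes>\<^sub>M L)"
    using f by (auto intro!: measurable_compose[OF f] borel_measurable_continuous_onI continuous_intros)
  show ?thesis unfolding cost_op_def
    by (intro borel_measurable_Pair borel_measurable_scaleR borel_measurable_add borel_measurable_const
        borel_measurable_matrix_vector_mult c f1)
qed

lemma cost_op_sq_int:
  assumes f: "sq_int N f"
  shows "sq_int N (\<lambda>z. cost_op (snd z) (f z))"
proof -
  obtain K where K: "K \<ge> 0" "AE t in L. \<forall>w. norm (cost_op t w) \<le> K * norm w" by (rule cost_op_bound)
  show ?thesis
    by (rule sq_int_bound[OF f cost_op_measurable[OF sq_int_measurable[OF f]], where C = K])
      (use AE_N_time[OF K(2)] in \<open>eventually_elim, blast\<close>)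
qed

lemma cost_end_sq_int: "sq_int M f \<Longrightarrow> sq_int M (\<lambda>\<omega>. cost_end (f \<omega>))"
  by (rule sq_int_bounded_linear[OF _ cost_end_linear])

lemma cost_lin_sq_int: "sq_int N (\<lambda>z. cost_lin (snd z))"
proof (rule sq_int_N_time)
  have l: "Linfty T (lq_L D)" "Linfty T (lq_q D)" "Linfty T (lq_r D)"
    using coefficients by (auto simp: lq_coefficients_def)
  have *: "sq_int L f" if f: "Linfty T f" for f :: "real \<Rightarrow> 'z::euclidean_space"
  proof -
    obtain C where C: "C \<ge> 0" "f \<in> borel_measurable L" "AE t in L. norm (f t) \<le> C" by (rule Linfty_leb[OF f])
    show ?thesis
      by (rule sq_int_bound[OF sq_int_const[OF finite_measure_leb, where c = C] C(2), where C = 1]) (use C in auto)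
  qed
  show "sq_int L cost_lin" unfolding cost_lin_def[abs_def]
    by (intro sq_int_Pair sq_int_uminus * l)
qed

text \<open>In the following functionals, the argument \<open>f\<close> is the process on the product space and \<open>fT\<close>
  its terminal value.\<close>

definition bil where
  "bil f fT g gT = (\<integral>z. cost_op (snd z) (f z) \<bullet> g z \<partial>N) + (\<integral>\<omega>. cost_end (fT \<omega>) \<bullet> gT \<omega> \<partial>M)"

definition lin where "lin f = (\<integral>z. cost_lin (snd z) \<bullet> f z \<partial>N)"

definition reward where "reward f fT = lin f - bil f fT f fT"

text \<open>The derivative of \<open>reward\<close> at \<open>f\<close> in the direction
  \<open>g\<close>. As \<open>bil\<close> is not symmetric, both mixed terms appear.\<close>

definition dreward where "dreward f fT g gT = lin g - bil f fT g gT - bil g gT f fT"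

lemma lin_add: "sq_int N f \<Longrightarrow> sq_int N g \<Longrightarrow> lin (\<lambda>z. f z + c *\<^sub>R g z) = lin f + c * lin g"
  unfolding lin_def by (simp add: inner_add_right sq_int_inner cost_lin_sq_int)

lemma bil_add_right:
  assumes "sq_int N f" "sq_int M fT" "sq_int N g" "sq_int M gT" "sq_int N h" "sq_int M hT"
  shows "bil f fT (\<lambda>z. g z + c *\<^sub>R h z) (\<lambda>\<omega>. gT \<omega> + c *\<^sub>R hT \<omega>) = bil f fT g gT + c * bil f fT h hT"
  unfolding bil_def using assms
  by (simp add: inner_add_right sq_int_inner cost_op_sq_int cost_end_sq_int distrib_left)

lemma bil_add_left:
  assumes "sq_int N f" "sq_int M fT" "sq_int N g" "sq_int M gT" "sq_int N h" "sq_int M hT"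
  shows "bil (\<lambda>z. g z + c *\<^sub>R h z) (\<lambda>\<omega>. gT \<omega> + c *\<^sub>R hT \<omega>) f fT = bil g gT f fT + c * bil h hT f fT"
proof -
  have a: "cost_op t (v + c *\<^sub>R w) = cost_op t v + c *\<^sub>R cost_op t w" for t v w
    using cost_op_linear[of t] by (simp add: linear_add linear_scale bounded_linear.linear)
  have b: "cost_end (v + c *\<^sub>R w) = cost_end v + c *\<^sub>R cost_end w" for v w
    using cost_end_linear by (simp add: linear_add linear_scale bounded_linear.linear)
  show ?thesis unfolding bil_def a b using assms
    by (simp add: inner_add_left sq_int_inner cost_op_sq_int cost_end_sq_int distrib_left)
qed

lemma reward_expansion:
  assumes "sq_int N f" "sq_int M fT" "sq_int N g" "sq_int M gT"
  shows "reward (\<lambda>z. f z + c *\<^sub>R g z) (\<lambda>\<omega>. fT \<omega> + c *\<^sub>R gT \<omega>)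
    = reward f fT + c * dreward f fT g gT - c\<^sup>2 * bil g gT g gT"
proof -
  have s: "sq_int N (\<lambda>z. f z + c *\<^sub>R g z)" "sq_int M (\<lambda>\<omega>. fT \<omega> + c *\<^sub>R gT \<omega>)"
    using assms by (auto intro: sq_int_add sq_int_scaleR)
  show ?thesis
    unfolding reward_def dreward_def
    using bil_add_left[OF s assms, of c] bil_add_right[OF assms(1,2,1,2,3,4), of c]
      bil_add_right[OF assms(3,4,1,2,3,4), of c] lin_add[OF assms(1,3), of c]
    by (simp add: algebra_simps power2_eq_square)
qed

lemma dreward_add:
  assumes "sq_int N f" "sq_int M fT" "sq_int N g" "sq_int M gT" "sq_int N h" "sq_int M hT"
  shows "dreward f fT (\<lambda>z. g z + c *\<^sub>R h z) (\<lambda>\<omega>. gT \<omega> + c *\<^sub>R hT \<omega>) = dreward f fT g gT + c * dreward f fT h hT"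
  unfolding dreward_def using bil_add_left[OF assms, of c] bil_add_right[OF assms, of c] lin_add[OF assms(3,5), of c]
  by (simp add: algebra_simps)

lemma bil_cong:
  assumes "sq_int N f" "sq_int M fT" "sq_int N g" "sq_int M gT"
    and "sq_int N f'" "sq_int M fT'" "sq_int N g'" "sq_int M gT'"
    and "AE z in N. f z = f' z" "AE \<omega> in M. fT \<omega> = fT' \<omega>" "AE z in N. g z = g' z" "AE \<omega> in M. gT \<omega> = gT' \<omega>"
  shows "bil f fT g gT = bil f' fT' g' gT'"
proof -
  have "(\<integral>z. cost_op (snd z) (f z) \<bullet> g z \<partial>N) = (\<integral>z. cost_op (snd z) (f' z) \<bullet> g' z \<partial>N)"
  proof (rule integral_cong_AE)
    show "(\<lambda>z. cost_op (snd z) (f z) \<bullet> g z) \<in> borel_measurable N" "(\<lambda>z. cost_op (snd z) (f' z) \<bullet> g' z) \<in> borel_measurable N"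
      by (intro borel_measurable_integrable sq_int_inner cost_op_sq_int assms)+
  qed (use assms(9,11) in \<open>eventually_elim, simp\<close>)
  moreover have "(\<integral>\<omega>. cost_end (fT \<omega>) \<bullet> gT \<omega> \<partial>M) = (\<integral>\<omega>. cost_end (fT' \<omega>) \<bullet> gT' \<omega> \<partial>M)"
  proof (rule integral_cong_AE)
    show "(\<lambda>\<omega>. cost_end (fT \<omega>) \<bullet> gT \<omega>) \<in> borel_measurable M" "(\<lambda>\<omega>. cost_end (fT' \<omega>) \<bullet> gT' \<omega>) \<in> borel_measurable M"
      by (intro borel_measurable_integrable sq_int_inner cost_end_sq_int assms)+
  qed (use assms(10,12) in \<open>eventually_elim, simp\<close>)
  ultimately show ?thesis by (simp add: bil_def)
qed

lemma lin_cong: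
  assumes "sq_int N f" "sq_int N f'" "AE z in N. f z = f' z"
  shows "lin f = lin f'"
  unfolding lin_def
proof (rule integral_cong_AE)
  show "(\<lambda>z. cost_lin (snd z) \<bullet> f z) \<in> borel_measurable N" "(\<lambda>z. cost_lin (snd z) \<bullet> f' z) \<in> borel_measurable N"
    by (intro borel_measurable_integrable sq_int_inner cost_lin_sq_int assms)+
qed (use assms(3) in \<open>eventually_elim, simp\<close>)

lemma dreward_cong:
  assumes "sq_int N f" "sq_int M fT" "sq_int N g" "sq_int M gT" "sq_int N g'" "sq_int M gT'"
    and "AE z in N. g z = g' z" "AE \<omega> in M. gT \<omega> = gT' \<omega>"
  shows "dreward f fT g gT = dreward f fT g' gT'"
  unfolding dreward_def
  using lin_cong[OF assms(3,5,7)] bil_cong[OF assms(1-4) assms(1,2,5,6) _ _ assms(7,8)] 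
    bil_cong[OF assms(3,4,1,2,5,6,1,2) assms(7,8)] by simp

lemma reward_cong:
  assumes "sq_int N f" "sq_int M fT" "sq_int N f'" "sq_int M fT'" "AE z in N. f z = f' z" "AE \<omega> in M. fT \<omega> = fT' \<omega>"
  shows "reward f fT = reward f' fT'"
  unfolding reward_def
  using lin_cong[OF assms(1,3,5)] bil_cong[OF assms(1,2,1,2,3,4,3,4,5,6,5,6)] by simp

section \<open>The payoff in terms of state, control and flow\<close>

definition triple :: "('a \<Rightarrow> real \<Rightarrow> real ^ 'd) \<Rightarrow> (real \<Rightarrow> 'a \<Rightarrow> real ^ 'k) \<Rightarrow> (real \<Rightarrow> 'a \<Rightarrow> real ^ 'd) \<Rightarrow> 'a \<times> real \<Rightarrow> ('d, 'k) triple" where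
  "triple x u mu z = (x (fst z) (snd z), u (snd z) (fst z), mu (snd z) (fst z))"

definition endpoint :: "('a \<Rightarrow> real \<Rightarrow> real ^ 'd) \<Rightarrow> (real \<Rightarrow> 'a \<Rightarrow> real ^ 'd) \<Rightarrow> 'a \<Rightarrow> 'd duple" where
  "endpoint x mu \<omega> = (x \<omega> T, mu T \<omega>)"

lemma triple_sq_int:
  assumes "sq_int N (\<lambda>z. x (fst z) (snd z))" "sq_int N (\<lambda>z. u (snd z) (fst z))" "sq_int N (\<lambda>z. mu (snd z) (fst z))"
  shows "sq_int N (triple x u mu)"
  unfolding triple_def[abs_def] by (intro sq_int_Pair assms)

lemma endpoint_sq_int: "sq_int M (\<lambda>\<omega>. x \<omega> T) \<Longrightarrow> sq_int M (mu T) \<Longrightarrow> sq_int M (endpoint x mu)"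
  unfolding endpoint_def[abs_def] by (intro sq_int_Pair)

text \<open>The payoff integrates in time along each path before taking the expectation; Fubini
  turns this into one integral over \<open>N\<close>. Replacing \<open>X\<close> by its version
  changes the path integral on a null set only, and completeness makes the original integrand
  measurable.\<close>

lemma payoff_reward:
  assumes s: "sq_int N (triple x u mu)" "sq_int M (endpoint x mu)"
    and ae: "AE \<omega> in M. \<forall>t\<in>{0..T}. X u t \<omega> = x \<omega> t"
  shows "payoff D P X u mu = reward (triple x u mu) (endpoint x mu)"
proof -
  define f where "f z = cost_lin (snd z) \<bullet> triple x u mu z - cost_op (snd z) (triple x u mu z) \<bullet> triple x u mu z" for z
  define g where "g \<omega> = cost_end (endpoint x mu \<omega>) \<bullet> endpoint x mu \<omega>" for \<omega>
  have i1: "integrable N (\<lambda>z. cost_lin (snd z) \<bullet> triple x u mu z)"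
    and i2: "integrable N (\<lambda>z. cost_op (snd z) (triple x u mu z) \<bullet> triple x u mu z)"
    by (intro sq_int_inner cost_lin_sq_int cost_op_sq_int s)+
  have fi: "integrable N f" unfolding f_def[abs_def] using i1 i2 by simp
  have gi: "integrable M g" unfolding g_def[abs_def] by (intro sq_int_inner cost_end_sq_int s)
  have fp: "integrable M (\<lambda>\<omega>. \<integral>t. f (\<omega>, t) \<partial>L)" by (rule pr.integrable_fst'[OF fi])
  define h where "h \<omega> = (LINT t:{0..T}|lborel.
             lq_L D t \<bullet> mu t \<omega>
           - 1/2 * ((lq_Qbar D t *v mu t \<omega>) \<bullet> mu t \<omega>)
           - 1/2 * ((lq_Q D t *v X u t \<omega>) \<bullet> X u t \<omega>)
           - (lq_Qtilde D t *v X u t \<omega>) \<bullet> mu t \<omega>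
           - lq_q D t \<bullet> X u t \<omega>
           - 1/2 * ((lq_R D t *v u t \<omega>) \<bullet> u t \<omega>)
           - (lq_S D t *v X u t \<omega>) \<bullet> u t \<omega>
           - lq_r D t \<bullet> u t \<omega>)
        - 1/2 * ((lq_Hbar D *v mu T \<omega>) \<bullet> mu T \<omega>)
        - 1/2 * ((lq_H D *v X u T \<omega>) \<bullet> X u T \<omega>)
        - (lq_Htilde D *v X u T \<omega>) \<bullet> mu T \<omega>" for \<omega>
  have eq: "AE \<omega> in M. (\<integral>t. f (\<omega>, t) \<partial>L) - g \<omega> = h \<omega>"
    using ae
  proof eventually_elim
    case (elim \<omega>)
    have "(LINT t:{0..T}|lborel.
             lq_L D t \<bullet> mu t \<omega>
           - 1/2 * ((lq_Qbar D t *v mu t \<omega>) \<bullet> mu t \<omega>)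
           - 1/2 * ((lq_Q D t *v X u t \<omega>) \<bullet> X u t \<omega>)
           - (lq_Qtilde D t *v X u t \<omega>) \<bullet> mu t \<omega>
           - lq_q D t \<bullet> X u t \<omega>
           - 1/2 * ((lq_R D t *v u t \<omega>) \<bullet> u t \<omega>)
           - (lq_S D t *v X u t \<omega>) \<bullet> u t \<omega>
           - lq_r D t \<bullet> u t \<omega>) = (\<integral>t. f (\<omega>, t) \<partial>L)"
      unfolding LINT_leb[OF T0(2)]
      by (intro Bochner_Integration.integral_cong refl)
        (use elim in \<open>auto simp: f_def triple_def cost_lin_def cost_op_def inner_add_left\<close>)
    moreover have "g \<omega> = 1/2 * ((lq_Hbar D *v mu T \<omega>) \<bullet> mu T \<omega>) + 1/2 * ((lq_H D *v X u T \<omega>) \<bullet> X u T \<omega>)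
        + (lq_Htilde D *v X u T \<omega>) \<bullet> mu T \<omega>"
      using elim T0 by (auto simp: g_def endpoint_def cost_end_def inner_add_left)
    ultimately show ?case by (simp add: h_def)
  qed
  have m: "(\<lambda>\<omega>. (\<integral>t. f (\<omega>, t) \<partial>L) - g \<omega>) \<in> borel_measurable M"
    by (intro borel_measurable_diff borel_measurable_integrable fp gi)
  have "payoff D P X u mu = (\<integral>\<omega>. h \<omega> \<partial>M)" unfolding payoff_def h_def ..
  also have "\<dots> = (\<integral>\<omega>. (\<integral>t. f (\<omega>, t) \<partial>L) - g \<omega> \<partial>M)"
    by (rule integral_cong_AE[OF complete_measure.borel_measurable_AE_eq[OF complete_M m eq] m])
      (use eq in \<open>eventually_elim, simp\<close>)
  also have "\<dots> = (\<integral>z. f z \<partial>N) - (\<integral>\<omega>. g \<omega> \<partial>M)" using fp gi pr.integral_fst'[OF fi] by simp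
  also have "(\<integral>z. f z \<partial>N) = lin (triple x u mu) - (\<integral>z. cost_op (snd z) (triple x u mu z) \<bullet> triple x u mu z \<partial>N)"
    unfolding f_def lin_def using i1 i2 by simp
  finally show ?thesis by (simp add: reward_def bil_def g_def)
qed

lemma bil_bound:
  obtains K where "K \<ge> 0"
    "\<And>f fT g gT. sq_int N f \<Longrightarrow> sq_int M fT \<Longrightarrow> sq_int N g \<Longrightarrow> sq_int M gT \<Longrightarrow>
      (bil f fT g gT)\<^sup>2 \<le> K * ((\<integral>z. (norm (f z))\<^sup>2 \<partial>N) + (\<integral>\<omega>. (norm (fT \<omega>))\<^sup>2 \<partial>M))
        * ((\<integral>z. (norm (g z))\<^sup>2 \<partial>N) + (\<integral>\<omega>. (norm (gT \<omega>))\<^sup>2 \<partial>M))"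
proof -
  obtain K1 where K1: "K1 \<ge> 0" "AE t in L. \<forall>w. norm (cost_op t w) \<le> K1 * norm w" by (rule cost_op_bound)
  obtain K2 where K2: "\<And>w. norm (cost_end w) \<le> norm w * K2" "K2 \<ge> 0"
    using bounded_linear.nonneg_bounded[OF cost_end_linear] by blast
  \<comment> \<open>The running and the terminal part are each estimated by Cauchy-Schwarz, and
    squaring their sum costs the factor 2.\<close>
  define K where "K = 2 * (K1\<^sup>2 + K2\<^sup>2)"
  show thesis
  proof (rule that[of K])
    show "K \<ge> 0" by (simp add: K_def)
    fix f g :: "'a \<times> real \<Rightarrow> ('d, 'k) triple" and fT gT :: "'a \<Rightarrow> 'd duple"
    assume s: "sq_int N f" "sq_int M fT" "sq_int N g" "sq_int M gT"
    let ?f = "\<integral>z. (norm (f z))\<^sup>2 \<partial>N" and ?fT = "\<integral>\<omega>. (norm (fT \<omega>))\<^sup>2 \<partial>M"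
    let ?g = "\<integral>z. (norm (g z))\<^sup>2 \<partial>N" and ?gT = "\<integral>\<omega>. (norm (gT \<omega>))\<^sup>2 \<partial>M"
    have nn: "?f \<ge> 0" "?fT \<ge> 0" "?g \<ge> 0" "?gT \<ge> 0" by simp_all
    have a: "(\<integral>z. (norm (cost_op (snd z) (f z)))\<^sup>2 \<partial>N) \<le> K1\<^sup>2 * ?f"
    proof -
      have "(\<integral>z. (norm (cost_op (snd z) (f z)))\<^sup>2 \<partial>N) \<le> (\<integral>z. K1\<^sup>2 * (norm (f z))\<^sup>2 \<partial>N)"
      proof (rule integral_mono_AE)
        show "integrable N (\<lambda>z. (norm (cost_op (snd z) (f z)))\<^sup>2)" by (intro sq_int_norm cost_op_sq_int s)
        show "integrable N (\<lambda>z. K1\<^sup>2 * (norm (f z))\<^sup>2)" using sq_int_norm[OF s(1)] by simp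
        show "AE z in N. (norm (cost_op (snd z) (f z)))\<^sup>2 \<le> K1\<^sup>2 * (norm (f z))\<^sup>2"
          using AE_N_time[OF K1(2)]
        proof eventually_elim
          case (elim z)
          have "(norm (cost_op (snd z) (f z)))\<^sup>2 \<le> (K1 * norm (f z))\<^sup>2"
            by (rule power_mono[OF spec[OF elim] norm_ge_zero])
          then show ?case by (simp add: power_mult_distrib)
        qed
      qed
      then show ?thesis by simp
    qed
    have b: "(\<integral>\<omega>. (norm (cost_end (fT \<omega>)))\<^sup>2 \<partial>M) \<le> K2\<^sup>2 * ?fT"
    proof -
      have "(\<integral>\<omega>. (norm (cost_end (fT \<omega>)))\<^sup>2 \<partial>M) \<le> (\<integral>\<omega>. K2\<^sup>2 * (norm (fT \<omega>))\<^sup>2 \<partial>M)"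
      proof (rule integral_mono)
        show "integrable M (\<lambda>\<omega>. (norm (cost_end (fT \<omega>)))\<^sup>2)" by (intro sq_int_norm cost_end_sq_int s)
        show "integrable M (\<lambda>\<omega>. K2\<^sup>2 * (norm (fT \<omega>))\<^sup>2)" using sq_int_norm[OF s(2)] by simp
        fix \<omega>
        have "(norm (cost_end (fT \<omega>)))\<^sup>2 \<le> (norm (fT \<omega>) * K2)\<^sup>2" by (intro power_mono K2) auto
        then show "(norm (cost_end (fT \<omega>)))\<^sup>2 \<le> K2\<^sup>2 * (norm (fT \<omega>))\<^sup>2" by (simp add: power_mult_distrib mult.commute)
      qed
      then show ?thesis by simp
    qed
    have c: "(\<integral>z. cost_op (snd z) (f z) \<bullet> g z \<partial>N)\<^sup>2 \<le> K1\<^sup>2 * ?f * ?g"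
      by (rule order_trans[OF Cauchy_Schwarz_inner[OF cost_op_sq_int[OF s(1)] s(3)] mult_right_mono[OF a nn(3)]])
    have d: "(\<integral>\<omega>. cost_end (fT \<omega>) \<bullet> gT \<omega> \<partial>M)\<^sup>2 \<le> K2\<^sup>2 * ?fT * ?gT"
      by (rule order_trans[OF Cauchy_Schwarz_inner[OF cost_end_sq_int[OF s(2)] s(4)] mult_right_mono[OF b nn(4)]])
    have "(bil f fT g gT)\<^sup>2 \<le> 2 * (\<integral>z. cost_op (snd z) (f z) \<bullet> g z \<partial>N)\<^sup>2 + 2 * (\<integral>\<omega>. cost_end (fT \<omega>) \<bullet> gT \<omega> \<partial>M)\<^sup>2"
      using norm_add_power2[of "\<integral>z. cost_op (snd z) (f z) \<bullet> g z \<partial>N" "\<integral>\<omega>. cost_end (fT \<omega>) \<bullet> gT \<omega> \<partial>M"]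
      by (simp add: bil_def)
    also have "\<dots> \<le> 2 * (K1\<^sup>2 * ?f * ?g) + 2 * (K2\<^sup>2 * ?fT * ?gT)" using c d by linarith
    also have "\<dots> \<le> 2 * (K1\<^sup>2 * ((?f + ?fT) * (?g + ?gT))) + 2 * (K2\<^sup>2 * ((?f + ?fT) * (?g + ?gT)))"
    proof -
      have "?f * ?g \<le> (?f + ?fT) * (?g + ?gT)" "?fT * ?gT \<le> (?f + ?fT) * (?g + ?gT)"
        using nn by (auto intro!: mult_mono)
      then have "K1\<^sup>2 * (?f * ?g) \<le> K1\<^sup>2 * ((?f + ?fT) * (?g + ?gT))" "K2\<^sup>2 * (?fT * ?gT) \<le> K2\<^sup>2 * ((?f + ?fT) * (?g + ?gT))"
        by (auto intro!: mult_left_mono)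
      then show ?thesis by (simp add: mult.assoc)
    qed
    also have "\<dots> = K * (?f + ?fT) * (?g + ?gT)" by (simp add: K_def algebra_simps)
    finally show "(bil f fT g gT)\<^sup>2 \<le> K * (?f + ?fT) * (?g + ?gT)" .
  qed
qed

text \<open>Continuity of the derivative in the direction, needed to pass to the limit along
  discretised controls. The constant comes from splitting the three terms of \<open>dreward\<close>
  twice, which gives their squares the weights 4, 4 and 2.\<close>

lemma dreward_bound:
  assumes f: "sq_int N f" "sq_int M fT"
  obtains K where "K \<ge> 0"
    "\<And>g gT. sq_int N g \<Longrightarrow> sq_int M gT \<Longrightarrow>
      (dreward f fT g gT)\<^sup>2 \<le> K * ((\<integral>z. (norm (g z))\<^sup>2 \<partial>N) + (\<integral>\<omega>. (norm (gT \<omega>))\<^sup>2 \<partial>M))"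
proof -
  obtain K where K: "K \<ge> 0"
    "\<And>f fT g gT. sq_int N f \<Longrightarrow> sq_int M fT \<Longrightarrow> sq_int N g \<Longrightarrow> sq_int M gT \<Longrightarrow>
      (bil f fT g gT)\<^sup>2 \<le> K * ((\<integral>z. (norm (f z))\<^sup>2 \<partial>N) + (\<integral>\<omega>. (norm (fT \<omega>))\<^sup>2 \<partial>M))
        * ((\<integral>z. (norm (g z))\<^sup>2 \<partial>N) + (\<integral>\<omega>. (norm (gT \<omega>))\<^sup>2 \<partial>M))"
    by (rule bil_bound) blast
  define c where "c = (\<integral>z. (norm (cost_lin (snd z)))\<^sup>2 \<partial>N)"
  define e where "e = (\<integral>z. (norm (f z))\<^sup>2 \<partial>N) + (\<integral>\<omega>. (norm (fT \<omega>))\<^sup>2 \<partial>M)"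
  have ce: "c \<ge> 0" "e \<ge> 0" by (simp_all add: c_def e_def)
  show thesis
  proof (rule that[of "4 * c + 6 * K * e"])
    show "0 \<le> 4 * c + 6 * K * e" using ce K(1) by simp
    fix g :: "'a \<times> real \<Rightarrow> ('d, 'k) triple" and gT :: "'a \<Rightarrow> 'd duple"
    assume g: "sq_int N g" "sq_int M gT"
    define G where "G = (\<integral>z. (norm (g z))\<^sup>2 \<partial>N) + (\<integral>\<omega>. (norm (gT \<omega>))\<^sup>2 \<partial>M)"
    have G: "(\<integral>z. (norm (g z))\<^sup>2 \<partial>N) \<le> G" "0 \<le> G" by (simp_all add: G_def)
    have l: "(lin g)\<^sup>2 \<le> c * G"
      unfolding lin_def c_def
      by (rule order_trans[OF Cauchy_Schwarz_inner[OF cost_lin_sq_int g(1)] mult_left_mono[OF G(1)]]) simp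
    have b1: "(bil f fT g gT)\<^sup>2 \<le> K * e * G" using K(2)[OF f g] by (simp add: e_def G_def)
    have b2: "(bil g gT f fT)\<^sup>2 \<le> K * e * G" using K(2)[OF g f] by (simp add: e_def G_def ac_simps)
    have "(dreward f fT g gT)\<^sup>2 \<le> 4 * (lin g)\<^sup>2 + 4 * (bil f fT g gT)\<^sup>2 + 2 * (bil g gT f fT)\<^sup>2"
      using norm_add_power2[of "lin g - bil f fT g gT" "- bil g gT f fT"] norm_add_power2[of "lin g" "- bil f fT g gT"]
      by (simp add: dreward_def)
    also have "\<dots> \<le> (4 * c + 6 * K * e) * G" using l b1 b2 by (simp add: algebra_simps)
    finally show "(dreward f fT g gT)\<^sup>2 \<le> (4 * c + 6 * K * e) * ((\<integral>z. (norm (g z))\<^sup>2 \<partial>N) + (\<integral>\<omega>. (norm (gT \<omega>))\<^sup>2 \<partial>M))"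
      by (simp add: G_def)
  qed
qed

end

section \<open>Vanishing first-order terms and directions of perturbation\<close>

lemma integral_Pair_zero:
  fixes f :: "'x \<Rightarrow> 'b::euclidean_space \<times> 'c::euclidean_space"
  assumes i: "integrable M f" and "(\<integral>x. fst (f x) \<partial>M) = 0" "(\<integral>x. snd (f x) \<partial>M) = 0"
  shows "(\<integral>x. f x \<partial>M) = 0"
proof (rule prod_eqI)
  show "fst (\<integral>x. f x \<partial>M) = fst 0" using integral_bounded_linear[OF bounded_linear_fst i] assms(2) by simp
  show "snd (\<integral>x. f x \<partial>M) = snd 0" using integral_bounded_linear[OF bounded_linear_snd i] assms(3) by simp
qed

text \<open>Expanding \<open>g\<close> in the basis reduces a bilinear expression in
  \<open>f\<close> and \<open>g\<close> to the products of \<open>f\<close> with one coordinate of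
  \<open>g\<close>, whose means vanish by assumption. Both orders are needed, as the cost operators
  are not symmetric.\<close>

lemma bilinear_mean_zero:
  fixes f g :: "'x \<Rightarrow> 'b::euclidean_space"
  assumes f: "sq_int M f" and g: "sq_int M g" and h: "bounded_linear h"
    and z: "\<And>b. b \<in> Basis \<Longrightarrow> (\<integral>x. (g x \<bullet> b) *\<^sub>R f x \<partial>M) = 0"
  shows "(\<integral>x. h (f x) \<bullet> g x \<partial>M) = 0" and "(\<integral>x. h (g x) \<bullet> f x \<partial>M) = 0"
proof -
  have gb: "sq_int M (\<lambda>x. g x \<bullet> b)" for b
    by (rule sq_int_bounded_linear[OF g bounded_linear_inner_left])
  have i: "integrable M (\<lambda>x. (g x \<bullet> b) *\<^sub>R f x)" for b by (rule sq_int_scaleR_fun[OF gb f])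
  have ih: "integrable M (\<lambda>x. h ((g x \<bullet> b) *\<^sub>R f x))" for b by (rule integrable_bounded_linear[OF h i])
  have hl: "linear h" by (rule bounded_linear.linear[OF h])
  have "h (f x) \<bullet> g x = (\<Sum>b\<in>Basis. h ((g x \<bullet> b) *\<^sub>R f x) \<bullet> b)" for x
    using euclidean_inner[of "h (f x)" "g x"] by (simp add: linear_scale[OF hl] mult.commute)
  then have "(\<integral>x. h (f x) \<bullet> g x \<partial>M) = (\<Sum>b\<in>Basis. (\<integral>x. h ((g x \<bullet> b) *\<^sub>R f x) \<bullet> b \<partial>M))"
    using ih by simp
  also have "\<dots> = (\<Sum>b\<in>Basis. h (\<integral>x. (g x \<bullet> b) *\<^sub>R f x \<partial>M) \<bullet> b)"
    using integral_bounded_linear[OF h i] ih by (intro sum.cong refl) (simp add: integral_inner_left)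
  also have "\<dots> = 0" using z linear_0[OF hl] by simp
  finally show "(\<integral>x. h (f x) \<bullet> g x \<partial>M) = 0" .
  have "h (g x) \<bullet> f x = (\<Sum>b\<in>Basis. ((g x \<bullet> b) *\<^sub>R f x) \<bullet> h b)" for x
  proof -
    have "h (g x) = (\<Sum>b\<in>Basis. (g x \<bullet> b) *\<^sub>R h b)"
      using arg_cong[OF euclidean_representation[of "g x"], of h] by (simp add: linear_sum[OF hl] linear_scale[OF hl])
    then show ?thesis by (simp add: inner_sum_left inner_commute[of "f x"])
  qed
  then have "(\<integral>x. h (g x) \<bullet> f x \<partial>M) = (\<integral>x. (\<Sum>b\<in>Basis. ((g x \<bullet> b) *\<^sub>R f x) \<bullet> h b) \<partial>M)" by (simp only:)
  also have "\<dots> = (\<Sum>b\<in>Basis. (\<integral>x. ((g x \<bullet> b) *\<^sub>R f x) \<bullet> h b \<partial>M))"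
    by (rule Bochner_Integration.integral_sum) (rule integrable_inner_left[OF i])
  also have "\<dots> = (\<Sum>b\<in>Basis. (\<integral>x. (g x \<bullet> b) *\<^sub>R f x \<partial>M) \<bullet> h b)"
    by (intro sum.cong refl integral_inner_left i)
  also have "\<dots> = 0" using z by simp
  finally show "(\<integral>x. h (g x) \<bullet> f x \<partial>M) = 0" .
qed

context lq_setting
begin

lemma dreward_zero:
  assumes f: "sq_int N f" "sq_int M fT" and g: "sq_int N g" "sq_int M gT"
    and a: "AE t in L. \<forall>b\<in>Basis. (\<integral>\<omega>. g (\<omega>, t) \<bullet> b \<partial>M) = 0 \<and> (\<integral>\<omega>. (g (\<omega>, t) \<bullet> b) *\<^sub>R f (\<omega>, t) \<partial>M) = 0"
    and b: "\<And>b. b \<in> Basis \<Longrightarrow> (\<integral>\<omega>. (gT \<omega> \<bullet> b) *\<^sub>R fT \<omega> \<partial>M) = 0"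
  shows "dreward f fT g gT = 0"
proof -
  note sf = cost_op_sq_int[OF f(1)] and sg = cost_op_sq_int[OF g(1)]
  have Fub: "(\<integral>z. h z \<partial>N) = (\<integral>t. (\<integral>\<omega>. h (\<omega>, t) \<partial>M) \<partial>L)" if "integrable N h" for h :: "_ \<Rightarrow> real"
  proof -
    have "integrable N (case_prod (\<lambda>\<omega> t. h (\<omega>, t)))" using that by (simp add: case_prod_unfold)
    from pr.integral_snd[OF this] show ?thesis by (simp add: case_prod_unfold)
  qed
  have AEs: "AE t in L. (\<forall>b\<in>Basis. (\<integral>\<omega>. g (\<omega>, t) \<bullet> b \<partial>M) = 0 \<and> (\<integral>\<omega>. (g (\<omega>, t) \<bullet> b) *\<^sub>R f (\<omega>, t) \<partial>M) = 0)
      \<and> sq_int M (\<lambda>\<omega>. f (\<omega>, t)) \<and> sq_int M (\<lambda>\<omega>. g (\<omega>, t))"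
    using a l2_AE_time[OF f(1)] l2_AE_time[OF g(1)] by eventually_elim blast
  have "lin g = (\<integral>t. (\<integral>\<omega>. cost_lin t \<bullet> g (\<omega>, t) \<partial>M) \<partial>L)"
    unfolding lin_def using Fub[OF sq_int_inner[OF cost_lin_sq_int g(1)]] by simp
  also have "\<dots> = 0"
  proof (rule integral_eq_zero_AE)
    show "AE t in L. (\<integral>\<omega>. cost_lin t \<bullet> g (\<omega>, t) \<partial>M) = 0" using AEs
    proof eventually_elim
      case (elim t)
      have i: "integrable M (\<lambda>\<omega>. g (\<omega>, t))" using elim by (intro sq_int_integrable[OF finite_measure_axioms]) blast
      have "(\<integral>\<omega>. g (\<omega>, t) \<partial>M) = 0"
      proof (rule euclidean_eqI)
        fix b :: "('d, 'k) triple" assume "b \<in> Basis"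
        then show "(\<integral>\<omega>. g (\<omega>, t) \<partial>M) \<bullet> b = 0 \<bullet> b" using elim integral_inner_left[OF i, of b] by simp
      qed
      then show ?case using i by (subst integral_inner_right) auto
    qed
  qed
  finally have 1: "lin g = 0" .
  have "(\<integral>z. cost_op (snd z) (f z) \<bullet> g z \<partial>N) = (\<integral>t. (\<integral>\<omega>. cost_op t (f (\<omega>, t)) \<bullet> g (\<omega>, t) \<partial>M) \<partial>L)"
    using Fub[OF sq_int_inner[OF sf g(1)]] by simp
  also have "\<dots> = 0"
    by (rule integral_eq_zero_AE, use AEs in eventually_elim) (intro bilinear_mean_zero(1)[OF _ _ cost_op_linear], blast+)
  finally have 2: "(\<integral>z. cost_op (snd z) (f z) \<bullet> g z \<partial>N) = 0" .
  have "(\<integral>z. cost_op (snd z) (g z) \<bullet> f z \<partial>N) = (\<integral>t. (\<integral>\<omega>. cost_op t (g (\<omega>, t)) \<bullet> f (\<omega>, t) \<partial>M) \<partial>L)"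
    using Fub[OF sq_int_inner[OF sg f(1)]] by simp
  also have "\<dots> = 0"
    by (rule integral_eq_zero_AE, use AEs in eventually_elim) (intro bilinear_mean_zero(2)[OF _ _ cost_op_linear], blast+)
  finally have 3: "(\<integral>z. cost_op (snd z) (g z) \<bullet> f z \<partial>N) = 0" .
  show ?thesis
    unfolding dreward_def bil_def using 1 2 3
      bilinear_mean_zero[OF f(2) g(2) cost_end_linear b] by simp
qed

lemma payoff_cong:
  assumes "\<And>\<omega> t. \<omega> \<in> space M \<Longrightarrow> t \<in> {0..T} \<Longrightarrow> mu t \<omega> = mu' t \<omega>"
  shows "payoff D P X u mu = payoff D P X u mu'"
proof -
  have run: "(LINT t:{0..T}|lborel. f t (mu t \<omega>)) = (LINT t:{0..T}|lborel. f t (mu' t \<omega>))"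
    if "\<omega> \<in> space M" for f :: "real \<Rightarrow> real ^ 'd \<Rightarrow> real" and \<omega>
    unfolding set_lebesgue_integral_def
    by (intro Bochner_Integration.integral_cong refl) (use assms[OF that] in \<open>auto simp: indicator_def\<close>)
  note run = run[of \<omega> "\<lambda>t v. lq_L D t \<bullet> v - 1/2 * ((lq_Qbar D t *v v) \<bullet> v)
           - 1/2 * ((lq_Q D t *v X u t \<omega>) \<bullet> X u t \<omega>) - (lq_Qtilde D t *v X u t \<omega>) \<bullet> v
           - lq_q D t \<bullet> X u t \<omega> - 1/2 * ((lq_R D t *v u t \<omega>) \<bullet> u t \<omega>)
           - (lq_S D t *v X u t \<omega>) \<bullet> u t \<omega> - lq_r D t \<bullet> u t \<omega>" for \<omega>]
  show ?thesis
    unfolding payoff_def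
    by (intro Bochner_Integration.integral_cong refl) (simp only: run assms T0(2))
qed

definition ymean :: "(real \<Rightarrow> 'a \<Rightarrow> real ^ 'k) \<Rightarrow> real \<Rightarrow> real ^ 'd" where
  "ymean \<beta> t = (\<integral>\<omega>. sol (\<lambda>s. \<beta> s \<omega>) t \<partial>M)"

text \<open>The response to perturbing the control by \<beta> when the flow follows: deviation of
  the state, of the control, and of the mean of the state.\<close>

definition dir :: "(real \<Rightarrow> 'a \<Rightarrow> real ^ 'k) \<Rightarrow> 'a \<times> real \<Rightarrow> ('d, 'k) triple" where
  "dir \<beta> = triple (\<lambda>\<omega>. sol (\<lambda>s. \<beta> s \<omega>)) \<beta> (\<lambda>t \<omega>. ymean \<beta> t)"

definition dir_end :: "(real \<Rightarrow> 'a \<Rightarrow> real ^ 'k) \<Rightarrow> 'a \<Rightarrow> 'd duple" where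
  "dir_end \<beta> = endpoint (\<lambda>\<omega>. sol (\<lambda>s. \<beta> s \<omega>)) (\<lambda>t \<omega>. ymean \<beta> t)"

lemma one_sq: "sq_int M (\<lambda>_. 1 :: real)" by (rule sq_int_const[OF finite_measure_axioms])

lemma ymean_sq: "\<beta> \<in> H2 M T F \<Longrightarrow> sq_int L (ymean \<beta>)"
  using sq_int_time_integral[OF sol_process(2) one_sq, of \<beta>] by (simp add: ymean_def[abs_def])

lemma dir_sq: "\<beta> \<in> H2 M T F \<Longrightarrow> sq_int N (dir \<beta>)"
  unfolding dir_def by (intro triple_sq_int sol_process(2) control_l2 sq_int_N_time ymean_sq)

lemma dir_end_sq: "\<beta> \<in> H2 M T F \<Longrightarrow> sq_int M (dir_end \<beta>)"
  unfolding dir_end_def by (intro endpoint_sq_int sol_process(1) T0 sq_int_const finite_measure_axioms)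

lemma sol_process_lin:
  assumes "\<beta> \<in> H2 M T F" "\<gamma> \<in> H2 M T F"
  shows "AE \<omega> in M. \<forall>t\<in>{0..T}. sol (\<lambda>s. \<beta> s \<omega> + c *\<^sub>R \<gamma> s \<omega>) t = sol (\<lambda>s. \<beta> s \<omega>) t + c *\<^sub>R sol (\<lambda>s. \<gamma> s \<omega>) t"
  using H2_AE_path[OF assms(1)] H2_AE_path[OF assms(2)] by eventually_elim (simp add: sol_lin)

lemma ymean_lin:
  assumes b: "\<beta> \<in> H2 M T F" "\<gamma> \<in> H2 M T F" and t: "t \<in> {0..T}"
  shows "ymean (\<lambda>s \<omega>. \<beta> s \<omega> + c *\<^sub>R \<gamma> s \<omega>) t = ymean \<beta> t + c *\<^sub>R ymean \<gamma> t"
proof -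
  note s = sol_process(1)[OF b(1) t] sol_process(1)[OF b(2) t] sol_process(1)[OF H2_lin[OF filtration_F b, of c] t]
  have "ymean (\<lambda>s \<omega>. \<beta> s \<omega> + c *\<^sub>R \<gamma> s \<omega>) t = (\<integral>\<omega>. sol (\<lambda>s. \<beta> s \<omega>) t + c *\<^sub>R sol (\<lambda>s. \<gamma> s \<omega>) t \<partial>M)"
    unfolding ymean_def
  proof (rule integral_cong_AE[OF sq_int_measurable[OF s(3)]])
    show "(\<lambda>\<omega>. sol (\<lambda>s. \<beta> s \<omega>) t + c *\<^sub>R sol (\<lambda>s. \<gamma> s \<omega>) t) \<in> borel_measurable M"
      by (rule sq_int_measurable[OF sq_int_add[OF s(1) sq_int_scaleR[OF s(2)]]])
  qed (use sol_process_lin[OF b, of c] in \<open>eventually_elim, use t in blast\<close>)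
  also have "\<dots> = ymean \<beta> t + c *\<^sub>R ymean \<gamma> t"
    unfolding ymean_def using s[THEN sq_int_integrable[OF finite_measure_axioms]] by simp
  finally show ?thesis .
qed

lemma dir_lin:
  assumes b: "\<beta> \<in> H2 M T F" "\<gamma> \<in> H2 M T F"
  shows "AE z in N. dir (\<lambda>s \<omega>. \<beta> s \<omega> + c *\<^sub>R \<gamma> s \<omega>) z = dir \<beta> z + c *\<^sub>R dir \<gamma> z"
    and "AE \<omega> in M. dir_end (\<lambda>s \<omega>. \<beta> s \<omega> + c *\<^sub>R \<gamma> s \<omega>) \<omega> = dir_end \<beta> \<omega> + c *\<^sub>R dir_end \<gamma> \<omega>"
proof -
  note sl = sol_process_lin[OF b, of c] and yl = ymean_lin[OF b, of _ c]
  show "AE z in N. dir (\<lambda>s \<omega>. \<beta> s \<omega> + c *\<^sub>R \<gamma> s \<omega>) z = dir \<beta> z + c *\<^sub>R dir \<gamma> z"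
    using AE_N_omega[OF sl] AE_space
  proof eventually_elim
    case (elim z)
    then have t: "snd z \<in> {0..T}" by (auto simp: space_pair_measure)
    then show ?case using elim yl[OF t] by (simp add: dir_def triple_def)
  qed
  show "AE \<omega> in M. dir_end (\<lambda>s \<omega>. \<beta> s \<omega> + c *\<^sub>R \<gamma> s \<omega>) \<omega> = dir_end \<beta> \<omega> + c *\<^sub>R dir_end \<gamma> \<omega>"
    using sl by eventually_elim (use yl[OF T0(2)] T0 in \<open>simp add: dir_end_def endpoint_def\<close>)
qed

lemma dir_bound:
  obtains K where "K \<ge> 0" "\<And>\<beta>. \<beta> \<in> H2 M T F \<Longrightarrow>
    (\<integral>z. (norm (dir \<beta> z))\<^sup>2 \<partial>N) + (\<integral>\<omega>. (norm (dir_end \<beta> \<omega>))\<^sup>2 \<partial>M) \<le> K * (\<integral>z. (norm (\<beta> (snd z) (fst z)))\<^sup>2 \<partial>N)"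
proof -
  obtain K where K: "K \<ge> 0" "\<And>u t. sq_int L u \<Longrightarrow> t \<in> {0..T} \<Longrightarrow> (norm (sol u t))\<^sup>2 \<le> K * (\<integral>s. (norm (u s))\<^sup>2 \<partial>L)"
    by (rule sol_bound) blast
  show thesis
  \<comment> \<open>State and mean contribute \<open>K * T\<close> each over time, the control
    contributes 1, and the two terminal values contribute \<open>K\<close> each.\<close>
  proof (rule that[of "T * (2 * K) + 1 + 2 * K"])
    show "0 \<le> T * (2 * K) + 1 + 2 * K" using K T_pos by simp
    fix \<beta> :: "real \<Rightarrow> 'a \<Rightarrow> real ^ 'k" assume b: "\<beta> \<in> H2 M T F"
    let ?n = "\<integral>z. (norm (\<beta> (snd z) (fst z)))\<^sup>2 \<partial>N"
    have n0: "?n \<ge> 0" by simp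
    note cn = sq_int_norm[OF control_l2[OF b]]
    have si: "integrable M (\<lambda>\<omega>. \<integral>s. (norm (\<beta> s \<omega>))\<^sup>2 \<partial>L)" and sn: "(\<integral>\<omega>. (\<integral>s. (norm (\<beta> s \<omega>))\<^sup>2 \<partial>L) \<partial>M) = ?n"
      using pr.integrable_fst'[OF cn] pr.integral_fst'[OF cn] by simp_all
    have s2: "(\<integral>\<omega>. (norm (sol (\<lambda>s. \<beta> s \<omega>) t))\<^sup>2 \<partial>M) \<le> K * ?n" if t: "t \<in> {0..T}" for t
    proof -
      have "(\<integral>\<omega>. (norm (sol (\<lambda>s. \<beta> s \<omega>) t))\<^sup>2 \<partial>M) \<le> (\<integral>\<omega>. K * (\<integral>s. (norm (\<beta> s \<omega>))\<^sup>2 \<partial>L) \<partial>M)"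
      proof (rule integral_mono_AE[OF sq_int_norm[OF sol_process(1)[OF b t]]])
        show "integrable M (\<lambda>\<omega>. K * (\<integral>s. (norm (\<beta> s \<omega>))\<^sup>2 \<partial>L))" using si by simp
        show "AE \<omega> in M. (norm (sol (\<lambda>s. \<beta> s \<omega>) t))\<^sup>2 \<le> K * (\<integral>s. (norm (\<beta> s \<omega>))\<^sup>2 \<partial>L)"
          using H2_AE_path[OF b] by eventually_elim (rule K(2)[OF _ t])
      qed
      then show ?thesis using sn by simp
    qed
    have y2: "(norm (ymean \<beta> t))\<^sup>2 \<le> K * ?n" if t: "t \<in> {0..T}" for t
      using norm_integral_power2_le[OF finite_measure_axioms sol_process(1)[OF b t]] s2[OF t]
      by (simp add: ymean_def prob_space)
    have sq3: "(norm (a, b, c))\<^sup>2 = (norm a)\<^sup>2 + (norm b)\<^sup>2 + (norm c)\<^sup>2" for a c :: "real ^ 'd" and b :: "real ^ 'k"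
      by (simp add: norm_Pair)
    note i = sq_int_norm[OF sol_process(2)[OF b]] cn sq_int_norm[OF sq_int_N_time[OF ymean_sq[OF b]]]
    have "(\<integral>z. (norm (dir \<beta> z))\<^sup>2 \<partial>N) = (\<integral>z. (norm (sol (\<lambda>s. \<beta> s (fst z)) (snd z)))\<^sup>2 \<partial>N) + ?n
        + (\<integral>z. (norm (ymean \<beta> (snd z)))\<^sup>2 \<partial>N)"
      unfolding dir_def triple_def sq3 using i by simp
    also have "(\<integral>z. (norm (sol (\<lambda>s. \<beta> s (fst z)) (snd z)))\<^sup>2 \<partial>N) \<le> T * (K * ?n)"
    proof -
      have c: "integrable N (case_prod (\<lambda>\<omega> t. (norm (sol (\<lambda>s. \<beta> s \<omega>) t))\<^sup>2))" using i(1) by (simp add: case_prod_unfold)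
      have "(\<integral>z. (norm (sol (\<lambda>s. \<beta> s (fst z)) (snd z)))\<^sup>2 \<partial>N) = (\<integral>t. (\<integral>\<omega>. (norm (sol (\<lambda>s. \<beta> s \<omega>) t))\<^sup>2 \<partial>M) \<partial>L)"
        using pr.integral_snd[OF c] by (simp add: case_prod_unfold)
      also have "\<dots> \<le> (\<integral>t. K * ?n \<partial>L)"
        by (rule integral_mono[OF pr.integrable_snd[OF c]]) (use s2 in auto)
      also have "\<dots> = T * (K * ?n)" using measure_leb[of T] T_pos by simp
      finally show ?thesis .
    qed
    also have "(\<integral>z. (norm (ymean \<beta> (snd z)))\<^sup>2 \<partial>N) \<le> T * (K * ?n)"
    proof -
      have "(\<integral>z. (norm (ymean \<beta> (snd z)))\<^sup>2 \<partial>N) = (\<integral>\<omega>. (\<integral>t. (norm (ymean \<beta> t))\<^sup>2 \<partial>L) \<partial>M)"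
        using pr.integral_fst'[OF i(3)] by simp
      also have "\<dots> = (\<integral>t. (norm (ymean \<beta> t))\<^sup>2 \<partial>L)" by (simp add: prob_space)
      also have "\<dots> \<le> (\<integral>t. K * ?n \<partial>L)"
        by (rule integral_mono[OF sq_int_norm[OF ymean_sq[OF b]]]) (use y2 in auto)
      also have "\<dots> = T * (K * ?n)" using measure_leb[of T] T_pos by simp
      finally show ?thesis .
    qed
    finally have 1: "(\<integral>z. (norm (dir \<beta> z))\<^sup>2 \<partial>N) \<le> T * (K * ?n) + ?n + T * (K * ?n)" by simp
    have "(\<integral>\<omega>. (norm (dir_end \<beta> \<omega>))\<^sup>2 \<partial>M) = (\<integral>\<omega>. (norm (sol (\<lambda>s. \<beta> s \<omega>) T))\<^sup>2 + (norm (ymean \<beta> T))\<^sup>2 \<partial>M)"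
      by (simp add: dir_end_def endpoint_def norm_Pair)
    also have "\<dots> = (\<integral>\<omega>. (norm (sol (\<lambda>s. \<beta> s \<omega>) T))\<^sup>2 \<partial>M) + (norm (ymean \<beta> T))\<^sup>2"
      using sq_int_norm[OF sol_process(1)[OF b T0(2)]] by (simp add: prob_space)
    finally have 2: "(\<integral>\<omega>. (norm (dir_end \<beta> \<omega>))\<^sup>2 \<partial>M) \<le> K * ?n + K * ?n" using s2[OF T0(2)] y2[OF T0(2)] by simp
    show "(\<integral>z. (norm (dir \<beta> z))\<^sup>2 \<partial>N) + (\<integral>\<omega>. (norm (dir_end \<beta> \<omega>))\<^sup>2 \<partial>M) \<le> (T * (2 * K) + 1 + 2 * K) * ?n"
      using 1 2 by (simp add: algebra_simps)
  qed
qed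

end

section \<open>Stationarity of the optimal control\<close>

locale mfc_setting = lq_setting P D X
  for P :: "('a, 'd::finite) stoch_basis" and D :: "('d, 'k::finite) lq_data" and X +
  fixes \<alpha> :: "real \<Rightarrow> 'a \<Rightarrow> real ^ 'k" and xa :: "'a \<Rightarrow> real \<Rightarrow> real ^ 'd"
  assumes mfc: "MFC_solution D P X \<alpha>" and xa: "state_version \<alpha> xa"
begin

lemma \<alpha>: "\<alpha> \<in> H2 M T F1" using mfc by (simp add: MFC_solution_def MFC_maximizer_def)
lemma \<alpha>_F: "\<alpha> \<in> H2 M T F" using \<alpha> H2_F1_F by blast

definition "m t = (\<integral>\<omega>. xa \<omega> t \<partial>M)"

lemma m_continuous: "continuous_on {0..T} m"
  unfolding m_def[abs_def] by (rule state_mean_continuous[OF \<alpha>_F xa])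

definition "z0 = triple xa \<alpha> (\<lambda>t \<omega>. m t)"
definition "zT = endpoint xa (\<lambda>t \<omega>. m t)"

lemma z0_sq: "sq_int N z0"
  unfolding z0_def
  by (intro triple_sq_int state_versionD(3)[OF xa] control_l2[OF \<alpha>_F] sq_int_N_time sq_int_continuous m_continuous)

lemma zT_sq: "sq_int M zT"
  unfolding zT_def by (intro endpoint_sq_int state_versionD(2)[OF xa T0(2)] sq_int_const finite_measure_axioms)

text \<open>First and second order coefficients, up to the sign of the latter, of the control
  problem's payoff along \<open>\<alpha> + c \<beta>\<close>, the mean path moving with the control.
  They are considered for all controls adapted to \<open>F\<close>, a class larger than the one in
  which \<alpha> is optimal.\<close>

definition "ell \<beta> = dreward z0 zT (dir \<beta>) (dir_end \<beta>)"
definition "quad \<beta> = bil (dir \<beta>) (dir_end \<beta>) (dir \<beta>) (dir_end \<beta>)"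

lemma ell_lin:
  assumes b: "\<beta> \<in> H2 M T F" "\<gamma> \<in> H2 M T F"
  shows "ell (\<lambda>s \<omega>. \<beta> s \<omega> + c *\<^sub>R \<gamma> s \<omega>) = ell \<beta> + c * ell \<gamma>"
proof -
  note s = dir_sq[OF b(1)] dir_end_sq[OF b(1)] dir_sq[OF b(2)] dir_end_sq[OF b(2)]
  note sc = H2_lin[OF filtration_F b, of c]
  have "ell (\<lambda>s \<omega>. \<beta> s \<omega> + c *\<^sub>R \<gamma> s \<omega>)
      = dreward z0 zT (\<lambda>z. dir \<beta> z + c *\<^sub>R dir \<gamma> z) (\<lambda>\<omega>. dir_end \<beta> \<omega> + c *\<^sub>R dir_end \<gamma> \<omega>)"
    unfolding ell_def
    by (rule dreward_cong[OF z0_sq zT_sq dir_sq[OF sc] dir_end_sq[OF sc] _ _ dir_lin[OF b]])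
      (intro sq_int_add sq_int_scaleR s)+
  also have "\<dots> = ell \<beta> + c * ell \<gamma>"
    unfolding ell_def by (rule dreward_add[OF z0_sq zT_sq s])
  finally show ?thesis .
qed

lemma mean_state_perturbed:
  assumes b: "\<beta> \<in> H2 M T F" and t: "t \<in> {0..T}"
  shows "mean_state P X (\<lambda>s \<omega>. \<alpha> s \<omega> + c *\<^sub>R \<beta> s \<omega>) t = m t + c *\<^sub>R ymean \<beta> t"
    and "AE \<omega> in M. \<forall>t\<in>{0..T}. X (\<lambda>s \<omega>. \<alpha> s \<omega> + c *\<^sub>R \<beta> s \<omega>) t \<omega> = xa \<omega> t + c *\<^sub>R sol (\<lambda>s. \<beta> s \<omega>) t"
proof -
  let ?l = "\<lambda>s \<omega>. \<alpha> s \<omega> + c *\<^sub>R \<beta> s \<omega>"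
  have l: "?l \<in> H2 M T F" by (rule H2_lin[OF filtration_F \<alpha>_F b])
  show ae: "AE \<omega> in M. \<forall>t\<in>{0..T}. X ?l t \<omega> = xa \<omega> t + c *\<^sub>R sol (\<lambda>s. \<beta> s \<omega>) t"
    using state_diff_sol[OF l \<alpha>_F] state_versionD(4)[OF xa] H2_AE_path[OF b]
  proof eventually_elim
    case (elim \<omega>)
    show ?case
    proof
      fix t assume t: "t \<in> {0..T}"
      have "X ?l t \<omega> - xa \<omega> t = c *\<^sub>R sol (\<lambda>s. \<beta> s \<omega>) t"
        using elim t sol_scale[OF elim(3) t, of c] by simp
      then show "X ?l t \<omega> = xa \<omega> t + c *\<^sub>R sol (\<lambda>s. \<beta> s \<omega>) t" by (simp add: algebra_simps)
    qed
  qed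
  note s = state_versionD(2)[OF xa t] sol_process(1)[OF b t]
  have "mean_state P X ?l t = (\<integral>\<omega>. xa \<omega> t + c *\<^sub>R sol (\<lambda>s. \<beta> s \<omega>) t \<partial>M)"
    unfolding mean_state_def
  proof (rule integral_cong_AE)
    show "X ?l t \<in> borel_measurable M"
      using state_solution[OF l] t measurable_F unfolding state_solution_def by blast
    show "(\<lambda>\<omega>. xa \<omega> t + c *\<^sub>R sol (\<lambda>s. \<beta> s \<omega>) t) \<in> borel_measurable M"
      by (rule sq_int_measurable[OF sq_int_add[OF s(1) sq_int_scaleR[OF s(2)]]])
  qed (use ae in \<open>eventually_elim, use t in blast\<close>)
  then show "mean_state P X ?l t = m t + c *\<^sub>R ymean \<beta> t"
    unfolding ymean_def m_def using s[THEN sq_int_integrable[OF finite_measure_axioms]] by simp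
qed

lemma mean_state_\<alpha>: "t \<in> {0..T} \<Longrightarrow> mean_state P X \<alpha> t = m t"
  using mean_state_perturbed(1)[OF H2_zero, of t 0] by simp

lemma payoff_perturbed:
  assumes b: "\<beta> \<in> H2 M T F"
  shows "payoff D P X (\<lambda>s \<omega>. \<alpha> s \<omega> + c *\<^sub>R \<beta> s \<omega>) (\<lambda>t \<omega>. mean_state P X (\<lambda>s \<omega>. \<alpha> s \<omega> + c *\<^sub>R \<beta> s \<omega>) t)
    = reward z0 zT + c * ell \<beta> - c\<^sup>2 * quad \<beta>"
proof -
  let ?l = "\<lambda>s \<omega>. \<alpha> s \<omega> + c *\<^sub>R \<beta> s \<omega>" and ?x = "\<lambda>\<omega> t. xa \<omega> t + c *\<^sub>R sol (\<lambda>s. \<beta> s \<omega>) t"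
  have "payoff D P X ?l (\<lambda>t \<omega>. mean_state P X ?l t) = payoff D P X ?l (\<lambda>t \<omega>. m t + c *\<^sub>R ymean \<beta> t)"
    by (rule payoff_cong) (rule mean_state_perturbed(1)[OF b])
  also have "\<dots> = reward (triple ?x ?l (\<lambda>t \<omega>. m t + c *\<^sub>R ymean \<beta> t)) (endpoint ?x (\<lambda>t \<omega>. m t + c *\<^sub>R ymean \<beta> t))"
  proof (rule payoff_reward)
    have "triple ?x ?l (\<lambda>t \<omega>. m t + c *\<^sub>R ymean \<beta> t) = (\<lambda>z. z0 z + c *\<^sub>R dir \<beta> z)"
      by (simp add: fun_eq_iff triple_def z0_def dir_def)
    then show "sq_int N (triple ?x ?l (\<lambda>t \<omega>. m t + c *\<^sub>R ymean \<beta> t))"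
      using sq_int_add[OF z0_sq sq_int_scaleR[OF dir_sq[OF b]]] by simp
    have "endpoint ?x (\<lambda>t \<omega>. m t + c *\<^sub>R ymean \<beta> t) = (\<lambda>\<omega>. zT \<omega> + c *\<^sub>R dir_end \<beta> \<omega>)"
      by (simp add: fun_eq_iff endpoint_def zT_def dir_end_def)
    then show "sq_int M (endpoint ?x (\<lambda>t \<omega>. m t + c *\<^sub>R ymean \<beta> t))"
      using sq_int_add[OF zT_sq sq_int_scaleR[OF dir_end_sq[OF b]]] by simp
    show "AE \<omega> in M. \<forall>t\<in>{0..T}. X ?l t \<omega> = xa \<omega> t + c *\<^sub>R sol (\<lambda>s. \<beta> s \<omega>) t"
      by (rule mean_state_perturbed(2)[OF b T0(2)])
  qed
  also have "\<dots> = reward (\<lambda>z. z0 z + c *\<^sub>R dir \<beta> z) (\<lambda>\<omega>. zT \<omega> + c *\<^sub>R dir_end \<beta> \<omega>)"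
    by (intro arg_cong2[where f = reward]) (simp_all add: fun_eq_iff triple_def endpoint_def z0_def zT_def dir_def dir_end_def)
  also have "\<dots> = reward z0 zT + c * ell \<beta> - c\<^sup>2 * quad \<beta>"
    unfolding ell_def quad_def by (rule reward_expansion[OF z0_sq zT_sq dir_sq[OF b] dir_end_sq[OF b]])
  finally show ?thesis .
qed

lemma payoff_\<alpha>: "payoff D P X \<alpha> (\<lambda>t \<omega>. mean_state P X \<alpha> t) = reward z0 zT"
  using payoff_perturbed[OF H2_zero, of 0] by simp

text \<open>Optimality says \<open>c * ell \<beta> \<le> c^2 * quad \<beta>\<close> for every real
  \<open>c\<close>. Adding the cases \<open>c = 1\<close> and \<open>c = -1\<close> gives the sign
  of the curvature. If the curvature vanishes as well as the derivative, the perturbed control is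
  another maximizer, and uniqueness identifies it with \<alpha>.\<close>

lemma stationarity:
  assumes b: "\<beta> \<in> H2 M T F1"
  shows "ell \<beta> = 0" "quad \<beta> \<ge> 0" "quad \<beta> = 0 \<Longrightarrow> AE z in N. \<beta> (snd z) (fst z) = 0"
proof -
  have bF: "\<beta> \<in> H2 M T F" using b H2_F1_F by blast
  have max: "c * ell \<beta> \<le> c\<^sup>2 * quad \<beta>" for c
  proof -
    have "(\<lambda>s \<omega>. \<alpha> s \<omega> + c *\<^sub>R \<beta> s \<omega>) \<in> H2 M T F1" by (rule H2_lin[OF filtration_F1 \<alpha> b])
    then have "payoff D P X (\<lambda>s \<omega>. \<alpha> s \<omega> + c *\<^sub>R \<beta> s \<omega>) (\<lambda>t \<omega>. mean_state P X (\<lambda>s \<omega>. \<alpha> s \<omega> + c *\<^sub>R \<beta> s \<omega>) t)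
        \<le> payoff D P X \<alpha> (\<lambda>t \<omega>. mean_state P X \<alpha> t)"
      using mfc unfolding MFC_solution_def MFC_maximizer_def by blast
    then show ?thesis unfolding payoff_perturbed[OF bF] payoff_\<alpha> by simp
  qed
  show q: "quad \<beta> \<ge> 0" using max[of 1] max[of "-1"] by simp
  show e: "ell \<beta> = 0"
  proof (rule ccontr)
    assume ne: "ell \<beta> \<noteq> 0"
    \<comment> \<open>One is added since the curvature may be zero; the choice makes
      \<open>c * ell \<beta>\<close> exceed \<open>c^2 * quad \<beta>\<close> by exactly
      \<open>c^2\<close>.\<close>
    define c where "c = ell \<beta> / (quad \<beta> + 1)"
    have q1: "quad \<beta> + 1 > 0" using q by simp
    have "c * ell \<beta> = c\<^sup>2 * (quad \<beta> + 1)" using q1 by (simp add: c_def power2_eq_square)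
    moreover have "c\<^sup>2 > 0" using ne q1 by (simp add: c_def)
    ultimately show False using max[of c] by (simp add: distrib_left)
  qed
  assume q0: "quad \<beta> = 0"
  let ?l = "\<lambda>s \<omega>. \<alpha> s \<omega> + 1 *\<^sub>R \<beta> s \<omega>"
  have "MFC_maximizer D P X ?l"
    unfolding MFC_maximizer_def
  proof (intro conjI ballI)
    show "?l \<in> H2 M T F1" by (rule H2_lin[OF filtration_F1 \<alpha> b])
    fix \<gamma> :: "real \<Rightarrow> 'a \<Rightarrow> real ^ 'k" assume "\<gamma> \<in> H2 M T F1"
    then have "payoff D P X \<gamma> (\<lambda>t \<omega>. mean_state P X \<gamma> t) \<le> payoff D P X \<alpha> (\<lambda>t \<omega>. mean_state P X \<alpha> t)"
      using mfc unfolding MFC_solution_def MFC_maximizer_def by blast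
    also have "\<dots> = payoff D P X ?l (\<lambda>t \<omega>. mean_state P X ?l t)"
      unfolding payoff_perturbed[OF bF] payoff_\<alpha> using e q0 by simp
    finally show "payoff D P X \<gamma> (\<lambda>t \<omega>. mean_state P X \<gamma> t) \<le> payoff D P X ?l (\<lambda>t \<omega>. mean_state P X ?l t)" .
  qed
  then have "control_eq D P ?l \<alpha>" using mfc unfolding MFC_solution_def by blast
  then have "AE z in N. ?l (snd z) (fst z) = \<alpha> (snd z) (fst z)" by (simp add: control_eq_def case_prod_unfold)
  then show "AE z in N. \<beta> (snd z) (fst z) = 0" by eventually_elim simp
qed

end

section \<open>Controls supported on one time block\<close>

context noise_basis
begin

text \<open>The control starts after \<open>a\<close>: before that time it is zero, and from
  \<open>a\<close> on \<open>Z\<close> is known.\<close>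

lemma H2_step:
  fixes v :: "real ^ 'k::finite"
  assumes G: "filtration G" and a: "a \<in> {0..T}" "{a<..b} \<subseteq> {0..T}"
    and Z: "sq_int M Z" "Z \<in> borel_measurable (G a)"
  shows "(\<lambda>t \<omega>. indicator {a<..b} t *\<^sub>R Z \<omega> *\<^sub>R v) \<in> H2 M T G"
  unfolding H2_iff[OF G]
proof
  have S: "{a<..b} \<in> sets L" using a(2) by (auto simp: sets_restrict_space_iff)
  have "sq_int M (\<lambda>\<omega>. Z \<omega> *\<^sub>R v)" by (rule sq_int_bounded_linear[OF Z(1) bounded_linear_scaleR_left])
  then show "sq_int N (\<lambda>z. indicator {a<..b} (snd z) *\<^sub>R Z (fst z) *\<^sub>R v)"
    by (intro sq_int_N_indicator_time S sq_int_N_omega[of "\<lambda>\<omega>. Z \<omega> *\<^sub>R v"])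
  show "progressive T G (\<lambda>t \<omega>. indicator {a<..b} t *\<^sub>R Z \<omega> *\<^sub>R v)"
    unfolding progressive_def
  proof
    fix t assume t: "t \<in> {0..T}"
    show "(\<lambda>(s, \<omega>). indicator {a<..b} s *\<^sub>R Z \<omega> *\<^sub>R v) \<in> borel_measurable (restrict_space borel {0..t} \<Otimes>\<^sub>M G t)"
    proof (cases "a \<le> t")
      case True
      have "space (G a) = space (G t)" "sets (G a) \<subseteq> sets (G t)"
        using G a t True by (auto simp: filtration_def subalgebra_def)
      then have Zt: "Z \<in> borel_measurable (G t)" by (rule measurable_mono_sets[OF Z(2)])
      have it: "(indicator {a<..b} :: real \<Rightarrow> real) \<in> borel_measurable (restrict_space borel {0..t})"
        by (rule measurable_restrict_space1) simp
      show ?thesis unfolding case_prod_unfold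
        by (intro borel_measurable_scaleR measurable_compose[OF measurable_fst it]
            measurable_compose[OF measurable_snd Zt] borel_measurable_const)
    next
      case False
      have "(\<lambda>(s, \<omega>). indicator {a<..b} s *\<^sub>R Z \<omega> *\<^sub>R v) \<in> borel_measurable (restrict_space borel {0..t} \<Otimes>\<^sub>M G t)
        \<longleftrightarrow> (\<lambda>_. 0 :: real ^ 'k) \<in> borel_measurable (restrict_space borel {0..t} \<Otimes>\<^sub>M G t)"
        by (rule measurable_cong) (use False in \<open>auto simp: space_pair_measure\<close>)
      then show ?thesis by simp
    qed
  qed
qed

lemma orth_cond_exp:
  assumes H: "subalgebra M H" and Z: "sq_int M Z"
  shows "orth M H (\<lambda>\<omega>. Z \<omega> - real_cond_exp M H Z \<omega>)"
  unfolding orth_def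
proof (intro conjI ballI)
  note c = cond_exp_sq_int[OF finite_measure_axioms H Z]
  show "integrable M (\<lambda>\<omega>. Z \<omega> - real_cond_exp M H Z \<omega>)"
    by (rule sq_int_integrable[OF finite_measure_axioms sq_int_diff[OF Z c(1)]])
  fix C assume C: "C \<in> sets H"
  have CM: "C \<in> sets M" using H C by (auto simp: subalgebra_def)
  have i: "sq_int M (indicator C :: 'a \<Rightarrow> real)"
    using sq_int_indicator_scaleR[OF sq_int_const[OF finite_measure_axioms, of "1 :: real"] CM] by simp
  have "(\<integral>\<omega>. indicator C \<omega> * real_cond_exp M H Z \<omega> \<partial>M) = (\<integral>\<omega>. indicator C \<omega> * Z \<omega> \<partial>M)"
    by (rule c(3)[OF i]) (use C in simp)
  moreover have "integrable M (\<lambda>\<omega>. indicator C \<omega> * Z \<omega>)" "integrable M (\<lambda>\<omega>. indicator C \<omega> * real_cond_exp M H Z \<omega>)"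
    using sq_int_scaleR_fun[OF i Z] sq_int_scaleR_fun[OF i c(1)] by simp_all
  ultimately show "(\<integral>\<omega>. indicator C \<omega> * (Z \<omega> - real_cond_exp M H Z \<omega>) \<partial>M) = 0"
    by (simp add: right_diff_distrib)
qed

lemma orth_mean: "orth M (sigma_noise P T) Z \<Longrightarrow> (\<integral>\<omega>. Z \<omega> \<partial>M) = 0"
proof -
  assume o: "orth M (sigma_noise P T) Z"
  have "space M \<in> sets (sigma_noise P T)" using sets.top[of "sigma_noise P T"] by simp
  then have "(\<integral>\<omega>. indicator (space M) \<omega> * Z \<omega> \<partial>M) = 0" using o by (auto simp: orth_def)
  moreover have "(\<integral>\<omega>. indicator (space M) \<omega> * Z \<omega> \<partial>M) = (\<integral>\<omega>. Z \<omega> \<partial>M)"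
    by (intro Bochner_Integration.integral_cong) auto
  ultimately show ?thesis by simp
qed

text \<open>The average looks only at times up to the right end of the block, so the integral may be
  taken over the shorter interval ending there, where progressive measurability at that time
  applies.\<close>

lemma block_avg_adapted:
  fixes \<beta> :: "real \<Rightarrow> 'a \<Rightarrow> real ^ 'k::finite"
  assumes b: "\<beta> \<in> H2 M T F" and i: "i < n"
  shows "sq_int M (\<lambda>\<omega>. block_avg T n (\<lambda>s. \<beta> s \<omega>) i)"
    and "(\<lambda>\<omega>. block_avg T n (\<lambda>s. \<beta> s \<omega>) i) \<in> borel_measurable (F (real (Suc i) * T / real n))"
proof -
  have pb: "progressive T F \<beta>" and sb: "sq_int N (\<lambda>z. \<beta> (snd z) (fst z))"
    using b by (simp_all add: H2_iff[OF filtration_F])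
  note S = block_sets_leb[OF T_pos i]
  have "sq_int M (\<lambda>\<omega>. \<integral>s. indicator (block T n i) s *\<^sub>R \<beta> s \<omega> \<partial>L)"
    using sq_int_path_integral[OF sq_int_N_indicator_time[OF sb S]] by simp
  then show "sq_int M (\<lambda>\<omega>. block_avg T n (\<lambda>s. \<beta> s \<omega>) i)" unfolding block_avg_def by (rule sq_int_scaleR)
  define a where "a = real (Suc i) * T / real n"
  have "real (Suc i) * T / real n \<le> real n * T / real n"
    using T_pos i by (intro divide_right_mono mult_right_mono) auto
  then have a: "a \<in> {0..T}" using T_pos i by (auto simp: a_def)
  have sub: "block T n i \<subseteq> {0..a}" using block_subset[OF T_pos i] by (auto simp: block_def a_def)
  have eq: "(\<integral>s. indicator (block T n i) s *\<^sub>R f s \<partial>leb T) = (\<integral>s. indicator (block T n i) s *\<^sub>R f s \<partial>leb a)"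
    for f :: "real \<Rightarrow> real ^ 'k"
  proof -
    have "(\<integral>s. indicator (block T n i) s *\<^sub>R f s \<partial>leb u) = (\<integral>s. indicator (block T n i) s *\<^sub>R f s \<partial>lborel)"
      if "block T n i \<subseteq> {0..u}" for u
    proof -
      have "(\<integral>s. indicator (block T n i) s *\<^sub>R f s \<partial>leb u)
          = (\<integral>s. indicator {0..u} s *\<^sub>R indicator (block T n i) s *\<^sub>R f s \<partial>lborel)"
        by (rule integral_restrict_space) simp
      also have "\<dots> = (\<integral>s. indicator (block T n i) s *\<^sub>R f s \<partial>lborel)"
        by (intro Bochner_Integration.integral_cong refl) (use that in \<open>auto simp: indicator_def\<close>)
      finally show ?thesis .
    qed
    from this[OF sub] this[OF block_subset[OF T_pos i]] show ?thesis by simp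
  qed
  have fl: "sigma_finite_measure (leb a)"
    using finite_measure_leb[of a] by (simp add: finite_measure_def)
  have ind: "(indicator (block T n i) :: real \<Rightarrow> real) \<in> borel_measurable (leb a)"
    by (rule measurable_restrict_space1) simp
  have "(\<lambda>z. indicator (block T n i) (snd z) *\<^sub>R \<beta> (snd z) (fst z)) \<in> borel_measurable (F a \<Otimes>\<^sub>M leb a)"
    by (intro borel_measurable_scaleR measurable_compose[OF measurable_snd ind] progressive_at[OF pb a])
  then have "(\<lambda>\<omega>. \<integral>s. indicator (block T n i) s *\<^sub>R \<beta> s \<omega> \<partial>leb a) \<in> borel_measurable (F a)"
    by (intro sigma_finite_measure.borel_measurable_lebesgue_integral[OF fl]) (simp add: case_prod_unfold)
  then show "(\<lambda>\<omega>. block_avg T n (\<lambda>s. \<beta> s \<omega>) i) \<in> borel_measurable (F (real (Suc i) * T / real n))"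
    unfolding block_avg_def eq a_def[symmetric] by (intro borel_measurable_scaleR borel_measurable_const)
qed

end

context mfc_setting
begin

text \<open>The state is orthogonal at every time and the control at almost every time; the mean
  path is deterministic, and \<open>Z\<close> has mean zero. The exceptional times do not depend on
  \<open>Z\<close>, as needed when \<open>Z\<close> itself varies with time.\<close>

lemma orth_z0:
  "AE t in L. \<forall>Z. sq_int M Z \<longrightarrow> orth M (sigma_noise P T) Z \<longrightarrow> (\<integral>\<omega>. Z \<omega> *\<^sub>R z0 (\<omega>, t) \<partial>M) = 0"
  and orth_zT: "sq_int M Z \<Longrightarrow> orth M (sigma_noise P T) Z \<Longrightarrow> (\<integral>\<omega>. Z \<omega> *\<^sub>R zT \<omega> \<partial>M) = 0"
proof -
  have c0: "(\<integral>\<omega>. Z \<omega> *\<^sub>R c \<partial>M) = 0" if "sq_int M Z" "orth M (sigma_noise P T) Z" for Z and c :: "real ^ 'd"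
    using orth_mean[OF that(2)] sq_int_integrable[OF finite_measure_axioms that(1)] by simp
  show "AE t in L. \<forall>Z. sq_int M Z \<longrightarrow> orth M (sigma_noise P T) Z \<longrightarrow> (\<integral>\<omega>. Z \<omega> *\<^sub>R z0 (\<omega>, t) \<partial>M) = 0"
    using AE_conjI[OF l2_AE_time[OF z0_sq] orth_control[OF \<alpha>]]
  proof (rule AE_mp, intro AE_I2 impI allI)
    fix t Z assume t: "t \<in> space L"
      and a: "sq_int M (\<lambda>\<omega>. z0 (\<omega>, t)) \<and> (\<forall>Z. sq_int M Z \<longrightarrow> orth M (sigma_noise P T) Z \<longrightarrow> (\<integral>\<omega>. Z \<omega> *\<^sub>R \<alpha> t \<omega> \<partial>M) = 0)"
      and Z: "sq_int M Z" "orth M (sigma_noise P T) Z"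
    have s: "sq_int M (\<lambda>\<omega>. z0 (\<omega>, t))" and z: "(\<integral>\<omega>. Z \<omega> *\<^sub>R \<alpha> t \<omega> \<partial>M) = 0" using a Z by blast+
    have x: "(\<integral>\<omega>. Z \<omega> *\<^sub>R xa \<omega> t \<partial>M) = 0" using orth_state[OF \<alpha> xa Z] t by simp
    note i = sq_int_scaleR_fun[OF Z(1) s]
    have i2: "integrable M (\<lambda>\<omega>. snd (Z \<omega> *\<^sub>R z0 (\<omega>, t)))" by (rule integrable_bounded_linear[OF bounded_linear_snd i])
    have "(\<integral>\<omega>. snd (Z \<omega> *\<^sub>R z0 (\<omega>, t)) \<partial>M) = 0"
      by (rule integral_Pair_zero[OF i2]) (use z c0[OF Z] in \<open>simp_all add: z0_def triple_def\<close>)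
    then show "(\<integral>\<omega>. Z \<omega> *\<^sub>R z0 (\<omega>, t) \<partial>M) = 0"
      by (intro integral_Pair_zero[OF i]) (use x in \<open>simp_all add: z0_def triple_def\<close>)
  qed
  assume Z: "sq_int M Z" "orth M (sigma_noise P T) Z"
  show "(\<integral>\<omega>. Z \<omega> *\<^sub>R zT \<omega> \<partial>M) = 0"
    by (rule integral_Pair_zero[OF sq_int_scaleR_fun[OF Z(1) zT_sq]])
      (use orth_state[OF \<alpha> xa Z T0(2)] c0[OF Z] in \<open>simp_all add: zT_def endpoint_def\<close>)
qed

text \<open>The derivative at the optimum pairs the direction with deterministic coefficients and
  with the optimal processes, which are orthogonal to everything that is orthogonal to the noise;
  such a direction is invisible to it.\<close>

lemma dreward_z0_orth:
  assumes g: "sq_int N g" "sq_int M gT"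
    and a: "AE t in L. \<forall>b\<in>Basis. orth M (sigma_noise P T) (\<lambda>\<omega>. g (\<omega>, t) \<bullet> b)"
    and b: "\<And>b. b \<in> Basis \<Longrightarrow> orth M (sigma_noise P T) (\<lambda>\<omega>. gT \<omega> \<bullet> b)"
  shows "dreward z0 zT g gT = 0"
proof (rule dreward_zero[OF z0_sq zT_sq g])
  show "AE t in L. \<forall>b\<in>Basis. (\<integral>\<omega>. g (\<omega>, t) \<bullet> b \<partial>M) = 0 \<and> (\<integral>\<omega>. (g (\<omega>, t) \<bullet> b) *\<^sub>R z0 (\<omega>, t) \<partial>M) = 0"
    using orth_z0 a l2_AE_time[OF g(1)]
  proof eventually_elim
    case (elim t)
    have "sq_int M (\<lambda>\<omega>. g (\<omega>, t) \<bullet> b)" for b by (rule sq_int_bounded_linear[OF elim(3) bounded_linear_inner_left])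
    then show ?case using elim orth_mean by blast
  qed
  show "(\<integral>\<omega>. (gT \<omega> \<bullet> b) *\<^sub>R zT \<omega> \<partial>M) = 0" if "b \<in> Basis" for b
    by (rule orth_zT[OF sq_int_bounded_linear[OF g(2) bounded_linear_inner_left] b[OF that]])
qed

lemma orth_mult: "orth K H Z \<Longrightarrow> orth K H (\<lambda>\<omega>. Z \<omega> * c)"
  by (auto simp: orth_def mult.assoc[symmetric])

text \<open>The conditional expectation of \<open>Z\<close> given the noise up to \<open>a\<close> yields a control adapted to the
  noise, for which stationarity is available. The remainder is orthogonal to all of the noise, hence
  to the optimal control and its state.\<close>

lemma ell_step:
  assumes a: "a \<in> {0..T}" "{a<..b} \<subseteq> {0..T}" and Z: "sq_int M Z" "Z \<in> borel_measurable (F a)"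
  shows "ell (\<lambda>t \<omega>. indicator {a<..b} t *\<^sub>R Z \<omega> *\<^sub>R v) = 0"
proof -
  let ?H = "\<lambda>Z t \<omega>. indicator {a<..b} t *\<^sub>R Z \<omega> *\<^sub>R v"
  define Z1 where "Z1 = real_cond_exp M (sigma_noise P a) Z"
  define Z2 where "Z2 \<omega> = Z \<omega> - Z1 \<omega>" for \<omega>
  note sub = sigma_noise_subalgebra[OF a(1)]
  have Z1: "sq_int M Z1" "Z1 \<in> borel_measurable (sigma_noise P a)"
    unfolding Z1_def using cond_exp_sq_int(1)[OF finite_measure_axioms sub Z(1)] by auto
  have sp: "space (sigma_noise P a) = space (F a)" "space (sigma_noise P a) = space (F1 a)"
    using F_subalgebra[OF a(1)] F1_subalgebra[OF a(1)] by (simp_all add: subalgebra_def)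
  have Z1F: "Z1 \<in> borel_measurable (F a)"
    by (rule measurable_mono_sets[OF Z1(2) sp(1) sigma_noise_F[OF a(1)]])
  have Z1F1: "Z1 \<in> borel_measurable (F1 a)"
    by (rule measurable_mono_sets[OF Z1(2) sp(2) sigma_noise_F1[OF a(1)]])
  have Z2: "sq_int M Z2" "Z2 \<in> borel_measurable (F a)"
    unfolding Z2_def[abs_def] using Z Z1(1) Z1F by (auto intro: sq_int_diff)
  have o: "orth M (sigma_noise P T) Z2"
    by (rule immersion[OF a(1) Z2(2)]) (use orth_cond_exp[OF sub Z(1)] in \<open>simp add: Z2_def[abs_def] Z1_def\<close>)
  have h1: "?H Z1 \<in> H2 M T F" by (rule H2_step[OF filtration_F a Z1(1) Z1F])
  have h2: "?H Z2 \<in> H2 M T F" by (rule H2_step[OF filtration_F a Z2])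
  have 1: "ell (?H Z1) = 0" by (rule stationarity(1)[OF H2_step[OF filtration_F1 a Z1(1) Z1F1]])
  have 2: "ell (?H Z2) = 0"
    unfolding ell_def
  proof (rule dreward_z0_orth[OF dir_sq[OF h2] dir_end_sq[OF h2]])
    have u: "sq_int L (\<lambda>t. indicator {a<..b} t *\<^sub>R v)"
      using a(2) by (intro sq_int_indicator_scaleR sq_int_const finite_measure_leb) (auto simp: sets_restrict_space_iff)
    \<comment> \<open>The response to a random multiple of a deterministic control is the same
      multiple of a deterministic path. Since \<open>Z2\<close> is centred, the mean path vanishes,
      so the whole direction is \<open>Z2\<close> times a deterministic vector at each time.\<close>
    have sol: "sol (\<lambda>s. ?H Z2 s \<omega>) t = Z2 \<omega> *\<^sub>R sol (\<lambda>t. indicator {a<..b} t *\<^sub>R v) t" if "t \<in> {0..T}" for t \<omega>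
      using sol_scale[OF u that, of "Z2 \<omega>"] by (simp add: mult.commute)
    have y: "ymean (?H Z2) t = 0" if "t \<in> {0..T}" for t
      using orth_mean[OF o] sq_int_integrable[OF finite_measure_axioms Z2(1)] unfolding ymean_def sol[OF that] by simp
    have d: "dir (?H Z2) (\<omega>, t) = Z2 \<omega> *\<^sub>R (sol (\<lambda>t. indicator {a<..b} t *\<^sub>R v) t, indicator {a<..b} t *\<^sub>R v, 0)"
      if "t \<in> {0..T}" for t \<omega> unfolding dir_def triple_def fst_conv snd_conv y[OF that] sol[OF that] by (simp add: mult.commute)
    have e: "dir_end (?H Z2) \<omega> = Z2 \<omega> *\<^sub>R (sol (\<lambda>t. indicator {a<..b} t *\<^sub>R v) T, 0)" for \<omega>
      unfolding dir_end_def endpoint_def y[OF T0(2)] sol[OF T0(2)] by simp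
    show "AE t in L. \<forall>b\<in>Basis. orth M (sigma_noise P T) (\<lambda>\<omega>. dir (?H Z2) (\<omega>, t) \<bullet> b)"
    proof (intro AE_I2 ballI)
      fix t and c :: "('d, 'k) triple" assume "t \<in> space L"
      then have t: "t \<in> {0..T}" by simp
      show "orth M (sigma_noise P T) (\<lambda>\<omega>. dir (?H Z2) (\<omega>, t) \<bullet> c)"
        unfolding d[OF t] inner_scaleR_left by (intro orth_mult o)
    qed
    show "orth M (sigma_noise P T) (\<lambda>\<omega>. dir_end (?H Z2) \<omega> \<bullet> c)" for c
      unfolding e inner_scaleR_left by (intro orth_mult o)
  qed
  have "?H Z = (\<lambda>t \<omega>. ?H Z1 t \<omega> + 1 *\<^sub>R ?H Z2 t \<omega>)"
    by (simp add: fun_eq_iff Z2_def scaleR_diff_left scaleR_diff_right)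
  then show ?thesis using ell_lin[OF h1 h2, of 1] 1 2 by simp
qed

definition "ell_kernel = {\<gamma> \<in> H2 M T F. ell \<gamma> = 0}"

lemma ell_kernel_sum: "finite I \<Longrightarrow> (\<And>i. i \<in> I \<Longrightarrow> f i \<in> ell_kernel) \<Longrightarrow> (\<lambda>t \<omega>. \<Sum>i\<in>I. f i t \<omega>) \<in> ell_kernel"
proof (induction rule: finite_induct)
  case empty
  show ?case using H2_zero ell_lin[OF H2_zero H2_zero, of 1] by (simp add: ell_kernel_def)
next
  case (insert i I)
  then have s: "f i \<in> H2 M T F" "(\<lambda>t \<omega>. \<Sum>i\<in>I. f i t \<omega>) \<in> H2 M T F" "ell (f i) = 0" "ell (\<lambda>t \<omega>. \<Sum>i\<in>I. f i t \<omega>) = 0"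
    by (simp_all add: ell_kernel_def)
  show ?case using insert(1,2) H2_lin[OF filtration_F s(1,2), of 1] ell_lin[OF s(1,2), of 1] s(3,4)
    by (simp add: ell_kernel_def)
qed

text \<open>The average over block \<open>i\<close> is known when block \<open>Suc i\<close> starts.
  Expanding it in the basis writes the discretised control as a sum of scalar variables times fixed
  vectors on single blocks.\<close>

lemma disc_ell_kernel:
  assumes b: "\<beta> \<in> H2 M T F"
  shows "(\<lambda>t \<omega>. disc T n (\<lambda>s. \<beta> s \<omega>) t) \<in> ell_kernel"
proof -
  have "(\<lambda>t \<omega>. indicator (block T n (Suc i)) t *\<^sub>R (block_avg T n (\<lambda>s. \<beta> s \<omega>) i \<bullet> e) *\<^sub>R e) \<in> ell_kernel"
    if i: "i < n - 1" for i e
  proof -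
    have i: "i < n" and Si: "Suc i < n" using i by auto
    let ?a = "real (Suc i) * T / real n"
    have "real (Suc i) * T / real n \<le> real n * T / real n"
      using T_pos i by (intro divide_right_mono mult_right_mono) auto
    then have a: "?a \<in> {0..T}" using T_pos i by auto
    have bl: "block T n (Suc i) = {?a<..real (Suc (Suc i)) * T / real n}" by (simp add: block_def)
    have sb: "{?a<..real (Suc (Suc i)) * T / real n} \<subseteq> {0..T}" using block_subset[OF T_pos Si] by (simp only: bl)
    note Z = sq_int_bounded_linear[OF block_avg_adapted(1)[OF b i] bounded_linear_inner_left[of e]]
      borel_measurable_inner[OF block_avg_adapted(2)[OF b i] borel_measurable_const[of e]]
    show ?thesis unfolding ell_kernel_def bl
      using H2_step[OF filtration_F a sb Z] ell_step[OF a sb Z] by blast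
  qed
  then have "(\<lambda>t \<omega>. \<Sum>i<n-1. \<Sum>e\<in>Basis. indicator (block T n (Suc i)) t *\<^sub>R (block_avg T n (\<lambda>s. \<beta> s \<omega>) i \<bullet> e) *\<^sub>R e) \<in> ell_kernel"
    by (intro ell_kernel_sum) auto
  then show ?thesis
    unfolding disc_def scaleR_sum_right[symmetric] euclidean_representation .
qed

text \<open>\<open>ell\<close> is linear, and continuous in the square norm of the control, because
  the response is bounded by the control and the derivative is bounded in the direction. It vanishes
  on the discretised controls, which converge to \<beta>.\<close>

lemma ell_zero:
  assumes b: "\<beta> \<in> H2 M T F"
  shows "ell \<beta> = 0"
proof -
  define \<beta>n where "\<beta>n n = (\<lambda>t \<omega>. disc T n (\<lambda>s. \<beta> s \<omega>) t)" for n
  have bn: "\<beta>n n \<in> H2 M T F" "ell (\<beta>n n) = 0" for n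
    using disc_ell_kernel[OF b, of n] by (simp_all add: \<beta>n_def ell_kernel_def)
  define g where "g n z = \<beta> (snd z) (fst z) + (-1) *\<^sub>R \<beta>n n (snd z) (fst z)" for n z
  have dn: "(\<lambda>t \<omega>. \<beta> t \<omega> + (-1) *\<^sub>R \<beta>n n t \<omega>) \<in> H2 M T F" for n by (rule H2_lin[OF filtration_F b bn(1)])
  have gs: "sq_int N (g n)" for n using control_l2[OF dn[of n]] by (simp add: g_def[abs_def])
  note bi = pr.integrable_fst'[OF sq_int_norm[OF control_l2[OF b]]]
  \<comment> \<open>Convergence is known path by path only; the contraction property gives the
    dominating function, whose factor 4 is the sum of two factors 2.\<close>
  have "(\<lambda>n. \<integral>\<omega>. (\<integral>t. (norm (g n (\<omega>, t)))\<^sup>2 \<partial>L) \<partial>M) \<longlonglongrightarrow> (\<integral>\<omega>. 0 \<partial>M)"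
  proof (rule integral_dominated_convergence[where w = "\<lambda>\<omega>. 4 * (\<integral>t. (norm (\<beta> t \<omega>))\<^sup>2 \<partial>L)"])
    show "(\<lambda>\<omega>. \<integral>t. (norm (g n (\<omega>, t)))\<^sup>2 \<partial>L) \<in> borel_measurable M" for n
      by (rule borel_measurable_integrable[OF pr.integrable_fst'[OF sq_int_norm[OF gs]]])
    show "integrable M (\<lambda>\<omega>. 4 * (\<integral>t. (norm (\<beta> t \<omega>))\<^sup>2 \<partial>L))" using bi by simp
    have g: "g n (\<omega>, t) = - (disc T n (\<lambda>s. \<beta> s \<omega>) t - \<beta> t \<omega>)" for n \<omega> t by (simp add: g_def \<beta>n_def)
    show "AE \<omega> in M. (\<lambda>n. \<integral>t. (norm (g n (\<omega>, t)))\<^sup>2 \<partial>L) \<longlonglongrightarrow> 0"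
      using H2_AE_path[OF b] unfolding g norm_minus_cancel by eventually_elim (rule disc_tendsto[OF T_pos])
    show "AE \<omega> in M. norm (\<integral>t. (norm (g n (\<omega>, t)))\<^sup>2 \<partial>L) \<le> 4 * (\<integral>t. (norm (\<beta> t \<omega>))\<^sup>2 \<partial>L)" for n
      using H2_AE_path[OF b]
    proof eventually_elim
      case (elim \<omega>)
      note ds = disc_sq_int[OF T_pos, of n "\<lambda>s. \<beta> s \<omega>"]
      have "(\<integral>t. (norm (g n (\<omega>, t)))\<^sup>2 \<partial>L)
          \<le> (\<integral>t. 2 * (norm (disc T n (\<lambda>s. \<beta> s \<omega>) t))\<^sup>2 + 2 * (norm (\<beta> t \<omega>))\<^sup>2 \<partial>L)"
      proof (rule integral_mono)
        show "integrable L (\<lambda>t. (norm (g n (\<omega>, t)))\<^sup>2)"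
          using sq_int_norm[OF sq_int_diff[OF ds elim]] by (simp only: g norm_minus_cancel)
        show "integrable L (\<lambda>t. 2 * (norm (disc T n (\<lambda>s. \<beta> s \<omega>) t))\<^sup>2 + 2 * (norm (\<beta> t \<omega>))\<^sup>2)"
          using sq_int_norm[OF ds] sq_int_norm[OF elim] by simp
        show "(norm (g n (\<omega>, t)))\<^sup>2 \<le> 2 * (norm (disc T n (\<lambda>s. \<beta> s \<omega>) t))\<^sup>2 + 2 * (norm (\<beta> t \<omega>))\<^sup>2" for t
          using norm_add_power2[of "disc T n (\<lambda>s. \<beta> s \<omega>) t" "- \<beta> t \<omega>"] by (simp only: g norm_minus_cancel) simp
      qed
      also have "\<dots> = 2 * (\<integral>t. (norm (disc T n (\<lambda>s. \<beta> s \<omega>) t))\<^sup>2 \<partial>L) + 2 * (\<integral>t. (norm (\<beta> t \<omega>))\<^sup>2 \<partial>L)"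
        using sq_int_norm[OF ds] sq_int_norm[OF elim] by simp
      also have "\<dots> \<le> 4 * (\<integral>t. (norm (\<beta> t \<omega>))\<^sup>2 \<partial>L)" using disc_contraction[OF T_pos elim, of n] by simp
      finally show ?case by simp
    qed
  qed simp
  then have lim: "(\<lambda>n. \<integral>z. (norm (g n z))\<^sup>2 \<partial>N) \<longlonglongrightarrow> 0"
    by (simp add: pr.integral_fst'[OF sq_int_norm[OF gs]])
  obtain K where K: "K \<ge> 0" "\<And>\<beta>. \<beta> \<in> H2 M T F \<Longrightarrow>
    (\<integral>z. (norm (dir \<beta> z))\<^sup>2 \<partial>N) + (\<integral>\<omega>. (norm (dir_end \<beta> \<omega>))\<^sup>2 \<partial>M) \<le> K * (\<integral>z. (norm (\<beta> (snd z) (fst z)))\<^sup>2 \<partial>N)"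
    by (rule dir_bound) blast
  obtain C where C: "C \<ge> 0" "\<And>h hT. sq_int N h \<Longrightarrow> sq_int M hT \<Longrightarrow>
      (dreward z0 zT h hT)\<^sup>2 \<le> C * ((\<integral>z. (norm (h z))\<^sup>2 \<partial>N) + (\<integral>\<omega>. (norm (hT \<omega>))\<^sup>2 \<partial>M))"
    by (rule dreward_bound[OF z0_sq zT_sq]) blast
  have "(ell \<beta>)\<^sup>2 \<le> C * (K * (\<integral>z. (norm (g n z))\<^sup>2 \<partial>N))" for n
  proof -
    have "ell \<beta> = ell (\<lambda>t \<omega>. \<beta> t \<omega> + (-1) *\<^sub>R \<beta>n n t \<omega>)" using ell_lin[OF b bn(1), of "-1"] bn(2) by simp
    then have "(ell \<beta>)\<^sup>2 \<le> C * ((\<integral>z. (norm (dir (\<lambda>t \<omega>. \<beta> t \<omega> + (-1) *\<^sub>R \<beta>n n t \<omega>) z))\<^sup>2 \<partial>N)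
        + (\<integral>\<omega>. (norm (dir_end (\<lambda>t \<omega>. \<beta> t \<omega> + (-1) *\<^sub>R \<beta>n n t \<omega>) \<omega>))\<^sup>2 \<partial>M))"
      unfolding ell_def using C(2)[OF dir_sq[OF dn] dir_end_sq[OF dn]] by simp
    also have "\<dots> \<le> C * (K * (\<integral>z. (norm (g n z))\<^sup>2 \<partial>N))"
      using K(2)[OF dn[of n]] C(1) unfolding g_def by (intro mult_left_mono)
    finally show ?thesis .
  qed
  moreover have "(\<lambda>n. C * (K * (\<integral>z. (norm (g n z))\<^sup>2 \<partial>N))) \<longlonglongrightarrow> C * (K * 0)"
    by (intro tendsto_mult tendsto_const lim)
  ultimately have "(ell \<beta>)\<^sup>2 \<le> C * (K * 0)" by (intro LIMSEQ_le_const) blast+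
  then show ?thesis by simp
qed

end

section \<open>Comparison with a coarse correlated equilibrium\<close>

text \<open>The sum is the adjoint of \<open>h\<close> applied to \<open>y\<close>, in coordinates.
  It serves to move the cost operator to the argument that is measurable for the flow.\<close>

lemma inner_linear_coordinates:
  fixes h :: "'b::euclidean_space \<Rightarrow> 'b"
  assumes "linear h"
  shows "h x \<bullet> y = (\<Sum>e\<in>Basis. (h e \<bullet> y) *\<^sub>R e) \<bullet> x"
proof -
  have "h x = (\<Sum>e\<in>Basis. (x \<bullet> e) *\<^sub>R h e)"
    using arg_cong[OF euclidean_representation[of x], of h] by (simp add: linear_sum[OF assms] linear_scale[OF assms])
  then show ?thesis by (simp add: inner_sum_left inner_commute[of x] mult.commute)
qed

lemma mat_vector_mult: "mat c *v x = c *\<^sub>R (x :: real ^ 'n)"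
  by (simp add: vec_eq_iff matrix_vector_mult_def mat_def if_distrib[of "\<lambda>a. a * _"] cong: if_cong)

lemma psd_le_mat: "psd_le (mat c) E \<Longrightarrow> c * (norm x)\<^sup>2 \<le> (E *v x) \<bullet> x"
  by (simp add: psd_le_def matrix_vector_mult_diff_rdistrib mat_vector_mult inner_diff_right inner_commute power2_norm_eq_inner)

context lq_setting
begin

text \<open>With the flow component zero only \<open>lq_Q\<close>, \<open>lq_R\<close> and
  \<open>lq_S\<close> are left. For \<open>d1 > 0\<close> completing the square absorbs the mixed
  term into the \<open>lq_Q\<close> part and leaves \<open>(d2 - c / d1) / 2\<close>, which is
  positive because \<open>c < d1 * d2\<close>. For \<open>d1 = 0\<close> the mixed term vanishes and
  \<open>d2 / 2\<close> remains.\<close>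

lemma coercive:
  obtains \<kappa> where "\<kappa> > 0"
    "\<And>t y v. t \<in> {0..T} \<Longrightarrow> \<kappa> * (norm v)\<^sup>2 \<le> cost_op t (y, v, 0) \<bullet> (y, v, 0)"
proof -
  obtain d1 d2 where d: "0 \<le> d1" "0 < d2"
    and Q: "\<And>t. t \<in> {0..T} \<Longrightarrow> psd_le (mat d1) (lq_Q D t)" and R: "\<And>t. t \<in> {0..T} \<Longrightarrow> psd_le (mat d2) (lq_R D t)"
    and S: "0 < d1 \<Longrightarrow> \<exists>c < d1 * d2. \<forall>t\<in>{0..T}. (onorm ((*v) (lq_S D t)))\<^sup>2 \<le> c"
    and S0: "d1 = 0 \<Longrightarrow> (\<forall>t\<in>{0..T}. lq_S D t = 0)"
    using coefficients unfolding lq_coefficients_def by blast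
  have eq: "cost_op t (y, v, 0) \<bullet> (y, v, 0)
      = 1/2 * ((lq_Q D t *v y) \<bullet> y) + 1/2 * ((lq_R D t *v v) \<bullet> v) + (lq_S D t *v y) \<bullet> v" for t y v
    by (simp add: cost_op_def inner_add_left)
  have low: "d1 / 2 * (norm y)\<^sup>2 + d2 / 2 * (norm v)\<^sup>2 + (lq_S D t *v y) \<bullet> v \<le> cost_op t (y, v, 0) \<bullet> (y, v, 0)"
    if "t \<in> {0..T}" for t y v
    using psd_le_mat[OF Q[OF that], of y] psd_le_mat[OF R[OF that], of v] unfolding eq by simp
  show thesis
  proof (cases "d1 = 0")
    case True
    show thesis
    proof (rule that[of "d2 / 2"])
      fix t y v assume t: "t \<in> {0..T}"
      show "d2 / 2 * (norm v)\<^sup>2 \<le> cost_op t (y, v, 0) \<bullet> (y, v, 0)" using low[OF t, of y v] S0 True t by simp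
    qed (use d in simp)
  next
    case False
    then have d1: "d1 > 0" using d by simp
    then obtain c where c: "c < d1 * d2" "\<And>t. t \<in> {0..T} \<Longrightarrow> (onorm ((*v) (lq_S D t)))\<^sup>2 \<le> c" using S by blast
    show thesis
    proof (rule that[of "(d2 - c / d1) / 2"])
      show "(d2 - c / d1) / 2 > 0" using c(1) d1 by (simp add: field_simps)
      fix t and y :: "real ^ 'd" and v :: "real ^ 'k" assume t: "t \<in> {0..T}"
      define s where "s = onorm ((*v) (lq_S D t))"
      have "norm (lq_S D t *v y) \<le> s * norm y"
        unfolding s_def by (rule onorm[OF matrix_vector_mul_bounded_linear])
      then have "\<bar>(lq_S D t *v y) \<bullet> v\<bar> \<le> s * norm y * norm v"
        using Cauchy_Schwarz_ineq2[of "lq_S D t *v y" v] mult_right_mono[OF _ norm_ge_zero[of v]] by fastforce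
      moreover have "s * norm y * norm v \<le> d1 / 2 * (norm y)\<^sup>2 + s\<^sup>2 / d1 / 2 * (norm v)\<^sup>2"
      proof -
        have "0 \<le> (d1 * norm y - s * norm v)\<^sup>2 / (2 * d1)" using d1 by simp
        also have "\<dots> = d1 / 2 * (norm y)\<^sup>2 + s\<^sup>2 / d1 / 2 * (norm v)\<^sup>2 - s * norm y * norm v"
          using d1 by (simp add: power2_eq_square field_simps)
        finally show ?thesis by simp
      qed
      moreover have "s\<^sup>2 / d1 / 2 * (norm v)\<^sup>2 \<le> c / d1 / 2 * (norm v)\<^sup>2"
        using c(2)[OF t] d1 by (intro mult_right_mono divide_right_mono) (simp_all add: s_def)
      ultimately have "d2 / 2 * (norm v)\<^sup>2 - c / d1 / 2 * (norm v)\<^sup>2 \<le> cost_op t (y, v, 0) \<bullet> (y, v, 0)"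
        using low[OF t, of y v] by linarith
      then show "(d2 - c / d1) / 2 * (norm v)\<^sup>2 \<le> cost_op t (y, v, 0) \<bullet> (y, v, 0)"
        by (simp add: left_diff_distrib diff_divide_distrib)
    qed
  qed
qed

lemma cost_end_nonneg: "0 \<le> cost_end (y, 0) \<bullet> (y, 0)"
  using coefficients by (simp add: lq_coefficients_def psd_le_def cost_end_def inner_commute)

lemma integral_N_time:
  fixes f :: "real \<Rightarrow> real"
  assumes "integrable N (\<lambda>z. f (snd z))"
  shows "(\<integral>z. f (snd z) \<partial>N) = (\<integral>t. f t \<partial>L)"
  using pr.integral_fst'[OF assms] by (simp add: prob_space)

end

locale cce_setting = mfc_setting P D X \<alpha> xa + cf: consistent_flow P D X \<alpha> lam mu xa x
  for P :: "('a, 'd::finite) stoch_basis" and D :: "('d, 'k::finite) lq_data" and X \<alpha> lam mu xa x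
begin

lemma m_eq: "cf.m = m" by (simp add: cf.m_def[abs_def] m_def[abs_def])

text \<open>The full deviation of the equilibrium from the optimum. Unlike \<open>dir\<close>, its
  third component is the random deviation of the flow instead of the mean of the state
  deviation.\<close>

definition "w = triple cf.Y cf.\<beta> (\<lambda>t \<omega>. cf.\<delta> \<omega> t)"
definition "wT = endpoint cf.Y (\<lambda>t \<omega>. cf.\<delta> \<omega> t)"

lemma w_sq: "sq_int N w" unfolding w_def
  by (intro triple_sq_int cf.Y_sq cf.\<delta>_sq control_l2 cf.\<beta>_F)

lemma wT_sq: "sq_int M wT" unfolding wT_def
  by (intro endpoint_sq_int cf.Y_sq cf.\<delta>_sq T0)

text \<open>The perturbation differs from \<open>dir\<close> of the control deviation in its flow
  component only, by \<delta> minus its mean. This is a centred function of the flow, hence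
  orthogonal to the noise, and the remaining direction is covered by
  \<open>ell_zero\<close>.\<close>

lemma dreward_w: "dreward z0 zT w wT = 0"
proof -
  note b = cf.\<beta>_F
  define e where "e z = w z + (-1) *\<^sub>R dir cf.\<beta> z" for z
  define eT where "eT \<omega> = wT \<omega> + (-1) *\<^sub>R dir_end cf.\<beta> \<omega>" for \<omega>
  have es: "sq_int N e" "sq_int M eT" unfolding e_def[abs_def] eT_def[abs_def]
    by (intro sq_int_add sq_int_scaleR w_sq wT_sq dir_sq dir_end_sq b)+
  have e: "e (\<omega>, t) = (0, 0, cf.\<delta> \<omega> t - ymean cf.\<beta> t)" for \<omega> t
    by (simp add: e_def w_def dir_def triple_def cf.Y_def zero_prod_def)
  have eT: "eT \<omega> = (0, cf.\<delta> \<omega> T - ymean cf.\<beta> T)" for \<omega>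
    by (simp add: eT_def wT_def dir_end_def endpoint_def cf.Y_def)
  have o: "orth M (sigma_noise P T) (\<lambda>\<omega>. (cf.\<delta> \<omega> t - ymean cf.\<beta> t) \<bullet> b)" if t: "t \<in> {0..T}" for t b
  proof -
    have s: "sq_int M (\<lambda>\<omega>. cf.\<delta> \<omega> t \<bullet> b)"
      by (rule sq_int_bounded_linear[OF cf.\<delta>_sq(1)[OF t] bounded_linear_inner_left])
    have "(\<lambda>\<omega>. cf.\<delta> \<omega> t \<bullet> b) \<in> borel_measurable cf.G"
      by (intro borel_measurable_inner cf.\<delta>_G t borel_measurable_const)
    note io = cf.indep_orth[OF s this]
    have "(\<integral>\<omega>. cf.\<delta> \<omega> t \<bullet> b \<partial>M) = ymean cf.\<beta> t \<bullet> b"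
      using integral_inner_left[OF sq_int_integrable[OF finite_measure_axioms cf.\<delta>_sq(1)[OF t]], of b] cf.mean_\<delta>[OF t]
      by (simp add: ymean_def cf.Y_def)
    then show ?thesis using io by (simp add: inner_diff_left)
  qed
  have 1: "dreward z0 zT e eT = 0"
  proof (rule dreward_z0_orth[OF es])
    show "AE t in L. \<forall>b\<in>Basis. orth M (sigma_noise P T) (\<lambda>\<omega>. e (\<omega>, t) \<bullet> b)"
    proof (intro AE_I2 ballI)
      fix t and b :: "('d, 'k) triple" assume "t \<in> space L"
      then have t: "t \<in> {0..T}" by simp
      show "orth M (sigma_noise P T) (\<lambda>\<omega>. e (\<omega>, t) \<bullet> b)"
        using o[OF t, of "snd (snd b)"] by (simp add: e inner_prod_def)
    qed
    show "orth M (sigma_noise P T) (\<lambda>\<omega>. eT \<omega> \<bullet> b)" for b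
      using o[OF T0(2), of "snd b"] by (simp add: eT inner_prod_def)
  qed
  have w: "w = (\<lambda>z. dir cf.\<beta> z + 1 *\<^sub>R e z)" "wT = (\<lambda>\<omega>. dir_end cf.\<beta> \<omega> + 1 *\<^sub>R eT \<omega>)"
    by (simp_all add: e_def eT_def)
  show ?thesis
    unfolding w dreward_add[OF z0_sq zT_sq dir_sq[OF b] dir_end_sq[OF b] es] using 1 ell_zero[OF b]
    by (simp add: ell_def)
qed

lemma payoff_lam: "payoff D P X lam mu = reward z0 zT - bil w wT w wT"
proof -
  let ?x = "\<lambda>\<omega> t. xa \<omega> t + cf.Y \<omega> t"
  have t: "triple ?x lam mu = (\<lambda>z. z0 z + 1 *\<^sub>R w z)" and e: "endpoint ?x mu = (\<lambda>\<omega>. zT \<omega> + 1 *\<^sub>R wT \<omega>)"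
    by (simp_all add: fun_eq_iff triple_def endpoint_def z0_def zT_def w_def wT_def cf.\<beta>_def cf.\<delta>_def m_eq)
  have ae: "AE \<omega> in M. \<forall>t\<in>{0..T}. X lam t \<omega> = xa \<omega> t + cf.Y \<omega> t"
    using cf.Y_eq state_versionD(4)[OF cf.x] by eventually_elim simp
  have "payoff D P X lam mu = reward (triple ?x lam mu) (endpoint ?x mu)"
    by (rule payoff_reward[OF _ _ ae], unfold t e) (intro sq_int_add sq_int_scaleR z0_sq zT_sq w_sq wT_sq)+
  also have "\<dots> = reward z0 zT - bil w wT w wT"
    unfolding t e reward_expansion[OF z0_sq zT_sq w_sq wT_sq] using dreward_w by simp
  finally show ?thesis .
qed

text \<open>The response to a deterministic control coincides with its own mean, so state and flow
  components are equal. This is exactly the shape of the conditional perturbation given the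
  flow.\<close>

lemma quad_deterministic:
  assumes u: "sq_int L u"
  defines "v \<equiv> \<lambda>t. (sol u t, u t, sol u t)"
  shows "quad (\<lambda>t \<omega>. u t) = (\<integral>t. cost_op t (v t) \<bullet> v t \<partial>L) + cost_end (sol u T, sol u T) \<bullet> (sol u T, sol u T)"
proof -
  have h: "(\<lambda>t \<omega>. u t) \<in> H2 M T F" by (rule H2_deterministic[OF filtration_F u])
  have d: "dir (\<lambda>t \<omega>. u t) z = v (snd z)" "dir_end (\<lambda>t \<omega>. u t) \<omega> = (sol u T, sol u T)" for z \<omega>
    by (simp_all add: dir_def dir_end_def triple_def endpoint_def ymean_def v_def prob_space)
  have "sq_int N (\<lambda>z. v (snd z))" using dir_sq[OF h] by (simp add: d(1)[abs_def])
  then have i: "integrable N (\<lambda>z. cost_op (snd z) (v (snd z)) \<bullet> v (snd z))"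
    by (intro sq_int_inner cost_op_sq_int)
  show ?thesis unfolding quad_def bil_def d integral_N_time[of "\<lambda>t. cost_op t (v t) \<bullet> v t", OF i]
    by (simp add: prob_space)
qed

text \<open>A deterministic control is adapted to the noise, so uniqueness of the optimum applies to
  it; the a priori bound on \<open>sol\<close> then carries the vanishing over to the path at every
  time.\<close>

lemma deterministic_zero:
  assumes u: "sq_int L u" and q: "quad (\<lambda>t \<omega>. u t) = 0"
  shows "(\<integral>t. (norm (u t))\<^sup>2 \<partial>L) = 0" "t \<in> {0..T} \<Longrightarrow> sol u t = 0"
proof -
  have ae: "AE z in N. u (snd z) = 0"
    by (rule stationarity(3)[OF H2_deterministic[OF filtration_F1 u] q])
  have "(\<integral>z. (norm (u (snd z)))\<^sup>2 \<partial>N) = 0"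
    by (rule integral_eq_zero_AE, use ae in eventually_elim) simp
  then show z: "(\<integral>t. (norm (u t))\<^sup>2 \<partial>L) = 0"
    using integral_N_time[of "\<lambda>t. (norm (u t))\<^sup>2", OF sq_int_norm[OF sq_int_N_time[OF u]]] by simp
  obtain K where "\<And>u t. sq_int L u \<Longrightarrow> t \<in> {0..T} \<Longrightarrow> (norm (sol u t))\<^sup>2 \<le> K * (\<integral>s. (norm (u s))\<^sup>2 \<partial>L)"
    by (rule sol_bound) blast
  from this[OF u, of t] show "t \<in> {0..T} \<Longrightarrow> sol u t = 0" by (simp add: z)
qed

text \<open>The perturbation is split into its conditional expectation given the flow and a residual. The
  cross terms vanish, the first part is an average of curvatures of deterministic controls, and
  only the coercivity in the control is left of the second, since the residual has no component
  along the flow.\<close>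

lemma bil_w:
  obtains \<kappa> b q where "\<kappa> > 0" "sq_int N (\<lambda>z. b (fst z) (snd z))"
    "AE \<omega> in M. sq_int L (b \<omega>) \<and> (\<forall>t\<in>{0..T}. cf.\<delta> \<omega> t = sol (b \<omega>) t) \<and> q \<omega> = quad (\<lambda>t _. b \<omega> t)"
    "integrable M q"
    "bil w wT w wT \<ge> (\<integral>\<omega>. q \<omega> \<partial>M) + \<kappa> * (\<integral>z. (norm (cf.\<beta> (snd z) (fst z) - b (fst z) (snd z)))\<^sup>2 \<partial>N)"
proof -
  obtain b where bm: "(\<lambda>z. b (fst z) (snd z)) \<in> borel_measurable (cf.G \<Otimes>\<^sub>M L)"
    and bs: "sq_int N (\<lambda>z. b (fst z) (snd z))"
    and bo: "\<And>\<phi>. sq_int N \<phi> \<Longrightarrow> \<phi> \<in> borel_measurable (cf.G \<Otimes>\<^sub>M L) \<Longrightarrow>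
      (\<integral>z. \<phi> z \<bullet> (cf.\<beta> (snd z) (fst z) - b (fst z) (snd z)) \<partial>N) = 0"
    and bsol: "AE \<omega> in M. sq_int L (b \<omega>) \<and> (\<forall>t\<in>{0..T}. cf.\<delta> \<omega> t = sol (b \<omega>) t)"
    by (rule cf.conditional_control) blast
  obtain \<kappa> where \<kappa>: "\<kappa> > 0" "\<And>t y v. t \<in> {0..T} \<Longrightarrow> \<kappa> * (norm v)\<^sup>2 \<le> cost_op t (y, v, 0) \<bullet> (y, v, 0)"
    by (rule coercive) blast
  \<comment> \<open>\<open>w0\<close> is the conditional expectation of \<open>w\<close> given the
    flow: \<open>Y\<close> is replaced by \<delta> and \<beta> by \<open>b\<close>, while \<delta>
    is kept. Hence the flow component of the rest \<open>w1\<close> is zero, as coercivity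
    requires.\<close>
  define w0 where "w0 z = (cf.\<delta> (fst z) (snd z), b (fst z) (snd z), cf.\<delta> (fst z) (snd z))" for z
  define w1 where "w1 z = (cf.Y (fst z) (snd z) - cf.\<delta> (fst z) (snd z), cf.\<beta> (snd z) (fst z) - b (fst z) (snd z), 0 :: real ^ 'd)" for z
  define w0T where "w0T \<omega> = (cf.\<delta> \<omega> T, cf.\<delta> \<omega> T)" for \<omega>
  define w1T where "w1T \<omega> = (cf.Y \<omega> T - cf.\<delta> \<omega> T, 0 :: real ^ 'd)" for \<omega>
  have split: "w = (\<lambda>z. w0 z + 1 *\<^sub>R w1 z)" "wT = (\<lambda>\<omega>. w0T \<omega> + 1 *\<^sub>R w1T \<omega>)"
    by (simp_all add: fun_eq_iff w_def wT_def triple_def endpoint_def w0_def w1_def w0T_def w1T_def)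
  note \<beta>s = control_l2[OF cf.\<beta>_F]
  have s0: "sq_int N w0" "sq_int M w0T" unfolding w0_def[abs_def] w0T_def[abs_def]
    by (intro sq_int_Pair cf.\<delta>_sq bs T0)+
  have s1: "sq_int N w1" "sq_int M w1T" unfolding w1_def[abs_def] w1T_def[abs_def]
    by (intro sq_int_Pair sq_int_diff cf.\<delta>_sq cf.Y_sq bs \<beta>s T0 sq_int_zero)+
  have m0: "w0 \<in> borel_measurable (cf.G \<Otimes>\<^sub>M L)" unfolding w0_def[abs_def]
    by (intro borel_measurable_Pair cf.\<delta>_GL bm)
  have m0T: "w0T \<in> borel_measurable cf.G" unfolding w0T_def[abs_def]
    by (intro borel_measurable_Pair cf.\<delta>_G T0)
  have o: "(\<integral>z. \<phi> z \<bullet> w1 z \<partial>N) = 0" if p: "sq_int N \<phi>" "\<phi> \<in> borel_measurable (cf.G \<Otimes>\<^sub>M L)" for \<phi>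
  proof -
    have pm: "(\<lambda>z. fst (\<phi> z)) \<in> borel_measurable (cf.G \<Otimes>\<^sub>M L)" "(\<lambda>z. fst (snd (\<phi> z))) \<in> borel_measurable (cf.G \<Otimes>\<^sub>M L)"
      by (intro measurable_compose[OF p(2)] borel_measurable_continuous_onI continuous_intros)+
    note ps = sq_int_fst[OF p(1)] sq_int_fst[OF sq_int_snd[OF p(1)]]
    have "(\<integral>z. \<phi> z \<bullet> w1 z \<partial>N) = (\<integral>z. fst (\<phi> z) \<bullet> (cf.Y (fst z) (snd z) - cf.\<delta> (fst z) (snd z))
        + fst (snd (\<phi> z)) \<bullet> (cf.\<beta> (snd z) (fst z) - b (fst z) (snd z)) \<partial>N)"
      by (simp add: w1_def inner_prod_def)
    also have "\<dots> = 0"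
      using cf.defect_orth_N[OF ps(1) pm(1)] bo[OF ps(2) pm(2)]
      by (subst Bochner_Integration.integral_add) (auto intro!: sq_int_inner ps sq_int_diff cf.Y_sq cf.\<delta>_sq \<beta>s bs)
    finally show ?thesis .
  qed
  have oT: "(\<integral>\<omega>. \<phi> \<omega> \<bullet> w1T \<omega> \<partial>M) = 0" if p: "sq_int M \<phi>" "\<phi> \<in> borel_measurable cf.G" for \<phi>
  proof -
    have pm: "(\<lambda>z. fst (\<phi> z)) \<in> borel_measurable cf.G"
      by (intro measurable_compose[OF p(2)] borel_measurable_continuous_onI continuous_intros)
    show ?thesis using cf.defect_orth_inner[OF sq_int_fst[OF p(1)] pm T0(2)] by (simp add: w1T_def inner_prod_def)
  qed
  have 01: "bil w0 w0T w1 w1T = 0"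
  proof -
    have "(\<lambda>\<omega>. cost_end (w0T \<omega>)) \<in> borel_measurable cf.G"
      by (rule measurable_compose[OF m0T borel_measurable_continuous_onI[OF linear_continuous_on[OF cost_end_linear]]])
    then show ?thesis unfolding bil_def
      using o[OF cost_op_sq_int[OF s0(1)] cost_op_measurable[OF m0]] oT[OF cost_end_sq_int[OF s0(2)]] by simp
  qed
  \<comment> \<open>Here the operator acts on the residual, which need not be measurable for the
    flow. Passing to the adjoint lets it act on the side of \<open>w0\<close>, which gives a test
    function measurable for the flow.\<close>
  have 10: "bil w1 w1T w0 w0T = 0"
  proof -
    define \<phi> where "\<phi> z = (\<Sum>e\<in>Basis. (cost_op (snd z) e \<bullet> w0 z) *\<^sub>R e)" for z
    define \<psi> where "\<psi> \<omega> = (\<Sum>e\<in>Basis. (cost_end e \<bullet> w0T \<omega>) *\<^sub>R e)" for \<omega>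
    have cm: "(\<lambda>z. cost_op (snd z) e) \<in> borel_measurable (cf.G \<Otimes>\<^sub>M L)" for e
      by (rule cost_op_measurable) simp
    have \<phi>m: "\<phi> \<in> borel_measurable (cf.G \<Otimes>\<^sub>M L)" unfolding \<phi>_def[abs_def]
      by (intro borel_measurable_sum borel_measurable_scaleR borel_measurable_inner cm m0 borel_measurable_const)
    have \<psi>m: "\<psi> \<in> borel_measurable cf.G" unfolding \<psi>_def[abs_def]
      by (intro borel_measurable_sum borel_measurable_scaleR borel_measurable_inner m0T borel_measurable_const)
    obtain K where K: "K \<ge> 0" "AE t in L. \<forall>w. norm (cost_op t w) \<le> K * norm w" by (rule cost_op_bound)
    have \<phi>s: "sq_int N \<phi>" unfolding \<phi>_def[abs_def]
    proof (rule sq_int_sum)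
      fix e :: "('d, 'k) triple" assume e: "e \<in> Basis"
      show "sq_int N (\<lambda>z. (cost_op (snd z) e \<bullet> w0 z) *\<^sub>R e)"
      proof (rule sq_int_bound[OF s0(1), where C = K])
        show "(\<lambda>z. (cost_op (snd z) e \<bullet> w0 z) *\<^sub>R e) \<in> borel_measurable N"
          by (intro borel_measurable_scaleR borel_measurable_inner cf.GL_N[OF cm] cf.GL_N[OF m0] borel_measurable_const)
        show "AE z in N. norm ((cost_op (snd z) e \<bullet> w0 z) *\<^sub>R e) \<le> K * norm (w0 z)"
          using AE_N_time[OF K(2)]
        proof eventually_elim
          case (elim z)
          have "\<bar>cost_op (snd z) e \<bullet> w0 z\<bar> \<le> norm (cost_op (snd z) e) * norm (w0 z)" by (rule Cauchy_Schwarz_ineq2)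
          also have "\<dots> \<le> K * norm (w0 z)" using spec[OF elim, of e] e by (intro mult_right_mono) auto
          finally show ?case using e by simp
        qed
      qed
    qed
    have \<psi>s: "sq_int M \<psi>" unfolding \<psi>_def[abs_def]
      by (intro sq_int_sum sq_int_bounded_linear[OF sq_int_bounded_linear[OF s0(2) bounded_linear_inner_right] bounded_linear_scaleR_left])
    have a: "cost_op (snd z) (w1 z) \<bullet> w0 z = \<phi> z \<bullet> w1 z" for z
      unfolding \<phi>_def by (rule inner_linear_coordinates[OF bounded_linear.linear[OF cost_op_linear]])
    have a': "cost_end (w1T \<omega>) \<bullet> w0T \<omega> = \<psi> \<omega> \<bullet> w1T \<omega>" for \<omega>
      unfolding \<psi>_def by (rule inner_linear_coordinates[OF bounded_linear.linear[OF cost_end_linear]])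
    show ?thesis unfolding bil_def a a' o[OF \<phi>s \<phi>m] oT[OF \<psi>s \<psi>m] by simp
  qed
  have 11: "bil w1 w1T w1 w1T \<ge> \<kappa> * (\<integral>z. (norm (cf.\<beta> (snd z) (fst z) - b (fst z) (snd z)))\<^sup>2 \<partial>N)"
  proof -
    have "(\<integral>z. \<kappa> * (norm (cf.\<beta> (snd z) (fst z) - b (fst z) (snd z)))\<^sup>2 \<partial>N) \<le> (\<integral>z. cost_op (snd z) (w1 z) \<bullet> w1 z \<partial>N)"
    proof (rule integral_mono)
      show "integrable N (\<lambda>z. \<kappa> * (norm (cf.\<beta> (snd z) (fst z) - b (fst z) (snd z)))\<^sup>2)"
        using sq_int_norm[OF sq_int_diff[OF \<beta>s bs]] by simp
      show "integrable N (\<lambda>z. cost_op (snd z) (w1 z) \<bullet> w1 z)" by (intro sq_int_inner cost_op_sq_int s1)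
      fix z assume "z \<in> space N"
      then have "snd z \<in> {0..T}" by (auto simp: space_pair_measure)
      then show "\<kappa> * (norm (cf.\<beta> (snd z) (fst z) - b (fst z) (snd z)))\<^sup>2 \<le> cost_op (snd z) (w1 z) \<bullet> w1 z"
        unfolding w1_def by (rule \<kappa>(2))
    qed
    moreover have "(\<integral>\<omega>. cost_end (w1T \<omega>) \<bullet> w1T \<omega> \<partial>M) \<ge> 0"
      unfolding w1T_def by (intro integral_nonneg_AE AE_I2 cost_end_nonneg)
    ultimately show ?thesis by (simp add: bil_def)
  qed
  \<comment> \<open>Almost surely this is the curvature at the deterministic control
    \<open>b \<omega>\<close>, by \<open>quad_deterministic\<close>.\<close>
  define q where "q \<omega> = (\<integral>t. cost_op t (w0 (\<omega>, t)) \<bullet> w0 (\<omega>, t) \<partial>L) + cost_end (w0T \<omega>) \<bullet> w0T \<omega>" for \<omega>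
  have i: "integrable N (\<lambda>z. cost_op (snd z) (w0 z) \<bullet> w0 z)" "integrable M (\<lambda>\<omega>. cost_end (w0T \<omega>) \<bullet> w0T \<omega>)"
    by (intro sq_int_inner cost_op_sq_int cost_end_sq_int s0)+
  note iq = pr.integrable_fst'[OF i(1)] pr.integral_fst'[OF i(1)]
  have qi: "integrable M q" unfolding q_def[abs_def] using iq(1) i(2) by simp
  have 00: "bil w0 w0T w0 w0T = (\<integral>\<omega>. q \<omega> \<partial>M)" unfolding q_def bil_def using iq i(2) by simp
  show thesis
  proof (rule that[OF \<kappa>(1) bs _ qi])
    show "AE \<omega> in M. sq_int L (b \<omega>) \<and> (\<forall>t\<in>{0..T}. cf.\<delta> \<omega> t = sol (b \<omega>) t) \<and> q \<omega> = quad (\<lambda>t _. b \<omega> t)"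
      using bsol
    proof eventually_elim
      case (elim \<omega>)
      have "w0T \<omega> = (sol (b \<omega>) T, sol (b \<omega>) T)" using elim T0(2) by (simp add: w0T_def)
      moreover have "(\<integral>t. cost_op t (w0 (\<omega>, t)) \<bullet> w0 (\<omega>, t) \<partial>L)
          = (\<integral>t. cost_op t (sol (b \<omega>) t, b \<omega> t, sol (b \<omega>) t) \<bullet> (sol (b \<omega>) t, b \<omega> t, sol (b \<omega>) t) \<partial>L)"
        by (intro Bochner_Integration.integral_cong refl) (use elim in \<open>simp add: w0_def\<close>)
      ultimately show ?case using elim quad_deterministic[of "b \<omega>"] by (simp add: q_def)
    qed
    have "bil w wT w wT = bil w0 w0T w0 w0T + bil w1 w1T w1 w1T"
      unfolding split bil_add_left[OF sq_int_add[OF s0(1) sq_int_scaleR[OF s1(1)]] sq_int_add[OF s0(2) sq_int_scaleR[OF s1(2)]] s0 s1]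
        bil_add_right[OF s0 s0 s1] bil_add_right[OF s1 s0 s1] using 01 10 by simp
    then show "bil w wT w wT \<ge> (\<integral>\<omega>. q \<omega> \<partial>M) + \<kappa> * (\<integral>z. (norm (cf.\<beta> (snd z) (fst z) - b (fst z) (snd z)))\<^sup>2 \<partial>N)"
      using 00 11 by simp
  qed
qed

text \<open>The lower bound for the second-order term is a sum of two nonnegative quantities, an
  average of curvatures and the residual of the control. If the optimum is reached, both vanish: the
  first forces the conditional control and \<delta> to be zero, and the second identifies \<beta>
  with the conditional control.\<close>

lemma payoff_le: "payoff D P X lam mu \<le> reward z0 zT"
  and payoff_eq_control: "reward z0 zT \<le> payoff D P X lam mu \<Longrightarrow> control_eq D P lam \<alpha>"
  and payoff_eq_flow: "reward z0 zT \<le> payoff D P X lam mu \<Longrightarrow> AE \<omega> in M. \<forall>t\<in>{0..T}. mu t \<omega> = m t"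
proof -
  obtain \<kappa> b q where k: "\<kappa> > 0" and bs: "sq_int N (\<lambda>z. b (fst z) (snd z))"
    and ae: "AE \<omega> in M. sq_int L (b \<omega>) \<and> (\<forall>t\<in>{0..T}. cf.\<delta> \<omega> t = sol (b \<omega>) t) \<and> q \<omega> = quad (\<lambda>t _. b \<omega> t)"
    and qi: "integrable M q"
    and le: "bil w wT w wT \<ge> (\<integral>\<omega>. q \<omega> \<partial>M) + \<kappa> * (\<integral>z. (norm (cf.\<beta> (snd z) (fst z) - b (fst z) (snd z)))\<^sup>2 \<partial>N)"
    by (rule bil_w) blast
  let ?r = "\<integral>z. (norm (cf.\<beta> (snd z) (fst z) - b (fst z) (snd z)))\<^sup>2 \<partial>N"
  have q0: "AE \<omega> in M. 0 \<le> q \<omega>"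
    using ae
  proof eventually_elim
    case (elim \<omega>)
    then show ?case using stationarity(2)[OF H2_deterministic[OF filtration_F1, of "b \<omega>"]] by simp
  qed
  have r0: "0 \<le> ?r" by simp
  have iq0: "(\<integral>\<omega>. q \<omega> \<partial>M) \<ge> 0" by (rule integral_nonneg_AE[OF q0])
  have "0 \<le> \<kappa> * ?r" using k r0 by simp
  then show "payoff D P X lam mu \<le> reward z0 zT" unfolding payoff_lam using le iq0 by linarith
  assume "reward z0 zT \<le> payoff D P X lam mu"
  then have z: "(\<integral>\<omega>. q \<omega> \<partial>M) = 0" "\<kappa> * ?r = 0"
    unfolding payoff_lam using le iq0 \<open>0 \<le> \<kappa> * ?r\<close> by linarith+
  have "AE \<omega> in M. q \<omega> = 0" using integral_nonneg_eq_0_iff_AE[OF qi q0] z(1) by simp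
  with ae have b0: "AE \<omega> in M. (\<integral>t. (norm (b \<omega> t))\<^sup>2 \<partial>L) = 0 \<and> (\<forall>t\<in>{0..T}. cf.\<delta> \<omega> t = 0)"
  proof eventually_elim
    case (elim \<omega>)
    then show ?case using deterministic_zero[of "b \<omega>"] by simp
  qed
  then show "AE \<omega> in M. \<forall>t\<in>{0..T}. mu t \<omega> = m t" by eventually_elim (simp add: cf.\<delta>_def m_eq)
  note sd = sq_int_diff[OF control_l2[OF cf.\<beta>_F] bs]
  have "AE z in N. (norm (cf.\<beta> (snd z) (fst z) - b (fst z) (snd z)))\<^sup>2 = 0"
    using integral_nonneg_eq_0_iff_AE[OF sq_int_norm[OF sd]] z(2) k by simp
  moreover have "AE z in N. (norm (b (fst z) (snd z)))\<^sup>2 = 0"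
  proof -
    have "(\<integral>z. (norm (b (fst z) (snd z)))\<^sup>2 \<partial>N) = (\<integral>\<omega>. (\<integral>t. (norm (b \<omega> t))\<^sup>2 \<partial>L) \<partial>M)"
      using pr.integral_fst'[OF sq_int_norm[OF bs]] by simp
    also have "\<dots> = 0" by (rule integral_eq_zero_AE) (use b0 in \<open>eventually_elim, simp\<close>)
    finally show ?thesis using integral_nonneg_eq_0_iff_AE[OF sq_int_norm[OF bs]] by simp
  qed
  ultimately have "AE z in N. lam (snd z) (fst z) = \<alpha> (snd z) (fst z)"
    by eventually_elim (simp add: cf.\<beta>_def)
  then show "control_eq D P lam \<alpha>" by (simp add: control_eq_def case_prod_unfold)
qed

text \<open>Used to pass from the random flow of the equilibrium to its almost sure deterministic
  value, for the equilibrium's deviations \<beta>; the payoff depends on the flow only up to null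
  sets.\<close>

lemma payoff_flow_eq:
  assumes b: "\<beta> \<in> H2 M T F" and ae: "AE \<omega> in M. \<forall>t\<in>{0..T}. mu t \<omega> = m t"
  shows "payoff D P X \<beta> (\<lambda>t \<omega>. m t) = payoff D P X \<beta> mu"
proof -
  obtain y where y: "state_version \<beta> y" using state_version_exists[OF b] by blast
  have s: "sq_int N (triple y \<beta> mu)" "sq_int M (endpoint y mu)"
    "sq_int N (triple y \<beta> (\<lambda>t \<omega>. m t))" "sq_int M (endpoint y (\<lambda>t \<omega>. m t))"
    by (intro triple_sq_int endpoint_sq_int state_versionD(2,3)[OF y] control_l2[OF b] cf.mu_N cf.mu_sq(1) T0
        sq_int_N_time sq_int_continuous m_continuous sq_int_const finite_measure_axioms)+
  have "AE z in N. triple y \<beta> (\<lambda>t \<omega>. m t) z = triple y \<beta> mu z"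
    using AE_N_omega[OF ae] AE_space
    by eventually_elim (auto simp: triple_def space_pair_measure)
  moreover have "AE \<omega> in M. endpoint y (\<lambda>t \<omega>. m t) \<omega> = endpoint y mu \<omega>"
    using ae by eventually_elim (use T0 in \<open>simp add: endpoint_def\<close>)
  ultimately show ?thesis
    unfolding payoff_reward[OF s(1,2) state_versionD(4)[OF y]] payoff_reward[OF s(3,4) state_versionD(4)[OF y]]
    by (rule reward_cong[OF s(3,4,1,2)])
qed

end

theorem theorem4p3:
  fixes D :: "('d::finite, 'k::finite) lq_data"
    and P :: "('a, 'd) stoch_basis"
    and X :: "(real \<Rightarrow> 'a \<Rightarrow> real ^ 'k) \<Rightarrow> real \<Rightarrow> 'a \<Rightarrow> real ^ 'd"
    and \<alpha> :: "real \<Rightarrow> 'a \<Rightarrow> real ^ 'k"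
    and xbar :: "real \<Rightarrow> real ^ 'd"
  assumes "lq_coefficients D"
    and "stochastic_setting P (lq_T D)"
    and "state_map D P X"
    and "MFC_solution D P X \<alpha>"
    and "\<And>t. t \<in> {0..lq_T D} \<Longrightarrow> xbar t = mean_state P X \<alpha> t"
  shows "(\<forall>lam mu. mean_field_CCE D P X lam mu \<longrightarrow>
            (payoff D P X lam mu \<ge> payoff D P X \<alpha> (\<lambda>t \<omega>. xbar t) \<longrightarrow>
               control_eq D P lam \<alpha> \<and>
               (AE \<omega> in sb_M P. \<forall>t\<in>{0..lq_T D}. mu t \<omega> = xbar t) \<and>
               payoff D P X lam mu = payoff D P X \<alpha> (\<lambda>t \<omega>. xbar t)) \<and>
            (\<not> mean_field_NE D P X \<alpha> xbar \<longrightarrow>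
               payoff D P X lam mu < payoff D P X \<alpha> (\<lambda>t \<omega>. xbar t))) \<and>
         (\<not> mean_field_NE D P X \<alpha> xbar \<longrightarrow> \<not> mean_field_CCE D P X \<alpha> (\<lambda>t \<omega>. xbar t))"
proof -
  interpret lq_setting P D X
    using assms(1-3) by unfold_locales (simp_all add: lq_coefficients_def)
  have "\<alpha> \<in> H2 M T F1" using assms(4) by (simp add: MFC_solution_def MFC_maximizer_def)
  then obtain xa where xa: "state_version \<alpha> xa" using state_version_exists H2_F1_F by blast
  interpret mfc_setting P D X \<alpha> xa by unfold_locales (rule assms(4), rule xa)
  have xbar: "xbar t = m t" if "t \<in> {0..T}" for t using assms(5)[OF that] mean_state_\<alpha>[OF that] by simp
  have cong: "payoff D P X \<beta> (\<lambda>t \<omega>. xbar t) = payoff D P X \<beta> (\<lambda>t \<omega>. m t)" for \<beta>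
    by (rule payoff_cong) (rule xbar)
  have opt: "payoff D P X \<alpha> (\<lambda>t \<omega>. xbar t) = reward z0 zT"
    using payoff_cong[of "\<lambda>t \<omega>. xbar t" "\<lambda>t \<omega>. mean_state P X \<alpha> t" \<alpha>] assms(5) payoff_\<alpha> by simp
  have main: "payoff D P X lam mu \<le> payoff D P X \<alpha> (\<lambda>t \<omega>. xbar t)"
    "payoff D P X \<alpha> (\<lambda>t \<omega>. xbar t) \<le> payoff D P X lam mu \<Longrightarrow>
      control_eq D P lam \<alpha> \<and> (AE \<omega> in M. \<forall>t\<in>{0..T}. mu t \<omega> = xbar t) \<and> mean_field_NE D P X \<alpha> xbar"
    if cce: "mean_field_CCE D P X lam mu" for lam mu
  proof -
    have lam: "lam \<in> H2 M T F" using cce by (simp add: mean_field_CCE_def correlated_flow_def)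
    then obtain x where x: "state_version lam x" using state_version_exists by blast
    interpret cce_setting P D X \<alpha> lam mu xa x
      by unfold_locales (use cce \<alpha> xa x in \<open>auto simp: mean_field_CCE_def correlated_flow_def\<close>)
    show "payoff D P X lam mu \<le> payoff D P X \<alpha> (\<lambda>t \<omega>. xbar t)" using payoff_le opt by simp
    assume ge: "payoff D P X \<alpha> (\<lambda>t \<omega>. xbar t) \<le> payoff D P X lam mu"
    then have r: "reward z0 zT \<le> payoff D P X lam mu" using opt by simp
    note flow = payoff_eq_flow[OF r]
    \<comment> \<open>The flow is almost surely the deterministic path \<open>xbar\<close>, so the
      deviation inequality of the equilibrium compares payoffs against \<open>xbar\<close>, and the
      payoff of the equilibrium is at most the optimal one.\<close>
    have "mean_field_NE D P X \<alpha> xbar" unfolding mean_field_NE_def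
    proof (intro conjI ballI)
      show "\<alpha> \<in> H2 M T F1" by (rule \<alpha>)
      show "continuous_on {0..T} xbar" by (rule continuous_on_eq[OF m_continuous]) (simp add: xbar)
      show "xbar t = mean_state P X \<alpha> t" if "t \<in> {0..T}" for t by (rule assms(5)[OF that])
      fix \<beta> :: "real \<Rightarrow> 'a \<Rightarrow> real ^ 'k" assume b: "\<beta> \<in> H2 M T F1"
      then have "payoff D P X \<beta> (\<lambda>t \<omega>. xbar t) = payoff D P X \<beta> mu"
        unfolding cong using H2_F1_F by (intro payoff_flow_eq[OF _ flow]) blast
      also have "\<dots> \<le> payoff D P X lam mu" using cce b by (simp add: mean_field_CCE_def)
      also have "\<dots> \<le> payoff D P X \<alpha> (\<lambda>t \<omega>. xbar t)" using payoff_le opt by simp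
      finally show "payoff D P X \<beta> (\<lambda>t \<omega>. xbar t) \<le> payoff D P X \<alpha> (\<lambda>t \<omega>. xbar t)" .
    qed
    moreover have "AE \<omega> in M. \<forall>t\<in>{0..T}. mu t \<omega> = xbar t"
      using flow by eventually_elim (simp add: xbar)
    ultimately show "control_eq D P lam \<alpha> \<and> (AE \<omega> in M. \<forall>t\<in>{0..T}. mu t \<omega> = xbar t) \<and> mean_field_NE D P X \<alpha> xbar"
      using payoff_eq_control[OF r] by blast
  qed
  show ?thesis
  proof (intro conjI allI impI)
    fix lam mu assume cce: "mean_field_CCE D P X lam mu"
    {
      assume ge: "payoff D P X lam mu \<ge> payoff D P X \<alpha> (\<lambda>t \<omega>. xbar t)"
      show "control_eq D P lam \<alpha>" "AE \<omega> in M. \<forall>t\<in>{0..T}. mu t \<omega> = xbar t"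
        using main(2)[OF cce ge] by simp_all
      show "payoff D P X lam mu = payoff D P X \<alpha> (\<lambda>t \<omega>. xbar t)" using main(1)[OF cce] ge by simp
    }
    assume "\<not> mean_field_NE D P X \<alpha> xbar"
    then show "payoff D P X lam mu < payoff D P X \<alpha> (\<lambda>t \<omega>. xbar t)"
      using main(2)[OF cce] by (meson not_le)
  next
    assume "\<not> mean_field_NE D P X \<alpha> xbar"
    \<comment> \<open>The optimal pair attains its own payoff, so if it were a coarse correlated
      equilibrium, the equality case would make it a Nash equilibrium.\<close>
    then show "\<not> mean_field_CCE D P X \<alpha> (\<lambda>t \<omega>. xbar t)" using main(2)[of \<alpha> "\<lambda>t \<omega>. xbar t"] by blast
  qed
qed

end
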